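(* Let $G$ be an abelian group and $\mathbb{K}$ an algebraically closed field of characteristic zero. Let $A=UT(d_1,\dots,d_m)$ and $A'=UT(d_1',\dots,d_m')$ be upper block-triangular matrix algebras over $\mathbb{K}$ with elementary $G$-gradings induced by the tuples ${\bf g}=(g_1,\dots,g_n)\in G^n$ and ${\bf g}'=(g_1',\dots,g_n')\in G^n$, respectively. Let $K$ be a finitely generated subgroup of $G$, let $B$ and $B'$ be $K$-graded division algebras over $\mathbb{K}$, each satisfying an ordinary polynomial identity, and let $R=A\otimes B$, $R'=A'\otimes B'$ with their $G$-gradings. Suppose $Id_G(R)=Id_G(R')$. Then: (1) $\mathrm{supp}\,B=\mathrm{supp}\,B'$ and $B\cong B'$ as graded algebras. (2) Put $H=\mathrm{supp}\,B$, let $\alpha:G\to G/H$ be the canonical epimorphism, and let $t$ be the p.i. degree of $B$ and $B'$. Let $U$ be the algebra $UT(d_1t,\dots,d_mt)$ with the elementary $G/H$-grading induced by $(g_1H,\dots,g_1H,\dots,g_nH,\dots,g_nH)$, and let $U'$ be the algebra $UT(d_1't,\dots,d_m't)$ with the elementary $G/H$-grading induced by $(g_1'H,\dots,g_1'H,\dots,g_n'H,\dots,g_n'H)$, where each coset $g_iH$, respectively $g_i'H$, is repeated $t$ times consecutively. Then $$Id_{G/H}({}^{\alpha}R)=Id_{G/H}(U)=Id_{G/H}(U')=Id_{G/H}({}^{\alpha}R').$$ (3) Moreover, if $U\cong U'$ as $G/H$-graded algebras, then $R\cong R'$ as $G$-graded algebras.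
   Context: A $G$-grading on an algebra $A$ is a vector space decomposition $A=\bigoplus_{g\in G}A_g$ with $A_gA_h\subseteq A_{gh}$; $\mathrm{supp}\,A=\{g\in G: A_g\neq 0\}$. An isomorphism of graded algebras is an algebra isomorphism $f$ with $f(A_g)\subseteq B_g$ for all $g$. An algebra graded by a subgroup $K$ of $G$ is regarded as $G$-graded. $UT(d_1,\dots,d_m)$ ($d_i$ positive integers, $n=d_1+\cdots+d_m$) is the subalgebra of $M_n(\mathbb{K})$ of block matrices $(A_{ij})_{1\le i,j\le m}$, with $A_{ij}$ of size $d_i\times d_j$ and $A_{ij}=0$ for $i>j$. The elementary grading induced by $(g_1,\dots,g_n)\in G^n$ is the one in which each matrix unit $e_{ij}$ of the algebra is homogeneous of degree $g_ig_j^{-1}$. If $B$ is a $G$-graded algebra, then $A\otimes B$ has the $G$-grading in which $(A\otimes B)_g$ is spanned by the elements $e_{ij}\otimes b$ with $b\in B$ homogeneous and $g_i(\deg_G b)g_j^{-1}=g$. A grading on a unital algebra $B$ is a division grading (and $B$ is a graded division algebra) if every nonzero homogeneous element is invertible. Convention: over the algebraically closed field $\mathbb{K}$ a graded division algebra is (isomorphic to) a twisted group algebra of its support, which is a subgroup; i.e. every nonzero homogeneous component is one-dimensional. For a homomorphism $\alpha:G\to Q$ and a $G$-graded algebra $R$, ${}^{\alpha}R$ denotes $R$ with the $Q$-grading $R_q=\bigoplus_{g\in\alpha^{-1}(q)}R_g$. $\mathbb{K}\langle X_G\rangle$ is the free $G$-graded associative algebra on variables $x_i^g$ ($i\ge1$,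 $g\in G$), $x_i^g$ being of degree $g$. $Id_G(R)$ is the set of polynomials in $\mathbb{K}\langle X_G\rangle$ that vanish under every substitution of the variables $x_i^g$ by elements of $R_g$. $Id(D)$ denotes the ideal of ordinary polynomial identities of an algebra $D$. The p.i. degree of a p.i. algebra $D$ is the largest $d$ such that every multilinear identity of $D$ is an identity of $M_d(\mathbb{K})$; for a graded division algebra $D$ as here it is the natural number $t$ such that $Id(D)=Id(M_t(\mathbb{K}))$. *)

theory Defs
  imports
    "HOL-Algebra.QuotRing"
    "HOL-Algebra.Generated_Groups"
    "HOL-Computational_Algebra.Polynomial"
    "HOL-Library.Poly_Mapping"
    "Jordan_Normal_Form.Matrix"
begin

section \<open>Algebras and gradings\<close>

text \<open>The HOL-Algebra locale \<open>algebra\<close> only covers commutative algebras.\<close>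

locale unital_algebra = ring A for A :: "('k::field, 'a, 'm) module_scheme" (structure) +
  assumes smult_closed: "x \<in> carrier A \<Longrightarrow> c \<odot> x \<in> carrier A"
    and smult_add_left: "x \<in> carrier A \<Longrightarrow> (c + d) \<odot> x = c \<odot> x \<oplus> d \<odot> x"
    and smult_add_right:
      "x \<in> carrier A \<Longrightarrow> y \<in> carrier A \<Longrightarrow> c \<odot> (x \<oplus> y) = c \<odot> x \<oplus> c \<odot> y"
    and smult_smult: "x \<in> carrier A \<Longrightarrow> c \<odot> (d \<odot> x) = (c * d) \<odot> x"
    and smult_1: "x \<in> carrier A \<Longrightarrow> 1 \<odot> x = x"
    and smult_mult_left:
      "x \<in> carrier A \<Longrightarrow> y \<in> carrier A \<Longrightarrow> (c \<odot> x) \<otimes> y = c \<odot> (x \<otimes> y)"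
    and smult_mult_right:
      "x \<in> carrier A \<Longrightarrow> y \<in> carrier A \<Longrightarrow> x \<otimes> (c \<odot> y) = c \<odot> (x \<otimes> y)"

inductive_set lin_span :: "('k, 'a, 'm) module_scheme \<Rightarrow> 'a set \<Rightarrow> 'a set"
  for A (structure) and S where
  zero: "\<zero> \<in> lin_span A S"
| step: "s \<in> S \<Longrightarrow> x \<in> lin_span A S \<Longrightarrow> c \<odot> s \<oplus> x \<in> lin_span A S"

text \<open>\<open>hcomp A g\<close> is the homogeneous component \<open>A\<^sub>g\<close>; its values at \<open>g\<close> outside the grading
  group are irrelevant.\<close>

record ('k, 'a, 'g) gr_algebra = "('k, 'a) module" +
  hcomp :: "'g \<Rightarrow> 'a set"

definition with_grading :: "('k, 'a) module \<Rightarrow> ('g \<Rightarrow> 'a set) \<Rightarrow> ('k, 'a, 'g) gr_algebra" where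
  "with_grading A C = module.extend A (gr_algebra.fields C)"

locale graded_algebra = group G + unital_algebra A
  for G :: "('g, 'n) monoid_scheme" and A :: "('k::field, 'a, 'g, 'm) gr_algebra_scheme" +
  assumes hcomp_subset: "g \<in> carrier G \<Longrightarrow> hcomp A g \<subseteq> carrier A"
    and hcomp_zero: "g \<in> carrier G \<Longrightarrow> \<zero>\<^bsub>A\<^esub> \<in> hcomp A g"
    and hcomp_add: "g \<in> carrier G \<Longrightarrow> x \<in> hcomp A g \<Longrightarrow> y \<in> hcomp A g \<Longrightarrow> x \<oplus>\<^bsub>A\<^esub> y \<in> hcomp A g"
    and hcomp_smult: "g \<in> carrier G \<Longrightarrow> x \<in> hcomp A g \<Longrightarrow> c \<odot>\<^bsub>A\<^esub> x \<in> hcomp A g"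
    and hcomp_direct_sum: "x \<in> carrier A \<Longrightarrow>
      \<exists>!c. (\<forall>g\<in>carrier G. c g \<in> hcomp A g) \<and> (\<forall>g. g \<notin> carrier G \<longrightarrow> c g = \<zero>\<^bsub>A\<^esub>) \<and>
           finite {g. c g \<noteq> \<zero>\<^bsub>A\<^esub>} \<and> x = (\<Oplus>\<^bsub>A\<^esub>g\<in>{g. c g \<noteq> \<zero>\<^bsub>A\<^esub>}. c g)"
    and hcomp_mult: "g \<in> carrier G \<Longrightarrow> h \<in> carrier G \<Longrightarrow> x \<in> hcomp A g \<Longrightarrow> y \<in> hcomp A h \<Longrightarrow>
      x \<otimes>\<^bsub>A\<^esub> y \<in> hcomp A (g \<otimes>\<^bsub>G\<^esub> h)"

definition supp :: "('g, 'n) monoid_scheme \<Rightarrow> ('k, 'a, 'g, 'm) gr_algebra_scheme \<Rightarrow> 'g set" where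
  "supp G A = {g \<in> carrier G. hcomp A g \<noteq> {\<zero>\<^bsub>A\<^esub>}}"

definition graded_isomorphic ::
  "('g, 'n) monoid_scheme \<Rightarrow> ('k, 'a, 'g, 'm) gr_algebra_scheme \<Rightarrow>
   ('k, 'b, 'g, 'l) gr_algebra_scheme \<Rightarrow> bool" where
  "graded_isomorphic G A B \<longleftrightarrow>
    (\<exists>f\<in>ring_iso A B.
      (\<forall>c. \<forall>x\<in>carrier A. f (c \<odot>\<^bsub>A\<^esub> x) = c \<odot>\<^bsub>B\<^esub> f x) \<and>
      (\<forall>g\<in>carrier G. f ` hcomp A g \<subseteq> hcomp B g))"

text \<open>The one-dimensionality of the nonzero components is automatic over an algebraically closed
  field when they are finite-dimensional, but not in general: it is the convention that a graded
  division algebra is a twisted group algebra of its support.\<close>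

definition graded_division_algebra ::
  "('g, 'n) monoid_scheme \<Rightarrow> ('k::field, 'a, 'g, 'm) gr_algebra_scheme \<Rightarrow> bool" where
  "graded_division_algebra G B \<longleftrightarrow>
    graded_algebra G B \<and> \<one>\<^bsub>B\<^esub> \<noteq> \<zero>\<^bsub>B\<^esub> \<and>
    (\<forall>g\<in>carrier G. \<forall>x\<in>hcomp B g. x \<noteq> \<zero>\<^bsub>B\<^esub> \<longrightarrow> x \<in> Units B) \<and>
    (\<forall>g\<in>supp G B. \<exists>b\<in>hcomp B g. hcomp B g = {c \<odot>\<^bsub>B\<^esub> b | c. True})"

definition coarsening ::
  "('g, 'n) monoid_scheme \<Rightarrow> ('g \<Rightarrow> 'q) \<Rightarrow> ('k, 'a, 'g, 'm) gr_algebra_scheme \<Rightarrow>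
   ('k, 'a, 'q) gr_algebra" where
  "coarsening G \<alpha> R =
    with_grading (module.truncate R)
      (\<lambda>q. lin_span R (\<Union>g\<in>{g \<in> carrier G. \<alpha> g = q}. hcomp R g))"


section \<open>Polynomial identities\<close>

text \<open>An element of the free unital algebra on variables of type \<open>'x\<close> is a finitely supported
  linear combination of words in the variables.\<close>

type_synonym ('x, 'k) ncpoly = "'x list \<Rightarrow>\<^sub>0 'k"

definition eval_word :: "('k, 'a, 'm) module_scheme \<Rightarrow> ('x \<Rightarrow> 'a) \<Rightarrow> 'x list \<Rightarrow> 'a" where
  "eval_word A v w = foldr (\<lambda>x a. v x \<otimes>\<^bsub>A\<^esub> a) w \<one>\<^bsub>A\<^esub>"

definition eval_ncpoly ::
  "('k::zero, 'a, 'm) module_scheme \<Rightarrow> ('x \<Rightarrow> 'a) \<Rightarrow> ('x, 'k) ncpoly \<Rightarrow> 'a" where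
  "eval_ncpoly A v f =
    (\<Oplus>\<^bsub>A\<^esub>w\<in>Poly_Mapping.keys f. Poly_Mapping.lookup f w \<odot>\<^bsub>A\<^esub> eval_word A v w)"

definition identities :: "('k::zero, 'a, 'm) module_scheme \<Rightarrow> (nat, 'k) ncpoly set" where
  "identities A = {f. \<forall>v. (\<forall>i. v i \<in> carrier A) \<longrightarrow> eval_ncpoly A v f = \<zero>\<^bsub>A\<^esub>}"

text \<open>The pair \<open>(i, g)\<close> is the variable \<open>x\<^sub>i\<close> of degree \<open>g\<close>.\<close>

definition graded_ncpolys ::
  "('g, 'n) monoid_scheme \<Rightarrow> (nat \<times> 'g, 'k::zero) ncpoly set" where
  "graded_ncpolys G = {f. \<forall>w\<in>Poly_Mapping.keys f. snd ` set w \<subseteq> carrier G}"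

definition graded_identities ::
  "('g, 'n) monoid_scheme \<Rightarrow> ('k::zero, 'a, 'g, 'm) gr_algebra_scheme \<Rightarrow>
   (nat \<times> 'g, 'k) ncpoly set" where
  "graded_identities G R = {f \<in> graded_ncpolys G.
    \<forall>v. (\<forall>i. \<forall>g\<in>carrier G. v (i, g) \<in> hcomp R g) \<longrightarrow> eval_ncpoly R v f = \<zero>\<^bsub>R\<^esub>}"

definition is_pi_algebra :: "('k::zero, 'a, 'm) module_scheme \<Rightarrow> bool" where
  "is_pi_algebra A \<longleftrightarrow> (\<exists>f\<in>identities A. f \<noteq> 0)"

definition multilinear :: "('x, 'k::zero) ncpoly \<Rightarrow> bool" where
  "multilinear f \<longleftrightarrow> (\<exists>V. \<forall>w\<in>Poly_Mapping.keys f. distinct w \<and> set w = V)"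

definition pi_degree :: "('k::field, 'a, 'm) module_scheme \<Rightarrow> nat" where
  "pi_degree D = (GREATEST d. d > 0 \<and>
    (\<forall>f\<in>identities D. multilinear f \<longrightarrow> f \<in> identities (module_mat TYPE('k) d d)))"


section \<open>Block-triangular matrices\<close>

text \<open>Rows, columns and blocks are numbered from 0.\<close>

definition block_of :: "nat list \<Rightarrow> nat \<Rightarrow> nat" where
  "block_of ds i = (LEAST k. i < sum_list (take (Suc k) ds))"

definition ut_positions :: "nat list \<Rightarrow> (nat \<times> nat) set" where
  "ut_positions ds =
    {(i, j). i < sum_list ds \<and> j < sum_list ds \<and> block_of ds i \<le> block_of ds j}"

definition matrix_unit :: "nat \<Rightarrow> nat \<Rightarrow> nat \<Rightarrow> 'k::{zero,one} mat" where
  "matrix_unit n i j = mat n n (\<lambda>p. if p = (i, j) then 1 else 0)"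

definition UT ::
  "('g, 'n) monoid_scheme \<Rightarrow> nat list \<Rightarrow> 'g list \<Rightarrow> ('k::field, 'k mat, 'g) gr_algebra" where
  "UT G ds gs = (let n = sum_list ds; M = module_mat TYPE('k) n n in
    with_grading
      (M\<lparr>carrier := {x \<in> carrier M. \<forall>i<n. \<forall>j<n.
         (i, j) \<notin> ut_positions ds \<longrightarrow> x $$ (i, j) = 0}\<rparr>)
      (\<lambda>g. lin_span M
        {matrix_unit n i j | i j. (i, j) \<in> ut_positions ds \<and>
           gs ! i \<otimes>\<^bsub>G\<^esub> inv\<^bsub>G\<^esub> (gs ! j) = g}))"

text \<open>\<open>M\<^sub>n(\<bbbK>) \<otimes> B\<close> is realized as the algebra of \<open>n \<times> n\<close> matrices over \<open>B\<close>, with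
  \<open>x \<otimes> b\<close> the matrix with entries \<open>x\<^sub>i\<^sub>j b\<close>.\<close>

definition matrices_over :: "nat \<Rightarrow> ('k, 'b, 'm) module_scheme \<Rightarrow> ('k, 'b mat) module" where
  "matrices_over n B =
    \<lparr> carrier = {x \<in> carrier_mat n n. \<forall>i<n. \<forall>j<n. x $$ (i, j) \<in> carrier B},
      monoid.mult = (\<lambda>x y. mat n n (\<lambda>(i, j). \<Oplus>\<^bsub>B\<^esub>l\<in>{..<n}. x $$ (i, l) \<otimes>\<^bsub>B\<^esub> y $$ (l, j))),
      one = mat n n (\<lambda>(i, j). if i = j then \<one>\<^bsub>B\<^esub> else \<zero>\<^bsub>B\<^esub>),
      ring.zero = mat n n (\<lambda>_. \<zero>\<^bsub>B\<^esub>),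
      add = (\<lambda>x y. mat n n (\<lambda>p. x $$ p \<oplus>\<^bsub>B\<^esub> y $$ p)),
      smult = (\<lambda>c x. mat n n (\<lambda>p. c \<odot>\<^bsub>B\<^esub> x $$ p)) \<rparr>"

definition simple_tensor ::
  "nat \<Rightarrow> ('k, 'b, 'm) module_scheme \<Rightarrow> 'k mat \<Rightarrow> 'b \<Rightarrow> 'b mat" where
  "simple_tensor n B x b = mat n n (\<lambda>p. x $$ p \<odot>\<^bsub>B\<^esub> b)"

lemma (in unital_algebra) simple_tensor_mult:
  assumes x: "x \<in> carrier_mat n n" and y: "y \<in> carrier_mat n n"
    and a: "a \<in> carrier A" and b: "b \<in> carrier A"
  shows "simple_tensor n A x a \<otimes>\<^bsub>matrices_over n A\<^esub> simple_tensor n A y b =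
         simple_tensor n A (x * y) (a \<otimes> b)"
proof -
  have smult_0: "(0::'k) \<odot> z = \<zero>" if "z \<in> carrier A" for z
    using smult_add_left[of z 0 0] smult_closed[of z 0] that
    by (metis add.r_cancel_one' add_0)
  have *: "(\<Oplus>l\<in>{..<m}. (x $$ (i, l) \<odot> a) \<otimes> (y $$ (l, j) \<odot> b)) =
        (\<Sum>l<m. x $$ (i, l) * y $$ (l, j)) \<odot> (a \<otimes> b)" for i j m
  proof (induction m)
    case 0
    then show ?case using a b by (simp add: smult_0)
  next
    case (Suc m)
    then show ?case
      using a b by (simp add: lessThan_Suc smult_closed smult_mult_left smult_mult_right
          smult_smult smult_add_left Pi_def mult.commute[of "y $$ (m, j)"])
  qed
  have "(\<Oplus>l\<in>{..<n}. simple_tensor n A x a $$ (i, l) \<otimes> simple_tensor n A y b $$ (l, j)) =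
        simple_tensor n A (x * y) (a \<otimes> b) $$ (i, j)" if "i < n" "j < n" for i j
  proof -
    have "(\<Oplus>l\<in>{..<n}. simple_tensor n A x a $$ (i, l) \<otimes> simple_tensor n A y b $$ (l, j)) =
          (\<Oplus>l\<in>{..<n}. (x $$ (i, l) \<odot> a) \<otimes> (y $$ (l, j) \<odot> b))"
      using that a b by (intro finsum_cong') (auto simp: simple_tensor_def smult_closed)
    then show ?thesis
      unfolding *
      using that x y
      by (simp add: simple_tensor_def scalar_prod_def lessThan_atLeast0)
  qed
  then show ?thesis
    by (intro eq_matI) (simp_all add: matrices_over_def simple_tensor_def)
qed

text \<open>The algebra \<open>UT(d\<^sub>1,\<dots>,d\<^sub>m) \<otimes> B\<close>, graded by the degrees of \<open>gs\<close> and of \<open>B\<close>.\<close>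

definition UT_tensor ::
  "('g, 'n) monoid_scheme \<Rightarrow> nat list \<Rightarrow> 'g list \<Rightarrow> ('k::field, 'b, 'g, 'm) gr_algebra_scheme \<Rightarrow>
   ('k, 'b mat, 'g) gr_algebra" where
  "UT_tensor G ds gs B = (let n = sum_list ds; M = matrices_over n B in
    with_grading
      (M\<lparr>carrier := {x \<in> carrier M. \<forall>i<n. \<forall>j<n.
         (i, j) \<notin> ut_positions ds \<longrightarrow> x $$ (i, j) = \<zero>\<^bsub>B\<^esub>}\<rparr>)
      (\<lambda>g. lin_span M
        {simple_tensor n B (matrix_unit n i j) b | i j h b.
           (i, j) \<in> ut_positions ds \<and> h \<in> carrier G \<and> b \<in> hcomp B h \<and>
           gs ! i \<otimes>\<^bsub>G\<^esub> h \<otimes>\<^bsub>G\<^esub> inv\<^bsub>G\<^esub> (gs ! j) = g}))"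

end

theory Submission
  imports Defs "Jordan_Normal_Form.Determinant"
begin

text \<open>Let \<open>H\<close> be the support of \<open>B\<close>, \<open>u\<^sub>h\<close> a generator of the component of degree \<open>h\<close>, and
  \<open>u\<^sub>h u\<^sub>k = \<beta>(h, k) u\<^sub>k u\<^sub>h\<close>. Symmetric cocycles with values in the divisible group \<open>\<bbbK>\<^sup>*\<close> split, so
  \<open>B\<close> is determined by \<open>H\<close> and \<open>\<beta>\<close>. Both are read off the graded identities of \<open>R\<close> modulo the strictly
  block-triangular matrices: let \<open>s\<close> be the largest number of rows in one block with the same degree
  modulo \<open>H\<close>. A Capelli polynomial in \<open>s\<^sup>2 + 1\<close> alternating variables of degrees in \<open>H\<close>, with signs
  corrected by \<open>\<beta>\<close>, vanishes, whereas it would have an invertible value on \<open>R'\<close> if a degree \<open>h \<in> H\<close>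
  were not in the support of \<open>B'\<close> or if \<open>\<beta>'(h, k) \<noteq> \<beta>(h, k)\<close>.

  The representations of \<open>B\<close> induced from the characters of a maximal isotropic subgroup \<open>I\<close> of \<open>H\<close> map
  onto \<open>M\<^sub>t(\<bbbK>)\<close> with \<open>t = [H : I]\<close>, finite since \<open>B\<close> satisfies an identity, and separate points. Applied
  entrywise they identify the \<open>G/H\<close>-graded identities of \<open>R\<close> with those of \<open>U\<close>.

  An isomorphism \<open>f\<close> from \<open>U\<close> to \<open>U'\<close> sends the diagonal matrix units to orthogonal idempotents, whose
  images are lines spanned by homogeneous vectors. A nonzero term in the determinant of the matrix of
  these vectors is a permutation matching the rows of \<open>U\<close> and \<open>U'\<close> up to a common shift of degrees, and
  the one obtained from the inverse of \<open>f\<close> forces it to preserve the blocks. It descends to the rows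
  of \<open>R\<close> and \<open>R'\<close>, where it combines with the isomorphism from \<open>B\<close> to \<open>B'\<close>.\<close>

section \<open>Characters and symmetric cocycles\<close>

text \<open>H may be infinite and B infinite-dimensional. Finite matrices are available only once a
  maximal isotropic subgroup is known to have finite index; until then rows and columns are indexed
  by a possibly infinite transversal, with finitely supported columns. A polynomial that vanishes
  modulo the radical is not yet an identity. Multiplied by one further variable and raised to the
  number of diagonal blocks it becomes one, whereas a value that is an invertible element of B in a
  single position (a, b) of a diagonal block survives, because the further variable can lead back
  from b to a. This is how nonvanishing passes between R and R'. The number s is taken from R alone;
  that R' has a class with at least s rows is itself read off the identities. R' then guarantees s^2
  distinct positions, while s^2 + 1 are needed. The missing one comes from a row reached through a
  degree outside the support of B', or is replaced by one position used twice, which detects the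
  commutation factor.\<close>

lemma nth_root_neq_1:
  fixes a :: "'k::{alg_closed_field, field_char_0}"
  assumes "2 \<le> m"
  shows "\<exists>z. z ^ m = a \<and> z \<noteq> 1"
proof (cases "a = 1")
  case False
  obtain z where "z ^ m = a" using nth_root_exists[of m a] assms by auto
  then show ?thesis using False by auto
next
  case True
  \<comment> \<open>A root of 1 + z + ... + z^(m-1). It is an m-th root of unity by the geometric
    sum, and it differs from 1 because at 1 the sum has the value m, which is nonzero in
    characteristic zero.\<close>
  obtain z :: 'k where z: "(\<Sum>k\<le>m - 1. 1 * z ^ k) = 0"
    using alg_closed[of "m - 1" "\<lambda>_. 1"] assms by auto
  have "z \<noteq> 1"
  proof
    assume "z = 1"
    then have "of_nat m = (0::'k)" using z assms by simp
    then show False using assms by simp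
  qed
  moreover have "z ^ m = 1"
  proof -
    have "{..m - 1} = {..<m}" using assms by auto
    then have "(z - 1) * (\<Sum>k<m. z ^ k) = 0" using z by simp
    then show ?thesis using power_diff_1_eq[of z m] by (metis eq_iff_diff_eq_0)
  qed
  ultimately show ?thesis using True by auto
qed

text \<open>A partial character is represented by its graph, so that unions of chains are again
  partial characters.\<close>

definition char_graph :: "('a, 'm) monoid_scheme \<Rightarrow> ('a \<times> 'k::field) set \<Rightarrow> bool" where
  "char_graph A \<Gamma> \<longleftrightarrow> (\<one>\<^bsub>A\<^esub>, 1) \<in> \<Gamma> \<and> (\<forall>(a, c)\<in>\<Gamma>. a \<in> carrier A \<and> c \<noteq> 0) \<and>
    (\<forall>(a, c)\<in>\<Gamma>. \<forall>(b, d)\<in>\<Gamma>. (a \<otimes>\<^bsub>A\<^esub> b, c * d) \<in> \<Gamma>) \<and>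
    (\<forall>(a, c)\<in>\<Gamma>. (inv\<^bsub>A\<^esub> a, inverse c) \<in> \<Gamma>) \<and> (\<forall>c. (\<one>\<^bsub>A\<^esub>, c) \<in> \<Gamma> \<longrightarrow> c = 1)"

lemma char_graphI:
  assumes "(\<one>\<^bsub>A\<^esub>, 1) \<in> \<Gamma>" and "\<And>a c. (a, c) \<in> \<Gamma> \<Longrightarrow> a \<in> carrier A \<and> c \<noteq> 0"
    and "\<And>a b c d. (a, c) \<in> \<Gamma> \<Longrightarrow> (b, d) \<in> \<Gamma> \<Longrightarrow> (a \<otimes>\<^bsub>A\<^esub> b, c * d) \<in> \<Gamma>"
    and "\<And>a c. (a, c) \<in> \<Gamma> \<Longrightarrow> (inv\<^bsub>A\<^esub> a, inverse c) \<in> \<Gamma>"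
    and "\<And>c. (\<one>\<^bsub>A\<^esub>, c) \<in> \<Gamma> \<Longrightarrow> c = 1"
  shows "char_graph A \<Gamma>"
  unfolding char_graph_def using assms by blast

context comm_group
begin

context
  fixes \<Gamma> :: "('a \<times> 'k::{alg_closed_field, field_char_0}) set"
  assumes graph: "char_graph G \<Gamma>"
begin

lemma char_graph_one: "(\<one>, 1) \<in> \<Gamma>"
  and char_graph_carrier: "(a, c) \<in> \<Gamma> \<Longrightarrow> a \<in> carrier G"
  and char_graph_nonzero: "(a, c) \<in> \<Gamma> \<Longrightarrow> c \<noteq> 0"
  and char_graph_mult: "(a, c) \<in> \<Gamma> \<Longrightarrow> (b, d) \<in> \<Gamma> \<Longrightarrow> (a \<otimes> b, c * d) \<in> \<Gamma>"
  and char_graph_inv: "(a, c) \<in> \<Gamma> \<Longrightarrow> (inv a, inverse c) \<in> \<Gamma>"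
  and char_graph_at_one: "(\<one>, c) \<in> \<Gamma> \<Longrightarrow> c = 1"
  using graph unfolding char_graph_def by fast+

lemma char_graph_unique:
  assumes "(a, c) \<in> \<Gamma>" "(a, d) \<in> \<Gamma>"
  shows "c = d"
proof -
  have "(a \<otimes> inv a, c * inverse d) \<in> \<Gamma>" using assms char_graph_mult char_graph_inv by blast
  then have "c * inverse d = 1"
    using char_graph_carrier[OF assms(1)] char_graph_at_one by simp
  then show ?thesis using char_graph_nonzero[OF assms(2)] by (simp add: field_simps)
qed

lemma char_graph_nat_pow:
  assumes "(a, c) \<in> \<Gamma>"
  shows "(a [^] (n::nat), c ^ n) \<in> \<Gamma>"
proof (induction n)
  case 0
  show ?case using char_graph_one by simp
next
  case (Suc n)
  have "(a [^] n \<otimes> a, c ^ n * c) \<in> \<Gamma>" using Suc assms char_graph_mult by blast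
  then show ?case by (simp add: mult.commute)
qed

lemma char_graph_int_pow:
  assumes "(a, c) \<in> \<Gamma>"
  shows "(a [^] (n::int), c powi n) \<in> \<Gamma>"
proof (cases "n \<ge> 0")
  case True
  then show ?thesis using char_graph_nat_pow[OF assms, of "nat n"]
    by (simp add: int_pow_def2 power_int_def del: pow_nat)
next
  case False
  then show ?thesis
    using char_graph_inv[OF char_graph_nat_pow[OF assms, of "nat (- n)"]]
    by (simp add: int_pow_def2 power_int_def power_inverse del: pow_nat)
qed

text \<open>The exponents n with h^n in the domain form a subgroup of the integers. If it is zero,
  every nonzero z is compatible. Otherwise it is generated by some m, at least 2 because h itself is
  outside the domain, and z must be an m-th root of the value at h^m. Insisting on z \<noteq> 1 is
  what lets characters separate points.\<close>

lemma char_graph_root: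
  assumes h: "h \<in> carrier G" "h \<notin> Domain \<Gamma>"
  shows "\<exists>z. z \<noteq> 0 \<and> z \<noteq> 1 \<and> (\<forall>(n::int) c. (h [^] n, c) \<in> \<Gamma> \<longrightarrow> c = z powi n)"
proof (cases "\<exists>m::nat. m > 0 \<and> h [^] m \<in> Domain \<Gamma>")
  case False
  \<comment> \<open>Nothing constrains the value at h in this case; 2 is an element other than 0 and
    1 in characteristic zero.\<close>
  have "c = 2 powi n" if c: "(h [^] (n::int), c) \<in> \<Gamma>" for n c
  proof -
    have "n = 0"
    proof (rule ccontr)
      assume "n \<noteq> 0"
      then consider "n > 0" | "n < 0" by linarith
      then show False
      proof cases
        case 1
        then have "h [^] nat n \<in> Domain \<Gamma>" using c by auto
        then show False using False 1 by (metis zero_less_nat_eq)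
      next
        case 2
        have "(inv (h [^] n), inverse c) \<in> \<Gamma>" using c char_graph_inv by blast
        then have "h [^] nat (- n) \<in> Domain \<Gamma>" using 2 h by (auto simp: int_pow_neg[symmetric])
        then show False using False 2 by (metis neg_0_less_iff_less zero_less_nat_eq)
      qed
    qed
    then show ?thesis using c char_graph_at_one by simp
  qed
  then show ?thesis by (intro exI[of _ "2::'k"]) auto
next
  case True
  define m where "m = (LEAST m::nat. m > 0 \<and> h [^] m \<in> Domain \<Gamma>)"
  have m: "m > 0" "h [^] m \<in> Domain \<Gamma>"
    using LeastI_ex[OF True] unfolding m_def by auto
  have m_least: "m \<le> k" if "k > 0" "h [^] k \<in> Domain \<Gamma>" for k :: nat
    unfolding m_def using that by (intro Least_le) auto
  have "m \<noteq> 1" using m h by auto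
  then have m2: "2 \<le> m" using m by simp
  obtain c0 where c0: "(h [^] m, c0) \<in> \<Gamma>" using m by auto
  obtain z where z: "z ^ m = c0" "z \<noteq> 1" using nth_root_neq_1[OF m2] by blast
  have z0: "z \<noteq> 0" using z char_graph_nonzero[OF c0] m by (auto simp: power_0_left)
  have "c = z powi n" if c: "(h [^] n, c) \<in> \<Gamma>" for n :: int and c
  proof -
    \<comment> \<open>Division with remainder: the domain contains h^n and h^(m q), hence h to the
      remainder, and minimality of m forces the remainder to be 0.\<close>
    define q where "q = n div int m"
    have mq: "((h [^] m) [^] q, c0 powi q) \<in> \<Gamma>" by (rule char_graph_int_pow[OF c0])
    have eq: "(h [^] m) [^] q = h [^] (int m * q)"
      using h by (metis int_pow_int int_pow_pow)
    have "(h [^] n \<otimes> inv ((h [^] m) [^] q), c * inverse (c0 powi q)) \<in> \<Gamma>"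
      using c mq char_graph_mult char_graph_inv by blast
    moreover have "h [^] n \<otimes> inv ((h [^] m) [^] q) = h [^] (n mod int m)"
    proof -
      have "n mod int m = n + - (int m * q)" unfolding q_def
        by (simp add: minus_div_mult_eq_mod[symmetric] mult.commute)
      then show ?thesis using h unfolding eq by (simp add: int_pow_diff)
    qed
    moreover have "h [^] (n mod int m) = h [^] nat (n mod int m)"
      using m by (simp add: int_pow_def2 del: pow_nat)
    ultimately have "h [^] nat (n mod int m) \<in> Domain \<Gamma>" by auto
    moreover have "n mod int m < int m" "n mod int m \<ge> 0" using m by simp_all
    ultimately have "n mod int m = 0" using m_least[of "nat (n mod int m)"] by force
    then have n: "n = int m * q" unfolding q_def by auto
    have "c = c0 powi q" using char_graph_unique c mq eq n by simp
    also have "\<dots> = z powi n" unfolding n z(1)[symmetric]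
      by (simp add: power_int_mult)
    finally show ?thesis .
  qed
  then show ?thesis using z0 z by blast
qed

text \<open>The subgroup generated by \<open>\<Gamma>\<close> and (h, z). It is still a graph: a
  relation 1 = a h^n puts h^n into the old domain with the inverse of the value at a, and z was
  chosen to agree there.\<close>

lemma char_graph_extend:
  assumes h: "h \<in> carrier G" "h \<notin> Domain \<Gamma>"
  shows "\<exists>\<Gamma>' z. char_graph G \<Gamma>' \<and> \<Gamma> \<subseteq> \<Gamma>' \<and> (h, z) \<in> \<Gamma>' \<and> z \<noteq> 1"
proof -
  obtain z where z: "z \<noteq> 0" "z \<noteq> 1" "\<And>(n::int) c. (h [^] n, c) \<in> \<Gamma> \<Longrightarrow> c = z powi n"
    using char_graph_root[OF h] by blast
  define \<Gamma>' where "\<Gamma>' = {(a \<otimes> h [^] n, c * z powi n) | a c (n::int). (a, c) \<in> \<Gamma>}"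
  have sub: "\<Gamma> \<subseteq> \<Gamma>'"
  proof (rule subrelI)
    fix a c assume ac: "(a, c) \<in> \<Gamma>"
    then have "(a, c) = (a \<otimes> h [^] (0::int), c * z powi 0)" using char_graph_carrier by simp
    then show "(a, c) \<in> \<Gamma>'" unfolding \<Gamma>'_def using ac by blast
  qed
  have "(h, z) = (\<one> \<otimes> h [^] (1::int), 1 * z powi 1)" using h by simp
  then have hz: "(h, z) \<in> \<Gamma>'" unfolding \<Gamma>'_def using char_graph_one by blast
  have "char_graph G \<Gamma>'"
  proof (rule char_graphI)
    show "(\<one>, 1) \<in> \<Gamma>'" using sub char_graph_one by blast
    show "a \<in> carrier G \<and> c \<noteq> 0" if "(a, c) \<in> \<Gamma>'" for a c
      using that h(1) z(1) char_graph_carrier char_graph_nonzero unfolding \<Gamma>'_def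
      by auto
    show "(a \<otimes> b, c * d) \<in> \<Gamma>'" if ac: "(a, c) \<in> \<Gamma>'" and bd: "(b, d) \<in> \<Gamma>'" for a b c d
    proof -
      obtain a1 c1 and n :: int where 1: "(a1, c1) \<in> \<Gamma>" "a = a1 \<otimes> h [^] n" "c = c1 * z powi n"
        using ac unfolding \<Gamma>'_def by auto
      obtain b1 d1 and k :: int where 2: "(b1, d1) \<in> \<Gamma>" "b = b1 \<otimes> h [^] k" "d = d1 * z powi k"
        using bd unfolding \<Gamma>'_def by auto
      have "a \<otimes> b = (a1 \<otimes> b1) \<otimes> h [^] (n + k)"
        using 1 2 h char_graph_carrier by (simp add: int_pow_mult m_ac)
      moreover have "c * d = (c1 * d1) * z powi (n + k)"
        using 1 2 z by (simp add: power_int_add)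
      ultimately show ?thesis unfolding \<Gamma>'_def using char_graph_mult[OF 1(1) 2(1)] by blast
    qed
    show "(inv a, inverse c) \<in> \<Gamma>'" if ac: "(a, c) \<in> \<Gamma>'" for a c
    proof -
      obtain a1 c1 and n :: int where 1: "(a1, c1) \<in> \<Gamma>" "a = a1 \<otimes> h [^] n" "c = c1 * z powi n"
        using ac unfolding \<Gamma>'_def by auto
      have "inv a = inv a1 \<otimes> h [^] (- n)"
        using 1 h char_graph_carrier by (simp add: int_pow_neg inv_mult)
      moreover have "inverse c = inverse c1 * z powi (- n)"
        using 1 z by (simp add: power_int_minus)
      ultimately show ?thesis unfolding \<Gamma>'_def using char_graph_inv[OF 1(1)] by blast
    qed
    show "c = 1" if c: "(\<one>, c) \<in> \<Gamma>'" for c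
    proof -
      obtain a1 c1 and n :: int where 1: "(a1, c1) \<in> \<Gamma>" "\<one> = a1 \<otimes> h [^] n" "c = c1 * z powi n"
        using c unfolding \<Gamma>'_def by auto
      have "inv a1 = h [^] n"
        using 1 h char_graph_carrier by (metis int_pow_closed inv_equality inv_inv m_comm)
      then have "(h [^] n, inverse c1) \<in> \<Gamma>" using char_graph_inv[OF 1(1)] by simp
      then have "inverse c1 = z powi n" using z by blast
      then show ?thesis using 1 char_graph_nonzero[OF 1(1)] by (metis right_inverse)
    qed
  qed
  then show ?thesis using sub hz z by blast
qed

end

text \<open>By Zorn's lemma there is a maximal partial character, and it is total since any missing
  element could be adjoined. This is the injectivity of the divisible group of nonzero
  scalars.\<close>

theorem character_extension:
  fixes \<Gamma> :: "('a \<times> 'k::{alg_closed_field, field_char_0}) set"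
  assumes "char_graph G \<Gamma>"
  obtains \<chi> where "\<And>a. a \<in> carrier G \<Longrightarrow> \<chi> a \<noteq> 0"
    and "\<And>a b. a \<in> carrier G \<Longrightarrow> b \<in> carrier G \<Longrightarrow> \<chi> (a \<otimes> b) = \<chi> a * \<chi> b"
    and "\<And>a c. (a, c) \<in> \<Gamma> \<Longrightarrow> \<chi> a = c"
proof -
  let ?A = "{\<Delta>. char_graph G \<Delta> \<and> \<Gamma> \<subseteq> \<Delta>}"
  have "\<Union>C \<in> ?A" if C: "subset.chain ?A C" "C \<noteq> {}" for C
  proof -
    have ch: "\<And>\<Delta>. \<Delta> \<in> C \<Longrightarrow> char_graph G \<Delta> \<and> \<Gamma> \<subseteq> \<Delta>"
      and tot: "\<And>\<Delta> \<Delta>'. \<Delta> \<in> C \<Longrightarrow> \<Delta>' \<in> C \<Longrightarrow> \<Delta> \<subseteq> \<Delta>' \<or> \<Delta>' \<subseteq> \<Delta>"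
      using C(1) unfolding subset.chain_def by (blast, auto simp: subset_iff_psubset_eq)
    have "char_graph G (\<Union>C)"
    proof (rule char_graphI)
      show "(\<one>, 1) \<in> \<Union>C" using C(2) ch char_graph_one by blast
      show "a \<in> carrier G \<and> c \<noteq> 0" if "(a, c) \<in> \<Union>C" for a c
        using that ch char_graph_carrier char_graph_nonzero by blast+
      show "(a \<otimes> b, c * d) \<in> \<Union>C"
        if ac: "(a, c) \<in> \<Union>C" and bd: "(b, d) \<in> \<Union>C" for a b c d
      proof -
        obtain \<Delta> \<Delta>' where "(a, c) \<in> \<Delta>" "\<Delta> \<in> C" "(b, d) \<in> \<Delta>'" "\<Delta>' \<in> C"
          using ac bd by blast
        then show ?thesis using tot[of \<Delta> \<Delta>'] ch char_graph_mult by (metis UnionI subsetD)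
      qed
      show "(inv a, inverse c) \<in> \<Union>C" if "(a, c) \<in> \<Union>C" for a c
        using that ch char_graph_inv by blast
      show "c = 1" if "(\<one>, c) \<in> \<Union>C" for c
        using that ch char_graph_at_one by blast
    qed
    then show ?thesis using C(2) ch by blast
  qed
  moreover have "?A \<noteq> {}" using assms by blast
  ultimately obtain M where M: "M \<in> ?A" and max: "\<And>X. X \<in> ?A \<Longrightarrow> M \<subseteq> X \<Longrightarrow> X = M"
    using subset_Zorn_nonempty[of ?A] by auto
  have dom: "a \<in> Domain M" if aG: "a \<in> carrier G" for a
  proof (rule ccontr)
    assume a: "a \<notin> Domain M"
    obtain \<Gamma>' z where "char_graph G \<Gamma>'" "M \<subseteq> \<Gamma>'" "(a, z) \<in> \<Gamma>'"
      using char_graph_extend[of M, OF _ aG a] M by blast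
    then show False using max[of \<Gamma>'] M a by blast
  qed
  define \<chi> where "\<chi> a = (THE c. (a, c) \<in> M)" for a
  have \<chi>: "\<chi> a = c" if "(a, c) \<in> M" for a c
    unfolding \<chi>_def using that char_graph_unique[of M] M by blast
  have \<chi>': "(a, \<chi> a) \<in> M" if "a \<in> carrier G" for a
    using \<chi> dom[OF that] by auto
  show ?thesis
  proof (rule that)
    show "\<chi> a \<noteq> 0" if "a \<in> carrier G" for a
      using \<chi>'[OF that] M char_graph_nonzero by blast
    show "\<chi> (a \<otimes> b) = \<chi> a * \<chi> b" if "a \<in> carrier G" "b \<in> carrier G" for a b
      using \<chi>'[OF that(1)] \<chi>'[OF that(2)] M char_graph_mult \<chi> by blast
    show "\<chi> a = c" if "(a, c) \<in> \<Gamma>" for a c using that M \<chi> by blast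
  qed
qed

text \<open>The trivial character of {1} is first extended to h with a value other than 1, and only
  then to the whole group.\<close>

theorem character_separation:
  assumes "h \<in> carrier G" "h \<noteq> \<one>"
  obtains \<chi> :: "'a \<Rightarrow> 'k::{alg_closed_field, field_char_0}"
  where "\<And>a. a \<in> carrier G \<Longrightarrow> \<chi> a \<noteq> 0"
    and "\<And>a b. a \<in> carrier G \<Longrightarrow> b \<in> carrier G \<Longrightarrow> \<chi> (a \<otimes> b) = \<chi> a * \<chi> b"
    and "\<chi> h \<noteq> 1"
proof -
  have "char_graph G {(\<one>, 1::'k)}" unfolding char_graph_def by auto
  moreover have "h \<notin> Domain {(\<one>, 1::'k)}" using assms by auto
  ultimately obtain \<Gamma> z where g: "char_graph G \<Gamma>" "(h, z) \<in> \<Gamma>" "z \<noteq> (1::'k)"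
    using char_graph_extend[of "{(\<one>, 1::'k)}"] assms by blast
  obtain \<chi> where "\<And>a. a \<in> carrier G \<Longrightarrow> \<chi> a \<noteq> 0"
    "\<And>a b. a \<in> carrier G \<Longrightarrow> b \<in> carrier G \<Longrightarrow> \<chi> (a \<otimes> b) = \<chi> a * \<chi> b"
    "\<And>a c. (a, c) \<in> \<Gamma> \<Longrightarrow> \<chi> a = c"
    using character_extension[OF g(1)] by blast
  then show ?thesis using that g by metis
qed

text \<open>The cocycle is a coboundary because it makes \<open>K\<^sup>* \<times> G\<close> an abelian group, to which
  the character \<open>(c, 1) \<mapsto> c\<close> extends.\<close>

theorem symmetric_cocycle_splits:
  fixes \<tau> :: "'a \<Rightarrow> 'a \<Rightarrow> 'k::{alg_closed_field, field_char_0}"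
  assumes nz: "\<And>a b. a \<in> carrier G \<Longrightarrow> b \<in> carrier G \<Longrightarrow> \<tau> a b \<noteq> 0"
    and one: "\<And>a. a \<in> carrier G \<Longrightarrow> \<tau> \<one> a = 1"
    and sym: "\<And>a b. a \<in> carrier G \<Longrightarrow> b \<in> carrier G \<Longrightarrow> \<tau> a b = \<tau> b a"
    and cocycle: "\<And>a b c. a \<in> carrier G \<Longrightarrow> b \<in> carrier G \<Longrightarrow> c \<in> carrier G \<Longrightarrow>
      \<tau> a b * \<tau> (a \<otimes> b) c = \<tau> a (b \<otimes> c) * \<tau> b c"
  obtains l where "\<And>a. a \<in> carrier G \<Longrightarrow> l a \<noteq> 0"
    and "\<And>a b. a \<in> carrier G \<Longrightarrow> b \<in> carrier G \<Longrightarrow> l a * l b = \<tau> a b * l (a \<otimes> b)"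
proof -
  define E where "E = \<lparr>carrier = {c::'k. c \<noteq> 0} \<times> carrier G,
    monoid.mult = (\<lambda>(c, a) (d, b). (c * d * \<tau> a b, a \<otimes> b)), one = (1, \<one>)\<rparr>"
  interpret E: comm_group E
  proof (rule comm_groupI)
    show "\<exists>y\<in>carrier E. y \<otimes>\<^bsub>E\<^esub> x = \<one>\<^bsub>E\<^esub>" if x: "x \<in> carrier E" for x
    proof -
      obtain c a where ca: "x = (c, a)" "c \<noteq> 0" "a \<in> carrier G" using x by (auto simp: E_def)
      have "(inverse c * inverse (\<tau> (inv a) a), inv a) \<otimes>\<^bsub>E\<^esub> x = \<one>\<^bsub>E\<^esub>"
        using ca nz[of "inv a" a] by (simp add: E_def field_simps)
      moreover have "(inverse c * inverse (\<tau> (inv a) a), inv a) \<in> carrier E"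
        using ca nz[of "inv a" a] by (simp add: E_def)
      ultimately show ?thesis by blast
    qed
    show "x \<otimes>\<^bsub>E\<^esub> y \<otimes>\<^bsub>E\<^esub> z = x \<otimes>\<^bsub>E\<^esub> (y \<otimes>\<^bsub>E\<^esub> z)"
      if "x \<in> carrier E" "y \<in> carrier E" "z \<in> carrier E" for x y z
    proof -
      obtain c a d b e f where "x = (c, a)" "y = (d, b)" "z = (e, f)" by (metis surj_pair)
      then show ?thesis using that cocycle[of a b f] by (auto simp: E_def m_assoc)
    qed
  qed (auto simp: E_def nz one sym[of _ "\<one>"] intro: sym m_comm)
  \<comment> \<open>The projection of the copy of the nonzero scalars inside E; it is multiplicative
    because \<tau> is normalized.\<close>
  have "char_graph E {((c, \<one>), c) | c. c \<noteq> (0::'k)}"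
  proof (rule char_graphI)
    fix a and c :: 'k assume "(a, c) \<in> {((c, \<one>), c) | c. c \<noteq> (0::'k)}"
    then have ac: "a = (c, \<one>)" and "c \<noteq> 0" by auto
    then have "inv\<^bsub>E\<^esub> (c, \<one>) = (inverse c, \<one>)"
      by (intro E.inv_equality) (auto simp: E_def one)
    then show "(inv\<^bsub>E\<^esub> a, inverse c) \<in> {((c, \<one>), c) | c. c \<noteq> (0::'k)}"
      using \<open>c \<noteq> 0\<close> ac by auto
  qed (auto simp: E_def one)
  then obtain \<chi> where \<chi>: "\<And>a. a \<in> carrier E \<Longrightarrow> \<chi> a \<noteq> (0::'k)"
    "\<And>a b. a \<in> carrier E \<Longrightarrow> b \<in> carrier E \<Longrightarrow> \<chi> (a \<otimes>\<^bsub>E\<^esub> b) = \<chi> a * \<chi> b"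
    "\<And>c. c \<noteq> 0 \<Longrightarrow> \<chi> (c, \<one>) = c"
    by (rule E.character_extension) blast
  \<comment> \<open>The splitting is l(a) = \<chi>(1, a); its relation is the image of (1, a)(1, b)
    = (\<tau>(a, b), 1)(1, ab).\<close>
  have "\<chi> (1, a) * \<chi> (1, b) = \<tau> a b * \<chi> (1, a \<otimes> b)" if "a \<in> carrier G" "b \<in> carrier G" for a b
  proof -
    have "\<chi> (1, a) * \<chi> (1, b) = \<chi> ((1, a) \<otimes>\<^bsub>E\<^esub> (1, b))"
      using that by (intro \<chi>(2)[symmetric]) (auto simp: E_def)
    also have "(1, a) \<otimes>\<^bsub>E\<^esub> (1, b) = (\<tau> a b, \<one>) \<otimes>\<^bsub>E\<^esub> (1, a \<otimes> b)"
      using that by (simp add: E_def one)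
    also have "\<chi> \<dots> = \<chi> (\<tau> a b, \<one>) * \<chi> (1, a \<otimes> b)"
      using that nz by (intro \<chi>(2)) (auto simp: E_def)
    finally show ?thesis using \<chi>(3) nz that by simp
  qed
  moreover have "\<chi> (1, a) \<noteq> 0" if "a \<in> carrier G" for a
    using \<chi>(1) that by (simp add: E_def)
  ultimately show ?thesis using that[of "\<lambda>a. \<chi> (1, a)"] by blast
qed

end

section \<open>Algebras and noncommutative polynomials\<close>

lemma (in abelian_monoid) finsum_swap:
  assumes "finite S" "finite T" "\<And>s t. s \<in> S \<Longrightarrow> t \<in> T \<Longrightarrow> f s t \<in> carrier G"
  shows "(\<Oplus>s\<in>S. \<Oplus>t\<in>T. f s t) = (\<Oplus>t\<in>T. \<Oplus>s\<in>S. f s t)"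
  using assms(1,3)
proof (induction S rule: finite_induct)
  case empty
  then show ?case by simp
next
  case (insert a S)
  then have "(\<Oplus>t\<in>T. \<Oplus>s\<in>insert a S. f s t) = (\<Oplus>t\<in>T. f a t \<oplus> (\<Oplus>s\<in>S. f s t))"
    by (intro finsum_cong') (auto simp: Pi_def intro!: a_closed finsum_closed)
  also have "\<dots> = (\<Oplus>t\<in>T. f a t) \<oplus> (\<Oplus>t\<in>T. \<Oplus>s\<in>S. f s t)"
    using insert by (intro finsum_addf) (auto intro!: finsum_closed)
  finally show ?case using insert by (simp add: Pi_def)
qed

context unital_algebra
begin

lemma smult_0: "x \<in> carrier A \<Longrightarrow> (0::'k) \<odot> x = \<zero>"
  using smult_add_left[of x 0 0] smult_closed[of x 0]
  by (metis add.r_cancel_one' add_0)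

lemma smult_zero: "c \<odot> \<zero> = \<zero>"
  using smult_add_right[of "\<zero>" "\<zero>" c] smult_closed[of "\<zero>" c] by (metis add.r_cancel_one' l_zero zero_closed)

lemma smult_minus: "x \<in> carrier A \<Longrightarrow> (- c) \<odot> x = \<ominus> (c \<odot> x)"
  using smult_add_left[of x "- c" c]
  by (simp add: smult_0 smult_closed minus_equality)

lemma smult_finsum:
  "finite S \<Longrightarrow> f \<in> S \<rightarrow> carrier A \<Longrightarrow> c \<odot> (\<Oplus>s\<in>S. f s) = (\<Oplus>s\<in>S. c \<odot> f s)"
proof (induction S rule: finite_induct)
  case empty
  then show ?case by (simp add: smult_zero)
next
  case (insert a S)
  then have "(\<lambda>s. c \<odot> f s) \<in> S \<rightarrow> carrier A" "f \<in> S \<rightarrow> carrier A" by (auto intro: smult_closed)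
  then show ?case using insert by (simp add: smult_add_right smult_closed)
qed

lemma sum_smult:
  "finite S \<Longrightarrow> x \<in> carrier A \<Longrightarrow> (\<Sum>s\<in>S. f s) \<odot> x = (\<Oplus>s\<in>S. f s \<odot> x)"
  by (induction S rule: finite_induct) (simp_all add: smult_0 smult_add_left smult_closed Pi_def)

lemma smult_eq_zero_iff: "x \<in> carrier A \<Longrightarrow> c \<odot> x = \<zero> \<longleftrightarrow> c = 0 \<or> x = \<zero>"
  by (metis left_inverse smult_0 smult_1 smult_smult smult_zero)

lemma smult_mult_smult:
  "x \<in> carrier A \<Longrightarrow> y \<in> carrier A \<Longrightarrow> (c \<odot> x) \<otimes> (d \<odot> y) = (c * d) \<odot> (x \<otimes> y)"
  by (simp add: smult_mult_left smult_mult_right smult_smult smult_closed mult.commute)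

lemma lin_span_closed: "x \<in> lin_span A S \<Longrightarrow> S \<subseteq> carrier A \<Longrightarrow> x \<in> carrier A"
  by (induction rule: lin_span.induct) (auto intro: smult_closed)

lemma lin_span_add:
  assumes "S \<subseteq> carrier A" "y \<in> lin_span A S"
  shows "x \<in> lin_span A S \<Longrightarrow> x \<oplus> y \<in> lin_span A S"
proof (induction rule: lin_span.induct)
  case zero
  then show ?case using assms lin_span_closed by simp
next
  case (step s x c)
  have "c \<odot> s \<oplus> x \<oplus> y = c \<odot> s \<oplus> (x \<oplus> y)"
    using step assms lin_span_closed by (intro a_assoc smult_closed) blast+
  then show ?case using lin_span.step[OF step.hyps(1) step.IH] by metis
qed

lemma lin_span_base: "S \<subseteq> carrier A \<Longrightarrow> s \<in> S \<Longrightarrow> s \<in> lin_span A S"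
  using lin_span.step[OF _ lin_span.zero, of s S A 1] by (auto simp: smult_1 subset_iff)

lemma lin_span_finsum:
  assumes "S \<subseteq> carrier A"
  shows "finite T \<Longrightarrow> (\<And>t. t \<in> T \<Longrightarrow> f t \<in> lin_span A S) \<Longrightarrow> (\<Oplus>t\<in>T. f t) \<in> lin_span A S"
proof (induction T rule: finite_induct)
  case empty
  then show ?case by (simp add: lin_span.zero)
next
  case (insert a T)
  then have "f \<in> T \<rightarrow> carrier A" "f a \<in> carrier A" using lin_span_closed assms by blast+
  then show ?case using insert lin_span_add assms by simp
qed

end

lemma with_grading_simps [simp]:
  "carrier (with_grading A C) = carrier A"
  "monoid.mult (with_grading A C) = monoid.mult A"
  "one (with_grading A C) = one A"
  "ring.zero (with_grading A C) = ring.zero A"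
  "ring.add (with_grading A C) = ring.add A"
  "module.smult (with_grading A C) = module.smult A"
  "hcomp (with_grading A C) = C"
  by (simp_all add: with_grading_def module.defs gr_algebra.defs)

lemma module_truncate_simps [simp]:
  "carrier (module.truncate A) = carrier A"
  "monoid.mult (module.truncate A) = monoid.mult A"
  "one (module.truncate A) = one A"
  "ring.zero (module.truncate A) = ring.zero A"
  "ring.add (module.truncate A) = ring.add A"
  "module.smult (module.truncate A) = module.smult A"
  by (simp_all add: module.defs)

text \<open>Additive inverses come from closure under scalars, as -x = (-1) x. The two record types
  may differ, so that the rule covers graded subalgebras of ungraded algebras and changes of the
  grading alike.\<close>

lemma unital_algebra_subalgebra:
  fixes A :: "('k::field, 'a, 'm) module_scheme" and A' :: "('k, 'a, 'n) module_scheme"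
  assumes A: "unital_algebra A"
    and ops: "monoid.mult A' = monoid.mult A" "one A' = one A" "ring.zero A' = ring.zero A"
      "ring.add A' = ring.add A" "module.smult A' = module.smult A"
    and sub: "carrier A' \<subseteq> carrier A"
    and closed: "\<one>\<^bsub>A\<^esub> \<in> carrier A'" "\<zero>\<^bsub>A\<^esub> \<in> carrier A'"
      "\<And>x y. x \<in> carrier A' \<Longrightarrow> y \<in> carrier A' \<Longrightarrow> x \<otimes>\<^bsub>A\<^esub> y \<in> carrier A'"
      "\<And>x y. x \<in> carrier A' \<Longrightarrow> y \<in> carrier A' \<Longrightarrow> x \<oplus>\<^bsub>A\<^esub> y \<in> carrier A'"
      "\<And>c x. x \<in> carrier A' \<Longrightarrow> c \<odot>\<^bsub>A\<^esub> x \<in> carrier A'"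
  shows "unital_algebra A'"
proof -
  interpret A: unital_algebra A by (rule A)
  have in_A: "\<And>x. x \<in> carrier A' \<Longrightarrow> x \<in> carrier A" using sub by blast
  interpret R: ring A'
  proof (rule ringI)
    show "abelian_group A'"
    proof (rule abelian_groupI)
      fix x assume x: "x \<in> carrier A'"
      show "\<exists>y\<in>carrier A'. y \<oplus>\<^bsub>A'\<^esub> x = \<zero>\<^bsub>A'\<^esub>"
        using closed(5)[OF x, of "-1"] in_A[OF x] A.smult_add_left[of x "-1" 1]
        by (intro bexI[of _ "(-1) \<odot>\<^bsub>A\<^esub> x"]) (simp_all add: ops A.smult_1 A.smult_0)
    qed (auto simp: ops closed in_A A.a_ac)
    show "monoid A'"
      by (rule monoidI) (auto simp: ops closed in_A A.m_assoc)
  qed (auto simp: ops in_A A.l_distr A.r_distr)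
  show ?thesis
    by unfold_locales
      (auto simp: ops closed in_A A.smult_add_left A.smult_add_right A.smult_smult A.smult_1
        A.smult_mult_left A.smult_mult_right)
qed

section \<open>Products, powers and substitutions of noncommutative polynomials\<close>

definition ncvars :: "('x, 'k::zero) ncpoly \<Rightarrow> 'x set" where
  "ncvars f = (\<Union>w\<in>Poly_Mapping.keys f. set w)"

definition ncmult :: "('x, 'k::semiring_1) ncpoly \<Rightarrow> ('x, 'k) ncpoly \<Rightarrow> ('x, 'k) ncpoly" where
  "ncmult f g = (\<Sum>u\<in>Poly_Mapping.keys f. \<Sum>w\<in>Poly_Mapping.keys g.
     Poly_Mapping.single (u @ w) (Poly_Mapping.lookup f u * Poly_Mapping.lookup g w))"

primrec ncpow :: "('x, 'k::semiring_1) ncpoly \<Rightarrow> nat \<Rightarrow> ('x, 'k) ncpoly" where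
  "ncpow f 0 = Poly_Mapping.single [] 1"
| "ncpow f (Suc m) = ncmult (ncpow f m) f"

definition ncsubst_word :: "('x \<Rightarrow> ('y, 'k::semiring_1) ncpoly) \<Rightarrow> 'x list \<Rightarrow> ('y, 'k) ncpoly" where
  "ncsubst_word s w = foldr (\<lambda>x p. ncmult (s x) p) w (Poly_Mapping.single [] 1)"

text \<open>Serves to replace a variable of coarse degree by a sum of variables of fine
  degrees.\<close>

definition ncsubst :: "('x \<Rightarrow> ('y, 'k::semiring_1) ncpoly) \<Rightarrow> ('x, 'k) ncpoly \<Rightarrow> ('y, 'k) ncpoly" where
  "ncsubst s f = (\<Sum>w\<in>Poly_Mapping.keys f.
     ncmult (Poly_Mapping.single [] (Poly_Mapping.lookup f w)) (ncsubst_word s w))"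

lemma ncvars_single: "ncvars (Poly_Mapping.single w c) \<subseteq> set w"
  by (auto simp: ncvars_def split: if_splits)

lemma ncvars_sum: "ncvars (\<Sum>s\<in>S. f s) \<subseteq> (\<Union>s\<in>S. ncvars (f s))"
  using Poly_Mapping.keys_sum[of f S] unfolding ncvars_def by blast

lemma ncvars_ncmult: "ncvars (ncmult f g) \<subseteq> ncvars f \<union> ncvars g"
proof -
  have "x \<in> ncvars f \<union> ncvars g" if x: "x \<in> ncvars (ncmult f g)" for x
  proof -
      obtain u where u: "u \<in> Poly_Mapping.keys f" "x \<in> ncvars (\<Sum>w\<in>Poly_Mapping.keys g.
        Poly_Mapping.single (u @ w) (Poly_Mapping.lookup f u * Poly_Mapping.lookup g w))"
        using x ncvars_sum unfolding ncmult_def by fast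
      then obtain w where w: "w \<in> Poly_Mapping.keys g" "x \<in> ncvars
        (Poly_Mapping.single (u @ w) (Poly_Mapping.lookup f u * Poly_Mapping.lookup g w))"
        using ncvars_sum by fast
      then have "x \<in> set (u @ w)" using ncvars_single by fast
      then show ?thesis using u w unfolding ncvars_def by auto
  qed
  then show ?thesis by blast
qed

lemma ncvars_ncpow: "ncvars (ncpow f m) \<subseteq> ncvars f"
proof (induction m)
  case 0
  then show ?case using ncvars_single[of "[]" "1::'b"] by auto
next
  case (Suc m)
  then show ?case using ncvars_ncmult[of "ncpow f m" f] by auto
qed

lemma ncvars_ncsubst: "ncvars (ncsubst s f) \<subseteq> (\<Union>x\<in>ncvars f. ncvars (s x))"
proof -
  have word: "ncvars (ncsubst_word s w) \<subseteq> (\<Union>x\<in>set w. ncvars (s x))" for w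
    unfolding ncsubst_word_def
  proof (induction w)
    case Nil
    then show ?case using ncvars_single[of "[]"] by simp
  next
    case (Cons x w)
    then show ?case
      using ncvars_ncmult[of "s x" "foldr (\<lambda>x. ncmult (s x)) w (Poly_Mapping.single [] 1)"] by auto
  qed
  show ?thesis
  proof
    fix y assume "y \<in> ncvars (ncsubst s f)"
    then obtain w where w: "w \<in> Poly_Mapping.keys f"
      "y \<in> ncvars (ncmult (Poly_Mapping.single [] (Poly_Mapping.lookup f w)) (ncsubst_word s w))"
      unfolding ncsubst_def using ncvars_sum by fastforce
    then have "y \<in> ncvars (ncsubst_word s w)"
      using ncvars_ncmult ncvars_single[of "[]"] by fastforce
    then show "y \<in> (\<Union>x\<in>ncvars f. ncvars (s x))" using word[of w] w unfolding ncvars_def by blast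
  qed
qed

lemma graded_ncpolys_iff: "f \<in> graded_ncpolys G \<longleftrightarrow> snd ` ncvars f \<subseteq> carrier G"
  unfolding graded_ncpolys_def ncvars_def by fast

lemma eval_word_Nil [simp]: "eval_word A v [] = \<one>\<^bsub>A\<^esub>"
  and eval_word_Cons [simp]: "eval_word A v (x # w) = v x \<otimes>\<^bsub>A\<^esub> eval_word A v w"
  by (simp_all add: eval_word_def)

lemma eval_word_cong: "(\<And>x. x \<in> set w \<Longrightarrow> v x = v' x) \<Longrightarrow> eval_word A v w = eval_word A v' w"
  by (induction w) auto

context unital_algebra
begin

lemma eval_word_closed [intro]:
  "(\<And>x. x \<in> set w \<Longrightarrow> v x \<in> carrier A) \<Longrightarrow> eval_word A v w \<in> carrier A"
  by (induction w) auto

lemma eval_ncpoly_cong: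
  assumes "\<And>x. x \<in> ncvars f \<Longrightarrow> v x = v' x \<and> v x \<in> carrier A"
  shows "eval_ncpoly A v f = eval_ncpoly A v' f"
  unfolding eval_ncpoly_def
proof (rule finsum_cong')
  show "(\<lambda>w. Poly_Mapping.lookup f w \<odot> eval_word A v' w) \<in> Poly_Mapping.keys f \<rightarrow> carrier A"
    using assms unfolding ncvars_def by (intro Pi_I smult_closed eval_word_closed) fastforce
  show "Poly_Mapping.lookup f w \<odot> eval_word A v w = Poly_Mapping.lookup f w \<odot> eval_word A v' w"
    if "w \<in> Poly_Mapping.keys f" for w
    using assms that unfolding ncvars_def by (auto intro!: arg_cong[of _ _ "\<lambda>x. _ \<odot> x"] eval_word_cong)
qed simp

context
  fixes v :: "'x \<Rightarrow> 'a"
  assumes v: "\<And>x. v x \<in> carrier A"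
begin

lemma eval_word_in_carrier [simp]: "eval_word A v w \<in> carrier A"
  using v by blast

lemma eval_word_append: "eval_word A v (w @ w') = eval_word A v w \<otimes> eval_word A v w'"
  by (induction w) (auto simp: v m_assoc)

lemma eval_ncpoly_closed [simp]: "eval_ncpoly A v f \<in> carrier A"
  unfolding eval_ncpoly_def by (intro finsum_closed) (auto intro: smult_closed)

lemma eval_ncpoly_superset:
  assumes "finite S" "Poly_Mapping.keys f \<subseteq> S"
  shows "eval_ncpoly A v f = (\<Oplus>w\<in>S. Poly_Mapping.lookup f w \<odot> eval_word A v w)"
  unfolding eval_ncpoly_def
  by (rule add.finprod_mono_neutral_cong_left)
    (use assms in \<open>auto simp: in_keys_iff smult_0 smult_closed\<close>)

lemma eval_ncpoly_zero: "eval_ncpoly A v 0 = \<zero>"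
  by (simp add: eval_ncpoly_def)

lemma eval_ncpoly_add: "eval_ncpoly A v (f + g) = eval_ncpoly A v f \<oplus> eval_ncpoly A v g"
proof -
  let ?S = "Poly_Mapping.keys f \<union> Poly_Mapping.keys g"
  have "Poly_Mapping.keys (f + g) \<subseteq> ?S" by (rule Poly_Mapping.keys_add)
  then have "eval_ncpoly A v (f + g) = (\<Oplus>w\<in>?S. (Poly_Mapping.lookup f w \<odot> eval_word A v w) \<oplus>
      (Poly_Mapping.lookup g w \<odot> eval_word A v w))"
    by (subst eval_ncpoly_superset[of ?S]) (simp_all add: lookup_add smult_add_left)
  also have "\<dots> = eval_ncpoly A v f \<oplus> eval_ncpoly A v g"
    by (subst finsum_addf) (auto simp: smult_closed eval_ncpoly_superset[of ?S])
  finally show ?thesis .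
qed

lemma eval_ncpoly_sum:
  "finite S \<Longrightarrow> eval_ncpoly A v (\<Sum>s\<in>S. f s) = (\<Oplus>s\<in>S. eval_ncpoly A v (f s))"
  by (induction S rule: finite_induct) (simp_all add: eval_ncpoly_zero eval_ncpoly_add Pi_def)

lemma eval_ncpoly_single: "eval_ncpoly A v (Poly_Mapping.single w c) = c \<odot> eval_word A v w"
  by (subst eval_ncpoly_superset[of "{w}"]) (simp_all add: smult_closed)

lemma eval_ncpoly_ncmult: "eval_ncpoly A v (ncmult f g) = eval_ncpoly A v f \<otimes> eval_ncpoly A v g"
proof -
  have "eval_ncpoly A v (ncmult f g) = (\<Oplus>u\<in>Poly_Mapping.keys f. \<Oplus>w\<in>Poly_Mapping.keys g.
      (Poly_Mapping.lookup f u \<odot> eval_word A v u) \<otimes> (Poly_Mapping.lookup g w \<odot> eval_word A v w))"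
    unfolding ncmult_def
    by (simp add: eval_ncpoly_sum eval_ncpoly_single eval_word_append smult_mult_smult)
  also have "\<dots> = (\<Oplus>u\<in>Poly_Mapping.keys f.
      (Poly_Mapping.lookup f u \<odot> eval_word A v u) \<otimes> eval_ncpoly A v g)"
    unfolding eval_ncpoly_def
    by (intro finsum_cong' refl) (auto simp: finsum_rdistr smult_closed intro!: finsum_closed)
  also have "\<dots> = eval_ncpoly A v f \<otimes> eval_ncpoly A v g"
    by (subst eval_ncpoly_def[of A v f], subst finsum_ldistr) (auto simp: smult_closed)
  finally show ?thesis .
qed

lemma eval_ncpoly_ncmult_const:
  "eval_ncpoly A v (ncmult (Poly_Mapping.single [] c) f) = c \<odot> eval_ncpoly A v f"
  by (simp add: eval_ncpoly_ncmult eval_ncpoly_single smult_mult_left)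

lemma eval_ncpow: "eval_ncpoly A v (ncpow f m) = eval_ncpoly A v f [^] m"
  by (induction m) (simp_all add: eval_ncpoly_single smult_1 eval_ncpoly_ncmult)

lemma eval_ncsubst:
  "eval_ncpoly A v (ncsubst s f) = eval_ncpoly A (\<lambda>x. eval_ncpoly A v (s x)) f"
proof -
  have "eval_ncpoly A v (ncsubst_word s w) = eval_word A (\<lambda>x. eval_ncpoly A v (s x)) w" for w
    unfolding ncsubst_word_def
    by (induction w) (simp_all add: eval_ncpoly_single smult_1 eval_ncpoly_ncmult)
  then show ?thesis
    unfolding ncsubst_def eval_ncpoly_def[of A "\<lambda>x. eval_ncpoly A v (s x)"]
    by (subst eval_ncpoly_sum)
      (auto simp: eval_ncpoly_ncmult_const intro!: finsum_cong' smult_closed eval_word_closed)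
qed

end

end

lemma eval_ncpoly_hom:
  fixes A :: "('k::field, 'a, 'm) module_scheme" and A' :: "('k, 'b, 'n) module_scheme"
  assumes A: "unital_algebra A" and A': "unital_algebra A'"
    and hom: "\<And>x. x \<in> carrier A \<Longrightarrow> \<phi> x \<in> carrier A'" "\<phi> \<one>\<^bsub>A\<^esub> = \<one>\<^bsub>A'\<^esub>"
      "\<And>x y. x \<in> carrier A \<Longrightarrow> y \<in> carrier A \<Longrightarrow> \<phi> (x \<otimes>\<^bsub>A\<^esub> y) = \<phi> x \<otimes>\<^bsub>A'\<^esub> \<phi> y"
      "\<And>x y. x \<in> carrier A \<Longrightarrow> y \<in> carrier A \<Longrightarrow> \<phi> (x \<oplus>\<^bsub>A\<^esub> y) = \<phi> x \<oplus>\<^bsub>A'\<^esub> \<phi> y"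
      "\<And>c x. x \<in> carrier A \<Longrightarrow> \<phi> (c \<odot>\<^bsub>A\<^esub> x) = c \<odot>\<^bsub>A'\<^esub> \<phi> x"
    and v: "\<And>x::'x. v x \<in> carrier A"
  shows "\<phi> (eval_ncpoly A v f) = eval_ncpoly A' (\<lambda>x. \<phi> (v x)) f"
proof -
  interpret A: unital_algebra A by (rule A)
  interpret A': unital_algebra A' by (rule A')
  have word: "\<phi> (eval_word A v w) = eval_word A' (\<lambda>x. \<phi> (v x)) w" for w
    by (induction w) (simp_all add: hom v)
  have zero: "\<phi> \<zero>\<^bsub>A\<^esub> = \<zero>\<^bsub>A'\<^esub>"
    using hom(5)[of "\<zero>\<^bsub>A\<^esub>" 0] hom(1)[of "\<zero>\<^bsub>A\<^esub>"] by (simp add: A.smult_zero A'.smult_0)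
  have "finite S \<Longrightarrow> \<phi> (\<Oplus>\<^bsub>A\<^esub>w\<in>S. g w) = (\<Oplus>\<^bsub>A'\<^esub>w\<in>S. \<phi> (g w))"
    if "\<And>w. g w \<in> carrier A" for S and g :: "'x list \<Rightarrow> _"
    by (induction S rule: finite_induct) (use that in \<open>simp_all add: zero hom Pi_def\<close>)
  then show ?thesis
    unfolding eval_ncpoly_def by (simp add: A.smult_closed hom word v)
qed

text \<open>In the definition a valuation is unconstrained at variables whose degree lies outside
  the group and may even leave the carrier there. Such variables do not occur in f, so they can be
  sent to zero; the evaluation lemmas, which want all values in the carrier, then apply.\<close>

lemma graded_identitiesI:
  fixes R :: "('k::field, 'a, 'g, 'm) gr_algebra_scheme"
  assumes A: "unital_algebra R" and f: "f \<in> graded_ncpolys G"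
    and hcomp: "\<And>g. g \<in> carrier G \<Longrightarrow> hcomp R g \<subseteq> carrier R"
    and "\<And>v. (\<And>(i::nat) g. g \<in> carrier G \<Longrightarrow> v (i, g) \<in> hcomp R g) \<Longrightarrow> (\<And>x. v x \<in> carrier R) \<Longrightarrow>
      eval_ncpoly R v f = \<zero>\<^bsub>R\<^esub>"
  shows "f \<in> graded_identities G R"
  unfolding graded_identities_def
proof (intro CollectI conjI allI impI f)
  interpret unital_algebra R by (rule A)
  fix v :: "nat \<times> 'g \<Rightarrow> 'a"
  assume v: "\<forall>i. \<forall>g\<in>carrier G. v (i, g) \<in> hcomp R g"
  let ?v = "\<lambda>x. if snd x \<in> carrier G then v x else \<zero>\<^bsub>R\<^esub>"
  have "eval_ncpoly R v f = eval_ncpoly R ?v f"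
    using f v hcomp unfolding graded_ncpolys_iff by (intro eval_ncpoly_cong) force
  also have "\<dots> = \<zero>\<^bsub>R\<^esub>"
    using v hcomp by (intro assms(4)) (auto, metis (no_types, lifting) prod.collapse subsetD)
  finally show "eval_ncpoly R v f = \<zero>\<^bsub>R\<^esub>" .
qed

lemma graded_identitiesD:
  "f \<in> graded_identities G R \<Longrightarrow> f \<in> graded_ncpolys G"
  "f \<in> graded_identities G R \<Longrightarrow> (\<And>i g. g \<in> carrier G \<Longrightarrow> v (i, g) \<in> hcomp R g) \<Longrightarrow>
    eval_ncpoly R v f = \<zero>\<^bsub>R\<^esub>"
  unfolding graded_identities_def by auto

section \<open>Matrix algebras over an arbitrary unital algebra\<close>

context
  fixes B :: "('k::field, 'b, 'm) module_scheme" and n :: nat and M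
  assumes B: "unital_algebra B"
  defines "M \<equiv> matrices_over n B"
begin

interpretation B: unital_algebra B by (rule B)

lemma matrices_over_carrier:
  "x \<in> carrier M \<longleftrightarrow> x \<in> carrier_mat n n \<and> (\<forall>i<n. \<forall>j<n. x $$ (i, j) \<in> carrier B)"
  by (simp add: M_def matrices_over_def)

lemma matrices_over_dim:
  "x \<oplus>\<^bsub>M\<^esub> y \<in> carrier_mat n n" "x \<otimes>\<^bsub>M\<^esub> y \<in> carrier_mat n n"
  "c \<odot>\<^bsub>M\<^esub> x \<in> carrier_mat n n" "\<zero>\<^bsub>M\<^esub> \<in> carrier_mat n n" "\<one>\<^bsub>M\<^esub> \<in> carrier_mat n n"
  by (simp_all add: M_def matrices_over_def)

lemma matrices_over_entry:
  assumes "i < n" "j < n"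
  shows "(x \<oplus>\<^bsub>M\<^esub> y) $$ (i, j) = x $$ (i, j) \<oplus>\<^bsub>B\<^esub> y $$ (i, j)"
    "(x \<otimes>\<^bsub>M\<^esub> y) $$ (i, j) = (\<Oplus>\<^bsub>B\<^esub>l\<in>{..<n}. x $$ (i, l) \<otimes>\<^bsub>B\<^esub> y $$ (l, j))"
    "(c \<odot>\<^bsub>M\<^esub> x) $$ (i, j) = c \<odot>\<^bsub>B\<^esub> x $$ (i, j)"
    "\<zero>\<^bsub>M\<^esub> $$ (i, j) = \<zero>\<^bsub>B\<^esub>" "\<one>\<^bsub>M\<^esub> $$ (i, j) = (if i = j then \<one>\<^bsub>B\<^esub> else \<zero>\<^bsub>B\<^esub>)"
  using assms by (simp_all add: M_def matrices_over_def)

lemma matrices_over_eqI: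
  assumes "x \<in> carrier_mat n n" "y \<in> carrier_mat n n"
    "\<And>i j. i < n \<Longrightarrow> j < n \<Longrightarrow> x $$ (i, j) = y $$ (i, j)"
  shows "x = y"
  using assms by (intro eq_matI) auto

lemma matrices_over_closed:
  assumes "x \<in> carrier M" "y \<in> carrier M"
  shows "x \<oplus>\<^bsub>M\<^esub> y \<in> carrier M" "x \<otimes>\<^bsub>M\<^esub> y \<in> carrier M" "c \<odot>\<^bsub>M\<^esub> x \<in> carrier M"
  using assms
  by (simp_all add: matrices_over_carrier matrices_over_dim matrices_over_entry B.smult_closed
      B.finsum_closed Pi_def)

lemma matrices_over_const_closed: "\<zero>\<^bsub>M\<^esub> \<in> carrier M" "\<one>\<^bsub>M\<^esub> \<in> carrier M"
  by (simp_all add: matrices_over_carrier matrices_over_dim matrices_over_entry)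

lemma matrices_over_abelian_group: "abelian_group M"
proof (rule abelian_groupI)
  fix x assume x: "x \<in> carrier M"
  have "(- 1) \<odot>\<^bsub>M\<^esub> x \<oplus>\<^bsub>M\<^esub> x = \<zero>\<^bsub>M\<^esub>"
    using x
    by (intro matrices_over_eqI matrices_over_dim)
      (simp add: matrices_over_carrier matrices_over_entry B.smult_minus B.smult_1 B.l_neg)
  then show "\<exists>y\<in>carrier M. y \<oplus>\<^bsub>M\<^esub> x = \<zero>\<^bsub>M\<^esub>" using matrices_over_closed(3)[OF x x] by blast
next
  fix x y assume "x \<in> carrier M" "y \<in> carrier M"
  then show "x \<oplus>\<^bsub>M\<^esub> y = y \<oplus>\<^bsub>M\<^esub> x"
    by (intro matrices_over_eqI matrices_over_dim)
      (simp add: matrices_over_carrier matrices_over_entry B.a_comm)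
next
  fix x y z assume "x \<in> carrier M" "y \<in> carrier M" "z \<in> carrier M"
  then show "x \<oplus>\<^bsub>M\<^esub> y \<oplus>\<^bsub>M\<^esub> z = x \<oplus>\<^bsub>M\<^esub> (y \<oplus>\<^bsub>M\<^esub> z)"
    by (intro matrices_over_eqI matrices_over_dim)
      (simp add: matrices_over_carrier matrices_over_entry B.a_assoc)
next
  fix x assume x: "x \<in> carrier M"
  show "\<zero>\<^bsub>M\<^esub> \<oplus>\<^bsub>M\<^esub> x = x"
    by (rule matrices_over_eqI[OF matrices_over_dim(1)])
      (use x in \<open>simp_all add: matrices_over_carrier matrices_over_entry\<close>)
qed (simp_all add: matrices_over_closed matrices_over_const_closed)

lemma matrices_over_assoc:
  assumes xyz: "x \<in> carrier M" "y \<in> carrier M" "z \<in> carrier M"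
  shows "x \<otimes>\<^bsub>M\<^esub> y \<otimes>\<^bsub>M\<^esub> z = x \<otimes>\<^bsub>M\<^esub> (y \<otimes>\<^bsub>M\<^esub> z)"
proof (rule matrices_over_eqI[OF matrices_over_dim(2) matrices_over_dim(2)])
  fix i j assume ij: "i < n" "j < n"
  have cl: "x $$ (i, k) \<in> carrier B" "y $$ (k, l) \<in> carrier B" "z $$ (l, j) \<in> carrier B"
    if "k < n" "l < n" for k l
    using xyz that ij by (simp_all add: matrices_over_carrier)
  have "(x \<otimes>\<^bsub>M\<^esub> y \<otimes>\<^bsub>M\<^esub> z) $$ (i, j) =
      (\<Oplus>\<^bsub>B\<^esub>l\<in>{..<n}. (\<Oplus>\<^bsub>B\<^esub>k\<in>{..<n}. x $$ (i, k) \<otimes>\<^bsub>B\<^esub> y $$ (k, l)) \<otimes>\<^bsub>B\<^esub> z $$ (l, j))"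
    using ij cl
    by (simp add: matrices_over_entry) (intro B.finsum_cong'; simp add: matrices_over_entry B.finsum_closed Pi_def)
  also have "\<dots> = (\<Oplus>\<^bsub>B\<^esub>l\<in>{..<n}. \<Oplus>\<^bsub>B\<^esub>k\<in>{..<n}. x $$ (i, k) \<otimes>\<^bsub>B\<^esub> (y $$ (k, l) \<otimes>\<^bsub>B\<^esub> z $$ (l, j)))"
    using cl
    by (intro B.finsum_cong')
      (auto simp: B.finsum_ldistr B.m_assoc Pi_def intro!: B.finsum_closed B.finsum_cong')
  also have "\<dots> = (\<Oplus>\<^bsub>B\<^esub>k\<in>{..<n}. \<Oplus>\<^bsub>B\<^esub>l\<in>{..<n}. x $$ (i, k) \<otimes>\<^bsub>B\<^esub> (y $$ (k, l) \<otimes>\<^bsub>B\<^esub> z $$ (l, j)))"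
    using cl by (intro B.finsum_swap) simp_all
  also have "\<dots> = (\<Oplus>\<^bsub>B\<^esub>k\<in>{..<n}. x $$ (i, k) \<otimes>\<^bsub>B\<^esub> (\<Oplus>\<^bsub>B\<^esub>l\<in>{..<n}. y $$ (k, l) \<otimes>\<^bsub>B\<^esub> z $$ (l, j)))"
    using cl by (intro B.finsum_cong') (auto simp: B.finsum_rdistr Pi_def intro!: B.finsum_closed)
  also have "\<dots> = (x \<otimes>\<^bsub>M\<^esub> (y \<otimes>\<^bsub>M\<^esub> z)) $$ (i, j)"
    using ij cl
    by (simp add: matrices_over_entry) (intro B.finsum_cong'; simp add: matrices_over_entry B.finsum_closed Pi_def)
  finally show "(x \<otimes>\<^bsub>M\<^esub> y \<otimes>\<^bsub>M\<^esub> z) $$ (i, j) = (x \<otimes>\<^bsub>M\<^esub> (y \<otimes>\<^bsub>M\<^esub> z)) $$ (i, j)" .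
qed

lemma matrices_over_one:
  assumes x: "x \<in> carrier M"
  shows "\<one>\<^bsub>M\<^esub> \<otimes>\<^bsub>M\<^esub> x = x" "x \<otimes>\<^bsub>M\<^esub> \<one>\<^bsub>M\<^esub> = x"
proof -
  have cl: "x $$ (k, l) \<in> carrier B" if "k < n" "l < n" for k l
    using x that by (simp add: matrices_over_carrier)
  have "(\<one>\<^bsub>M\<^esub> \<otimes>\<^bsub>M\<^esub> x) $$ (i, j) = x $$ (i, j)" "(x \<otimes>\<^bsub>M\<^esub> \<one>\<^bsub>M\<^esub>) $$ (i, j) = x $$ (i, j)"
    if ij: "i < n" "j < n" for i j
  proof -
    have "(\<one>\<^bsub>M\<^esub> \<otimes>\<^bsub>M\<^esub> x) $$ (i, j) = (\<Oplus>\<^bsub>B\<^esub>l\<in>{..<n}. if i = l then x $$ (l, j) else \<zero>\<^bsub>B\<^esub>)"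
      using cl ij by (simp add: matrices_over_entry) (intro B.finsum_cong'; simp add: matrices_over_entry)
    then show "(\<one>\<^bsub>M\<^esub> \<otimes>\<^bsub>M\<^esub> x) $$ (i, j) = x $$ (i, j)"
      using B.finsum_singleton[of i "{..<n}" "\<lambda>l. x $$ (l, j)"] cl ij by (simp add: Pi_def)
    have "(x \<otimes>\<^bsub>M\<^esub> \<one>\<^bsub>M\<^esub>) $$ (i, j) = (\<Oplus>\<^bsub>B\<^esub>l\<in>{..<n}. if j = l then x $$ (i, l) else \<zero>\<^bsub>B\<^esub>)"
      using cl ij by (simp add: matrices_over_entry) (intro B.finsum_cong'; simp add: matrices_over_entry)
    then show "(x \<otimes>\<^bsub>M\<^esub> \<one>\<^bsub>M\<^esub>) $$ (i, j) = x $$ (i, j)"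
      using B.finsum_singleton[of j "{..<n}" "\<lambda>l. x $$ (i, l)"] cl ij by (simp add: Pi_def)
  qed
  then show "\<one>\<^bsub>M\<^esub> \<otimes>\<^bsub>M\<^esub> x = x" "x \<otimes>\<^bsub>M\<^esub> \<one>\<^bsub>M\<^esub> = x"
    using x by (auto intro!: matrices_over_eqI[OF matrices_over_dim(2)] simp: matrices_over_carrier)
qed

lemma matrices_over_distrib:
  assumes xyz: "x \<in> carrier M" "y \<in> carrier M" "z \<in> carrier M"
  shows "(x \<oplus>\<^bsub>M\<^esub> y) \<otimes>\<^bsub>M\<^esub> z = x \<otimes>\<^bsub>M\<^esub> z \<oplus>\<^bsub>M\<^esub> y \<otimes>\<^bsub>M\<^esub> z" (is ?l)
    "z \<otimes>\<^bsub>M\<^esub> (x \<oplus>\<^bsub>M\<^esub> y) = z \<otimes>\<^bsub>M\<^esub> x \<oplus>\<^bsub>M\<^esub> z \<otimes>\<^bsub>M\<^esub> y" (is ?r)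
proof -
  have cl: "x $$ (i, j) \<in> carrier B" "y $$ (i, j) \<in> carrier B" "z $$ (i, j) \<in> carrier B"
    if "i < n" "j < n" for i j
    using xyz that by (simp_all add: matrices_over_carrier)
  have "((x \<oplus>\<^bsub>M\<^esub> y) \<otimes>\<^bsub>M\<^esub> z) $$ (i, j) = (x \<otimes>\<^bsub>M\<^esub> z \<oplus>\<^bsub>M\<^esub> y \<otimes>\<^bsub>M\<^esub> z) $$ (i, j)"
    if ij: "i < n" "j < n" for i j
  proof -
    have "((x \<oplus>\<^bsub>M\<^esub> y) \<otimes>\<^bsub>M\<^esub> z) $$ (i, j) =
        (\<Oplus>\<^bsub>B\<^esub>l\<in>{..<n}. x $$ (i, l) \<otimes>\<^bsub>B\<^esub> z $$ (l, j) \<oplus>\<^bsub>B\<^esub> y $$ (i, l) \<otimes>\<^bsub>B\<^esub> z $$ (l, j))"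
      unfolding matrices_over_entry(2)[OF ij] using cl ij
      by (intro B.finsum_cong') (simp_all add: matrices_over_entry(1) B.l_distr)
    also have "\<dots> = (x \<otimes>\<^bsub>M\<^esub> z \<oplus>\<^bsub>M\<^esub> y \<otimes>\<^bsub>M\<^esub> z) $$ (i, j)"
      unfolding matrices_over_entry(1,2)[OF ij] using cl ij by (intro B.finsum_addf) simp_all
    finally show ?thesis .
  qed
  moreover have "(z \<otimes>\<^bsub>M\<^esub> (x \<oplus>\<^bsub>M\<^esub> y)) $$ (i, j) = (z \<otimes>\<^bsub>M\<^esub> x \<oplus>\<^bsub>M\<^esub> z \<otimes>\<^bsub>M\<^esub> y) $$ (i, j)"
    if ij: "i < n" "j < n" for i j
  proof -
    have "(z \<otimes>\<^bsub>M\<^esub> (x \<oplus>\<^bsub>M\<^esub> y)) $$ (i, j) =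
        (\<Oplus>\<^bsub>B\<^esub>l\<in>{..<n}. z $$ (i, l) \<otimes>\<^bsub>B\<^esub> x $$ (l, j) \<oplus>\<^bsub>B\<^esub> z $$ (i, l) \<otimes>\<^bsub>B\<^esub> y $$ (l, j))"
      unfolding matrices_over_entry(2)[OF ij] using cl ij
      by (intro B.finsum_cong') (simp_all add: matrices_over_entry(1) B.r_distr)
    also have "\<dots> = (z \<otimes>\<^bsub>M\<^esub> x \<oplus>\<^bsub>M\<^esub> z \<otimes>\<^bsub>M\<^esub> y) $$ (i, j)"
      unfolding matrices_over_entry(1,2)[OF ij] using cl ij by (intro B.finsum_addf) simp_all
    finally show ?thesis .
  qed
  ultimately show ?l ?r
    by (rule_tac [!] matrices_over_eqI) (simp_all add: matrices_over_dim)
qed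

lemma matrices_over_smult_mult:
  assumes xy: "x \<in> carrier M" "y \<in> carrier M"
  shows "(c \<odot>\<^bsub>M\<^esub> x) \<otimes>\<^bsub>M\<^esub> y = c \<odot>\<^bsub>M\<^esub> (x \<otimes>\<^bsub>M\<^esub> y)" (is ?l)
    "x \<otimes>\<^bsub>M\<^esub> (c \<odot>\<^bsub>M\<^esub> y) = c \<odot>\<^bsub>M\<^esub> (x \<otimes>\<^bsub>M\<^esub> y)" (is ?r)
proof -
  have cl: "x $$ (i, j) \<in> carrier B" "y $$ (i, j) \<in> carrier B" if "i < n" "j < n" for i j
    using xy that by (simp_all add: matrices_over_carrier)
  have "((c \<odot>\<^bsub>M\<^esub> x) \<otimes>\<^bsub>M\<^esub> y) $$ (i, j) = (c \<odot>\<^bsub>M\<^esub> (x \<otimes>\<^bsub>M\<^esub> y)) $$ (i, j)"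
    "(x \<otimes>\<^bsub>M\<^esub> (c \<odot>\<^bsub>M\<^esub> y)) $$ (i, j) = (c \<odot>\<^bsub>M\<^esub> (x \<otimes>\<^bsub>M\<^esub> y)) $$ (i, j)"
    if ij: "i < n" "j < n" for i j
    using cl ij
    by (simp_all add: matrices_over_entry B.smult_finsum Pi_def)
      (intro B.finsum_cong'; simp add: matrices_over_entry B.smult_mult_left B.smult_mult_right
        B.smult_closed)+
  then show ?l ?r
    by (auto intro!: matrices_over_eqI simp: matrices_over_dim)
qed

lemma matrices_over_smult:
  assumes "x \<in> carrier M" "y \<in> carrier M"
  shows "c \<odot>\<^bsub>M\<^esub> (x \<oplus>\<^bsub>M\<^esub> y) = c \<odot>\<^bsub>M\<^esub> x \<oplus>\<^bsub>M\<^esub> c \<odot>\<^bsub>M\<^esub> y"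
    "(c + d) \<odot>\<^bsub>M\<^esub> x = c \<odot>\<^bsub>M\<^esub> x \<oplus>\<^bsub>M\<^esub> d \<odot>\<^bsub>M\<^esub> x"
    "c \<odot>\<^bsub>M\<^esub> (d \<odot>\<^bsub>M\<^esub> x) = (c * d) \<odot>\<^bsub>M\<^esub> x" "1 \<odot>\<^bsub>M\<^esub> x = x"
  by (rule matrices_over_eqI;
      use assms in \<open>simp add: matrices_over_carrier matrices_over_entry matrices_over_dim
        B.smult_add_left B.smult_add_right B.smult_smult B.smult_1\<close>)+

lemma matrices_over_ring: "ring M"
proof (rule ringI[OF matrices_over_abelian_group])
  show "monoid M"
    by (rule monoidI)
      (simp_all add: matrices_over_closed matrices_over_const_closed matrices_over_assoc
        matrices_over_one)
qed (fact matrices_over_distrib)+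

lemma unital_algebra_matrices_over: "unital_algebra M"
proof -
  interpret M: ring M by (rule matrices_over_ring)
  show ?thesis
    by unfold_locales
      (rule matrices_over_smult matrices_over_smult_mult matrices_over_closed(3); assumption)+
qed

end

section \<open>Graded division algebras\<close>

locale graded_division = G: comm_group G + B: unital_algebra B
  for G :: "('g, 'n) monoid_scheme" (structure)
    and B :: "('k::{alg_closed_field, field_char_0}, 'b, 'g) gr_algebra" +
  assumes gda: "graded_division_algebra G B"
begin

abbreviation H :: "'g set" where "H \<equiv> supp G B"

lemma graded: "graded_algebra G B"
  using gda unfolding graded_division_algebra_def by blast

lemmas hcomp_subset = graded_algebra.hcomp_subset[OF graded]
  and hcomp_zero = graded_algebra.hcomp_zero[OF graded]
  and hcomp_add = graded_algebra.hcomp_add[OF graded]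
  and hcomp_smult = graded_algebra.hcomp_smult[OF graded]
  and hcomp_mult = graded_algebra.hcomp_mult[OF graded]
  and hcomp_direct_sum = graded_algebra.hcomp_direct_sum[OF graded]

lemma hcomp_carrier: "g \<in> carrier G \<Longrightarrow> x \<in> hcomp B g \<Longrightarrow> x \<in> carrier B"
  using hcomp_subset by blast

lemma one_neq_zero: "\<one>\<^bsub>B\<^esub> \<noteq> \<zero>\<^bsub>B\<^esub>"
  using gda unfolding graded_division_algebra_def by blast

lemma hcomp_Units: "g \<in> carrier G \<Longrightarrow> x \<in> hcomp B g \<Longrightarrow> x \<noteq> \<zero>\<^bsub>B\<^esub> \<Longrightarrow> x \<in> Units B"
  using gda unfolding graded_division_algebra_def by blast

lemma Units_neq_zero: "x \<in> Units B \<Longrightarrow> x \<noteq> \<zero>\<^bsub>B\<^esub>"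
  using one_neq_zero B.Units_l_inv B.r_null B.Units_inv_closed by metis

text \<open>The prescribed degree \<open>g0\<close> is put into the index set so that its component
  can be named even when it is zero.\<close>

lemma decomp_exists:
  assumes x: "x \<in> carrier B" and g0: "g0 \<in> carrier G"
  obtains F c where "finite F" "F \<subseteq> carrier G" "g0 \<in> F" "\<And>g. g \<in> F \<Longrightarrow> c g \<in> hcomp B g"
    "x = (\<Oplus>\<^bsub>B\<^esub>g\<in>F. c g)"
proof -
  obtain c where c: "\<forall>g\<in>carrier G. c g \<in> hcomp B g" "\<forall>g. g \<notin> carrier G \<longrightarrow> c g = \<zero>\<^bsub>B\<^esub>"
    "finite {g. c g \<noteq> \<zero>\<^bsub>B\<^esub>}" "x = (\<Oplus>\<^bsub>B\<^esub>g\<in>{g. c g \<noteq> \<zero>\<^bsub>B\<^esub>}. c g)"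
    using hcomp_direct_sum[OF x] by blast
  let ?F = "insert g0 {g. c g \<noteq> \<zero>\<^bsub>B\<^esub>}"
  have F: "?F \<subseteq> carrier G" using c(2) g0 by blast
  have "x = (\<Oplus>\<^bsub>B\<^esub>g\<in>?F. c g)"
    unfolding c(4)
    by (rule B.add.finprod_mono_neutral_cong_left) (use c F hcomp_carrier in auto)
  then show ?thesis using that[of ?F c] c F by blast
qed

text \<open>Carries uniqueness from families that vanish off their support to sums over any common
  finite set of degrees, by extending both families by zero.\<close>

lemma decomp_unique:
  assumes F: "finite F" "F \<subseteq> carrier G"
    and c: "\<And>g. g \<in> F \<Longrightarrow> c g \<in> hcomp B g" and d: "\<And>g. g \<in> F \<Longrightarrow> d g \<in> hcomp B g"
    and eq: "(\<Oplus>\<^bsub>B\<^esub>g\<in>F. c g) = (\<Oplus>\<^bsub>B\<^esub>g\<in>F. d g)" and g: "g \<in> F"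
  shows "c g = d g"
proof -
  define P where "P x c \<longleftrightarrow> (\<forall>g\<in>carrier G. c g \<in> hcomp B g) \<and> (\<forall>g. g \<notin> carrier G \<longrightarrow> c g = \<zero>\<^bsub>B\<^esub>) \<and>
    finite {g. c g \<noteq> \<zero>\<^bsub>B\<^esub>} \<and> x = (\<Oplus>\<^bsub>B\<^esub>g\<in>{g. c g \<noteq> \<zero>\<^bsub>B\<^esub>}. c g)" for x c
  have P: "P (\<Oplus>\<^bsub>B\<^esub>g\<in>F. c g) (\<lambda>g. if g \<in> F then c g else \<zero>\<^bsub>B\<^esub>)"
    if "\<And>g. g \<in> F \<Longrightarrow> c g \<in> hcomp B g" for c
  proof -
    let ?c = "\<lambda>g. if g \<in> F then c g else \<zero>\<^bsub>B\<^esub>"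
    have "(\<Oplus>\<^bsub>B\<^esub>g\<in>F. c g) = (\<Oplus>\<^bsub>B\<^esub>g\<in>{g. ?c g \<noteq> \<zero>\<^bsub>B\<^esub>}. ?c g)"
      by (rule B.add.finprod_mono_neutral_cong_right)
        (use that F hcomp_carrier in \<open>auto split: if_splits\<close>)
    moreover have "finite {g. ?c g \<noteq> \<zero>\<^bsub>B\<^esub>}" using F(1) by (rule rev_finite_subset) auto
    ultimately show ?thesis
      unfolding P_def using that F hcomp_zero by auto
  qed
  have "(\<Oplus>\<^bsub>B\<^esub>g\<in>F. c g) \<in> carrier B" using c F hcomp_carrier by (intro B.finsum_closed) auto
  then have "\<exists>!e. P (\<Oplus>\<^bsub>B\<^esub>g\<in>F. c g) e" unfolding P_def by (rule hcomp_direct_sum)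
  then have "(\<lambda>g. if g \<in> F then c g else \<zero>\<^bsub>B\<^esub>) = (\<lambda>g. if g \<in> F then d g else \<zero>\<^bsub>B\<^esub>)"
    using P[of c] P[of d] c d eq by auto
  then show ?thesis using g by metis
qed

text \<open>Multiplication by x of degree h shifts all components by h, so a product that is
  homogeneous of degree m comes from the component of degree inv h m alone. Used where the product
  is known to be x or the unit.\<close>

lemma decomp_mult:
  assumes h: "h \<in> carrier G" "x \<in> hcomp B h" and F: "finite F" "F \<subseteq> carrier G"
    and c: "\<And>g. g \<in> F \<Longrightarrow> c g \<in> hcomp B g"
    and m: "m \<in> carrier G" "inv h \<otimes> m \<in> F" "x \<otimes>\<^bsub>B\<^esub> (\<Oplus>\<^bsub>B\<^esub>g\<in>F. c g) \<in> hcomp B m"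
  shows "x \<otimes>\<^bsub>B\<^esub> c (inv h \<otimes> m) = x \<otimes>\<^bsub>B\<^esub> (\<Oplus>\<^bsub>B\<^esub>g\<in>F. c g)"
proof -
  let ?F = "(\<otimes>) h ` F" and ?s = "x \<otimes>\<^bsub>B\<^esub> (\<Oplus>\<^bsub>B\<^esub>g\<in>F. c g)"
  have cB: "\<And>g. g \<in> F \<Longrightarrow> c g \<in> carrier B" and xB: "x \<in> carrier B"
    using c F h hcomp_carrier by auto
  have inv_h: "inv h \<otimes> (h \<otimes> g) = g" if "g \<in> F" for g
    using that F h by (metis G.inv_closed G.l_inv G.l_one G.m_assoc subsetD)
  have F': "?F \<subseteq> carrier G" "finite ?F" using F h by auto
  have mF: "m \<in> ?F"
    using m h by (metis G.inv_closed G.r_inv G.l_one G.m_assoc imageI)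
  have d: "x \<otimes>\<^bsub>B\<^esub> c (inv h \<otimes> g) \<in> hcomp B g" if "g \<in> ?F" for g
    using that inv_h c F h hcomp_mult by auto
  have "?s = (\<Oplus>\<^bsub>B\<^esub>g\<in>F. x \<otimes>\<^bsub>B\<^esub> c g)" using F cB xB by (intro B.finsum_rdistr) auto
  also have "\<dots> = (\<Oplus>\<^bsub>B\<^esub>g\<in>F. x \<otimes>\<^bsub>B\<^esub> c (inv h \<otimes> (h \<otimes> g)))"
    using cB xB inv_h by (intro B.finsum_cong') auto
  also have "\<dots> = (\<Oplus>\<^bsub>B\<^esub>g\<in>?F. x \<otimes>\<^bsub>B\<^esub> c (inv h \<otimes> g))"
    using cB xB inv_h by (intro B.finsum_reindex[symmetric]) (auto intro: inj_on_inverseI)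
  finally have s: "?s = (\<Oplus>\<^bsub>B\<^esub>g\<in>?F. x \<otimes>\<^bsub>B\<^esub> c (inv h \<otimes> g))" .
  have sB: "?s \<in> carrier B" using m hcomp_carrier by blast
  have "?s = (\<Oplus>\<^bsub>B\<^esub>g\<in>?F. if m = g then ?s else \<zero>\<^bsub>B\<^esub>)"
    using B.finsum_singleton[OF mF F'(2), of "\<lambda>_. ?s"] sB by simp
  then have "x \<otimes>\<^bsub>B\<^esub> c (inv h \<otimes> m) = (if m = m then ?s else \<zero>\<^bsub>B\<^esub>)"
    using d F' m hcomp_zero s
    by (intro decomp_unique[OF F'(2,1) _ _ _ mF, where d = "\<lambda>g. if m = g then ?s else \<zero>\<^bsub>B\<^esub>"]) auto
  then show ?thesis by simp
qed

text \<open>Let e be the component of trivial degree of the unit. Comparing degrees in x 1 = x gives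
  x e = x for homogeneous x; summing this over the components of the unit gives 1 e = 1.\<close>

lemma one_hcomp: "\<one>\<^bsub>B\<^esub> \<in> hcomp B \<one>"
proof -
  obtain F e where F: "finite F" "F \<subseteq> carrier G" "\<one> \<in> F" "\<And>g. g \<in> F \<Longrightarrow> e g \<in> hcomp B g"
    and e: "\<one>\<^bsub>B\<^esub> = (\<Oplus>\<^bsub>B\<^esub>g\<in>F. e g)"
    using decomp_exists[of "\<one>\<^bsub>B\<^esub>" \<one>] by auto
  have e1: "e \<one> \<in> carrier B" using F hcomp_carrier by auto
  have hom: "x \<otimes>\<^bsub>B\<^esub> e \<one> = x" if "h \<in> carrier G" "x \<in> hcomp B h" for h x
  proof -
    have "inv h \<otimes> h = \<one>" "x \<otimes>\<^bsub>B\<^esub> (\<Oplus>\<^bsub>B\<^esub>g\<in>F. e g) = x"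
      using that hcomp_carrier[OF that] unfolding e[symmetric] by simp_all
    then show ?thesis using decomp_mult[OF that F(1,2,4), of h] that F(3) by simp
  qed
  have "\<one>\<^bsub>B\<^esub> \<otimes>\<^bsub>B\<^esub> e \<one> = (\<Oplus>\<^bsub>B\<^esub>g\<in>F. e g \<otimes>\<^bsub>B\<^esub> e \<one>)"
    unfolding e using F e1 hcomp_carrier by (intro B.finsum_ldistr) auto
  also have "\<dots> = (\<Oplus>\<^bsub>B\<^esub>g\<in>F. e g)"
    using F hom hcomp_carrier by (intro B.finsum_cong') auto
  finally have "e \<one> = \<one>\<^bsub>B\<^esub>" using e1 unfolding e[symmetric] by simp
  then show ?thesis using F by metis
qed

text \<open>The component of degree inv h of the inverse is already a right inverse of x, hence
  equals the inverse.\<close>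

lemma hcomp_inverse:
  assumes h: "h \<in> carrier G" and x: "x \<in> hcomp B h" "x \<noteq> \<zero>\<^bsub>B\<^esub>"
  shows "inv\<^bsub>B\<^esub> x \<in> hcomp B (inv h)"
proof -
  have xU: "x \<in> Units B" using hcomp_Units assms by blast
  obtain F c where F: "finite F" "F \<subseteq> carrier G" "inv h \<in> F" "\<And>g. g \<in> F \<Longrightarrow> c g \<in> hcomp B g"
    and c: "inv\<^bsub>B\<^esub> x = (\<Oplus>\<^bsub>B\<^esub>g\<in>F. c g)"
    using decomp_exists[OF B.Units_inv_closed[OF xU] G.inv_closed[OF h]] by blast
  have "x \<otimes>\<^bsub>B\<^esub> c (inv h \<otimes> \<one>) = \<one>\<^bsub>B\<^esub>"
    using decomp_mult[OF h x(1) F(1,2,4), of \<one>] c[symmetric] F(3) h xU one_hcomp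
    by (simp add: B.Units_r_inv)
  then have "c (inv h) = inv\<^bsub>B\<^esub> x"
    using xU F(3,4) h hcomp_carrier[of "inv h" "c (inv h)"]
      B.m_assoc[of "inv\<^bsub>B\<^esub> x" x "c (inv h)"]
    by (simp add: B.Units_l_inv B.Units_closed)
  then show ?thesis using F by metis
qed

text \<open>Taking the unit itself as generator in trivial degree normalizes the cocycle, as the
  splitting of symmetric cocycles requires.\<close>

definition u :: "'g \<Rightarrow> 'b" where
  "u h = (if h = \<one> then \<one>\<^bsub>B\<^esub> else SOME b. b \<in> hcomp B h \<and> hcomp B h = {c \<odot>\<^bsub>B\<^esub> b | c. True})"

lemma H_carrier: "h \<in> H \<Longrightarrow> h \<in> carrier G"
  by (simp add: supp_def)

lemma hcomp_outside: "g \<in> carrier G \<Longrightarrow> g \<notin> H \<Longrightarrow> hcomp B g = {\<zero>\<^bsub>B\<^esub>}"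
  by (simp add: supp_def)

lemma u_one [simp]: "u \<one> = \<one>\<^bsub>B\<^esub>"
  by (simp add: u_def)

lemma u_hcomp_eq:
  assumes h: "h \<in> H"
  shows "u h \<in> hcomp B h" and "hcomp B h = {c \<odot>\<^bsub>B\<^esub> u h | c. True}"
proof -
  have ex: "\<exists>b\<in>hcomp B h. hcomp B h = {c \<odot>\<^bsub>B\<^esub> b | c. True}"
    using gda h unfolding graded_division_algebra_def by blast
  have "u h \<in> hcomp B h \<and> hcomp B h = {c \<odot>\<^bsub>B\<^esub> u h | c. True}"
  proof (cases "h = \<one>")
    case False
    then have "u h = (SOME b. b \<in> hcomp B h \<and> hcomp B h = {c \<odot>\<^bsub>B\<^esub> b | c. True})"
      by (simp add: u_def)
    moreover have "\<exists>b. b \<in> hcomp B h \<and> hcomp B h = {c \<odot>\<^bsub>B\<^esub> b | c. True}" using ex by blast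
    ultimately show ?thesis
      by (simp only:) (rule someI_ex[of "\<lambda>b. b \<in> hcomp B h \<and> hcomp B h = {c \<odot>\<^bsub>B\<^esub> b | c. True}"])
  next
    case True
    obtain b where b: "b \<in> hcomp B h" "hcomp B h = {c \<odot>\<^bsub>B\<^esub> b | c. True}" using ex by blast
    have bB: "b \<in> carrier B" using b hcomp_carrier H_carrier h by blast
    obtain d where d: "\<one>\<^bsub>B\<^esub> = d \<odot>\<^bsub>B\<^esub> b" using one_hcomp b True by auto
    have "d \<noteq> 0" using d one_neq_zero B.smult_0[OF bB] by auto
    have 1: "c \<odot>\<^bsub>B\<^esub> b = (c / d) \<odot>\<^bsub>B\<^esub> \<one>\<^bsub>B\<^esub>" for c
      unfolding d using \<open>d \<noteq> 0\<close> by (simp add: B.smult_smult bB)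
    have 2: "c \<odot>\<^bsub>B\<^esub> \<one>\<^bsub>B\<^esub> = (c * d) \<odot>\<^bsub>B\<^esub> b" for c unfolding d by (simp add: B.smult_smult bB)
    have "hcomp B h = {c \<odot>\<^bsub>B\<^esub> \<one>\<^bsub>B\<^esub> | c. True}"
    proof (intro equalityI subsetI)
      fix x assume "x \<in> hcomp B h"
      then obtain c where "x = c \<odot>\<^bsub>B\<^esub> b" using b(2) by blast
      then show "x \<in> {c \<odot>\<^bsub>B\<^esub> \<one>\<^bsub>B\<^esub> | c. True}" using 1 by blast
    next
      fix x assume "x \<in> {c \<odot>\<^bsub>B\<^esub> \<one>\<^bsub>B\<^esub> | c. True}"
      then obtain c where "x = c \<odot>\<^bsub>B\<^esub> \<one>\<^bsub>B\<^esub>" by blast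
      then show "x \<in> hcomp B h" unfolding b(2) using 2 by blast
    qed
    then show ?thesis using one_hcomp True by simp
  qed
  then show "u h \<in> hcomp B h" "hcomp B h = {c \<odot>\<^bsub>B\<^esub> u h | c. True}" by blast+
qed

lemma u_closed: "h \<in> H \<Longrightarrow> u h \<in> carrier B"
  using u_hcomp_eq hcomp_carrier H_carrier by blast

lemma u_neq_zero:
  assumes "h \<in> H"
  shows "u h \<noteq> \<zero>\<^bsub>B\<^esub>"
proof
  assume "u h = \<zero>\<^bsub>B\<^esub>"
  then have "hcomp B h = {\<zero>\<^bsub>B\<^esub>}" using u_hcomp_eq(2)[OF assms] by (auto simp: B.smult_zero)
  then show False using assms by (simp add: supp_def)
qed

lemma u_Units: "h \<in> H \<Longrightarrow> u h \<in> Units B"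
  using hcomp_Units u_neq_zero u_hcomp_eq H_carrier by blast

lemma hcomp_memE:
  assumes "h \<in> H" "x \<in> hcomp B h"
  obtains c where "x = c \<odot>\<^bsub>B\<^esub> u h"
  using assms u_hcomp_eq(2) by blast

lemma H_memI: "g \<in> carrier G \<Longrightarrow> x \<in> hcomp B g \<Longrightarrow> x \<noteq> \<zero>\<^bsub>B\<^esub> \<Longrightarrow> g \<in> H"
  by (auto simp: supp_def)

lemma subgroup_H: "subgroup H G"
proof (rule G.subgroupI)
  show "H \<subseteq> carrier G" using H_carrier by blast
  show "H \<noteq> {}" using H_memI[OF _ one_hcomp one_neq_zero] by auto
  show "inv h \<in> H" if "h \<in> H" for h
  proof (rule H_memI)
    show "inv h \<in> carrier G" using that H_carrier by blast
    show "inv\<^bsub>B\<^esub> (u h) \<in> hcomp B (inv h)"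
      using that hcomp_inverse u_hcomp_eq(1) u_neq_zero H_carrier by blast
    show "inv\<^bsub>B\<^esub> (u h) \<noteq> \<zero>\<^bsub>B\<^esub>" using that u_Units Units_neq_zero B.Units_inv_Units by blast
  qed
  show "a \<otimes> b \<in> H" if "a \<in> H" "b \<in> H" for a b
  proof (rule H_memI)
    show "a \<otimes> b \<in> carrier G" using that H_carrier by blast
    show "u a \<otimes>\<^bsub>B\<^esub> u b \<in> hcomp B (a \<otimes> b)"
      using that hcomp_mult u_hcomp_eq(1) H_carrier by blast
    show "u a \<otimes>\<^bsub>B\<^esub> u b \<noteq> \<zero>\<^bsub>B\<^esub>" using that u_Units Units_neq_zero B.Units_m_closed by blast
  qed
qed

lemmas H_mult = subgroup.m_closed[OF subgroup_H]
  and H_inv = subgroup.m_inv_closed[OF subgroup_H]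
  and H_one = subgroup.one_closed[OF subgroup_H]

lemma smult_u_inject: "h \<in> H \<Longrightarrow> c \<odot>\<^bsub>B\<^esub> u h = d \<odot>\<^bsub>B\<^esub> u h \<Longrightarrow> c = d"
  using B.smult_add_left[OF u_closed, of h c "- d"] B.smult_minus[OF u_closed, of h d]
    B.smult_eq_zero_iff[OF u_closed, of h "c - d"] u_neq_zero[of h] B.smult_closed[OF u_closed, of h d]
  by (simp add: B.r_neg)

definition \<sigma> :: "'g \<Rightarrow> 'g \<Rightarrow> 'k" where
  "\<sigma> a b = (THE c. u a \<otimes>\<^bsub>B\<^esub> u b = c \<odot>\<^bsub>B\<^esub> u (a \<otimes> b))"

lemma u_mult:
  assumes "a \<in> H" "b \<in> H"
  shows "u a \<otimes>\<^bsub>B\<^esub> u b = \<sigma> a b \<odot>\<^bsub>B\<^esub> u (a \<otimes> b)"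
proof -
  obtain c where c: "u a \<otimes>\<^bsub>B\<^esub> u b = c \<odot>\<^bsub>B\<^esub> u (a \<otimes> b)"
    using hcomp_memE[OF H_mult[OF assms], of "u a \<otimes>\<^bsub>B\<^esub> u b"]
      hcomp_mult[of a b "u a" "u b"] assms u_hcomp_eq(1) H_carrier by blast
  then have "\<sigma> a b = c"
    unfolding \<sigma>_def using smult_u_inject[OF H_mult[OF assms]] by (intro the_equality) metis+
  then show ?thesis using c by simp
qed

lemma \<sigma>_eqI: "a \<in> H \<Longrightarrow> b \<in> H \<Longrightarrow> u a \<otimes>\<^bsub>B\<^esub> u b = c \<odot>\<^bsub>B\<^esub> u (a \<otimes> b) \<Longrightarrow> \<sigma> a b = c"
  using u_mult smult_u_inject H_mult by metis

lemma \<sigma>_neq_zero: "a \<in> H \<Longrightarrow> b \<in> H \<Longrightarrow> \<sigma> a b \<noteq> 0"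
  using u_mult[of a b] B.smult_0[OF u_closed[OF H_mult]] Units_neq_zero B.Units_m_closed u_Units
  by metis

lemma \<sigma>_one: "a \<in> H \<Longrightarrow> \<sigma> \<one> a = 1"
  using \<sigma>_eqI[OF H_one, of a 1] by (simp add: u_closed B.smult_1 H_carrier)

lemma \<sigma>_cocycle:
  assumes "a \<in> H" "b \<in> H" "c \<in> H"
  shows "\<sigma> a b * \<sigma> (a \<otimes> b) c = \<sigma> a (b \<otimes> c) * \<sigma> b c"
proof (rule smult_u_inject[OF H_mult[OF H_mult[OF assms(1,2)] assms(3)]])
  have "(\<sigma> a b * \<sigma> (a \<otimes> b) c) \<odot>\<^bsub>B\<^esub> u (a \<otimes> b \<otimes> c) = (u a \<otimes>\<^bsub>B\<^esub> u b) \<otimes>\<^bsub>B\<^esub> u c"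
    using assms by (simp add: u_mult H_mult u_closed B.smult_mult_left B.smult_smult)
  also have "\<dots> = u a \<otimes>\<^bsub>B\<^esub> (u b \<otimes>\<^bsub>B\<^esub> u c)" using assms by (simp add: u_closed B.m_assoc)
  also have "\<dots> = (\<sigma> a (b \<otimes> c) * \<sigma> b c) \<odot>\<^bsub>B\<^esub> u (a \<otimes> b \<otimes> c)"
    using assms
    by (simp add: u_mult H_mult u_closed B.smult_mult_right B.smult_smult H_carrier G.m_assoc
        mult.commute)
  finally show "(\<sigma> a b * \<sigma> (a \<otimes> b) c) \<odot>\<^bsub>B\<^esub> u (a \<otimes> b \<otimes> c) =
    (\<sigma> a (b \<otimes> c) * \<sigma> b c) \<odot>\<^bsub>B\<^esub> u (a \<otimes> b \<otimes> c)" .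
qed

text \<open>The commutation factor. Rescaling the generators changes \<sigma> by a coboundary, which
  is symmetric and cancels in the quotient; so \<beta> belongs to the graded algebra itself and can
  be recovered from identities.\<close>

definition \<beta> :: "'g \<Rightarrow> 'g \<Rightarrow> 'k" where
  "\<beta> a b = \<sigma> a b / \<sigma> b a"

lemma \<beta>_neq_zero: "a \<in> H \<Longrightarrow> b \<in> H \<Longrightarrow> \<beta> a b \<noteq> 0"
  by (simp add: \<beta>_def \<sigma>_neq_zero)

lemma \<beta>_self: "a \<in> H \<Longrightarrow> \<beta> a a = 1"
  by (simp add: \<beta>_def \<sigma>_neq_zero)

lemma \<beta>_swap: "\<beta> b a = inverse (\<beta> a b)"
  by (simp add: \<beta>_def)

lemma u_commute: "a \<in> H \<Longrightarrow> b \<in> H \<Longrightarrow> u a \<otimes>\<^bsub>B\<^esub> u b = \<beta> a b \<odot>\<^bsub>B\<^esub> (u b \<otimes>\<^bsub>B\<^esub> u a)"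
  using G.m_comm[of a b]
  by (simp add: \<beta>_def u_mult B.smult_smult u_closed H_mult \<sigma>_neq_zero H_carrier)

text \<open>Three instances of the cocycle identity, in which c moves from the right of a and b past
  b and then past a; commutativity of the group identifies their mixed terms.\<close>

lemma \<beta>_mult:
  assumes "a \<in> H" "b \<in> H" "c \<in> H"
  shows "\<beta> (a \<otimes> b) c = \<beta> a c * \<beta> b c"
proof -
  have comm: "b \<otimes> c = c \<otimes> b" "a \<otimes> c = c \<otimes> a" using assms H_carrier G.m_comm by blast+
  have 1: "\<sigma> a b * \<sigma> (a \<otimes> b) c = \<sigma> a (c \<otimes> b) * \<sigma> b c"
    and 2: "\<sigma> a c * \<sigma> (c \<otimes> a) b = \<sigma> a (c \<otimes> b) * \<sigma> c b"
    and 3: "\<sigma> c a * \<sigma> (c \<otimes> a) b = \<sigma> c (a \<otimes> b) * \<sigma> a b"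
    using \<sigma>_cocycle[of a b c] \<sigma>_cocycle[of a c b] \<sigma>_cocycle[of c a b] assms comm by simp_all
  have nz: "\<sigma> a b \<noteq> 0" "\<sigma> c a \<noteq> 0" "\<sigma> c b \<noteq> 0" "\<sigma> c (a \<otimes> b) \<noteq> 0" "\<sigma> (c \<otimes> a) b \<noteq> 0"
    using assms \<sigma>_neq_zero H_mult by auto
  have "(\<sigma> a b * \<sigma> (c \<otimes> a) b) * (\<sigma> (a \<otimes> b) c * (\<sigma> c a * \<sigma> c b)) =
      (\<sigma> a b * \<sigma> (a \<otimes> b) c) * (\<sigma> c a * \<sigma> (c \<otimes> a) b) * \<sigma> c b"
    by (simp add: mult_ac)
  also have "\<dots> = (\<sigma> a (c \<otimes> b) * \<sigma> c b) * \<sigma> b c * \<sigma> c (a \<otimes> b) * \<sigma> a b"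
    unfolding 1 3 by (simp add: mult_ac)
  also have "\<dots> = (\<sigma> a b * \<sigma> (c \<otimes> a) b) * (\<sigma> a c * \<sigma> b c * \<sigma> c (a \<otimes> b))"
    unfolding 2[symmetric] by (simp add: mult_ac)
  finally have "\<sigma> (a \<otimes> b) c * (\<sigma> c a * \<sigma> c b) = \<sigma> a c * \<sigma> b c * \<sigma> c (a \<otimes> b)" using nz by simp
  then show ?thesis unfolding \<beta>_def using nz by (simp add: divide_simps mult_ac)
qed

lemma \<beta>_mult_right: "a \<in> H \<Longrightarrow> b \<in> H \<Longrightarrow> c \<in> H \<Longrightarrow> \<beta> c (a \<otimes> b) = \<beta> c a * \<beta> c b"
  using \<beta>_mult[of a b c] \<beta>_swap[of c] by (metis inverse_mult_distrib)

lemma \<beta>_one: "a \<in> H \<Longrightarrow> \<beta> \<one> a = 1"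
  using \<beta>_mult[OF H_one H_one, of a] \<beta>_neq_zero[OF H_one, of a] by simp

lemma \<beta>_inv: "a \<in> H \<Longrightarrow> b \<in> H \<Longrightarrow> \<beta> (inv a) b = inverse (\<beta> a b)"
  using \<beta>_mult[OF H_inv, of a a b] \<beta>_one[of b] \<beta>_neq_zero[of a b] H_carrier[of a]
  by (simp add: field_simps)

section \<open>Coordinates with respect to the homogeneous basis\<close>

definition fin_coeffs :: "('g \<Rightarrow> 'k) \<Rightarrow> bool" where
  "fin_coeffs a \<longleftrightarrow> finite {h. a h \<noteq> 0} \<and> {h. a h \<noteq> 0} \<subseteq> H"

definition lincomb :: "('g \<Rightarrow> 'k) \<Rightarrow> 'b" where
  "lincomb a = (\<Oplus>\<^bsub>B\<^esub>h\<in>{h. a h \<noteq> 0}. a h \<odot>\<^bsub>B\<^esub> u h)"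

lemma lincomb_superset:
  assumes "finite F" "{h. a h \<noteq> 0} \<subseteq> F" "F \<subseteq> H"
  shows "lincomb a = (\<Oplus>\<^bsub>B\<^esub>h\<in>F. a h \<odot>\<^bsub>B\<^esub> u h)"
  unfolding lincomb_def
  by (rule B.add.finprod_mono_neutral_cong_left)
    (use assms in \<open>auto simp: B.smult_0 u_closed B.smult_closed subset_iff\<close>)

lemma lincomb_closed: "fin_coeffs a \<Longrightarrow> lincomb a \<in> carrier B"
  unfolding lincomb_def fin_coeffs_def
  by (intro B.finsum_closed) (auto intro: B.smult_closed u_closed)

lemma lincomb_inject:
  assumes "fin_coeffs a" "fin_coeffs b" "lincomb a = lincomb b"
  shows "a = b"
proof
  fix h
  let ?F = "{h. a h \<noteq> 0} \<union> {h. b h \<noteq> 0}"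
  have F: "finite ?F" "?F \<subseteq> H" using assms unfolding fin_coeffs_def by auto
  then have eq: "(\<Oplus>\<^bsub>B\<^esub>h\<in>?F. a h \<odot>\<^bsub>B\<^esub> u h) = (\<Oplus>\<^bsub>B\<^esub>h\<in>?F. b h \<odot>\<^bsub>B\<^esub> u h)"
    using assms(3) lincomb_superset[of ?F a] lincomb_superset[of ?F b] by simp
  show "a h = b h"
  proof (cases "h \<in> ?F")
    case True
    have "a h \<odot>\<^bsub>B\<^esub> u h = b h \<odot>\<^bsub>B\<^esub> u h"
      by (rule decomp_unique[OF F(1) _ _ _ eq True])
        (use F H_carrier hcomp_smult u_hcomp_eq(1) in blast)+
    then show ?thesis using smult_u_inject F True by blast
  qed simp
qed

lemma lincomb_exists:
  assumes x: "x \<in> carrier B"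
  shows "\<exists>a. fin_coeffs a \<and> lincomb a = x"
proof -
  obtain F c where F: "finite F" "F \<subseteq> carrier G" "\<And>g. g \<in> F \<Longrightarrow> c g \<in> hcomp B g"
    and c: "x = (\<Oplus>\<^bsub>B\<^esub>g\<in>F. c g)"
    using decomp_exists[OF x G.one_closed] by metis
  have "\<exists>d. c g = d \<odot>\<^bsub>B\<^esub> u g" if "g \<in> F \<inter> H" for g
    using that hcomp_memE F by (metis IntD1 IntD2)
  then obtain d where d: "\<And>g. g \<in> F \<inter> H \<Longrightarrow> c g = d g \<odot>\<^bsub>B\<^esub> u g" by metis
  let ?a = "\<lambda>g. if g \<in> F \<inter> H then d g else 0"
  have "lincomb ?a = (\<Oplus>\<^bsub>B\<^esub>h\<in>F \<inter> H. ?a h \<odot>\<^bsub>B\<^esub> u h)"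
    using F by (intro lincomb_superset) auto
  also have "\<dots> = (\<Oplus>\<^bsub>B\<^esub>g\<in>F. c g)"
  proof (rule B.add.finprod_mono_neutral_cong_left)
    show "c g = \<zero>\<^bsub>B\<^esub>" if "g \<in> F - F \<inter> H" for g using that F hcomp_outside by blast
  qed (use F d hcomp_carrier in auto)
  finally have "lincomb ?a = x" using c by simp
  moreover have "fin_coeffs ?a"
  proof -
    have "{h. ?a h \<noteq> 0} \<subseteq> F \<inter> H" by auto
    then show ?thesis unfolding fin_coeffs_def using F(1) by (meson finite_Int le_inf_iff rev_finite_subset)
  qed
  ultimately show ?thesis by blast
qed

definition cf :: "'b \<Rightarrow> 'g \<Rightarrow> 'k" where
  "cf x = (SOME a. fin_coeffs a \<and> lincomb a = x)"

lemma cf_fin: "x \<in> carrier B \<Longrightarrow> fin_coeffs (cf x)"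
  and lincomb_cf: "x \<in> carrier B \<Longrightarrow> lincomb (cf x) = x"
  using someI_ex[OF lincomb_exists] unfolding cf_def by blast+

lemma cf_lincomb: "fin_coeffs a \<Longrightarrow> cf (lincomb a) = a"
  using lincomb_inject cf_fin lincomb_cf lincomb_closed by blast

lemma cf_inject: "x \<in> carrier B \<Longrightarrow> y \<in> carrier B \<Longrightarrow> cf x = cf y \<Longrightarrow> x = y"
  by (metis lincomb_cf)

lemma cf_outside: "x \<in> carrier B \<Longrightarrow> h \<notin> H \<Longrightarrow> cf x h = 0"
  using cf_fin[of x] unfolding fin_coeffs_def by blast

lemma fin_coeffs_add: "fin_coeffs a \<Longrightarrow> fin_coeffs b \<Longrightarrow> fin_coeffs (\<lambda>h. a h + b h)"
proof -
  assume a: "fin_coeffs a" "fin_coeffs b"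
  have "{h. a h + b h \<noteq> 0} \<subseteq> {h. a h \<noteq> 0} \<union> {h. b h \<noteq> 0}" by auto
  then show ?thesis using a unfolding fin_coeffs_def
    by (meson finite_UnI le_sup_iff order_trans rev_finite_subset)
qed

lemma fin_coeffs_scale: "fin_coeffs a \<Longrightarrow> fin_coeffs (\<lambda>h. f h * a h)"
proof -
  assume a: "fin_coeffs a"
  have "{h. f h * a h \<noteq> 0} \<subseteq> {h. a h \<noteq> 0}" by auto
  then show ?thesis using a unfolding fin_coeffs_def by (meson order_trans rev_finite_subset)
qed

lemma lincomb_add:
  assumes "fin_coeffs a" "fin_coeffs b"
  shows "lincomb (\<lambda>h. a h + b h) = lincomb a \<oplus>\<^bsub>B\<^esub> lincomb b"
proof -
  let ?F = "{h. a h \<noteq> 0} \<union> {h. b h \<noteq> 0}"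
  have F: "finite ?F" "?F \<subseteq> H" using assms unfolding fin_coeffs_def by auto
  have "lincomb (\<lambda>h. a h + b h) = (\<Oplus>\<^bsub>B\<^esub>h\<in>?F. (a h + b h) \<odot>\<^bsub>B\<^esub> u h)"
    using F by (intro lincomb_superset) auto
  also have "\<dots> = (\<Oplus>\<^bsub>B\<^esub>h\<in>?F. a h \<odot>\<^bsub>B\<^esub> u h \<oplus>\<^bsub>B\<^esub> b h \<odot>\<^bsub>B\<^esub> u h)"
    using F u_closed by (intro B.finsum_cong') (auto simp: B.smult_add_left B.smult_closed)
  also have "\<dots> = lincomb a \<oplus>\<^bsub>B\<^esub> lincomb b"
    using F u_closed
    by (subst B.finsum_addf) (auto simp: B.smult_closed lincomb_superset[of ?F])
  finally show ?thesis .
qed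

lemma lincomb_smult:
  assumes "fin_coeffs a"
  shows "lincomb (\<lambda>h. c * a h) = c \<odot>\<^bsub>B\<^esub> lincomb a"
proof -
  let ?F = "{h. a h \<noteq> 0}"
  have F: "finite ?F" "?F \<subseteq> H" using assms unfolding fin_coeffs_def by auto
  have "lincomb (\<lambda>h. c * a h) = (\<Oplus>\<^bsub>B\<^esub>h\<in>?F. (c * a h) \<odot>\<^bsub>B\<^esub> u h)"
    using F by (intro lincomb_superset) auto
  also have "\<dots> = (\<Oplus>\<^bsub>B\<^esub>h\<in>?F. c \<odot>\<^bsub>B\<^esub> (a h \<odot>\<^bsub>B\<^esub> u h))"
    using F u_closed by (intro B.finsum_cong') (auto simp: B.smult_smult B.smult_closed)
  also have "\<dots> = c \<odot>\<^bsub>B\<^esub> lincomb a"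
    unfolding lincomb_def using F u_closed
    by (intro B.smult_finsum[symmetric]) (auto simp: B.smult_closed)
  finally show ?thesis .
qed

lemma lincomb_single:
  assumes "k \<in> H"
  shows "lincomb (\<lambda>h. if h = k then c else 0) = c \<odot>\<^bsub>B\<^esub> u k"
  by (subst lincomb_superset[of "{k}"]) (use assms u_closed B.smult_closed in auto)

lemma fin_coeffs_single: "k \<in> H \<Longrightarrow> fin_coeffs (\<lambda>h. if h = k then c else 0)"
  unfolding fin_coeffs_def by auto

lemma cf_add: "x \<in> carrier B \<Longrightarrow> y \<in> carrier B \<Longrightarrow> cf (x \<oplus>\<^bsub>B\<^esub> y) h = cf x h + cf y h"
  using cf_lincomb[OF fin_coeffs_add[OF cf_fin cf_fin], of x y] lincomb_add[OF cf_fin cf_fin, of x y]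
  by (simp add: lincomb_cf)

lemma cf_smult: "x \<in> carrier B \<Longrightarrow> cf (c \<odot>\<^bsub>B\<^esub> x) h = c * cf x h"
  using cf_lincomb[OF fin_coeffs_scale[OF cf_fin], of x "\<lambda>_. c"] lincomb_smult[OF cf_fin, of x c]
  by (simp add: lincomb_cf)

lemma cf_u: "k \<in> H \<Longrightarrow> cf (u k) h = (if h = k then 1 else 0)"
  using cf_lincomb[OF fin_coeffs_single, of k 1] lincomb_single[of k 1]
  by (simp add: B.smult_1 u_closed)

lemma cf_zero: "cf \<zero>\<^bsub>B\<^esub> h = 0"
  using cf_smult[of "\<zero>\<^bsub>B\<^esub>" 0 h] by (simp add: B.smult_zero)

text \<open>Reduces statements that are additive in x to multiples of the basis elements
  \<open>u h\<close>, without explicit finite sums.\<close>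

lemma B_induct [consumes 1, case_names zero step]:
  assumes "x \<in> carrier B" and "P \<zero>\<^bsub>B\<^esub>"
    and "\<And>c h y. h \<in> H \<Longrightarrow> y \<in> carrier B \<Longrightarrow> P y \<Longrightarrow> P (c \<odot>\<^bsub>B\<^esub> u h \<oplus>\<^bsub>B\<^esub> y)"
  shows "P x"
proof -
  have "P (\<Oplus>\<^bsub>B\<^esub>h\<in>F. a h \<odot>\<^bsub>B\<^esub> u h)" if "finite F" "F \<subseteq> H" for F a
    using that
  proof (induction F rule: finite_induct)
    case empty
    then show ?case using assms by simp
  next
    case (insert h F)
    have cl: "(\<lambda>h. a h \<odot>\<^bsub>B\<^esub> u h) \<in> F \<rightarrow> carrier B" using insert u_closed by (auto simp: B.smult_closed)
    then have "P (a h \<odot>\<^bsub>B\<^esub> u h \<oplus>\<^bsub>B\<^esub> (\<Oplus>\<^bsub>B\<^esub>h\<in>F. a h \<odot>\<^bsub>B\<^esub> u h))"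
      using insert by (intro assms(3)) (auto intro: B.finsum_closed)
    then show ?case using insert cl u_closed by (simp add: B.smult_closed)
  qed
  then have "P (lincomb (cf x))"
    using cf_fin[OF assms(1)] unfolding lincomb_def fin_coeffs_def by blast
  then show ?thesis using lincomb_cf assms(1) by simp
qed

lemma cf_u_mult:
  assumes "x \<in> carrier B" "a \<in> H" "h \<in> H"
  shows "cf (u a \<otimes>\<^bsub>B\<^esub> x) (a \<otimes> h) = \<sigma> a h * cf x h"
  using assms(1)
proof (induction rule: B_induct)
  case zero
  then show ?case using assms by (simp add: cf_zero u_closed)
next
  case (step c k y)
  have "a \<otimes> h = a \<otimes> k \<longleftrightarrow> h = k" using step assms H_carrier by auto
  then show ?case
    using step assms
    by (auto simp: B.r_distr cf_add cf_smult cf_u u_closed B.smult_closed B.smult_mult_right u_mult H_mult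
        algebra_simps)
qed

lemma cf_mult_u:
  assumes "x \<in> carrier B" "b \<in> H" "h \<in> H"
  shows "cf (x \<otimes>\<^bsub>B\<^esub> u b) (h \<otimes> b) = cf x h * \<sigma> h b"
  using assms(1)
proof (induction rule: B_induct)
  case zero
  then show ?case using assms by (simp add: cf_zero u_closed)
next
  case (step c k y)
  have "h \<otimes> b = k \<otimes> b \<longleftrightarrow> h = k" using step assms H_carrier by auto
  then show ?case
    using step assms
    by (auto simp: B.l_distr cf_add cf_smult cf_u u_closed B.smult_closed B.smult_mult_left u_mult H_mult
        algebra_simps)
qed

lemma hcomp_iff_cf:
  assumes "x \<in> carrier B" "g \<in> carrier G"
  shows "x \<in> hcomp B g \<longleftrightarrow> (\<forall>h. h \<noteq> g \<longrightarrow> cf x h = 0)"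
proof
  assume x: "x \<in> hcomp B g"
  show "\<forall>h. h \<noteq> g \<longrightarrow> cf x h = 0"
  proof (cases "g \<in> H")
    case True
    then obtain c where "x = c \<odot>\<^bsub>B\<^esub> u g" using hcomp_memE x by blast
    then show ?thesis using True by (simp add: cf_smult cf_u u_closed)
  next
    case False
    then show ?thesis using x hcomp_outside assms cf_zero by auto
  qed
next
  assume z: "\<forall>h. h \<noteq> g \<longrightarrow> cf x h = 0"
  show "x \<in> hcomp B g"
  proof (cases "g \<in> H")
    case True
    have "cf x = (\<lambda>h. if h = g then cf x g else 0)" using z by auto
    then have "x = lincomb (\<lambda>h. if h = g then cf x g else 0)" using lincomb_cf[OF assms(1)] by metis
    then have "x = cf x g \<odot>\<^bsub>B\<^esub> u g" using lincomb_single True by simp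
    then show ?thesis using u_hcomp_eq[OF True] by blast
  next
    case False
    then have "cf x h = cf \<zero>\<^bsub>B\<^esub> h" for h
      using z cf_zero cf_outside[OF assms(1)] by (cases "h = g") auto
    then have "cf x = cf \<zero>\<^bsub>B\<^esub>" by blast
    then have "x = \<zero>\<^bsub>B\<^esub>" using cf_inject assms by blast
    then show ?thesis using hcomp_zero assms by simp
  qed
qed

lemma inv_u:
  assumes "h \<in> H"
  obtains d where "d \<noteq> 0" "inv\<^bsub>B\<^esub> (u h) = d \<odot>\<^bsub>B\<^esub> u (inv h)"
proof -
  have "inv\<^bsub>B\<^esub> (u h) \<in> hcomp B (inv h)"
    using hcomp_inverse u_hcomp_eq u_neq_zero assms H_carrier by blast
  then obtain d where d: "inv\<^bsub>B\<^esub> (u h) = d \<odot>\<^bsub>B\<^esub> u (inv h)" using hcomp_memE H_inv assms by blast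
  moreover have "d \<noteq> 0"
    using d B.smult_0[OF u_closed[OF H_inv[OF assms]]] Units_neq_zero u_Units[OF assms]
      B.Units_inv_Units by metis
  ultimately show ?thesis using that by blast
qed

end

section \<open>Representations induced from isotropic subgroups\<close>

lemma (in comm_group) subgroup_comm_group:
  assumes "subgroup I G"
  shows "comm_group (G\<lparr>carrier := I\<rparr>)"
proof (rule group.group_comm_groupI)
  show "group (G\<lparr>carrier := I\<rparr>)" using assms subgroup_imp_group by blast
next
  fix x y assume "x \<in> carrier (G\<lparr>carrier := I\<rparr>)" "y \<in> carrier (G\<lparr>carrier := I\<rparr>)"
  then have "x \<in> carrier G" "y \<in> carrier G" using subgroup.mem_carrier[OF assms] by auto
  then show "x \<otimes>\<^bsub>G\<lparr>carrier := I\<rparr>\<^esub> y = y \<otimes>\<^bsub>G\<lparr>carrier := I\<rparr>\<^esub> x" using m_comm by simp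
qed

text \<open>The dual of Dedekind's independence of characters: group elements are independent as
  functions on the characters. For h \<noteq> k some character \<psi> separates them; subtracting
  \<psi>(k) times the relation for \<chi> from the one for \<psi>\<chi> eliminates k and multiplies
  the coefficient of h by \<psi>(h) - \<psi>(k). The trivial character then disposes of k.\<close>

lemma (in comm_group) characters_independent:
  fixes a :: "'a \<Rightarrow> 'k::{alg_closed_field, field_char_0}"
  assumes "finite F" "F \<subseteq> carrier G"
    and "\<And>\<chi>. (\<And>x. x \<in> carrier G \<Longrightarrow> \<chi> x \<noteq> 0) \<Longrightarrow>
      (\<And>x y. x \<in> carrier G \<Longrightarrow> y \<in> carrier G \<Longrightarrow> \<chi> (x \<otimes> y) = \<chi> x * \<chi> y) \<Longrightarrow>
      (\<Sum>h\<in>F. a h * \<chi> h) = 0"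
    and "h \<in> F"
  shows "a h = 0"
  using assms
proof (induction F arbitrary: a h rule: finite_induct)
  case empty
  then show ?case by simp
next
  case (insert k F)
  have F_zero: "a h = 0" if h: "h \<in> F" for h
  proof -
    have kh: "k \<in> carrier G" "h \<in> carrier G" "h \<noteq> k" using h insert by auto
    then have "h \<otimes> inv k \<noteq> \<one>" by (metis inv_closed inv_equality inv_inv)
    then obtain \<psi> :: "'a \<Rightarrow> 'k" where \<psi>: "\<And>x. x \<in> carrier G \<Longrightarrow> \<psi> x \<noteq> 0"
      "\<And>x y. x \<in> carrier G \<Longrightarrow> y \<in> carrier G \<Longrightarrow> \<psi> (x \<otimes> y) = \<psi> x * \<psi> y" "\<psi> (h \<otimes> inv k) \<noteq> 1"
      using character_separation[of "h \<otimes> inv k"] kh by (metis inv_closed m_closed)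
    have "\<psi> h = \<psi> (h \<otimes> inv k) * \<psi> k" using \<psi>(2)[of "h \<otimes> inv k" k] kh by (simp add: m_assoc)
    then have ne: "\<psi> h \<noteq> \<psi> k" using \<psi>(1)[OF kh(1)] \<psi>(3) by auto
    have "a h * (\<psi> h - \<psi> k) = 0"
    proof (rule insert.IH[OF _ _ h])
      show "F \<subseteq> carrier G" using insert by simp
      fix \<chi> :: "'a \<Rightarrow> 'k"
      assume \<chi>: "\<And>x. x \<in> carrier G \<Longrightarrow> \<chi> x \<noteq> 0"
        "\<And>x y. x \<in> carrier G \<Longrightarrow> y \<in> carrier G \<Longrightarrow> \<chi> (x \<otimes> y) = \<chi> x * \<chi> y"
      have "(\<Sum>h\<in>insert k F. a h * (\<psi> h * \<chi> h)) = 0"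
        by (rule insert.prems(2)) (auto simp: \<psi> \<chi>)
      moreover have "(\<Sum>h\<in>insert k F. a h * \<chi> h) = 0"
        by (rule insert.prems(2)) (auto simp: \<chi>)
      ultimately have "(\<Sum>h\<in>insert k F. a h * (\<psi> h * \<chi> h)) - \<psi> k * (\<Sum>h\<in>insert k F. a h * \<chi> h) = 0"
        by simp
      then have "(\<Sum>h\<in>insert k F. a h * (\<psi> h - \<psi> k) * \<chi> h) = 0"
        by (simp only: sum_distrib_left sum_subtractf[symmetric]) (simp add: algebra_simps)
      then show "(\<Sum>h\<in>F. a h * (\<psi> h - \<psi> k) * \<chi> h) = 0" using insert by simp
    qed
    then show ?thesis using ne by simp
  qed
  have "(\<Sum>h\<in>insert k F. a h * 1) = 0" by (rule insert.prems(2)[of "\<lambda>_. 1"]) simp_all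
  moreover have "(\<Sum>h\<in>F. a h) = 0" using F_zero by (rule sum.neutral[OF ballI])
  ultimately have "a k = 0" using insert.hyps by simp
  then show ?case using F_zero insert.prems(3) by blast
qed

context graded_division
begin

text \<open>The \<open>u a\<close> with a in I commute, so they span a commutative twisted group
  algebra, which has one-dimensional representations.\<close>

definition isotropic :: "'g set \<Rightarrow> bool" where
  "isotropic I \<longleftrightarrow> subgroup I G \<and> I \<subseteq> H \<and> (\<forall>a\<in>I. \<forall>b\<in>I. \<beta> a b = 1)"

text \<open>The elements orthogonal to a fixed y form a subgroup, so triviality of \<beta> spreads
  from generators to the generated subgroup, one argument at a time. The pair (r, r) is harmless
  because \<beta> is alternating.\<close>

lemma isotropic_extend:
  assumes I: "isotropic I" and r: "r \<in> H" "\<And>i. i \<in> I \<Longrightarrow> \<beta> i r = 1"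
  shows "isotropic (generate G (insert r I))"
proof -
  let ?J = "generate G (insert r I)"
  have cent: "subgroup {x \<in> H. \<beta> x y = 1} G" if "y \<in> H" for y
    by (rule G.subgroupI)
      (use that H_carrier H_one H_inv H_mult \<beta>_one \<beta>_inv \<beta>_mult in auto)
  have IH: "insert r I \<subseteq> H" using I r unfolding isotropic_def by blast
  then have JH: "?J \<subseteq> H" using G.generate_subgroup_incl[OF _ subgroup_H] by blast
  have base: "\<beta> x y = 1" if "x \<in> insert r I" "y \<in> insert r I" for x y
    using that I r \<beta>_self \<beta>_swap[of x y] unfolding isotropic_def by auto
  have one: "\<beta> x y = 1" if "x \<in> ?J" "y \<in> insert r I" for x y
    using G.generate_subgroup_incl[OF _ cent[of y], of "insert r I"] base IH that by blast
  have "\<beta> x y = 1" if "x \<in> ?J" "y \<in> ?J" for x y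
  proof -
    have "insert r I \<subseteq> {z \<in> H. \<beta> z x = 1}" using one[OF that(1)] IH \<beta>_swap[of _ x] by auto
    then have "\<beta> y x = 1" using G.generate_subgroup_incl[OF _ cent[of x]] JH that by blast
    then show ?thesis using \<beta>_swap[of x y] by simp
  qed
  moreover have "subgroup ?J G" using G.generate_is_subgroup IH H_carrier by blast
  ultimately show ?thesis using JH unfolding isotropic_def by blast
qed

text \<open>Maximality is recorded in the form that is used: I contains its orthogonal complement
  under \<beta>, since an orthogonal element could be adjoined.\<close>

lemma maximal_isotropic_exists:
  obtains I where "isotropic I" "\<And>r. r \<in> H \<Longrightarrow> (\<And>i. i \<in> I \<Longrightarrow> \<beta> i r = 1) \<Longrightarrow> r \<in> I"
proof -
  let ?A = "{I. isotropic I}"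
  have "isotropic {\<one>}"
    unfolding isotropic_def using G.triv_subgroup H_one \<beta>_one by simp
  moreover have "\<Union>C \<in> ?A" if C: "subset.chain ?A C" "C \<noteq> {}" for C
  proof -
    have ch: "\<And>I. I \<in> C \<Longrightarrow> isotropic I" and tot: "\<And>I J. I \<in> C \<Longrightarrow> J \<in> C \<Longrightarrow> I \<subseteq> J \<or> J \<subseteq> I"
      using C(1) unfolding subset.chain_def by (blast, auto simp: subset_iff_psubset_eq)
    have pair: "\<exists>I\<in>C. a \<in> I \<and> b \<in> I" if ab: "a \<in> \<Union>C" "b \<in> \<Union>C" for a b
    proof -
      obtain I J where "I \<in> C" "J \<in> C" "a \<in> I" "b \<in> J" using ab by blast
      then show ?thesis using tot[of I J] by blast
    qed
    have sg: "\<And>I. I \<in> C \<Longrightarrow> subgroup I G" using ch unfolding isotropic_def by blast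
    have "subgroup (\<Union>C) G"
    proof (rule G.subgroupI)
      show "\<Union>C \<subseteq> carrier G" using sg subgroup.subset by blast
      obtain J where "J \<in> C" using C(2) by blast
      then show "\<Union>C \<noteq> {}" using subgroup.one_closed[OF sg] by blast
      show "inv a \<in> \<Union>C" if a: "a \<in> \<Union>C" for a
      proof -
        obtain J where "J \<in> C" "a \<in> J" using a by blast
        then show ?thesis using subgroup.m_inv_closed[OF sg] by blast
      qed
      show "a \<otimes> b \<in> \<Union>C" if ab: "a \<in> \<Union>C" "b \<in> \<Union>C" for a b
      proof -
        obtain J where "J \<in> C" "a \<in> J" "b \<in> J" using pair[OF ab] by blast
        then show ?thesis using subgroup.m_closed[OF sg] by blast
      qed
    qed
    moreover have "\<beta> a b = 1" if "a \<in> \<Union>C" "b \<in> \<Union>C" for a b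
      using pair[OF that] ch unfolding isotropic_def by blast
    ultimately show ?thesis using ch unfolding isotropic_def by blast
  qed
  ultimately obtain I where I: "isotropic I" "\<And>J. isotropic J \<Longrightarrow> I \<subseteq> J \<Longrightarrow> J = I"
    using subset_Zorn_nonempty[of ?A] by blast
  show ?thesis
  proof (rule that[OF I(1)])
    fix r assume r: "r \<in> H" "\<And>i. i \<in> I \<Longrightarrow> \<beta> i r = 1"
    let ?J = "generate G (insert r I)"
    have "insert r I \<subseteq> ?J" using generate.incl[of _ "insert r I"] by blast
    then show "r \<in> I" using I(2)[OF isotropic_extend[OF I(1) r]] by blast
  qed
qed

end

text \<open>T is a transversal of the cosets of I in H, possibly infinite at this stage.\<close>

locale polarized_division = graded_division G B
  for G :: "('g, 'n) monoid_scheme" (structure)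
    and B :: "('k::{alg_closed_field, field_char_0}, 'b, 'g) gr_algebra" +
  fixes I T :: "'g set"
  assumes iso: "isotropic I"
    and max: "\<And>r. r \<in> H \<Longrightarrow> (\<And>i. i \<in> I \<Longrightarrow> \<beta> i r = 1) \<Longrightarrow> r \<in> I"
    and T: "T \<subseteq> H" "\<And>h. h \<in> H \<Longrightarrow> \<exists>r\<in>T. inv r \<otimes> h \<in> I"
    and T_unique: "\<And>r s. r \<in> T \<Longrightarrow> s \<in> T \<Longrightarrow> inv r \<otimes> s \<in> I \<Longrightarrow> r = s"
begin

lemma subgroup_I: "subgroup I G" and I_subset: "I \<subseteq> H"
  and \<beta>_I: "a \<in> I \<Longrightarrow> b \<in> I \<Longrightarrow> \<beta> a b = 1"
  using iso unfolding isotropic_def by blast+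

lemmas I_mult = subgroup.m_closed[OF subgroup_I]
  and I_inv = subgroup.m_inv_closed[OF subgroup_I]
  and I_one = subgroup.one_closed[OF subgroup_I]

lemma I_cancel:
  assumes "a \<in> carrier G" "b \<in> I"
  shows "a \<otimes> b \<in> I \<longleftrightarrow> a \<in> I"
proof
  have b: "b \<in> carrier G" using assms(2) I_subset H_carrier by blast
  assume "a \<otimes> b \<in> I"
  then have "a \<otimes> b \<otimes> inv b \<in> I" using assms I_mult I_inv by blast
  then show "a \<in> I" using assms b by (simp add: G.m_assoc)
qed (use assms I_mult in blast)

text \<open>\<open>l a\<close> is the value at \<open>u a\<close> of a one-dimensional
  representation of the span of the \<open>u a\<close> with a in I.\<close>

definition splitting :: "('g \<Rightarrow> 'k) \<Rightarrow> bool" where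
  "splitting l \<longleftrightarrow> (\<forall>a\<in>I. l a \<noteq> 0) \<and> (\<forall>a\<in>I. \<forall>b\<in>I. l a * l b = \<sigma> a b * l (a \<otimes> b))"

text \<open>On I the cocycle is symmetric because \<beta> is trivial there, so it is a
  coboundary.\<close>

lemma splitting_exists: "\<exists>l. splitting l"
proof -
  interpret I: comm_group "G\<lparr>carrier := I\<rparr>"
    by (rule G.subgroup_comm_group[OF subgroup_I])
  have "\<sigma> a b = \<sigma> b a" if "a \<in> I" "b \<in> I" for a b
    using \<beta>_I[OF that] \<sigma>_neq_zero[of b a] that I_subset unfolding \<beta>_def by auto
  then obtain l where "\<And>a. a \<in> I \<Longrightarrow> l a \<noteq> 0"
    "\<And>a b. a \<in> I \<Longrightarrow> b \<in> I \<Longrightarrow> l a * l b = \<sigma> a b * l (a \<otimes> b)"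
    using I.symmetric_cocycle_splits[of \<sigma>] I_subset \<sigma>_neq_zero \<sigma>_one \<sigma>_cocycle
    by (simp add: subset_iff) metis
  then show ?thesis unfolding splitting_def by blast
qed

text \<open>Projection to the degrees in I followed by the one-dimensional representation given by
  l.\<close>

definition ev :: "('g \<Rightarrow> 'k) \<Rightarrow> 'b \<Rightarrow> 'k" where
  "ev l x = (\<Sum>h | h \<in> I \<and> cf x h \<noteq> 0. cf x h * l h)"

lemma cf_finite: "x \<in> carrier B \<Longrightarrow> finite {h \<in> I. cf x h \<noteq> 0}"
  using cf_fin[of x] unfolding fin_coeffs_def by (auto elim: rev_finite_subset)

lemma ev_superset:
  assumes "finite F" "{h \<in> I. cf x h \<noteq> 0} \<subseteq> F" "F \<subseteq> I"
  shows "ev l x = (\<Sum>h\<in>F. cf x h * l h)"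
  unfolding ev_def by (rule sum.mono_neutral_left) (use assms in auto)

lemma ev_add:
  assumes "x \<in> carrier B" "y \<in> carrier B"
  shows "ev l (x \<oplus>\<^bsub>B\<^esub> y) = ev l x + ev l y"
proof -
  let ?F = "{h \<in> I. cf x h \<noteq> 0} \<union> {h \<in> I. cf y h \<noteq> 0}"
  have F: "finite ?F" using cf_finite assms by blast
  have "ev l z = (\<Sum>h\<in>?F. cf z h * l h)" if "z \<in> {x, y, x \<oplus>\<^bsub>B\<^esub> y}" for z
    using that assms by (intro ev_superset F) (auto simp: cf_add)
  then show ?thesis using assms by (simp add: cf_add algebra_simps sum.distrib)
qed

lemma ev_smult:
  assumes "x \<in> carrier B"
  shows "ev l (c \<odot>\<^bsub>B\<^esub> x) = c * ev l x"
proof -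
  have "ev l (c \<odot>\<^bsub>B\<^esub> x) = (\<Sum>h | h \<in> I \<and> cf x h \<noteq> 0. cf (c \<odot>\<^bsub>B\<^esub> x) h * l h)"
    using assms by (intro ev_superset cf_finite) (auto simp: cf_smult)
  then show ?thesis
    unfolding ev_def using assms by (simp add: cf_smult sum_distrib_left mult.assoc)
qed

lemma ev_zero: "ev l \<zero>\<^bsub>B\<^esub> = 0"
  by (simp add: ev_def cf_zero)

lemma ev_u: "h \<in> H \<Longrightarrow> ev l (u h) = (if h \<in> I then l h else 0)"
  by (subst ev_superset[of "{h} \<inter> I"]) (auto simp: cf_u)

lemma ev_hcomp_outside:
  "g \<in> carrier G \<Longrightarrow> g \<notin> I \<Longrightarrow> x \<in> hcomp B g \<Longrightarrow> ev l x = 0"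
  unfolding ev_def using hcomp_iff_cf[of x g] hcomp_carrier[of g x]
  by (intro sum.neutral) auto

text \<open>The induced representation, by left multiplication on \<open>B\<close> regarded as a right module over the
  span of \<open>u ` I\<close> with basis \<open>u ` T\<close>, followed by the character \<open>l\<close>.\<close>

definition rep :: "('g \<Rightarrow> 'k) \<Rightarrow> 'g \<Rightarrow> 'g \<Rightarrow> 'b \<Rightarrow> 'k" where
  "rep l r s x = ev l (inv\<^bsub>B\<^esub> (u r) \<otimes>\<^bsub>B\<^esub> x \<otimes>\<^bsub>B\<^esub> u s)"

lemma T_H: "r \<in> T \<Longrightarrow> r \<in> H"
  using T by blast

lemma u_inv_closed: "r \<in> H \<Longrightarrow> inv\<^bsub>B\<^esub> (u r) \<in> carrier B"
  using u_Units B.Units_inv_closed by blast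

lemma rep_add: "r \<in> T \<Longrightarrow> s \<in> T \<Longrightarrow> x \<in> carrier B \<Longrightarrow> y \<in> carrier B \<Longrightarrow>
    rep l r s (x \<oplus>\<^bsub>B\<^esub> y) = rep l r s x + rep l r s y"
  unfolding rep_def
  by (simp add: B.r_distr B.l_distr u_inv_closed u_closed T_H ev_add)

lemma rep_smult: "r \<in> T \<Longrightarrow> s \<in> T \<Longrightarrow> x \<in> carrier B \<Longrightarrow> rep l r s (c \<odot>\<^bsub>B\<^esub> x) = c * rep l r s x"
  unfolding rep_def
  by (simp add: B.smult_mult_right B.smult_mult_left u_inv_closed u_closed T_H ev_smult)

lemma rep_zero: "r \<in> T \<Longrightarrow> s \<in> T \<Longrightarrow> rep l r s \<zero>\<^bsub>B\<^esub> = 0"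
  unfolding rep_def by (simp add: u_inv_closed u_closed T_H ev_zero)

lemma rep_finsum:
  assumes "r \<in> T" "s \<in> T" "finite F" "\<And>i. i \<in> F \<Longrightarrow> f i \<in> carrier B"
  shows "rep l r s (\<Oplus>\<^bsub>B\<^esub>i\<in>F. f i) = (\<Sum>i\<in>F. rep l r s (f i))"
  using assms(3,4)
  by (induction F rule: finite_induct) (simp_all add: assms(1,2) rep_zero rep_add Pi_def)

lemma rep_hcomp_outside:
  assumes "r \<in> T" "s \<in> T" "g \<in> carrier G" "x \<in> hcomp B g" "inv r \<otimes> g \<otimes> s \<notin> I"
  shows "rep l r s x = 0"
proof -
  have rs: "r \<in> H" "s \<in> H" "r \<in> carrier G" "s \<in> carrier G" using assms T_H H_carrier by blast+
  have "inv\<^bsub>B\<^esub> (u r) \<in> hcomp B (inv r)" using rs hcomp_inverse u_hcomp_eq(1) u_neq_zero by blast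
  then have "inv\<^bsub>B\<^esub> (u r) \<otimes>\<^bsub>B\<^esub> x \<otimes>\<^bsub>B\<^esub> u s \<in> hcomp B (inv r \<otimes> g \<otimes> s)"
    using rs assms hcomp_mult u_hcomp_eq(1) by (meson G.inv_closed G.m_closed)
  then show ?thesis
    unfolding rep_def using assms(5) rs assms(3) by (intro ev_hcomp_outside) simp_all
qed

context
  fixes l :: "'g \<Rightarrow> 'k"
  assumes l: "splitting l"
begin

lemma l_one: "l \<one> = 1"
  using l I_one \<sigma>_one[OF H_one] unfolding splitting_def
  by (metis G.l_one G.one_closed mult_cancel_left mult_cancel_right2)

text \<open>Right multiplication by degrees in I preserves both I and its complement, so the
  projection commutes with it; on I the formula is the splitting relation.\<close>

lemma ev_mult_u:
  assumes "x \<in> carrier B" "b \<in> I"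
  shows "ev l (x \<otimes>\<^bsub>B\<^esub> u b) = ev l x * l b"
  using assms(1)
proof (induction rule: B_induct)
  case zero
  then show ?case using assms I_subset by (auto simp: ev_zero u_closed)
next
  case (step c h y)
  have b: "b \<in> H" using assms I_subset by blast
  have "ev l (u h \<otimes>\<^bsub>B\<^esub> u b) = ev l (u h) * l b"
    using step(1) b assms(2) I_cancel[of h b] l H_carrier[of h] H_mult[of h b]
    by (auto simp: u_mult ev_smult ev_u u_closed splitting_def)
  then show ?case
    using step b
    by (simp add: B.l_distr u_closed B.smult_closed B.smult_mult_left ev_add ev_smult algebra_simps)
qed

lemma ev_mult_hcomp:
  assumes "x \<in> carrier B" "b \<in> I" "z \<in> hcomp B b"
  shows "ev l (x \<otimes>\<^bsub>B\<^esub> z) = ev l x * ev l z"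
proof -
  have b: "b \<in> H" using assms I_subset by blast
  then obtain c where "z = c \<odot>\<^bsub>B\<^esub> u b" using hcomp_memE assms by blast
  then show ?thesis
    using assms b by (simp add: B.smult_mult_right u_closed ev_smult ev_mult_u ev_u)
qed

lemma rep_one: "r \<in> T \<Longrightarrow> s \<in> T \<Longrightarrow> rep l r s \<one>\<^bsub>B\<^esub> = (if r = s then 1 else 0)"
proof -
  assume rs: "r \<in> T" "s \<in> T"
  show ?thesis
  proof (cases "r = s")
    case True
    then have "rep l r s \<one>\<^bsub>B\<^esub> = ev l (u \<one>)"
      unfolding rep_def using rs u_inv_closed u_Units T_H by (simp add: B.Units_l_inv)
    then show ?thesis using True ev_u[OF H_one] I_one l_one by simp
  next
    case False
    then show ?thesis
      using rep_hcomp_outside[OF rs _ one_hcomp] T_unique[OF rs] rs T_H H_carrier by auto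
  qed
qed

text \<open>Column s of \<open>u k\<close> has its only nonzero entry in the row m that represents
  the coset of k s; inserting \<open>u m\<close> and its inverse splits the product there.\<close>

lemma rep_mult_u:
  assumes "r \<in> T" "s \<in> T" "k \<in> H" "x \<in> carrier B" "m \<in> T" "inv m \<otimes> k \<otimes> s \<in> I"
  shows "rep l r s (x \<otimes>\<^bsub>B\<^esub> u k) = rep l r m x * rep l m s (u k)"
proof -
  have H: "r \<in> H" "s \<in> H" "m \<in> H" using assms T_H by blast+
  have cl: "inv\<^bsub>B\<^esub> (u r) \<in> carrier B" "inv\<^bsub>B\<^esub> (u m) \<in> carrier B" "u m \<in> carrier B" "u k \<in> carrier B"
    "u s \<in> carrier B"
    using assms H u_inv_closed u_closed by blast+
  have "inv\<^bsub>B\<^esub> (u m) \<in> hcomp B (inv m)"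
    using hcomp_inverse u_hcomp_eq(1) u_neq_zero H H_carrier by blast
  then have hc: "inv\<^bsub>B\<^esub> (u m) \<otimes>\<^bsub>B\<^esub> u k \<otimes>\<^bsub>B\<^esub> u s \<in> hcomp B (inv m \<otimes> k \<otimes> s)"
    using hcomp_mult H assms(3) H_carrier u_hcomp_eq(1) by (meson G.inv_closed G.m_closed)
  have "u m \<otimes>\<^bsub>B\<^esub> (inv\<^bsub>B\<^esub> (u m) \<otimes>\<^bsub>B\<^esub> u k \<otimes>\<^bsub>B\<^esub> u s) = u k \<otimes>\<^bsub>B\<^esub> u s"
    using cl u_Units[OF H(3)] by (simp add: B.m_assoc[symmetric] B.Units_r_inv)
  then have "inv\<^bsub>B\<^esub> (u r) \<otimes>\<^bsub>B\<^esub> (x \<otimes>\<^bsub>B\<^esub> u k) \<otimes>\<^bsub>B\<^esub> u s =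
      (inv\<^bsub>B\<^esub> (u r) \<otimes>\<^bsub>B\<^esub> x \<otimes>\<^bsub>B\<^esub> u m) \<otimes>\<^bsub>B\<^esub> (inv\<^bsub>B\<^esub> (u m) \<otimes>\<^bsub>B\<^esub> u k \<otimes>\<^bsub>B\<^esub> u s)"
    using cl assms(4) by (simp add: B.m_assoc)
  then show ?thesis
    unfolding rep_def using ev_mult_hcomp[OF _ assms(6) hc] cl assms(4) by simp
qed

lemma T_coset:
  assumes "k \<in> H"
  obtains m where "m \<in> T" "inv m \<otimes> k \<in> I" "\<And>m'. m' \<in> T \<Longrightarrow> m' \<noteq> m \<Longrightarrow> inv m' \<otimes> k \<notin> I"
proof -
  obtain m where m: "m \<in> T" "inv m \<otimes> k \<in> I" using T(2) assms by blast
  have "m' = m" if m': "m' \<in> T" "inv m' \<otimes> k \<in> I" for m'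
  proof (rule T_unique[OF m'(1) m(1)])
    have "inv m' \<otimes> m = (inv m' \<otimes> k) \<otimes> inv (inv m \<otimes> k)"
      using m m' assms T_H H_carrier by (simp add: G.inv_mult_group G.m_assoc[symmetric])
        (simp add: G.m_assoc)
    then show "inv m' \<otimes> m \<in> I" using m m' I_mult I_inv by metis
  qed
  then show ?thesis using that m by blast
qed

text \<open>T may be infinite, and matrix multiplication makes sense only because the columns are
  finitely supported. S contains the support of column s of y and depends neither on x nor on
  r.\<close>

lemma rep_mult_exists:
  assumes "y \<in> carrier B" "s \<in> T"
  shows "\<exists>S. finite S \<and> S \<subseteq> T \<and> (\<forall>m\<in>T - S. rep l m s y = 0) \<and>
    (\<forall>x\<in>carrier B. \<forall>r\<in>T. rep l r s (x \<otimes>\<^bsub>B\<^esub> y) = (\<Sum>m\<in>S. rep l r m x * rep l m s y))"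
  using assms(1)
proof (induction rule: B_induct)
  case zero
  then show ?case using assms(2) by (intro exI[of _ "{}"]) (auto simp: rep_zero)
next
  case (step c k y)
  obtain S where S: "finite S" "S \<subseteq> T" "\<forall>m\<in>T - S. rep l m s y = 0"
    "\<forall>x\<in>carrier B. \<forall>r\<in>T. rep l r s (x \<otimes>\<^bsub>B\<^esub> y) = (\<Sum>m\<in>S. rep l r m x * rep l m s y)"
    using step.IH by auto
  have ks: "k \<otimes> s \<in> H" "k \<in> carrier G" "s \<in> carrier G" using step assms T_H H_mult H_carrier by blast+
  obtain m where m: "m \<in> T" "inv m \<otimes> (k \<otimes> s) \<in> I"
    "\<And>m'. m' \<in> T \<Longrightarrow> m' \<noteq> m \<Longrightarrow> inv m' \<otimes> (k \<otimes> s) \<notin> I"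
    using T_coset[OF ks(1)] by blast
  have assoc: "inv m' \<otimes> (k \<otimes> s) = inv m' \<otimes> k \<otimes> s" if "m' \<in> T" for m'
    using that ks T_H H_carrier by (simp add: G.m_assoc)
  have zero: "rep l m' s (u k) = 0" if "m' \<in> T" "m' \<noteq> m" for m'
    using rep_hcomp_outside[OF that(1) assms(2) ks(2) u_hcomp_eq(1)[OF step(1)]] m(3)[OF that]
      assoc[OF that(1)] by simp
  have yc: "c \<odot>\<^bsub>B\<^esub> u k \<in> carrier B" "u k \<in> carrier B" using step u_closed B.smult_closed by blast+
  let ?S = "insert m S"
  have fin: "finite ?S" "?S \<subseteq> T" using S m by auto
  have sum1: "rep l r s (x \<otimes>\<^bsub>B\<^esub> u k) = (\<Sum>m'\<in>?S. rep l r m' x * rep l m' s (u k))"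
    if x: "x \<in> carrier B" and r: "r \<in> T" for x r
  proof -
    have "rep l r s (x \<otimes>\<^bsub>B\<^esub> u k) = rep l r m x * rep l m s (u k)"
      using rep_mult_u[OF r assms(2) step(1) x m(1)] m(2) assoc[OF m(1)] by simp
    also have "\<dots> = (\<Sum>m'\<in>{m}. rep l r m' x * rep l m' s (u k))" by simp
    also have "\<dots> = (\<Sum>m'\<in>?S. rep l r m' x * rep l m' s (u k))"
      by (rule sum.mono_neutral_left) (use fin zero in auto)
    finally show ?thesis .
  qed
  have sum2: "rep l r s (x \<otimes>\<^bsub>B\<^esub> y) = (\<Sum>m'\<in>?S. rep l r m' x * rep l m' s y)"
    if x: "x \<in> carrier B" and r: "r \<in> T" for x r
  proof -
    have "rep l r s (x \<otimes>\<^bsub>B\<^esub> y) = (\<Sum>m'\<in>S. rep l r m' x * rep l m' s y)" using S(4) x r by blast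
    also have "\<dots> = (\<Sum>m'\<in>?S. rep l r m' x * rep l m' s y)"
      by (rule sum.mono_neutral_left) (use fin S(3) in auto)
    finally show ?thesis .
  qed
  have "rep l r s (x \<otimes>\<^bsub>B\<^esub> (c \<odot>\<^bsub>B\<^esub> u k \<oplus>\<^bsub>B\<^esub> y)) =
      (\<Sum>m'\<in>?S. rep l r m' x * rep l m' s (c \<odot>\<^bsub>B\<^esub> u k \<oplus>\<^bsub>B\<^esub> y))"
    if x: "x \<in> carrier B" and r: "r \<in> T" for x r
  proof -
    have "x \<otimes>\<^bsub>B\<^esub> (c \<odot>\<^bsub>B\<^esub> u k \<oplus>\<^bsub>B\<^esub> y) = c \<odot>\<^bsub>B\<^esub> (x \<otimes>\<^bsub>B\<^esub> u k) \<oplus>\<^bsub>B\<^esub> x \<otimes>\<^bsub>B\<^esub> y"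
      using x yc step by (simp add: B.r_distr B.smult_mult_right)
    then have "rep l r s (x \<otimes>\<^bsub>B\<^esub> (c \<odot>\<^bsub>B\<^esub> u k \<oplus>\<^bsub>B\<^esub> y)) =
        c * rep l r s (x \<otimes>\<^bsub>B\<^esub> u k) + rep l r s (x \<otimes>\<^bsub>B\<^esub> y)"
      using x yc step r assms by (simp add: rep_add rep_smult B.smult_closed)
    also have "\<dots> = (\<Sum>m'\<in>?S. rep l r m' x * (c * rep l m' s (u k) + rep l m' s y))"
      unfolding sum1[OF x r] sum2[OF x r] sum_distrib_left sum.distrib[symmetric]
      by (intro sum.cong refl) (simp add: algebra_simps)
    also have "\<dots> = (\<Sum>m'\<in>?S. rep l r m' x * rep l m' s (c \<odot>\<^bsub>B\<^esub> u k \<oplus>\<^bsub>B\<^esub> y))"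
    proof (intro sum.cong refl)
      fix m' assume "m' \<in> ?S"
      then have "m' \<in> T" using fin(2) by blast
      then show "rep l r m' x * (c * rep l m' s (u k) + rep l m' s y) =
          rep l r m' x * rep l m' s (c \<odot>\<^bsub>B\<^esub> u k \<oplus>\<^bsub>B\<^esub> y)"
        using yc step(2) assms(2) by (simp add: rep_add rep_smult)
    qed
    finally show ?thesis .
  qed
  moreover have "rep l m' s (c \<odot>\<^bsub>B\<^esub> u k \<oplus>\<^bsub>B\<^esub> y) = 0" if "m' \<in> T - ?S" for m'
    using that S(3) zero[of m'] step(2) yc assms by (simp add: rep_add rep_smult)
  ultimately show ?case using fin by blast
qed

lemma rep_mult:
  assumes "x \<in> carrier B" "y \<in> carrier B" "r \<in> T" "s \<in> T" "finite S" "S \<subseteq> T"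
    and "\<And>m. m \<in> T \<Longrightarrow> m \<notin> S \<Longrightarrow> rep l m s y = 0"
  shows "rep l r s (x \<otimes>\<^bsub>B\<^esub> y) = (\<Sum>m\<in>S. rep l r m x * rep l m s y)"
proof -
  obtain S0 where S0: "finite S0" "S0 \<subseteq> T" "\<forall>m\<in>T - S0. rep l m s y = 0"
    "\<forall>x\<in>carrier B. \<forall>r\<in>T. rep l r s (x \<otimes>\<^bsub>B\<^esub> y) = (\<Sum>m\<in>S0. rep l r m x * rep l m s y)"
    using rep_mult_exists[OF assms(2,4)] by auto
  have "rep l r s (x \<otimes>\<^bsub>B\<^esub> y) = (\<Sum>m\<in>S0. rep l r m x * rep l m s y)"
    using S0(4) assms(1,3) by blast
  also have "\<dots> = (\<Sum>m\<in>S0 \<inter> S. rep l r m x * rep l m s y)"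
    using S0(1,2) assms(7) by (intro sum.mono_neutral_right) (auto simp: subset_iff)
  also have "\<dots> = (\<Sum>m\<in>S. rep l r m x * rep l m s y)"
    using S0 assms by (intro sum.mono_neutral_left) auto
  finally show ?thesis .
qed

lemma rep_diag:
  assumes "z \<in> lin_span B (u ` I)" "m \<in> T" "j \<in> T" "m \<noteq> j"
  shows "rep l m j z = 0"
  using assms(1)
proof (induction rule: lin_span.induct)
  case zero
  then show ?case using assms by (simp add: rep_zero)
next
  case (step b z c)
  obtain i where i: "i \<in> I" "b = u i" using step by blast
  have mj: "m \<in> carrier G" "j \<in> carrier G" "i \<in> carrier G" "i \<in> H"
    using assms T_H H_carrier i I_subset by blast+
  have "u ` I \<subseteq> carrier B" using I_subset u_closed by blast
  then have "z \<in> carrier B" using step B.lin_span_closed by blast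
  moreover have "inv m \<otimes> i \<otimes> j \<notin> I"
  proof
    assume "inv m \<otimes> i \<otimes> j \<in> I"
    moreover have "inv m \<otimes> i \<otimes> j = (inv m \<otimes> j) \<otimes> i" using mj by (simp add: G.m_ac)
    ultimately have "inv m \<otimes> j \<in> I" using I_cancel[OF _ i(1)] mj by simp
    then show False using T_unique assms by blast
  qed
  then have "rep l m j b = 0" using rep_hcomp_outside[OF assms(2,3) mj(3)] u_hcomp_eq(1) mj i by blast
  ultimately show ?case using step assms mj i by (simp add: rep_add rep_smult u_closed B.smult_closed)
qed

text \<open>Degrees in I act diagonally, with eigenvalue \<beta>(i, j) l(i) at j. By maximality of I
  the characters \<beta>(-, j) differ for different j in T, and this separates the diagonal
  positions.\<close>

lemma rep_u_diag:
  assumes "i \<in> I" "j \<in> T"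
  shows "rep l j j (u i) = \<beta> i j * l i"
proof -
  have ij: "i \<in> H" "j \<in> H" using assms I_subset T_H by blast+
  have "inv\<^bsub>B\<^esub> (u j) \<otimes>\<^bsub>B\<^esub> u i \<otimes>\<^bsub>B\<^esub> u j = \<beta> i j \<odot>\<^bsub>B\<^esub> (inv\<^bsub>B\<^esub> (u j) \<otimes>\<^bsub>B\<^esub> (u j \<otimes>\<^bsub>B\<^esub> u i))"
    using ij u_closed u_inv_closed by (simp add: B.m_assoc u_commute[OF ij] B.smult_mult_right)
  also have "inv\<^bsub>B\<^esub> (u j) \<otimes>\<^bsub>B\<^esub> (u j \<otimes>\<^bsub>B\<^esub> u i) = u i"
    using ij u_closed u_inv_closed u_Units by (simp add: B.m_assoc[symmetric] B.Units_l_inv)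
  finally show ?thesis unfolding rep_def using ij assms by (simp add: ev_smult ev_u u_closed)
qed

text \<open>Lagrange interpolation with the commuting operators \<open>u i\<close>: each step
  multiplies z by a factor (u_i - a_j) / (a_s - a_j), which is 0 at j and 1 at s.\<close>

lemma separating_diag:
  assumes "finite S" "S \<subseteq> T" "s \<in> T" "s \<notin> S"
  shows "\<exists>z\<in>lin_span B (u ` I). (\<forall>j\<in>S. rep l j j z = 0) \<and> rep l s s z = 1"
  using assms
proof (induction S rule: finite_induct)
  have uI: "u ` I \<subseteq> carrier B" using I_subset u_closed by blast
  case empty
  have "u \<one> \<in> lin_span B (u ` I)" using B.lin_span_base[OF uI] I_one by blast
  then show ?case using rep_one assms by (intro bexI[of _ "u \<one>"]) auto
next
  have uI: "u ` I \<subseteq> carrier B" using I_subset u_closed by blast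
  case (insert j S)
  then obtain z where z: "z \<in> lin_span B (u ` I)" "\<And>j. j \<in> S \<Longrightarrow> rep l j j z = 0" "rep l s s z = 1"
    by auto
  have zB: "z \<in> carrier B" using z B.lin_span_closed uI by blast
  have js: "j \<in> T" "s \<in> T" "j \<noteq> s" "j \<in> H" "s \<in> H" using insert T_H by auto
  \<comment> \<open>Otherwise inv j s would be orthogonal to I, hence in I, and j and s would
    represent the same coset.\<close>
  have "\<exists>i\<in>I. \<beta> i j \<noteq> \<beta> i s"
  proof (rule ccontr)
    assume c: "\<not> (\<exists>i\<in>I. \<beta> i j \<noteq> \<beta> i s)"
    have "inv j \<otimes> s \<in> I"
    proof (rule max)
      show "inv j \<otimes> s \<in> H" using js H_mult H_inv by blast
      show "\<beta> i (inv j \<otimes> s) = 1" if "i \<in> I" for i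
      proof -
        have i: "i \<in> H" using that I_subset by blast
        have "\<beta> i (inv j) = inverse (\<beta> i j)" using \<beta>_inv[OF js(4) i] \<beta>_swap[of i] \<beta>_swap[of j] by metis
        then show ?thesis using c that \<beta>_mult_right[OF H_inv[OF js(4)] js(5) i] \<beta>_neq_zero[OF i js(5)]
          by auto
      qed
    qed
    then show False using T_unique js by blast
  qed
  then obtain i where i: "i \<in> I" "\<beta> i j \<noteq> \<beta> i s" by blast
  have iH: "i \<in> H" "u i \<in> carrier B" using i I_subset u_closed by blast+
  define a where "a k = \<beta> i k * l i" for k
  have a_ne: "a s - a j \<noteq> 0" using i l unfolding a_def splitting_def by auto
  define z' where "z' = (1 / (a s - a j)) \<odot>\<^bsub>B\<^esub> (z \<otimes>\<^bsub>B\<^esub> u i \<oplus>\<^bsub>B\<^esub> (- a j) \<odot>\<^bsub>B\<^esub> z)"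
  have scale: "c \<odot>\<^bsub>B\<^esub> x \<in> lin_span B (u ` I)" if x: "x \<in> lin_span B (u ` I)" for c x
    using x
  proof (induction rule: lin_span.induct)
    case zero
    then show ?case by (simp add: B.smult_zero lin_span.zero)
  next
    case (step s x d)
    then have "s \<in> carrier B" "x \<in> carrier B" using uI B.lin_span_closed by blast+
    then show ?case using lin_span.step[OF step(1) step(3), of "c * d"]
      by (simp add: B.smult_add_right B.smult_smult B.smult_closed)
  qed
  have zu: "x \<otimes>\<^bsub>B\<^esub> u i \<in> lin_span B (u ` I)" if x: "x \<in> lin_span B (u ` I)" for x
    using x
  proof (induction rule: lin_span.induct)
    case zero
    then show ?case using iH by (simp add: lin_span.zero)
  next
    case (step s x d)
    then obtain k where k: "k \<in> I" "s = u k" by blast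
    have cl: "s \<in> carrier B" "x \<in> carrier B" "k \<in> H" "u (k \<otimes> i) \<in> carrier B"
      using step uI B.lin_span_closed k I_subset I_mult i by blast+
    have "(d \<odot>\<^bsub>B\<^esub> s \<oplus>\<^bsub>B\<^esub> x) \<otimes>\<^bsub>B\<^esub> u i = (d * \<sigma> k i) \<odot>\<^bsub>B\<^esub> u (k \<otimes> i) \<oplus>\<^bsub>B\<^esub> x \<otimes>\<^bsub>B\<^esub> u i"
      using cl iH k by (simp add: B.l_distr B.smult_mult_left u_mult B.smult_smult B.smult_closed)
    then show ?case using lin_span.step[OF _ step(3)] I_mult[OF k(1) i(1)] by simp
  qed
  have zuB: "z \<otimes>\<^bsub>B\<^esub> u i \<in> carrier B" using zB iH by simp
  have rep: "rep l k k z' = (rep l k k z * (a k - a j)) / (a s - a j)" if k: "k \<in> T" for k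
  proof -
    have "inv k \<otimes> i \<otimes> k = i" using k T_H H_carrier iH by (simp add: G.m_ac)
    then have "rep l k k (z \<otimes>\<^bsub>B\<^esub> u i) = rep l k k z * a k"
      using rep_mult_u[OF k k iH(1) zB k] rep_u_diag[OF i(1) k] i unfolding a_def by simp
    then show ?thesis
      unfolding z'_def using k zuB zB
      by (simp add: rep_smult rep_add B.smult_closed algebra_simps diff_divide_distrib)
  qed
  have "z' \<in> lin_span B (u ` I)"
    unfolding z'_def by (intro scale B.lin_span_add zu z uI)
  moreover have "rep l s s z' = 1" using rep[OF js(2)] z(3) a_ne by simp
  moreover have "rep l k k z' = 0" if "k \<in> insert j S" for k
    using that rep[of k] z(2)[of k] insert js by auto
  ultimately show ?case by blast
qed

text \<open>\<open>u r\<close> times the inverse of \<open>u s\<close> carries basis vector s to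
  basis vector r but has other nonzero columns as well. The diagonal element z vanishes on S except
  at s and removes those in S.\<close>

lemma density_unit:
  assumes "finite S" "S \<subseteq> T" "s \<in> S" "r \<in> T"
  shows "\<exists>x\<in>carrier B. \<forall>j\<in>S. \<forall>m\<in>T. rep l m j x = (if m = r \<and> j = s then 1 else 0)"
proof -
  have uI: "u ` I \<subseteq> carrier B" using I_subset u_closed by blast
  obtain z where z: "z \<in> lin_span B (u ` I)" "\<And>j. j \<in> S - {s} \<Longrightarrow> rep l j j z = 0" "rep l s s z = 1"
    using separating_diag[of "S - {s}" s] assms by auto
  have zB: "z \<in> carrier B" using z B.lin_span_closed uI by blast
  have rs: "r \<in> H" "s \<in> H" using assms T_H by auto
  define y where "y = u r \<otimes>\<^bsub>B\<^esub> inv\<^bsub>B\<^esub> (u s)"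
  have y: "y \<in> carrier B" unfolding y_def using rs u_closed u_inv_closed by simp
  have "rep l m s y = (if m = r then 1 else 0)" if m: "m \<in> T" for m
  proof -
    have mH: "m \<in> H" using m T_H by blast
    have "inv\<^bsub>B\<^esub> (u m) \<otimes>\<^bsub>B\<^esub> y \<otimes>\<^bsub>B\<^esub> u s = inv\<^bsub>B\<^esub> (u m) \<otimes>\<^bsub>B\<^esub> \<one>\<^bsub>B\<^esub> \<otimes>\<^bsub>B\<^esub> u r"
      unfolding y_def using rs mH u_closed u_inv_closed u_Units by (simp add: B.m_assoc B.Units_l_inv)
    then show ?thesis using rep_one[OF m assms(4)] unfolding rep_def by simp
  qed
  moreover have "rep l m j (y \<otimes>\<^bsub>B\<^esub> z) = rep l m j y * rep l j j z" if "m \<in> T" "j \<in> T" for m j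
    using rep_mult[OF y zB that, of "{j}"] rep_diag[OF z(1)] that by auto
  ultimately have "rep l m j (y \<otimes>\<^bsub>B\<^esub> z) = (if m = r \<and> j = s then 1 else 0)" if "j \<in> S" "m \<in> T" for m j
    using that z(2)[of j] z(3) assms(2) by (cases "j = s") auto
  then show ?thesis using y zB by (intro bexI[of _ "y \<otimes>\<^bsub>B\<^esub> z"]) auto
qed

text \<open>Linear combinations of the elements from \<open>density_unit\<close>. This is Jacobson
  density for the induced representation, with finitely many columns prescribed.\<close>

lemma density:
  assumes S: "finite S" "S \<subseteq> T"
  shows "\<exists>x\<in>carrier B. \<forall>j\<in>S. \<forall>m\<in>T. rep l m j x = (if m \<in> S then M m j else 0)"
proof -
  define e where "e r s = (SOME x. x \<in> carrier B \<and>
    (\<forall>j\<in>S. \<forall>m\<in>T. rep l m j x = (if m = r \<and> j = s then 1 else 0)))" for r s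
  have e': "e r s \<in> carrier B \<and> (\<forall>j\<in>S. \<forall>m\<in>T. rep l m j (e r s) = (if m = r \<and> j = s then 1 else 0))"
    if "r \<in> S" "s \<in> S" for r s
    unfolding e_def by (rule someI_ex) (use density_unit[OF S that(2)] that S(2) in blast)
  then have e: "\<And>r s. r \<in> S \<Longrightarrow> s \<in> S \<Longrightarrow> e r s \<in> carrier B"
    "\<And>r s j m. r \<in> S \<Longrightarrow> s \<in> S \<Longrightarrow> j \<in> S \<Longrightarrow> m \<in> T \<Longrightarrow>
      rep l m j (e r s) = (if m = r \<and> j = s then 1 else 0)"
    by blast+
  define x where "x = (\<Oplus>\<^bsub>B\<^esub>p\<in>S \<times> S. M (fst p) (snd p) \<odot>\<^bsub>B\<^esub> e (fst p) (snd p))"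
  have cl: "M (fst p) (snd p) \<odot>\<^bsub>B\<^esub> e (fst p) (snd p) \<in> carrier B" if "p \<in> S \<times> S" for p
    using that e B.smult_closed by auto
  have "rep l m j x = (if m \<in> S then M m j else 0)" if jm: "j \<in> S" "m \<in> T" for j m
  proof -
    have j: "j \<in> T" using jm S by blast
    have "rep l m j x = (\<Sum>p\<in>S \<times> S. rep l m j (M (fst p) (snd p) \<odot>\<^bsub>B\<^esub> e (fst p) (snd p)))"
      unfolding x_def using S cl by (intro rep_finsum jm j) auto
    also have "\<dots> = (\<Sum>p\<in>S \<times> S. if p = (m, j) then M m j else 0)"
      using e jm j by (intro sum.cong refl) (auto simp: rep_smult split: if_splits)
    also have "\<dots> = (if m \<in> S then M m j else 0)" using S jm by (simp add: sum.delta)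
    finally show ?thesis .
  qed
  moreover have "x \<in> carrier B" unfolding x_def using cl by (intro B.finsum_closed) auto
  ultimately show ?thesis by blast
qed

end

text \<open>If \<open>T\<close> were infinite, density would provide, for a word \<open>w\<close> occurring in an identity, elements
  whose products vanish on a chosen vector for all other words.\<close>

lemma finite_T:
  assumes "is_pi_algebra B"
  shows "finite T"
proof (rule ccontr)
  assume "infinite T"
  obtain l where l: "splitting l" using splitting_exists by blast
  obtain f where f: "f \<in> identities B" "f \<noteq> 0" using assms unfolding is_pi_algebra_def by blast
  obtain w where w: "w \<in> Poly_Mapping.keys f" using f(2) by (metis ex_in_conv keys_eq_empty)
  define d where "d = length w"
  obtain S where S: "S \<subseteq> T" "finite S" "card S = Suc d"
    using infinite_arbitrarily_large[OF \<open>infinite T\<close>] by blast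
  obtain s where s: "bij_betw s {0..<Suc d} S" using ex_bij_betw_nat_finite[OF S(2)] S(3) by metis
  have sS: "s i \<in> S" if "i \<le> d" for i using s that unfolding bij_betw_def by auto
  have s_inj: "s i = s j \<longleftrightarrow> i = j" if "i \<le> d" "j \<le> d" for i j
    using s that unfolding bij_betw_def inj_on_def by auto
  \<comment> \<open>The letter a becomes the sum of the matrix units from s(i) to s(i+1) over the
    places i where w has the letter a, so that w traces the path s(0), ..., s(d).\<close>
  define M where "M a m j = (if \<exists>i<d. w ! i = a \<and> m = s i \<and> j = s (Suc i) then 1 else 0::'k)" for a m j
  obtain x where x: "\<And>a. x a \<in> carrier B"
    "\<And>a j m. j \<in> S \<Longrightarrow> m \<in> T \<Longrightarrow> rep l m j (x a) = (if m \<in> S then M a m j else 0)"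
    using density[OF l S(2,1), of "M _"] by metis
  \<comment> \<open>Column s(d) of the value of v is the basis vector s(d - |v|) if v is a suffix of
    w, and 0 otherwise. The bound on the length guards the truncated subtraction.\<close>
  have word: "rep l m (s d) (eval_word B x v) =
      (if length v \<le> d \<and> v = drop (d - length v) w \<and> m = s (d - length v) then 1 else 0)"
    if "m \<in> T" for m v
    using that
  proof (induction v arbitrary: m)
    case Nil
    then show ?case using rep_one[OF l] sS[of d] S by (auto simp: d_def)
  next
    case (Cons a v)
    have sd: "s d \<in> T" using sS S by blast
    have vB: "eval_word B x v \<in> carrier B" using x by auto
    have zero: "rep l k (s d) (eval_word B x v) = 0" if "k \<in> T" "k \<notin> S" for k
      using Cons.IH[OF that(1)] that sS[of "d - length v"] by auto
    have "rep l m (s d) (eval_word B x (a # v)) =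
        (\<Sum>k\<in>S. rep l m k (x a) * rep l k (s d) (eval_word B x v))"
      using rep_mult[OF l x(1) vB Cons.prems sd S(2,1) zero] by simp
    also have "\<dots> = (\<Sum>k\<in>S. if k = s (d - length v) then
        (if length v \<le> d \<and> v = drop (d - length v) w then rep l m k (x a) else 0) else 0)"
      using S by (intro sum.cong refl) (auto simp: Cons.IH subset_iff)
    also have "\<dots> = (if length v \<le> d \<and> v = drop (d - length v) w then rep l m (s (d - length v)) (x a) else 0)"
      using S(2) sS[of "d - length v"] by (simp add: sum.delta)
    also have "\<dots> = (if length (a # v) \<le> d \<and> a # v = drop (d - length (a # v)) w \<and>
        m = s (d - length (a # v)) then 1 else 0)"
    proof (cases "length v < d \<and> v = drop (d - length v) w")
      case True
      define q where "q = d - Suc (length v)"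
      have q: "d - length v = Suc q" "q < d" "d - length (a # v) = q" using True unfolding q_def by auto
      have "drop q w = w ! q # drop (Suc q) w" using q d_def by (simp add: Cons_nth_drop_Suc)
      moreover have "(\<exists>i<d. w ! i = a \<and> m = s i \<and> s (Suc q) = s (Suc i)) \<longleftrightarrow> w ! q = a \<and> m = s q"
      proof
        assume "\<exists>i<d. w ! i = a \<and> m = s i \<and> s (Suc q) = s (Suc i)"
        then obtain i where i: "i < d" "w ! i = a" "m = s i" "s (Suc q) = s (Suc i)" by blast
        then have "q = i" using s_inj[of "Suc q" "Suc i"] q by simp
        then show "w ! q = a \<and> m = s q" using i by simp
      qed (use q in blast)
      then have "rep l m (s (Suc q)) (x a) = (if w ! q = a \<and> m = s q then 1 else 0)"
        using x(2)[OF sS[of "Suc q"] Cons.prems, of a] q sS[of q] unfolding M_def by auto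
      ultimately show ?thesis using True q by auto
    next
      case False
      \<comment> \<open>No step of the path ends in s(0), so a letter in front of all of w gives 0;
        this disposes of words longer than w.\<close>
      have "rep l m (s 0) (x a) = 0"
      proof -
        have "s 0 \<noteq> s (Suc i)" if "i < d" for i using s_inj[of 0 "Suc i"] that by simp
        then show ?thesis using x(2)[OF sS[of 0] Cons.prems, of a] unfolding M_def by auto
      qed
      moreover have "length v = d" if "length v \<le> d" "v = drop (d - length v) w" using that False by simp
      moreover have "\<not> (length (a # v) \<le> d \<and> a # v = drop (d - length (a # v)) w)"
      proof
        assume c: "length (a # v) \<le> d \<and> a # v = drop (d - length (a # v)) w"
        then have "v = tl (drop (d - Suc (length v)) w)" by (metis length_Cons list.sel(3))
        also have "\<dots> = drop (Suc (d - Suc (length v))) w" by (simp add: drop_Suc tl_drop)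
        also have "Suc (d - Suc (length v)) = d - length v" using c by auto
        finally show False using False c by auto
      qed
      ultimately show ?thesis by auto
    qed
    finally show ?case .
  qed
  have s0: "s 0 \<in> T" "s d \<in> T" using sS S by blast+
  have "0 = rep l (s 0) (s d) (eval_ncpoly B x f)"
    using f(1) x(1) rep_zero s0 unfolding identities_def by auto
  also have "\<dots> = (\<Sum>v\<in>Poly_Mapping.keys f. Poly_Mapping.lookup f v * rep l (s 0) (s d) (eval_word B x v))"
    unfolding eval_ncpoly_def using x(1) s0
    by (subst rep_finsum) (auto simp: rep_smult B.smult_closed intro!: sum.cong)
  \<comment> \<open>Row s(0) is reached only by words of length d, and the only suffix of w of that
    length is w.\<close>
  also have "\<dots> = (\<Sum>v\<in>Poly_Mapping.keys f. if v = w then Poly_Mapping.lookup f w else 0)"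
    using word[OF s0(1)] s_inj[of 0] by (intro sum.cong refl) (auto simp: d_def)
  also have "\<dots> = Poly_Mapping.lookup f w" using w by (simp add: sum.delta)
  finally show False using w by (simp add: in_keys_iff)
qed

lemma T_nonempty: "T \<noteq> {}"
  using T(2)[OF H_one] by blast

text \<open>With r chosen in the right coset, some nonzero coordinate of x is moved into I, giving
  y. Every product of a splitting with a character of I is again a splitting; if all of them killed
  y, independence of characters would make that coordinate zero.\<close>

lemma rep_separates:
  assumes x: "x \<in> carrier B" "x \<noteq> \<zero>\<^bsub>B\<^esub>"
  obtains l r s where "splitting l" "r \<in> T" "s \<in> T" "rep l r s x \<noteq> 0"
proof -
  obtain h where h: "cf x h \<noteq> 0" using x cf_zero cf_inject B.zero_closed by (metis ext)
  have hH: "h \<in> H" using h cf_outside[OF x(1)] by blast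
  obtain s where s: "s \<in> T" using T_nonempty by blast
  have sH: "s \<in> H" using s T_H by blast
  obtain r where r: "r \<in> T" "inv r \<otimes> (h \<otimes> s) \<in> I" using T(2)[OF H_mult[OF hH sH]] by blast
  have rH: "r \<in> H" using r T_H by blast
  define y where "y = inv\<^bsub>B\<^esub> (u r) \<otimes>\<^bsub>B\<^esub> (x \<otimes>\<^bsub>B\<^esub> u s)"
  obtain d where d: "d \<noteq> 0" "inv\<^bsub>B\<^esub> (u r) = d \<odot>\<^bsub>B\<^esub> u (inv r)" using inv_u[OF rH] by blast
  have y: "y \<in> carrier B" unfolding y_def using x rH sH u_inv_closed u_closed by simp
  have "cf y (inv r \<otimes> (h \<otimes> s)) = d * (\<sigma> (inv r) (h \<otimes> s) * (cf x h * \<sigma> h s))"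
    unfolding y_def d(2) using x hH rH sH H_inv H_mult u_closed
    by (simp add: B.smult_mult_left cf_smult cf_u_mult cf_mult_u)
  then have cy: "cf y (inv r \<otimes> (h \<otimes> s)) \<noteq> 0"
    using d h \<sigma>_neq_zero H_inv H_mult rH sH hH by simp
  obtain l where l: "splitting l" using splitting_exists by blast
  interpret I: comm_group "G\<lparr>carrier := I\<rparr>"
    by (rule G.subgroup_comm_group[OF subgroup_I])
  have "\<exists>l. splitting l \<and> ev l y \<noteq> 0"
  proof (rule ccontr)
    assume c: "\<not> (\<exists>l. splitting l \<and> ev l y \<noteq> 0)"
    have "cf y (inv r \<otimes> (h \<otimes> s)) * l (inv r \<otimes> (h \<otimes> s)) = 0"
    proof (rule I.characters_independent[of "{h \<in> I. cf y h \<noteq> 0}" "\<lambda>h. cf y h * l h"])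
      fix \<chi> :: "'g \<Rightarrow> 'k" assume \<chi>: "\<And>x. x \<in> carrier (G\<lparr>carrier := I\<rparr>) \<Longrightarrow> \<chi> x \<noteq> 0"
        "\<And>x y. x \<in> carrier (G\<lparr>carrier := I\<rparr>) \<Longrightarrow> y \<in> carrier (G\<lparr>carrier := I\<rparr>) \<Longrightarrow>
          \<chi> (x \<otimes>\<^bsub>G\<lparr>carrier := I\<rparr>\<^esub> y) = \<chi> x * \<chi> y"
      have "splitting (\<lambda>a. l a * \<chi> a)" using l \<chi> unfolding splitting_def by (simp add: algebra_simps)
      then have "ev (\<lambda>a. l a * \<chi> a) y = 0" using c by blast
      then show "(\<Sum>h | h \<in> I \<and> cf y h \<noteq> 0. cf y h * l h * \<chi> h) = 0"
        unfolding ev_def by (simp add: mult.assoc)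
    qed (use cf_finite[OF y] cy r in auto)
    then show False using cy l r unfolding splitting_def by auto
  qed
  then obtain l' where l': "splitting l'" "ev l' y \<noteq> 0" by blast
  have "rep l' r s x = ev l' y"
    unfolding rep_def y_def using x rH sH u_inv_closed u_closed by (simp add: B.m_assoc)
  then show ?thesis using that l' r s by metis
qed

end

definition algebra_hom :: "('k, 'a, 'm) module_scheme \<Rightarrow> ('k, 'b, 'n) module_scheme \<Rightarrow> ('a \<Rightarrow> 'b) \<Rightarrow> bool" where
  "algebra_hom A A' \<phi> \<longleftrightarrow> \<phi> \<in> Ring.ring_hom A A' \<and> (\<forall>c. \<forall>x\<in>carrier A. \<phi> (c \<odot>\<^bsub>A\<^esub> x) = c \<odot>\<^bsub>A'\<^esub> \<phi> x)"

text \<open>The p.i. degree and the coarsened identities use the induced representations only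
  through such a family. One t serves the whole family because all its members are induced from the
  same subgroup I.\<close>

definition matrix_reps :: "('k::field, 'a, 'm) module_scheme \<Rightarrow> nat \<Rightarrow> ('a \<Rightarrow> 'k mat) set \<Rightarrow> bool" where
  "matrix_reps A t \<Phi> \<longleftrightarrow> t > 0 \<and> \<Phi> \<noteq> {} \<and>
    (\<forall>\<phi>\<in>\<Phi>. algebra_hom A (module_mat TYPE('k) t t) \<phi> \<and> \<phi> ` carrier A = carrier_mat t t) \<and>
    (\<forall>x\<in>carrier A. (\<forall>\<phi>\<in>\<Phi>. \<phi> x = 0\<^sub>m t t) \<longrightarrow> x = \<zero>\<^bsub>A\<^esub>)"

lemma (in polarized_division) matrix_reps_exist:
  assumes "is_pi_algebra B"
  obtains t \<Phi> where "matrix_reps B t \<Phi>"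
proof -
  have T_fin: "finite T" by (rule finite_T[OF assms])
  obtain e where e: "bij_betw e {0..<card T} T" using ex_bij_betw_nat_finite[OF T_fin] by blast
  let ?t = "card T"
  have eT: "e i \<in> T" if "i < ?t" for i using e that unfolding bij_betw_def by auto
  have e_inj: "e i = e j \<longleftrightarrow> i = j" if "i < ?t" "j < ?t" for i j
    using e that unfolding bij_betw_def inj_on_def by auto
  define \<phi> where "\<phi> l x = mat ?t ?t (\<lambda>(i, j). rep l (e i) (e j) x)" for l x
  have hom: "algebra_hom B (module_mat TYPE('k) ?t ?t) (\<phi> l)" if l: "splitting l" for l
    unfolding algebra_hom_def
  proof (intro conjI allI ballI ring_hom_memI)
    fix x y assume xy: "x \<in> carrier B" "y \<in> carrier B"
    show "\<phi> l (x \<otimes>\<^bsub>B\<^esub> y) = \<phi> l x \<otimes>\<^bsub>module_mat TYPE('k) ?t ?t\<^esub> \<phi> l y"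
    proof (rule eq_matI)
      fix i j assume "i < dim_row (\<phi> l x \<otimes>\<^bsub>module_mat TYPE('k) ?t ?t\<^esub> \<phi> l y)"
        "j < dim_col (\<phi> l x \<otimes>\<^bsub>module_mat TYPE('k) ?t ?t\<^esub> \<phi> l y)"
      then have ij: "i < ?t" "j < ?t" by (simp_all add: module_mat_simps \<phi>_def)
      have "rep l (e i) (e j) (x \<otimes>\<^bsub>B\<^esub> y) = (\<Sum>m\<in>T. rep l (e i) m x * rep l m (e j) y)"
        using rep_mult[OF l xy eT[OF ij(1)] eT[OF ij(2)] T_fin] by simp
      also have "\<dots> = (\<Sum>k\<in>{0..<?t}. rep l (e i) (e k) x * rep l (e k) (e j) y)"
        by (rule sum.reindex_bij_betw[OF e, symmetric])
      finally show "\<phi> l (x \<otimes>\<^bsub>B\<^esub> y) $$ (i, j) = (\<phi> l x \<otimes>\<^bsub>module_mat TYPE('k) ?t ?t\<^esub> \<phi> l y) $$ (i, j)"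
        using ij by (simp add: module_mat_simps \<phi>_def scalar_prod_def)
    qed (simp_all add: module_mat_simps \<phi>_def)
    show "\<phi> l (x \<oplus>\<^bsub>B\<^esub> y) = \<phi> l x \<oplus>\<^bsub>module_mat TYPE('k) ?t ?t\<^esub> \<phi> l y"
      by (rule eq_matI) (simp_all add: module_mat_simps \<phi>_def rep_add xy eT)
  next
    show "\<phi> l \<one>\<^bsub>B\<^esub> = \<one>\<^bsub>module_mat TYPE('k) ?t ?t\<^esub>"
      by (rule eq_matI) (simp_all add: module_mat_simps \<phi>_def rep_one[OF l] eT e_inj)
  next
    fix c x assume "x \<in> carrier B"
    then show "\<phi> l (c \<odot>\<^bsub>B\<^esub> x) = c \<odot>\<^bsub>module_mat TYPE('k) ?t ?t\<^esub> \<phi> l x"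
      by (intro eq_matI) (simp_all add: module_mat_simps \<phi>_def rep_smult eT)
  qed (simp add: module_mat_simps \<phi>_def)
  have surj: "\<phi> l ` carrier B = carrier_mat ?t ?t" if l: "splitting l" for l
  proof
    show "\<phi> l ` carrier B \<subseteq> carrier_mat ?t ?t" by (auto simp: \<phi>_def)
    show "carrier_mat ?t ?t \<subseteq> \<phi> l ` carrier B"
    proof
      fix A :: "'k mat" assume A: "A \<in> carrier_mat ?t ?t"
      define e' where "e' = the_inv_into {0..<?t} e"
      have e': "e' (e i) = i" if "i < ?t" for i
        unfolding e'_def using e that by (intro the_inv_into_f_f) (auto simp: bij_betw_def)
      obtain x where x: "x \<in> carrier B"
        "\<And>j m. j \<in> T \<Longrightarrow> m \<in> T \<Longrightarrow> rep l m j x = A $$ (e' m, e' j)"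
        using density[OF l T_fin subset_refl, of "\<lambda>m j. A $$ (e' m, e' j)"] by auto
      have "A = \<phi> l x"
        using A x(2) eT e' by (intro eq_matI) (auto simp: \<phi>_def)
      then show "A \<in> \<phi> l ` carrier B" using x by blast
    qed
  qed
  have "matrix_reps B ?t (\<phi> ` {l. splitting l})"
    unfolding matrix_reps_def
  proof (intro conjI ballI impI)
    show "?t > 0" using T_nonempty T_fin by (simp add: card_gt_0_iff)
    show "\<phi> ` {l. splitting l} \<noteq> {}" using splitting_exists by blast
    fix x assume x: "x \<in> carrier B" "\<forall>\<psi>\<in>\<phi> ` {l. splitting l}. \<psi> x = 0\<^sub>m ?t ?t"
    show "x = \<zero>\<^bsub>B\<^esub>"
    proof (rule ccontr)
      assume "x \<noteq> \<zero>\<^bsub>B\<^esub>"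
      then obtain l r s where l: "splitting l" "r \<in> T" "s \<in> T" "rep l r s x \<noteq> 0"
        using rep_separates[OF x(1)] by blast
      have "r \<in> e ` {0..<?t}" "s \<in> e ` {0..<?t}" using l e unfolding bij_betw_def by simp_all
      then obtain i j where "i < ?t" "j < ?t" "r = e i" "s = e j" by auto
      then have "\<phi> l x $$ (i, j) \<noteq> 0" using l unfolding \<phi>_def by simp
      then show False using x(2) l \<open>i < ?t\<close> \<open>j < ?t\<close> by auto
    qed
  qed (use hom surj in auto)
  then show ?thesis using that by blast
qed

theorem (in graded_division) matrix_reps_exist:
  assumes "is_pi_algebra B"
  obtains t \<Phi> where "matrix_reps B t \<Phi>"
proof -
  obtain I where I: "isotropic I" "\<And>r. r \<in> H \<Longrightarrow> (\<And>i. i \<in> I \<Longrightarrow> \<beta> i r = 1) \<Longrightarrow> r \<in> I"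
    using maximal_isotropic_exists by blast
  have sg: "subgroup I G" and IH: "I \<subseteq> H" using I unfolding isotropic_def by blast+
  \<comment> \<open>The predicate depends only on the coset of h, so the choice gives equal cosets
    the same representative.\<close>
  define rp where "rp h = (SOME r. r \<in> H \<and> inv r \<otimes> h \<in> I)" for h
  have rp: "rp h \<in> H \<and> inv (rp h) \<otimes> h \<in> I" if "h \<in> H" for h
    unfolding rp_def
    by (rule someI[of _ h]) (use that subgroup.one_closed[OF sg] H_carrier in auto)
  have canc: "h \<otimes> (inv h \<otimes> k) = k" if "h \<in> H" "k \<in> H" for h k
    using that H_carrier by (simp add: G.m_assoc[symmetric])
  have rp_eq: "rp h = rp k" if "h \<in> H" "k \<in> H" "inv h \<otimes> k \<in> I" for h k
  proof -
    have "(r \<in> H \<and> inv r \<otimes> h \<in> I) \<longleftrightarrow> (r \<in> H \<and> inv r \<otimes> k \<in> I)" for r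
    proof -
      have "inv r \<otimes> k \<in> I" if r: "r \<in> H" "inv r \<otimes> h \<in> I"
      proof -
        have "inv r \<otimes> k = (inv r \<otimes> h) \<otimes> (inv h \<otimes> k)"
          using r \<open>h \<in> H\<close> \<open>k \<in> H\<close> H_carrier by (simp add: G.m_assoc canc)
        then show ?thesis using r \<open>inv h \<otimes> k \<in> I\<close> subgroup.m_closed[OF sg] by metis
      qed
      moreover have "inv r \<otimes> h \<in> I" if r: "r \<in> H" "inv r \<otimes> k \<in> I"
      proof -
        have "inv r \<otimes> h = (inv r \<otimes> k) \<otimes> inv (inv h \<otimes> k)"
          using r \<open>h \<in> H\<close> \<open>k \<in> H\<close> H_carrier by (simp add: G.inv_mult_group G.m_assoc canc)
        then show ?thesis
          using r \<open>inv h \<otimes> k \<in> I\<close> subgroup.m_closed[OF sg] subgroup.m_inv_closed[OF sg] by metis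
      qed
      ultimately show ?thesis by blast
    qed
    then show ?thesis unfolding rp_def by simp
  qed
  have "polarized_division G B I (rp ` H)"
  proof unfold_locales
    show "isotropic I" "\<And>r. r \<in> H \<Longrightarrow> (\<And>i. i \<in> I \<Longrightarrow> \<beta> i r = 1) \<Longrightarrow> r \<in> I" by (fact I)+
    show "rp ` H \<subseteq> H" using rp by blast
    show "\<exists>r\<in>rp ` H. inv r \<otimes> h \<in> I" if "h \<in> H" for h using rp that by blast
    fix r s assume rs: "r \<in> rp ` H" "s \<in> rp ` H" "inv r \<otimes> s \<in> I"
    then obtain h k where hk: "h \<in> H" "k \<in> H" "r = rp h" "s = rp k" by blast
    have "rp h = rp (rp h)" "rp k = rp (rp k)"
      using rp hk rp_eq by metis+
    moreover have "rp (rp h) = rp (rp k)" using rp_eq rp hk rs by metis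
    ultimately show "r = s" using hk by simp
  qed
  then show ?thesis using polarized_division.matrix_reps_exist[OF _ assms] that by blast
qed

section \<open>Capelli polynomials and the p.i. degree\<close>

text \<open>Equal commutation factors make the quotient of the two cocycles symmetric. A splitting l
  of this quotient corrects the scalars: sending \<open>u h\<close> to \<open>l h\<close> times the
  corresponding generator of B' is multiplicative.\<close>

theorem graded_division_isomorphic:
  fixes G :: "('g, 'n) monoid_scheme"
    and B :: "('k::{alg_closed_field, field_char_0}, 'b, 'g) gr_algebra"
    and B' :: "('k, 'c, 'g) gr_algebra"
  assumes D: "graded_division G B" and D': "graded_division G B'"
    and supp: "supp G B' = supp G B"
    and \<beta>: "\<And>a b. a \<in> supp G B \<Longrightarrow> b \<in> supp G B \<Longrightarrow>
      graded_division.\<beta> G B' a b = graded_division.\<beta> G B a b"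
  shows "graded_isomorphic G B B'"
proof -
  interpret D: graded_division G B by (rule D)
  interpret D': graded_division G B' by (rule D')
  interpret H: comm_group "G\<lparr>carrier := D.H\<rparr>" by (rule D.G.subgroup_comm_group[OF D.subgroup_H])
  let ?\<tau> = "\<lambda>a b. D.\<sigma> a b / D'.\<sigma> a b"
  have nz: "D.\<sigma> a b \<noteq> 0" "D'.\<sigma> a b \<noteq> 0" if "a \<in> D.H" "b \<in> D.H" for a b
    using that D.\<sigma>_neq_zero D'.\<sigma>_neq_zero supp by auto
  have sym: "?\<tau> a b = ?\<tau> b a" if "a \<in> D.H" "b \<in> D.H" for a b
    using \<beta>[OF that] nz[of a b] nz[of b a] that unfolding D.\<beta>_def D'.\<beta>_def by (simp add: field_simps)
  have coc: "?\<tau> a b * ?\<tau> (a \<otimes>\<^bsub>G\<^esub> b) c = ?\<tau> a (b \<otimes>\<^bsub>G\<^esub> c) * ?\<tau> b c"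
    if "a \<in> D.H" "b \<in> D.H" "c \<in> D.H" for a b c
    using D.\<sigma>_cocycle[OF that] D'.\<sigma>_cocycle[of a b c] that supp by (simp add: times_divide_times_eq)
  obtain l where l: "\<And>a. a \<in> D.H \<Longrightarrow> l a \<noteq> 0"
    "\<And>a b. a \<in> D.H \<Longrightarrow> b \<in> D.H \<Longrightarrow> l a * l b = ?\<tau> a b * l (a \<otimes>\<^bsub>G\<^esub> b)"
  proof (rule H.symmetric_cocycle_splits[of ?\<tau>])
    fix l assume "\<And>a. a \<in> carrier (G\<lparr>carrier := D.H\<rparr>) \<Longrightarrow> l a \<noteq> 0"
      "\<And>a b. a \<in> carrier (G\<lparr>carrier := D.H\<rparr>) \<Longrightarrow> b \<in> carrier (G\<lparr>carrier := D.H\<rparr>) \<Longrightarrow>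
        l a * l b = ?\<tau> a b * l (a \<otimes>\<^bsub>G\<lparr>carrier := D.H\<rparr>\<^esub> b)"
    then show thesis by (intro that[of l]) simp_all
  qed (use nz sym coc D.\<sigma>_one D'.\<sigma>_one supp in \<open>simp_all\<close>)
  have fc: "D'.fin_coeffs a \<longleftrightarrow> D.fin_coeffs a" for a
    unfolding D.fin_coeffs_def D'.fin_coeffs_def supp by simp
  define \<phi> where "\<phi> x = D'.lincomb (\<lambda>h. l h * D.cf x h)" for x
  have fcl: "D'.fin_coeffs (\<lambda>h. l h * D.cf x h)" if "x \<in> carrier B" for x
    unfolding fc by (rule D.fin_coeffs_scale[OF D.cf_fin[OF that]])
  have cf: "D'.cf (\<phi> x) h = l h * D.cf x h" if "x \<in> carrier B" for x h
    unfolding \<phi>_def using D'.cf_lincomb[OF fcl[OF that]] by simp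
  have cl: "\<phi> x \<in> carrier B'" if "x \<in> carrier B" for x
    unfolding \<phi>_def using D'.lincomb_closed fcl that by blast
  have add: "\<phi> (x \<oplus>\<^bsub>B\<^esub> y) = \<phi> x \<oplus>\<^bsub>B'\<^esub> \<phi> y" if "x \<in> carrier B" "y \<in> carrier B" for x y
    by (rule D'.cf_inject)
      (use that cl in \<open>simp_all add: fun_eq_iff cf D'.cf_add D.cf_add algebra_simps\<close>)
  have smult: "\<phi> (c \<odot>\<^bsub>B\<^esub> x) = c \<odot>\<^bsub>B'\<^esub> \<phi> x" if "x \<in> carrier B" for c x
    by (rule D'.cf_inject)
      (use that cl in \<open>simp_all add: fun_eq_iff cf D'.cf_smult D.cf_smult D.B.smult_closed D'.B.smult_closed\<close>)
  have \<phi>_zero: "\<phi> \<zero>\<^bsub>B\<^esub> = \<zero>\<^bsub>B'\<^esub>"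
    by (rule D'.cf_inject) (use cl in \<open>simp_all add: fun_eq_iff cf D.cf_zero D'.cf_zero\<close>)
  have u: "\<phi> (D.u h) = l h \<odot>\<^bsub>B'\<^esub> D'.u h" if "h \<in> D.H" for h
    by (rule D'.cf_inject)
      (use that cl supp in \<open>simp_all add: fun_eq_iff cf D.cf_u D'.cf_u D.u_closed D'.u_closed
        D'.cf_smult D'.B.smult_closed\<close>)
  have "l \<one>\<^bsub>G\<^esub> = 1"
    using l(1)[OF D.H_one] l(2)[OF D.H_one D.H_one] D.\<sigma>_one[OF D.H_one] D'.\<sigma>_one[OF D'.H_one] by simp
  then have one: "\<phi> \<one>\<^bsub>B\<^esub> = \<one>\<^bsub>B'\<^esub>" using u[OF D.H_one] by (simp add: D'.B.smult_1)
  have mult_u: "\<phi> (D.u a \<otimes>\<^bsub>B\<^esub> D.u b) = \<phi> (D.u a) \<otimes>\<^bsub>B'\<^esub> \<phi> (D.u b)" if ab: "a \<in> D.H" "b \<in> D.H" for a b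
  proof -
    have abH: "a \<otimes>\<^bsub>G\<^esub> b \<in> D.H" "a \<otimes>\<^bsub>G\<^esub> b \<in> D'.H" "a \<in> D'.H" "b \<in> D'.H"
      using ab D.H_mult supp by auto
    have "\<phi> (D.u a \<otimes>\<^bsub>B\<^esub> D.u b) = (D.\<sigma> a b * l (a \<otimes>\<^bsub>G\<^esub> b)) \<odot>\<^bsub>B'\<^esub> D'.u (a \<otimes>\<^bsub>G\<^esub> b)"
      using ab abH by (simp add: D.u_mult smult D.u_closed u D'.B.smult_smult D'.u_closed)
    also have "D.\<sigma> a b * l (a \<otimes>\<^bsub>G\<^esub> b) = l a * l b * D'.\<sigma> a b" using l(2)[OF ab] nz[OF ab] by simp
    also have "(l a * l b * D'.\<sigma> a b) \<odot>\<^bsub>B'\<^esub> D'.u (a \<otimes>\<^bsub>G\<^esub> b) = \<phi> (D.u a) \<otimes>\<^bsub>B'\<^esub> \<phi> (D.u b)"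
      using ab abH by (simp add: u D'.B.smult_mult_smult D'.u_closed D'.u_mult D'.B.smult_smult)
    finally show ?thesis .
  qed
  have mult1: "\<phi> (D.u a \<otimes>\<^bsub>B\<^esub> y) = \<phi> (D.u a) \<otimes>\<^bsub>B'\<^esub> \<phi> y" if a: "a \<in> D.H" and y: "y \<in> carrier B" for a y
    using y
  proof (induction rule: D.B_induct)
    case zero
    then show ?case using a D.u_closed cl by (simp add: \<phi>_zero)
  next
    case (step c h y)
    then show ?case
      using a D.u_closed cl mult_u
      by (simp add: D.B.r_distr D'.B.r_distr add smult D.B.smult_closed D.B.smult_mult_right
          D'.B.smult_mult_right D'.B.smult_closed)
  qed
  have mult: "\<phi> (x \<otimes>\<^bsub>B\<^esub> y) = \<phi> x \<otimes>\<^bsub>B'\<^esub> \<phi> y" if x: "x \<in> carrier B" and y: "y \<in> carrier B" for x y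
    using x
  proof (induction rule: D.B_induct)
    case zero
    then show ?case using y cl by (simp add: \<phi>_zero)
  next
    case (step c h x)
    then show ?case
      using y D.u_closed cl mult1
      by (simp add: D.B.l_distr D'.B.l_distr add smult D.B.smult_closed D.B.smult_mult_left
          D'.B.smult_mult_left D'.B.smult_closed)
  qed
  have "inj_on \<phi> (carrier B)"
  proof (rule inj_onI)
    fix x y assume xy: "x \<in> carrier B" "y \<in> carrier B" "\<phi> x = \<phi> y"
    have "D.cf x h = D.cf y h" for h
    proof (cases "h \<in> D.H")
      case True
      then show ?thesis using cf[OF xy(1), of h] cf[OF xy(2), of h] xy(3) l(1) by simp
    qed (simp add: D.cf_outside xy)
    then have "D.cf x = D.cf y" by (rule ext)
    then show "x = y" by (rule D.cf_inject[OF xy(1,2)])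
  qed
  moreover have "\<phi> ` carrier B = carrier B'"
  proof (intro equalityI subsetI)
    fix y assume y: "y \<in> carrier B'"
    define a where "a h = inverse (l h) * D'.cf y h" for h
    have fa: "D.fin_coeffs a" unfolding a_def fc[symmetric] by (rule D'.fin_coeffs_scale[OF D'.cf_fin[OF y]])
    have "\<phi> (D.lincomb a) = y"
    proof (rule D'.cf_inject)
      show "D'.cf (\<phi> (D.lincomb a)) = D'.cf y"
      proof
        fix h
        have "D'.cf (\<phi> (D.lincomb a)) h = l h * a h"
          using cf[OF D.lincomb_closed[OF fa]] D.cf_lincomb[OF fa] by simp
        also have "\<dots> = D'.cf y h"
          using l(1)[of h] D'.cf_outside[OF y, of h] supp unfolding a_def by (cases "h \<in> D.H") auto
        finally show "D'.cf (\<phi> (D.lincomb a)) h = D'.cf y h" .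
      qed
    qed (use y cl D.lincomb_closed[OF fa] in auto)
    then show "y \<in> \<phi> ` carrier B" using D.lincomb_closed[OF fa] by blast
  qed (use cl in blast)
  ultimately have "bij_betw \<phi> (carrier B) (carrier B')" unfolding bij_betw_def by blast
  moreover have "\<phi> \<in> Ring.ring_hom B B'"
    by (rule ring_hom_memI) (simp_all add: cl add mult one)
  ultimately have iso: "\<phi> \<in> ring_iso B B'" unfolding ring_iso_def by simp
  have hcomp: "\<phi> ` hcomp B g \<subseteq> hcomp B' g" if g: "g \<in> carrier G" for g
  proof (rule image_subsetI)
    fix x assume x: "x \<in> hcomp B g"
    then have xB: "x \<in> carrier B" by (rule D.hcomp_carrier[OF g])
    have "D.cf x h = 0" if "h \<noteq> g" for h using D.hcomp_iff_cf[OF xB g] x that by blast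
    then show "\<phi> x \<in> hcomp B' g" using D'.hcomp_iff_cf[OF cl[OF xB] g] cf[OF xB] by simp
  qed
  show ?thesis
    unfolding graded_isomorphic_def
  proof (intro bexI[OF _ iso] conjI allI ballI)
    show "\<phi> (c \<odot>\<^bsub>B\<^esub> x) = c \<odot>\<^bsub>B'\<^esub> \<phi> x" if "x \<in> carrier B" for c x by (rule smult[OF that])
    show "\<phi> ` hcomp B g \<subseteq> hcomp B' g" if "g \<in> carrier G" for g by (rule hcomp[OF that])
  qed
qed

section \<open>Identities of matrix algebras\<close>

lemma unital_algebra_module_mat: "unital_algebra (module_mat TYPE('k::field) n n)"
proof -
  let ?M = "module_mat TYPE('k) n n"
  interpret R: ring "ring_mat TYPE('k) n ()" by (rule ring_mat)
  interpret A: abelian_group ?M by (rule abelian_group_mat)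
  have "ring ?M"
  proof (rule ringI)
    show "abelian_group ?M" by (rule abelian_group_mat)
    show "monoid ?M" by (rule monoidI) (auto simp: module_mat_simps)
  qed (auto simp: module_mat_simps add_mult_distrib_mat mult_add_distrib_mat)
  then interpret ring ?M .
  show ?thesis
  proof unfold_locales
    fix x y :: "'k mat" and c d :: 'k
    assume x: "x \<in> carrier ?M"
    then have x': "x \<in> carrier_mat n n" by (simp add: module_mat_simps)
    show "c \<odot>\<^bsub>?M\<^esub> x \<in> carrier ?M"
      using x' by (simp add: module_mat_simps)
    show "(c + d) \<odot>\<^bsub>?M\<^esub> x =
      c \<odot>\<^bsub>?M\<^esub> x \<oplus>\<^bsub>?M\<^esub> d \<odot>\<^bsub>?M\<^esub> x"
      using x' by (intro eq_matI) (simp_all add: module_mat_simps distrib_right)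
    show "c \<odot>\<^bsub>?M\<^esub> (d \<odot>\<^bsub>?M\<^esub> x) =
      (c * d) \<odot>\<^bsub>?M\<^esub> x"
      using x' by (intro eq_matI) (simp_all add: module_mat_simps)
    show "1 \<odot>\<^bsub>?M\<^esub> x = x"
      using x' by (intro eq_matI) (simp_all add: module_mat_simps)
    assume "y \<in> carrier ?M"
    then have y': "y \<in> carrier_mat n n" by (simp add: module_mat_simps)
    show "c \<odot>\<^bsub>?M\<^esub> (x \<oplus>\<^bsub>?M\<^esub> y) =
      c \<odot>\<^bsub>?M\<^esub> x \<oplus>\<^bsub>?M\<^esub> c \<odot>\<^bsub>?M\<^esub> y"
      using x' y' by (intro eq_matI) (simp_all add: module_mat_simps distrib_left)
    show "(c \<odot>\<^bsub>?M\<^esub> x) \<otimes>\<^bsub>?M\<^esub> y =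
      c \<odot>\<^bsub>?M\<^esub> (x \<otimes>\<^bsub>?M\<^esub> y)"
      unfolding module_mat_simps by (rule mult_smult_assoc_mat[OF x' y'])
    show "x \<otimes>\<^bsub>?M\<^esub> (c \<odot>\<^bsub>?M\<^esub> y) =
      c \<odot>\<^bsub>?M\<^esub> (x \<otimes>\<^bsub>?M\<^esub> y)"
      unfolding module_mat_simps by (rule mult_smult_distrib[OF x' y'])
  qed
qed

lemma (in unital_algebra) eval_ncpoly_algebra_hom:
  assumes A': "unital_algebra A'" and \<phi>: "algebra_hom A A' \<phi>" and v: "\<And>x. v x \<in> carrier A"
  shows "\<phi> (eval_ncpoly A v f) = eval_ncpoly A' (\<lambda>x. \<phi> (v x)) f"
proof (rule eval_ncpoly_hom[OF unital_algebra_axioms A'])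
  have h: "\<phi> \<in> Ring.ring_hom A A'" using \<phi> unfolding algebra_hom_def by blast
  show "\<phi> (c \<odot> x) = c \<odot>\<^bsub>A'\<^esub> \<phi> x" if "x \<in> carrier A" for c x
    using \<phi> that unfolding algebra_hom_def by blast
  show "\<phi> x \<in> carrier A'" if "x \<in> carrier A" for x using ring_hom_closed[OF h that] .
  show "\<phi> \<one> = \<one>\<^bsub>A'\<^esub>" using ring_hom_one[OF h] .
  show "\<phi> (x \<otimes> y) = \<phi> x \<otimes>\<^bsub>A'\<^esub> \<phi> y" if "x \<in> carrier A" "y \<in> carrier A" for x y
    using ring_hom_mult[OF h that] .
  show "\<phi> (x \<oplus> y) = \<phi> x \<oplus>\<^bsub>A'\<^esub> \<phi> y" if "x \<in> carrier A" "y \<in> carrier A" for x y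
    using ring_hom_add[OF h that] .
qed (rule v)

text \<open>A single surjection pushes identities forward from A to A'; pulling them back takes the
  whole family, which must be jointly injective.\<close>

lemma identities_separating_homs:
  fixes A :: "('k::field, 'a, 'm) module_scheme" and A' :: "('k, 'b, 'n) module_scheme"
  assumes A: "unital_algebra A" and A': "unital_algebra A'" and ne: "\<Phi> \<noteq> {}"
    and hom: "\<And>\<phi>. \<phi> \<in> \<Phi> \<Longrightarrow> algebra_hom A A' \<phi>"
    and surj: "\<And>\<phi>. \<phi> \<in> \<Phi> \<Longrightarrow> \<phi> ` carrier A = carrier A'"
    and sep: "\<And>x. x \<in> carrier A \<Longrightarrow> (\<And>\<phi>. \<phi> \<in> \<Phi> \<Longrightarrow> \<phi> x = \<zero>\<^bsub>A'\<^esub>) \<Longrightarrow> x = \<zero>\<^bsub>A\<^esub>"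
  shows "identities A = identities A'"
proof (intro equalityI subsetI)
  interpret A: unital_algebra A by (rule A)
  interpret A': unital_algebra A' by (rule A')
  have eval: "\<phi> (eval_ncpoly A v f) = eval_ncpoly A' (\<lambda>x. \<phi> (v x)) f"
    if "\<phi> \<in> \<Phi>" "\<And>x. v x \<in> carrier A" for \<phi> v and f :: "(nat, 'k) ncpoly"
    by (rule A.eval_ncpoly_algebra_hom[OF A' hom[OF that(1)] that(2)])
  {
    fix f assume f: "f \<in> identities A"
    obtain \<phi> where \<phi>: "\<phi> \<in> \<Phi>" using ne by blast
    have h: "\<phi> \<in> Ring.ring_hom A A'" using hom[OF \<phi>] unfolding algebra_hom_def by (rule conjunct1)
    show "f \<in> identities A'"
      unfolding identities_def
    proof (intro CollectI allI impI)
      fix v :: "nat \<Rightarrow> 'b" assume v: "\<forall>i. v i \<in> carrier A'"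
      have "\<exists>x. x \<in> carrier A \<and> \<phi> x = v i" for i using v surj[OF \<phi>] by (metis imageE)
      then obtain w where w: "\<And>i. w i \<in> carrier A" "\<And>i. \<phi> (w i) = v i" by metis
      have "eval_ncpoly A w f = \<zero>\<^bsub>A\<^esub>" using f w(1) unfolding identities_def by simp
      moreover have "\<phi> (eval_ncpoly A w f) = eval_ncpoly A' v f"
        using eval[where v = w and f = f, OF \<phi> w(1)] unfolding w(2) .
      ultimately show "eval_ncpoly A' v f = \<zero>\<^bsub>A'\<^esub>"
        using ring_hom_zero[OF h A.ring_axioms A'.ring_axioms] by simp
    qed
  next
    fix f assume f: "f \<in> identities A'"
    show "f \<in> identities A"
      unfolding identities_def
    proof (intro CollectI allI impI)
      fix v :: "nat \<Rightarrow> 'a" assume "\<forall>i. v i \<in> carrier A"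
      then have v: "\<And>i. v i \<in> carrier A" by simp
      show "eval_ncpoly A v f = \<zero>\<^bsub>A\<^esub>"
      proof (rule sep[OF A.eval_ncpoly_closed[OF v]])
        fix \<phi> assume \<phi>: "\<phi> \<in> \<Phi>"
        have "\<phi> (v i) \<in> carrier A'" for i using surj[OF \<phi>] v by blast
        then show "\<phi> (eval_ncpoly A v f) = \<zero>\<^bsub>A'\<^esub>"
          using f unfolding eval[where v = v and f = f, OF \<phi> v] identities_def by simp
      qed
    qed
  }
qed

lemma identities_matrix_reps:
  fixes A :: "('k::field, 'a, 'm) module_scheme"
  assumes A: "unital_algebra A" and \<Phi>: "matrix_reps A t \<Phi>"
  shows "identities A = identities (module_mat TYPE('k) t t)"
  by (rule identities_separating_homs[OF A unital_algebra_module_mat, of \<Phi>])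
    (use \<Phi> in \<open>auto simp: matrix_reps_def module_mat_simps\<close>)

section \<open>Alternating polynomials and their values on matrix units\<close>

definition alt_word :: "nat \<Rightarrow> (nat \<Rightarrow> 'x) \<Rightarrow> (nat \<Rightarrow> 'x) \<Rightarrow> (nat \<Rightarrow> nat) \<Rightarrow> 'x list" where
  "alt_word N X W \<pi> = concat (map (\<lambda>r. [X (\<pi> r), W r]) [0..<N])"

text \<open>For \<open>\<epsilon> = signof\<close> this is the Capelli polynomial.\<close>

definition alt_poly ::
  "nat \<Rightarrow> (nat \<Rightarrow> 'x) \<Rightarrow> (nat \<Rightarrow> 'x) \<Rightarrow> ((nat \<Rightarrow> nat) \<Rightarrow> 'k::comm_ring_1) \<Rightarrow> ('x, 'k) ncpoly" where
  "alt_poly N X W \<epsilon> = (\<Sum>\<pi> | \<pi> permutes {0..<N}. Poly_Mapping.single (alt_word N X W \<pi>) (\<epsilon> \<pi>))"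

lemma set_alt_word: "\<pi> permutes {0..<N} \<Longrightarrow> set (alt_word N X W \<pi>) = X ` {0..<N} \<union> W ` {0..<N}"
proof -
  assume \<pi>: "\<pi> permutes {0..<N}"
  have "set (alt_word N X W \<pi>) = X ` (\<pi> ` {0..<N}) \<union> W ` {0..<N}" unfolding alt_word_def by auto
  then show ?thesis using permutes_image[OF \<pi>] by simp
qed

lemma upt_split: "r < N \<Longrightarrow> [0..<N] = [0..<r] @ r # [Suc r..<N]"
  using upt_add_eq_append[of 0 r "N - r"] by (simp add: upt_conv_Cons)

lemma ncvars_alt_poly: "ncvars (alt_poly N X W \<epsilon>) \<subseteq> X ` {0..<N} \<union> W ` {0..<N}"
proof
  fix x assume "x \<in> ncvars (alt_poly N X W \<epsilon>)"
  then have "x \<in> (\<Union>\<pi>\<in>{\<pi>. \<pi> permutes {0..<N}}. ncvars (Poly_Mapping.single (alt_word N X W \<pi>) (\<epsilon> \<pi>)))"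
    unfolding alt_poly_def by (rule subsetD[OF ncvars_sum])
  then obtain \<pi> where \<pi>: "\<pi> permutes {0..<N}"
    and "x \<in> ncvars (Poly_Mapping.single (alt_word N X W \<pi>) (\<epsilon> \<pi>))"
    by blast
  then have "x \<in> set (alt_word N X W \<pi>)" by (intro subsetD[OF ncvars_single])
  then show "x \<in> X ` {0..<N} \<union> W ` {0..<N}" unfolding set_alt_word[OF \<pi>] .
qed

lemma multilinear_alt_poly:
  assumes "inj X" "inj W" "range X \<inter> range W = {}"
  shows "multilinear (alt_poly N X W \<epsilon>)"
  unfolding multilinear_def
proof (intro exI ballI conjI)
  fix w assume "w \<in> Poly_Mapping.keys (alt_poly N X W \<epsilon>)"
  then have "w \<in> (\<Union>\<pi>\<in>{\<pi>. \<pi> permutes {0..<N}}.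
      Poly_Mapping.keys (Poly_Mapping.single (alt_word N X W \<pi>) (\<epsilon> \<pi>)))"
    unfolding alt_poly_def by (rule subsetD[OF Poly_Mapping.keys_sum])
  then obtain \<pi> where \<pi>: "\<pi> permutes {0..<N}"
    "w \<in> Poly_Mapping.keys (Poly_Mapping.single (alt_word N X W \<pi>) (\<epsilon> \<pi>))"
    by blast
  then have w: "w = alt_word N X W \<pi>" by (auto split: if_splits)
  show "set w = X ` {0..<N} \<union> W ` {0..<N}" unfolding w by (rule set_alt_word[OF \<pi>(1)])
  have "distinct (concat (map (\<lambda>r. [X (\<pi> r), W r]) rs))" if "distinct rs" for rs
    using that
  proof (induction rs)
    case (Cons r rs)
    have "X (\<pi> r) \<noteq> W r'" "W r \<noteq> X (\<pi> r')" for r' using assms(3) by blast+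
    moreover have "X (\<pi> r) \<noteq> X (\<pi> r')" "W r \<noteq> W r'" if "r' \<in> set rs" for r'
    proof -
      have "r \<noteq> r'" using that Cons.prems by auto
      then show "X (\<pi> r) \<noteq> X (\<pi> r')" "W r \<noteq> W r'"
        using assms(1,2) permutes_inj[OF \<pi>(1)] by (auto simp: inj_def)
    qed
    ultimately show ?case using Cons by auto
  qed simp
  then show "distinct w" unfolding w alt_word_def by simp
qed

lemma (in unital_algebra) eval_alt_poly:
  assumes "\<And>x. v x \<in> carrier A"
  shows "eval_ncpoly A v (alt_poly N X W \<epsilon>) =
    (\<Oplus>\<pi>\<in>{\<pi>. \<pi> permutes {0..<N}}. \<epsilon> \<pi> \<odot> eval_word A v (alt_word N X W \<pi>))"
  unfolding alt_poly_def using assms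
  by (subst eval_ncpoly_sum) (simp_all add: eval_ncpoly_single finite_permutations)

lemma (in unital_algebra) eval_word_zero_factor:
  assumes "\<And>x. v x \<in> carrier A" "v x \<otimes> v y = \<zero>"
  shows "eval_word A v (w @ x # y # w') = \<zero>"
  using assms by (simp add: eval_word_append m_assoc[symmetric])

text \<open>The words of an alternating polynomial evaluated at elements behaving like matrix units, where
  \<open>X r\<close> has row \<open>\<rho> r\<close> and column \<open>\<kappa> r\<close>, and \<open>W r\<close> joins \<open>\<kappa> r\<close> to \<open>\<rho> (Suc r)\<close>.\<close>

lemma (in unital_algebra) eval_alt_word_zero:
  assumes v: "\<And>x. v x \<in> carrier A"
    and XW: "\<And>r s. r < N \<Longrightarrow> s < N \<Longrightarrow> \<kappa> s \<noteq> \<kappa> r \<Longrightarrow> v (X s) \<otimes> v (W r) = \<zero>"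
    and WX: "\<And>r s. Suc r < N \<Longrightarrow> s < N \<Longrightarrow> \<rho> s \<noteq> \<rho> (Suc r) \<Longrightarrow> v (W r) \<otimes> v (X s) = \<zero>"
    and \<pi>: "\<pi> permutes {0..<N}"
    and r: "r < N" "\<kappa> (\<pi> r) \<noteq> \<kappa> r \<or> (r > 0 \<and> \<rho> (\<pi> r) \<noteq> \<rho> r)"
  shows "eval_word A v (alt_word N X W \<pi>) = \<zero>"
proof -
  have \<pi>r: "\<pi> r < N" using permutes_in_image[OF \<pi>, of r] r by simp
  show ?thesis
  proof (cases "\<kappa> (\<pi> r) \<noteq> \<kappa> r")
    case True
    have "alt_word N X W \<pi> = concat (map (\<lambda>r. [X (\<pi> r), W r]) [0..<r]) @ X (\<pi> r) # W r #
        concat (map (\<lambda>r. [X (\<pi> r), W r]) [Suc r..<N])"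
      unfolding alt_word_def upt_split[OF r(1)] by simp
    then show ?thesis by (simp only: eval_word_zero_factor[OF v XW[OF r(1) \<pi>r True]])
  next
    case False
    then obtain q where q: "r = Suc q" "\<rho> (\<pi> r) \<noteq> \<rho> r" using r by (cases r) auto
    have "[0..<N] = [0..<q] @ q # Suc q # [Suc (Suc q)..<N]"
      using upt_split[of q N] upt_conv_Cons[of "Suc q" N] r(1) q(1) by simp
    then have "alt_word N X W \<pi> = (concat (map (\<lambda>r. [X (\<pi> r), W r]) [0..<q]) @ [X (\<pi> q)]) @ W q # X (\<pi> r) #
        (W r # concat (map (\<lambda>r. [X (\<pi> r), W r]) [Suc (Suc q)..<N]))"
      unfolding alt_word_def q by simp
    moreover have "v (W q) \<otimes> v (X (\<pi> r)) = \<zero>" using WX[of q "\<pi> r"] r q \<pi>r by simp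
    ultimately show ?thesis using eval_word_zero_factor[OF v] by (simp only:)
  qed
qed

text \<open>\<open>Q i j y\<close> abstracts that y is a matrix unit at (i, j), possibly with an
  invertible coefficient; the lemma is applied to scalar matrices and to matrices over B. The
  condition on the unit is there because words are evaluated from the right, starting with the
  unit.\<close>

lemma eval_alt_word_chain:
  assumes Q: "\<And>i j k y z. Q i j y \<Longrightarrow> Q j k z \<Longrightarrow> Q i k (y \<otimes>\<^bsub>A\<^esub> z)"
    and Q1: "\<And>i j y. Q i j y \<Longrightarrow> y \<otimes>\<^bsub>A\<^esub> \<one>\<^bsub>A\<^esub> = y"
    and X: "\<And>r. r < N \<Longrightarrow> Q (\<rho> r) (\<kappa> r) (v (X r))"
    and W: "\<And>r. r < N \<Longrightarrow> Q (\<kappa> r) (\<rho> (Suc r)) (v (W r))"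
    and m: "m < N"
  shows "Q (\<rho> m) (\<rho> N) (eval_word A v (concat (map (\<lambda>r. [X r, W r]) [m..<N])))"
  using m
proof (induction "N - m" arbitrary: m)
  case 0
  then show ?case by simp
next
  case (Suc n)
  have up: "[m..<N] = m # [Suc m..<N]" using Suc by (simp add: upt_conv_Cons)
  show ?case
  proof (cases "Suc m = N")
    case True
    then show ?thesis using X[of m] W[of m] Suc.prems Q[of "\<rho> m" "\<kappa> m" "v (X m)" "\<rho> N" "v (W m)"]
      unfolding up by (simp add: Q1[OF W[of m]])
  next
    case False
    then have "Q (\<rho> (Suc m)) (\<rho> N) (eval_word A v (concat (map (\<lambda>r. [X r, W r]) [Suc m..<N])))"
      using Suc by simp
    then show ?thesis using X[of m] W[of m] Suc.prems unfolding up by (auto intro: Q)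
  qed
qed

text \<open>An entry of a product of matrices given as functions, with intermediate indices confined
  to P. This form is chosen because P will be a class of rows, which need not be an initial
  segment.\<close>

fun path_entry :: "'i set \<Rightarrow> ('i \<Rightarrow> 'i \<Rightarrow> 'k::comm_ring_1) list \<Rightarrow> 'i \<Rightarrow> 'i \<Rightarrow> 'k" where
  "path_entry P [] i j = (if i = j then 1 else 0)"
| "path_entry P (A # As) i j = (\<Sum>l\<in>P. A i l * path_entry P As l j)"

text \<open>The product is multilinear in the factors \<open>A r\<close>. The function p selects the
  entry taken from each of them, and Q collects what the factors \<open>W r\<close> contribute.
  Since Q does not depend on A, the factors A can be permuted under the sum.\<close>

lemma path_entry_expand:
  fixes W :: "nat \<Rightarrow> 'i \<Rightarrow> 'i \<Rightarrow> 'k::comm_ring_1"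
  assumes P: "finite P"
  shows "distinct rs \<Longrightarrow> \<exists>Q. \<forall>A. \<forall>i\<in>P. \<forall>j.
    path_entry P (concat (map (\<lambda>r. [A r, W r]) rs)) i j =
    (\<Sum>p\<in>set rs \<rightarrow>\<^sub>E P \<times> P. (\<Prod>r\<in>set rs. A r (fst (p r)) (snd (p r))) * Q i j p)"
proof (induction rs)
  case Nil
  show ?case by (rule exI[of _ "\<lambda>i j p. if i = j then 1 else 0"]) simp
next
  case (Cons r rs)
  have "\<exists>Q. \<forall>A. \<forall>i\<in>P. \<forall>j. path_entry P (concat (map (\<lambda>r. [A r, W r]) rs)) i j =
    (\<Sum>p\<in>set rs \<rightarrow>\<^sub>E P \<times> P. (\<Prod>r\<in>set rs. A r (fst (p r)) (snd (p r))) * Q i j p)"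
    using Cons by simp
  then obtain Q where "\<forall>A. \<forall>i\<in>P. \<forall>j. path_entry P (concat (map (\<lambda>r. [A r, W r]) rs)) i j =
    (\<Sum>p\<in>set rs \<rightarrow>\<^sub>E P \<times> P. (\<Prod>r\<in>set rs. A r (fst (p r)) (snd (p r))) * Q i j p)"
    by (rule exE)
  then have Q: "\<And>A i j. i \<in> P \<Longrightarrow> path_entry P (concat (map (\<lambda>r. [A r, W r]) rs)) i j =
    (\<Sum>p\<in>set rs \<rightarrow>\<^sub>E P \<times> P. (\<Prod>r\<in>set rs. A r (fst (p r)) (snd (p r))) * Q i j p)"
    by blast
  have r: "r \<notin> set rs" using Cons.prems by simp
  \<comment> \<open>For the factors \<open>A r\<close>, \<open>W r\<close> put in front: the entry
    of \<open>A r\<close> must start in row i, and \<open>W r\<close> joins its column to the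
    remaining path. Resetting p at r restores an extensional function for the tail.\<close>
  define Q' where "Q' i j p = (if fst (p r) = i
    then \<Sum>m\<in>P. W r (snd (p r)) m * Q m j (p(r := undefined)) else 0)" for i j p
  have "path_entry P (concat (map (\<lambda>r. [A r, W r]) (r # rs))) i j =
    (\<Sum>p\<in>set (r # rs) \<rightarrow>\<^sub>E P \<times> P. (\<Prod>r\<in>set (r # rs). A r (fst (p r)) (snd (p r))) * Q' i j p)"
    if i: "i \<in> P" for A i j
  proof -
    let ?F = "set rs \<rightarrow>\<^sub>E P \<times> P"
    let ?pr = "\<lambda>p. \<Prod>r\<in>set rs. A r (fst (p r)) (snd (p r))"
    have fin: "finite ?F" using P by (intro finite_PiE) auto
    have upd: "(p(r := y))(r := undefined) = p" if "p \<in> ?F" for p y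
      using that r by (auto simp: fun_eq_iff PiE_def extensional_def)
    have inj: "inj_on (\<lambda>x. (snd x)(r := fst x)) ((P \<times> P) \<times> ?F)"
    proof (rule inj_onI)
      fix x y assume xy: "x \<in> (P \<times> P) \<times> ?F" "y \<in> (P \<times> P) \<times> ?F"
        "(snd x)(r := fst x) = (snd y)(r := fst y)"
      then have "snd x = snd y" using upd[of "snd x" "fst x"] upd[of "snd y" "fst y"] by auto
      moreover have "fst x = fst y" using fun_cong[OF xy(3), of r] by simp
      ultimately show "x = y" by (rule prod_eqI[rotated])
    qed
    have cart: "(\<Sum>y\<in>P \<times> P. g (fst y) (snd y)) = (\<Sum>a\<in>P. \<Sum>b\<in>P. g a b)" for g :: "'i \<Rightarrow> 'i \<Rightarrow> 'k"
      by (simp only: sum.cartesian_product case_prod_unfold)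
    have "(\<Sum>p\<in>set (r # rs) \<rightarrow>\<^sub>E P \<times> P. (\<Prod>r\<in>set (r # rs). A r (fst (p r)) (snd (p r))) * Q' i j p) =
      (\<Sum>(y, p)\<in>(P \<times> P) \<times> ?F. (\<Prod>s\<in>set (r # rs). A s (fst ((p(r := y)) s)) (snd ((p(r := y)) s))) * Q' i j (p(r := y)))"
    proof -
      have "set (r # rs) \<rightarrow>\<^sub>E P \<times> P = (\<lambda>x. (snd x)(r := fst x)) ` ((P \<times> P) \<times> ?F)"
        by (simp add: PiE_insert_eq case_prod_unfold)
      then show ?thesis by (simp only: sum.reindex[OF inj] o_def case_prod_unfold)
    qed
    also have "\<dots> = (\<Sum>(y, p)\<in>(P \<times> P) \<times> ?F. A r (fst y) (snd y) * ?pr p *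
        (if fst y = i then \<Sum>m\<in>P. W r (snd y) m * Q m j p else 0))"
    proof -
      have "(\<Prod>s\<in>set (r # rs). A s (fst ((p(r := y)) s)) (snd ((p(r := y)) s))) * Q' i j (p(r := y)) =
        A r (fst y) (snd y) * ?pr p * (if fst y = i then \<Sum>m\<in>P. W r (snd y) m * Q m j p else 0)"
        if p: "p \<in> ?F" for y p
      proof -
        have "(\<Prod>s\<in>set rs. A s (fst ((p(r := y)) s)) (snd ((p(r := y)) s))) = ?pr p"
          using r by (intro prod.cong) auto
        then show ?thesis using r upd[OF p] unfolding Q'_def by simp
      qed
      then show ?thesis by (intro sum.cong refl) auto
    qed
    also have "\<dots> = (\<Sum>y\<in>P \<times> P. \<Sum>p\<in>?F. A r (fst y) (snd y) * ?pr p *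
        (if fst y = i then \<Sum>m\<in>P. W r (snd y) m * Q m j p else 0))"
      by (simp only: sum.cartesian_product)
    also have "\<dots> = (\<Sum>a\<in>P. \<Sum>b\<in>P. \<Sum>p\<in>?F. A r a b * ?pr p *
        (if a = i then \<Sum>m\<in>P. W r b m * Q m j p else 0))"
      by (rule cart)
    also have "\<dots> = (\<Sum>a\<in>P. if a = i then \<Sum>b\<in>P. \<Sum>p\<in>?F. A r i b * ?pr p * (\<Sum>m\<in>P. W r b m * Q m j p) else 0)"
      by (intro sum.cong refl) auto
    also have "\<dots> = (\<Sum>b\<in>P. \<Sum>p\<in>?F. A r i b * ?pr p * (\<Sum>m\<in>P. W r b m * Q m j p))"
      using i P by (simp only: sum.delta if_True)
    also have "\<dots> = (\<Sum>b\<in>P. A r i b * (\<Sum>m\<in>P. W r b m * (\<Sum>p\<in>?F. ?pr p * Q m j p)))"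
    proof (intro sum.cong refl)
      fix b
      have "(\<Sum>p\<in>?F. A r i b * ?pr p * (\<Sum>m\<in>P. W r b m * Q m j p)) =
        (\<Sum>p\<in>?F. \<Sum>m\<in>P. A r i b * (W r b m * (?pr p * Q m j p)))"
        unfolding sum_distrib_left by (intro sum.cong refl) (simp add: mult_ac)
      also have "\<dots> = (\<Sum>m\<in>P. \<Sum>p\<in>?F. A r i b * (W r b m * (?pr p * Q m j p)))"
        by (rule sum.swap)
      also have "\<dots> = A r i b * (\<Sum>m\<in>P. W r b m * (\<Sum>p\<in>?F. ?pr p * Q m j p))"
        by (simp only: sum_distrib_left)
      finally show "(\<Sum>p\<in>?F. A r i b * ?pr p * (\<Sum>m\<in>P. W r b m * Q m j p)) =
        A r i b * (\<Sum>m\<in>P. W r b m * (\<Sum>p\<in>?F. ?pr p * Q m j p))" .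
    qed
    also have "\<dots> = path_entry P (concat (map (\<lambda>r. [A r, W r]) (r # rs))) i j"
      by (simp add: Q)
    finally show ?thesis by (rule sym)
  qed
  then show ?case by blast
qed

text \<open>For a fixed choice p of positions the alternating sum is a determinant whose row r
  consists of the entries at position p(r). There are fewer than N positions, so two rows
  coincide.\<close>

theorem capelli_vanishes:
  fixes A W :: "nat \<Rightarrow> 'i \<Rightarrow> 'i \<Rightarrow> 'k::field"
  assumes P: "finite P" "card P * card P < N" and i: "i \<in> P"
  shows "(\<Sum>\<pi> | \<pi> permutes {0..<N}. signof \<pi> *
    path_entry P (concat (map (\<lambda>r. [A (\<pi> r), W r]) [0..<N])) i j) = 0"
proof -
  have "\<exists>Q. \<forall>A. \<forall>i\<in>P. \<forall>j. path_entry P (concat (map (\<lambda>r. [A r, W r]) [0..<N])) i j =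
    (\<Sum>p\<in>{0..<N} \<rightarrow>\<^sub>E P \<times> P. (\<Prod>r\<in>{0..<N}. A r (fst (p r)) (snd (p r))) * Q i j p)"
    using path_entry_expand[OF P(1), of "[0..<N]" W] by simp
  then obtain Q where "\<forall>A. \<forall>i\<in>P. \<forall>j. path_entry P (concat (map (\<lambda>r. [A r, W r]) [0..<N])) i j =
    (\<Sum>p\<in>{0..<N} \<rightarrow>\<^sub>E P \<times> P. (\<Prod>r\<in>{0..<N}. A r (fst (p r)) (snd (p r))) * Q i j p)"
    by (rule exE)
  then have Q: "\<And>A i j. i \<in> P \<Longrightarrow> path_entry P (concat (map (\<lambda>r. [A r, W r]) [0..<N])) i j =
    (\<Sum>p\<in>{0..<N} \<rightarrow>\<^sub>E P \<times> P. (\<Prod>r\<in>{0..<N}. A r (fst (p r)) (snd (p r))) * Q i j p)"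
    by blast
  have det0: "(\<Sum>\<pi> | \<pi> permutes {0..<N}. signof \<pi> * (\<Prod>r\<in>{0..<N}. A (\<pi> r) (fst (p r)) (snd (p r)))) = 0"
    if p: "p \<in> {0..<N} \<rightarrow>\<^sub>E P \<times> P" for p
  proof -
    let ?M = "mat N N (\<lambda>(r, s). A s (fst (p r)) (snd (p r)))"
    have "p ` {0..<N} \<subseteq> P \<times> P" using p by blast
    then have "card (p ` {0..<N}) \<le> card P * card P"
      using P(1) card_mono[of "P \<times> P"] by (simp add: card_cartesian_product)
    then have "\<not> inj_on p {0..<N}" using P(2) card_image[of p "{0..<N}"] by auto
    then obtain r s where rs: "r < N" "s < N" "r \<noteq> s" "p r = p s" unfolding inj_on_def by auto
    have "det ?M = 0"
      by (rule det_identical_rows[of _ N r s]) (use rs in \<open>auto intro!: eq_vecI\<close>)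
    moreover have "det ?M = (\<Sum>\<pi> | \<pi> permutes {0..<N}. signof \<pi> * (\<Prod>r\<in>{0..<N}. A (\<pi> r) (fst (p r)) (snd (p r))))"
      unfolding det_def
      by (auto intro!: sum.cong prod.cong arg_cong2[where f = "(*)"] simp: permutes_in_image)
    ultimately show ?thesis by simp
  qed
  have "(\<Sum>\<pi> | \<pi> permutes {0..<N}. signof \<pi> *
      path_entry P (concat (map (\<lambda>r. [A (\<pi> r), W r]) [0..<N])) i j) =
    (\<Sum>p\<in>{0..<N} \<rightarrow>\<^sub>E P \<times> P. (\<Sum>\<pi> | \<pi> permutes {0..<N}. signof \<pi> *
      (\<Prod>r\<in>{0..<N}. A (\<pi> r) (fst (p r)) (snd (p r)))) * Q i j p)"
    unfolding Q[OF i] sum_distrib_left sum_distrib_right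
    by (subst sum.swap) (simp add: mult.assoc)
  also have "\<dots> = 0" using det0 by simp
  finally show ?thesis .
qed

lemma matrix_unit_mult:
  assumes "i < n" "j < n" "k < n" "l < n"
  shows "matrix_unit n i j * matrix_unit n k l =
    (if j = k then matrix_unit n i l else 0\<^sub>m n n :: 'k::comm_ring_1 mat)"
proof (rule eq_matI)
  fix a b
  assume "a < dim_row (if j = k then matrix_unit n i l else 0\<^sub>m n n :: 'k mat)"
    "b < dim_col (if j = k then matrix_unit n i l else 0\<^sub>m n n :: 'k mat)"
  then have ab: "a < n" "b < n" by (auto simp: matrix_unit_def split: if_splits)
  have "(matrix_unit n i j * matrix_unit n k l :: 'k mat) $$ (a, b) =
    (\<Sum>m\<in>{0..<n}. (if a = i \<and> m = j then 1 else 0) * (if m = k \<and> b = l then 1 else 0))"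
    using ab by (simp add: matrix_unit_def scalar_prod_def)
  also have "\<dots> = (\<Sum>m\<in>{0..<n}. if m = j then (if a = i \<and> k = j \<and> b = l then 1 else 0) else 0)"
    by (rule sum.cong) auto
  also have "\<dots> = (if a = i \<and> k = j \<and> b = l then 1 else 0)" using assms by (simp add: sum.delta)
  finally show "(matrix_unit n i j * matrix_unit n k l) $$ (a, b) =
    (if j = k then matrix_unit n i l else 0\<^sub>m n n :: 'k mat) $$ (a, b)"
    using ab by (auto simp: matrix_unit_def)
qed (auto simp: matrix_unit_def)

lemma matrix_unit_carrier: "matrix_unit n i j \<in> carrier_mat n n"
  by (simp add: matrix_unit_def)

text \<open>The row of the first factor is not tested, since nothing stands before it; this leaves
  only \<pi>(0) open, and a permutation that fixes all other points fixes 0 too.\<close>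

lemma permutes_mismatch:
  fixes \<pi> :: "nat \<Rightarrow> nat"
  assumes \<pi>: "\<pi> permutes {0..<N}" "\<pi> \<noteq> id"
    and inj: "inj_on (\<lambda>r. (\<rho> r, \<kappa> r)) {0..<N}"
  shows "\<exists>r<N. \<kappa> (\<pi> r) \<noteq> \<kappa> r \<or> (r > 0 \<and> \<rho> (\<pi> r) \<noteq> \<rho> r)"
proof (rule ccontr)
  assume c: "\<not> ?thesis"
  have img: "\<pi> r < N" if "r < N" for r
  proof -
    have "\<pi> r \<in> \<pi> ` {0..<N}" using that by (intro imageI) simp
    then show ?thesis unfolding permutes_image[OF \<pi>(1)] by simp
  qed
  have pos: "\<pi> r = r" if "0 < r" "r < N" for r
  proof -
    have "\<pi> r < N" using img that by blast
    moreover have "\<rho> (\<pi> r) = \<rho> r" "\<kappa> (\<pi> r) = \<kappa> r" using c that by auto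
    ultimately show ?thesis using inj_onD[OF inj, of "\<pi> r" r] that by simp
  qed
  have "\<pi> 0 = 0"
  proof (rule ccontr)
    assume n0: "\<pi> 0 \<noteq> 0"
    have "0 < N"
    proof (rule ccontr)
      assume "\<not> 0 < N"
      then show False using n0 permutes_not_in[OF \<pi>(1), of 0] by simp
    qed
    then have "\<pi> 0 < N" by (rule img)
    then have "\<pi> (\<pi> 0) = \<pi> 0" using pos n0 by simp
    then show False using n0 permutes_inj[OF \<pi>(1)] by (simp add: inj_eq)
  qed
  then have "\<pi> r = r" for r using pos[of r] permutes_not_in[OF \<pi>(1), of r] by (cases "0 < r"; cases "r < N") auto
  then show False using \<pi>(2) by auto
qed

lemma signof_id: "signof id = 1"
  by (simp add: sign_id)

lemma module_mat_finsum_entry: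
  fixes f :: "'s \<Rightarrow> 'k::field mat"
  assumes "finite S" "\<And>s. s \<in> S \<Longrightarrow> f s \<in> carrier_mat n n" and ij: "i < n" "j < n"
  shows "(\<Oplus>\<^bsub>module_mat TYPE('k) n n\<^esub>s\<in>S. f s) $$ (i, j) = (\<Sum>s\<in>S. f s $$ (i, j))"
proof -
  interpret M: unital_algebra "module_mat TYPE('k) n n" by (rule unital_algebra_module_mat)
  have cm: "carrier (module_mat TYPE('k) n n) = carrier_mat n n" by (simp add: module_mat_simps)
  show ?thesis
    using assms(1,2)
  proof (induction S rule: finite_induct)
    case empty
    then show ?case using ij by (simp add: module_mat_simps)
  next
    case (insert a S)
    have "(\<Oplus>\<^bsub>module_mat TYPE('k) n n\<^esub>s\<in>S. f s) \<in> carrier_mat n n"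
      using insert M.finsum_closed[of f S] by (auto simp: cm)
    moreover have "(\<Oplus>\<^bsub>module_mat TYPE('k) n n\<^esub>s\<in>insert a S. f s) =
        f a + (\<Oplus>\<^bsub>module_mat TYPE('k) n n\<^esub>s\<in>S. f s)"
      using insert M.finsum_insert[of S a f] by (simp add: cm Pi_def module_mat_simps)
    ultimately show ?case using insert ij by simp
  qed
qed

lemma module_mat_eval_word_entry:
  fixes v :: "'x \<Rightarrow> 'k::field mat"
  assumes v: "\<And>x. v x \<in> carrier_mat n n" and ij: "i < n" "j < n"
  shows "eval_word (module_mat TYPE('k) n n) v w $$ (i, j) =
    path_entry {0..<n} (map (\<lambda>x i j. v x $$ (i, j)) w) i j"
proof -
  interpret M: unital_algebra "module_mat TYPE('k) n n" by (rule unital_algebra_module_mat)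
  have cl: "eval_word (module_mat TYPE('k) n n) v w \<in> carrier_mat n n" for w
    using M.eval_word_closed[of w v] v by (simp add: module_mat_simps)
  show ?thesis
    using ij(1)
  proof (induction w arbitrary: i)
    case Nil
    then show ?case using ij by (simp add: module_mat_simps)
  next
    case (Cons x w)
    have "eval_word (module_mat TYPE('k) n n) v (x # w) $$ (i, j) =
      (\<Sum>l\<in>{0..<n}. v x $$ (i, l) * eval_word (module_mat TYPE('k) n n) v w $$ (l, j))"
      using v[of x] cl[of w] ij Cons.prems by (simp add: module_mat_simps scalar_prod_def)
    also have "\<dots> = path_entry {0..<n} (map (\<lambda>x i j. v x $$ (i, j)) (x # w)) i j"
      using Cons.IH by simp
    finally show ?case .
  qed
qed

lemma capelli_module_mat:
  fixes X W :: "nat \<Rightarrow> nat"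
  assumes "t * t < N"
  shows "alt_poly N X W signof \<in> identities (module_mat TYPE('k::field) t t)"
  unfolding identities_def
proof (intro CollectI allI impI)
  let ?M = "module_mat TYPE('k) t t"
  interpret M: unital_algebra ?M by (rule unital_algebra_module_mat)
  fix v :: "nat \<Rightarrow> 'k mat" assume "\<forall>i. v i \<in> carrier ?M"
  then have v: "\<And>i. v i \<in> carrier_mat t t" "\<And>i. v i \<in> carrier ?M" by (auto simp: module_mat_simps)
  let ?S = "{\<pi>. \<pi> permutes {0..<N}}"
  have w: "eval_word ?M v w \<in> carrier_mat t t" for w
    using M.eval_word_closed[of w v] v by (simp add: module_mat_simps)
  have entry: "(\<Oplus>\<^bsub>?M\<^esub>\<pi>\<in>?S. signof \<pi> \<odot>\<^bsub>?M\<^esub> eval_word ?M v (alt_word N X W \<pi>)) $$ (i, j) = 0"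
    if ij: "i < t" "j < t" for i j
  proof -
    have "(\<Oplus>\<^bsub>?M\<^esub>\<pi>\<in>?S. signof \<pi> \<odot>\<^bsub>?M\<^esub> eval_word ?M v (alt_word N X W \<pi>)) $$ (i, j) =
      (\<Sum>\<pi>\<in>?S. (signof \<pi> \<odot>\<^bsub>?M\<^esub> eval_word ?M v (alt_word N X W \<pi>)) $$ (i, j))"
      using w by (intro module_mat_finsum_entry ij) (auto simp: module_mat_simps finite_permutations)
    also have "\<dots> = (\<Sum>\<pi>\<in>?S. signof \<pi> * path_entry {0..<t} (concat (map (\<lambda>r.
      [(\<lambda>i j. v (X (\<pi> r)) $$ (i, j)), (\<lambda>i j. v (W r) $$ (i, j))]) [0..<N])) i j)"
    proof (intro sum.cong refl)
      fix \<pi>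
      have "(signof \<pi> \<odot>\<^bsub>?M\<^esub> eval_word ?M v (alt_word N X W \<pi>)) $$ (i, j) =
        signof \<pi> * eval_word ?M v (alt_word N X W \<pi>) $$ (i, j)"
        using w[of "alt_word N X W \<pi>"] ij by (simp add: module_mat_simps)
      also have "eval_word ?M v (alt_word N X W \<pi>) $$ (i, j) = path_entry {0..<t} (concat (map (\<lambda>r.
        [(\<lambda>i j. v (X (\<pi> r)) $$ (i, j)), (\<lambda>i j. v (W r) $$ (i, j))]) [0..<N])) i j"
        unfolding module_mat_eval_word_entry[OF v(1) ij]
        by (simp add: alt_word_def map_concat o_def)
      finally show "(signof \<pi> \<odot>\<^bsub>?M\<^esub> eval_word ?M v (alt_word N X W \<pi>)) $$ (i, j) =
        signof \<pi> * path_entry {0..<t} (concat (map (\<lambda>r.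
        [(\<lambda>i j. v (X (\<pi> r)) $$ (i, j)), (\<lambda>i j. v (W r) $$ (i, j))]) [0..<N])) i j" .
    qed
    also have "\<dots> = 0"
      using capelli_vanishes[of "{0..<t}" N i "\<lambda>s i j. v (X s) $$ (i, j)" "\<lambda>r i j. v (W r) $$ (i, j)" j]
        assms ij by simp
    finally show ?thesis .
  qed
  have "(\<Oplus>\<^bsub>?M\<^esub>\<pi>\<in>?S. signof \<pi> \<odot>\<^bsub>?M\<^esub> eval_word ?M v (alt_word N X W \<pi>)) \<in> carrier ?M"
    using v M.smult_closed by (intro M.finsum_closed) (auto intro!: M.eval_word_closed)
  then have "(\<Oplus>\<^bsub>?M\<^esub>\<pi>\<in>?S. signof \<pi> \<odot>\<^bsub>?M\<^esub> eval_word ?M v (alt_word N X W \<pi>)) = 0\<^sub>m t t"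
    using entry by (intro eq_matI) (auto simp: module_mat_simps)
  then show "eval_ncpoly ?M v (alt_poly N X W signof) = \<zero>\<^bsub>?M\<^esub>"
    unfolding M.eval_alt_poly[OF v(2)] by (simp add: module_mat_simps)
qed

text \<open>The alternating variables run through N distinct positions and the others connect
  consecutive ones, so only the identity permutation survives and the value is a matrix
  unit.\<close>

lemma capelli_not_identity:
  assumes N: "0 < N" "N \<le> d * d"
  shows "alt_poly N (\<lambda>r. 2 * r) (\<lambda>r. 2 * r + 1) signof \<notin> identities (module_mat TYPE('k::field) d d)"
proof
  let ?M = "module_mat TYPE('k) d d"
  let ?X = "\<lambda>r::nat. 2 * r" and ?W = "\<lambda>r::nat. 2 * r + 1"
  interpret M: unital_algebra ?M by (rule unital_algebra_module_mat)
  assume id: "alt_poly N ?X ?W signof \<in> identities ?M"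
  have d: "d > 0" using N by (cases d) auto
  \<comment> \<open>The last connecting variable needs a row for r = N, where r div d may already be
    d; 0 serves as default.\<close>
  define \<rho> where "\<rho> r = (if r < N then r div d else 0)" for r
  define \<kappa> where "\<kappa> r = r mod d" for r
  have \<rho>: "\<rho> r < d" for r using N d unfolding \<rho>_def by (auto simp: div_less_iff_less_mult)
  have \<kappa>: "\<kappa> r < d" for r using d unfolding \<kappa>_def by simp
  define v :: "nat \<Rightarrow> 'k mat" where "v x = (if even x then matrix_unit d (\<rho> (x div 2)) (\<kappa> (x div 2))
    else matrix_unit d (\<kappa> (x div 2)) (\<rho> (Suc (x div 2))))" for x
  have vX: "v (?X r) = matrix_unit d (\<rho> r) (\<kappa> r)" and vW: "v (?W r) = matrix_unit d (\<kappa> r) (\<rho> (Suc r))" for r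
    unfolding v_def by simp_all
  have v: "v x \<in> carrier ?M" for x unfolding v_def by (simp add: module_mat_simps matrix_unit_def)
  have inj: "inj_on (\<lambda>r. (\<rho> r, \<kappa> r)) {0..<N}"
    unfolding \<rho>_def \<kappa>_def by (rule inj_onI) (simp, metis div_mult_mod_eq)
  have zero: "eval_word ?M v (alt_word N ?X ?W \<pi>) = \<zero>\<^bsub>?M\<^esub>" if \<pi>: "\<pi> permutes {0..<N}" "\<pi> \<noteq> id" for \<pi>
  proof -
    obtain r where r: "r < N" "\<kappa> (\<pi> r) \<noteq> \<kappa> r \<or> (r > 0 \<and> \<rho> (\<pi> r) \<noteq> \<rho> r)"
      using permutes_mismatch[OF \<pi> inj] by blast
    show ?thesis
      by (rule M.eval_alt_word_zero[OF v _ _ \<pi>(1) r])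
        (simp_all add: vX vW[simplified] matrix_unit_mult \<rho> \<kappa> module_mat_simps)
  qed
  have "\<rho> 0 < d \<and> \<rho> N < d \<and> eval_word ?M v (concat (map (\<lambda>r. [?X r, ?W r]) [0..<N])) = matrix_unit d (\<rho> 0) (\<rho> N)"
  proof (rule eval_alt_word_chain[where Q = "\<lambda>i j y. i < d \<and> j < d \<and> y = matrix_unit d i j" and \<kappa> = \<kappa>])
    fix i j k and y z :: "'k mat"
    assume "i < d \<and> j < d \<and> y = matrix_unit d i j" "j < d \<and> k < d \<and> z = matrix_unit d j k"
    then show "i < d \<and> k < d \<and> y \<otimes>\<^bsub>?M\<^esub> z = matrix_unit d i k"
      by (simp add: module_mat_simps matrix_unit_mult)
  next
    fix i j and y :: "'k mat"
    assume "i < d \<and> j < d \<and> y = matrix_unit d i j"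
    then show "y \<otimes>\<^bsub>?M\<^esub> \<one>\<^bsub>?M\<^esub> = y"
      by (simp add: module_mat_simps right_mult_one_mat[OF matrix_unit_carrier])
  qed (use N in \<open>simp_all add: vX vW[simplified] \<rho> \<kappa>\<close>)
  then have one: "eval_word ?M v (alt_word N ?X ?W id) = matrix_unit d (\<rho> 0) (\<rho> N)"
    unfolding alt_word_def by simp
  have "eval_ncpoly ?M v (alt_poly N ?X ?W signof) =
    (\<Oplus>\<^bsub>?M\<^esub>\<pi>\<in>{id}. signof \<pi> \<odot>\<^bsub>?M\<^esub> eval_word ?M v (alt_word N ?X ?W \<pi>))"
    unfolding M.eval_alt_poly[OF v]
  proof (rule M.add.finprod_mono_neutral_cong_right)
    show "signof \<pi> \<odot>\<^bsub>?M\<^esub> eval_word ?M v (alt_word N ?X ?W \<pi>) = \<zero>\<^bsub>?M\<^esub>"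
      if "\<pi> \<in> {\<pi>. \<pi> permutes {0..<N}} - {id}" for \<pi>
      using that zero[of \<pi>] M.smult_zero by simp
  qed (use v in \<open>auto simp: finite_permutations permutes_id intro!: M.smult_closed M.eval_word_closed\<close>)
  also have "\<dots> = matrix_unit d (\<rho> 0) (\<rho> N)"
    unfolding one[symmetric] using v by (simp add: M.eval_word_closed M.smult_1 sign_id)
  finally have "matrix_unit d (\<rho> 0) (\<rho> N) = (0\<^sub>m d d :: 'k mat)"
    using id v unfolding identities_def by (simp add: module_mat_simps)
  then have "matrix_unit d (\<rho> 0) (\<rho> N) $$ (\<rho> 0, \<rho> N) = (0\<^sub>m d d :: 'k mat) $$ (\<rho> 0, \<rho> N)" by simp
  then show False using \<rho> by (simp add: matrix_unit_def)
qed

text \<open>A and the t by t matrices have the same identities. For d > t the Capelli polynomial in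
  t^2 + 1 alternating variables is a multilinear identity of A that fails for d by d
  matrices.\<close>

theorem pi_degree_matrix_reps:
  fixes A :: "('k::field, 'a, 'm) module_scheme"
  assumes A: "unital_algebra A" and \<Phi>: "matrix_reps A t \<Phi>"
  shows "pi_degree A = t"
  unfolding pi_degree_def
proof (rule Greatest_equality)
  show "0 < t \<and> (\<forall>f\<in>identities A. multilinear f \<longrightarrow> f \<in> identities (module_mat TYPE('k) t t))"
    using \<Phi> identities_matrix_reps[OF A \<Phi>] unfolding matrix_reps_def by blast
next
  fix d assume d: "0 < d \<and> (\<forall>f\<in>identities A. multilinear f \<longrightarrow> f \<in> identities (module_mat TYPE('k) d d))"
  let ?f = "alt_poly (t * t + 1) (\<lambda>r. 2 * r) (\<lambda>r. 2 * r + 1) signof :: (nat, 'k) ncpoly"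
  have "?f \<in> identities A" unfolding identities_matrix_reps[OF A \<Phi>] by (rule capelli_module_mat) simp
  moreover have "multilinear ?f"
  proof (rule multilinear_alt_poly)
    show "inj (\<lambda>r::nat. 2 * r)" "inj (\<lambda>r::nat. 2 * r + 1)" by (auto intro: injI)
    show "range (\<lambda>r::nat. 2 * r) \<inter> range (\<lambda>r. 2 * r + 1) = {}"
      by (auto dest: arg_cong[where f = even])
  qed
  ultimately have "?f \<in> identities (module_mat TYPE('k) d d)" using d by blast
  then have "\<not> t * t + 1 \<le> d * d" using capelli_not_identity[of "t * t + 1" d] by auto
  then show "d \<le> t"
    using mult_strict_mono[of t d t d] by linarith
qed

section \<open>The graded algebra R as block-triangular matrices over B\<close>

lemma simple_tensor_unit_entry:
  assumes "unital_algebra B" "b \<in> carrier B" "k < n" "l < n"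
  shows "simple_tensor n B (matrix_unit n i j) b $$ (k, l) = (if k = i \<and> l = j then b else \<zero>\<^bsub>B\<^esub>)"
  using assms by (auto simp: simple_tensor_def matrix_unit_def unital_algebra.smult_1 unital_algebra.smult_0)

locale block_tensor = D: graded_division G B
  for G :: "('g, 'n) monoid_scheme"
    and B :: "('k::{alg_closed_field, field_char_0}, 'b, 'g) gr_algebra" (structure) +
  fixes ds :: "nat list" and gs :: "'g list"
  assumes ds: "ds \<noteq> []" "\<forall>d\<in>set ds. d > 0"
    and gs: "length gs = sum_list ds" "set gs \<subseteq> carrier G"
begin

abbreviation n :: nat where "n \<equiv> sum_list ds"
abbreviation R where "R \<equiv> UT_tensor G ds gs B"
abbreviation M where "M \<equiv> matrices_over n B"
abbreviation bl :: "nat \<Rightarrow> nat" where "bl \<equiv> block_of ds"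
text \<open>An entry in position (i, j) of an element of degree g lies in this component of
  B.\<close>

abbreviation entry_deg where "entry_deg g i j \<equiv> inv\<^bsub>G\<^esub> (gs ! i) \<otimes>\<^bsub>G\<^esub> g \<otimes>\<^bsub>G\<^esub> gs ! j"
abbreviation E :: "nat \<Rightarrow> nat \<Rightarrow> 'b \<Rightarrow> 'b mat" where "E i j \<equiv> simple_tensor n B (matrix_unit n i j)"

lemma gs_carrier: "i < n \<Longrightarrow> gs ! i \<in> carrier G"
  using gs by auto

lemma pos_iff: "(i, j) \<in> ut_positions ds \<longleftrightarrow> i < n \<and> j < n \<and> bl i \<le> bl j"
  by (simp add: ut_positions_def)

lemma R_simps:
  "monoid.mult R = monoid.mult M" "one R = one M" "ring.zero R = ring.zero M"
  "ring.add R = ring.add M" "module.smult R = module.smult M"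
  "carrier R = {x \<in> carrier M. \<forall>i<n. \<forall>j<n. \<not> bl i \<le> bl j \<longrightarrow> x $$ (i, j) = \<zero>}"
  "hcomp R g = lin_span M {E i j b | i j h b. (i, j) \<in> ut_positions ds \<and> h \<in> carrier G \<and>
    b \<in> hcomp B h \<and> gs ! i \<otimes>\<^bsub>G\<^esub> h \<otimes>\<^bsub>G\<^esub> inv\<^bsub>G\<^esub> (gs ! j) = g}"
  by (auto simp: UT_tensor_def Let_def pos_iff matrices_over_def)

lemmas M_carrier = matrices_over_carrier[OF D.B.unital_algebra_axioms]
  and M_dim = matrices_over_dim[OF D.B.unital_algebra_axioms]
  and M_entry = matrices_over_entry[OF D.B.unital_algebra_axioms]
  and M_eqI = matrices_over_eqI[OF D.B.unital_algebra_axioms, where n = n]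

sublocale M: unital_algebra "matrices_over n B"
  by (rule unital_algebra_matrices_over[OF D.B.unital_algebra_axioms])

lemma R_carrier: "x \<in> carrier R \<longleftrightarrow> x \<in> carrier_mat n n \<and>
    (\<forall>i<n. \<forall>j<n. x $$ (i, j) \<in> carrier B) \<and> (\<forall>i<n. \<forall>j<n. \<not> bl i \<le> bl j \<longrightarrow> x $$ (i, j) = \<zero>)"
  unfolding R_simps M_carrier by (simp add: M_carrier)

lemma R_mult_entry_zero:
  assumes "x \<in> carrier R" "y \<in> carrier R" "i < n" "j < n" "\<not> bl i \<le> bl j"
  shows "(x \<otimes>\<^bsub>M\<^esub> y) $$ (i, j) = \<zero>"
proof -
  have "(x \<otimes>\<^bsub>M\<^esub> y) $$ (i, j) = (\<Oplus>l\<in>{..<n}. x $$ (i, l) \<otimes> y $$ (l, j))"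
    using assms by (intro M_entry)
  also have "\<dots> = (\<Oplus>l\<in>{..<n}. \<zero>)"
  proof (rule D.B.finsum_cong')
    fix l assume l: "l \<in> {..<n}"
    have "\<not> bl i \<le> bl l \<or> \<not> bl l \<le> bl j" using assms(5) by linarith
    then show "x $$ (i, l) \<otimes> y $$ (l, j) = \<zero>"
      using assms(1-4) l unfolding R_carrier by auto
  qed auto
  finally show ?thesis by simp
qed

sublocale R: unital_algebra "UT_tensor G ds gs B"
proof (rule unital_algebra_subalgebra[OF M.unital_algebra_axioms])
  show "carrier R \<subseteq> carrier M" by (auto simp: R_simps)
  show "\<one>\<^bsub>M\<^esub> \<in> carrier R" "\<zero>\<^bsub>M\<^esub> \<in> carrier R" by (auto simp: R_carrier M_dim M_entry)
  fix x y c assume x: "x \<in> carrier R"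
  then have xM: "x \<in> carrier M" by (simp add: R_simps)
  show "c \<odot>\<^bsub>M\<^esub> x \<in> carrier R"
    using x by (simp add: R_carrier M_dim M_entry D.B.smult_closed D.B.smult_zero)
  assume y: "y \<in> carrier R"
  then have yM: "y \<in> carrier M" by (simp add: R_simps)
  show "x \<oplus>\<^bsub>M\<^esub> y \<in> carrier R" using x y by (simp add: R_carrier M_dim M_entry)
  have "x \<otimes>\<^bsub>M\<^esub> y \<in> carrier M" using xM yM by simp
  then show "x \<otimes>\<^bsub>M\<^esub> y \<in> carrier R" using R_mult_entry_zero[OF x y] by (simp add: R_simps(6))
qed (simp_all only: R_simps)

lemma R_entry:
  assumes "i < n" "j < n"
  shows "(x \<oplus>\<^bsub>R\<^esub> y) $$ (i, j) = x $$ (i, j) \<oplus> y $$ (i, j)"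
    "(x \<otimes>\<^bsub>R\<^esub> y) $$ (i, j) = (\<Oplus>l\<in>{..<n}. x $$ (i, l) \<otimes> y $$ (l, j))"
    "(c \<odot>\<^bsub>R\<^esub> x) $$ (i, j) = c \<odot> x $$ (i, j)"
    "\<zero>\<^bsub>R\<^esub> $$ (i, j) = \<zero>" "\<one>\<^bsub>R\<^esub> $$ (i, j) = (if i = j then \<one> else \<zero>)"
  using M_entry[OF assms] by (simp_all add: R_simps)

lemma R_eqI:
  assumes "x \<in> carrier R" "y \<in> carrier R" "\<And>i j. i < n \<Longrightarrow> j < n \<Longrightarrow> bl i \<le> bl j \<Longrightarrow> x $$ (i, j) = y $$ (i, j)"
  shows "x = y"
proof (rule M_eqI)
  show "x $$ (i, j) = y $$ (i, j)" if "i < n" "j < n" for i j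
    using assms that unfolding R_carrier by (cases "bl i \<le> bl j") auto
qed (use assms R_carrier in auto)

lemma R_finsum_entry:
  assumes "finite S" "\<And>s. s \<in> S \<Longrightarrow> f s \<in> carrier R" and ij: "i < n" "j < n"
  shows "(\<Oplus>\<^bsub>R\<^esub>s\<in>S. f s) $$ (i, j) = (\<Oplus>s\<in>S. f s $$ (i, j))"
  using assms(1,2)
proof (induction S rule: finite_induct)
  case empty
  then show ?case using ij by (simp add: R_entry)
next
  case (insert a S)
  then have "(\<lambda>s. f s $$ (i, j)) \<in> S \<rightarrow> carrier B" "f a $$ (i, j) \<in> carrier B"
    using ij unfolding R_carrier by auto
  then show ?case using insert ij by (simp add: R_entry Pi_def)
qed

lemma E_dim: "E i j b \<in> carrier_mat n n"
  by (simp add: simple_tensor_def)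

lemma E_entry: "b \<in> carrier B \<Longrightarrow> k < n \<Longrightarrow> l < n \<Longrightarrow>
    E i j b $$ (k, l) = (if k = i \<and> l = j then b else \<zero>)"
  by (rule simple_tensor_unit_entry[OF D.B.unital_algebra_axioms])

lemma E_carrier: "b \<in> carrier B \<Longrightarrow> bl i \<le> bl j \<Longrightarrow> E i j b \<in> carrier R"
  by (auto simp: R_carrier E_dim E_entry)

lemma E_mult:
  assumes "i < n" "j < n" "k < n" "l < n" "b \<in> carrier B" "c \<in> carrier B"
  shows "E i j b \<otimes>\<^bsub>R\<^esub> E k l c = (if j = k then E i l (b \<otimes> c) else \<zero>\<^bsub>R\<^esub>)"
proof -
  have "E i j b \<otimes>\<^bsub>R\<^esub> E k l c = simple_tensor n B (matrix_unit n i j * matrix_unit n k l) (b \<otimes> c)"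
    unfolding R_simps using assms
    by (intro D.B.simple_tensor_mult) (simp_all add: matrix_unit_def)
  moreover have "simple_tensor n B (0\<^sub>m n n) (b \<otimes> c) = \<zero>\<^bsub>R\<^esub>"
    using assms unfolding R_simps
    by (intro M_eqI) (auto simp: simple_tensor_def M_entry M_dim D.B.smult_0)
  ultimately show ?thesis using assms by (simp add: matrix_unit_mult)
qed

text \<open>Each spanning tensor occupies one position, so membership in the span can be tested
  entry by entry.\<close>

lemma hcomp_iff:
  assumes g: "g \<in> carrier G"
  shows "x \<in> hcomp R g \<longleftrightarrow> x \<in> carrier_mat n n \<and> (\<forall>i<n. \<forall>j<n.
    if bl i \<le> bl j then x $$ (i, j) \<in> hcomp B (entry_deg g i j) else x $$ (i, j) = \<zero>)"
    (is "_ \<longleftrightarrow> ?P x")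
proof
  let ?S = "{E i j b | i j h b. (i, j) \<in> ut_positions ds \<and> h \<in> carrier G \<and>
    b \<in> hcomp B h \<and> gs ! i \<otimes>\<^bsub>G\<^esub> h \<otimes>\<^bsub>G\<^esub> inv\<^bsub>G\<^esub> (gs ! j) = g}"
  have deg: "entry_deg g i j \<in> carrier G" if "i < n" "j < n" for i j
    using that gs_carrier g by simp
  {
    assume "x \<in> hcomp R g"
    then have "x \<in> lin_span M ?S" by (simp add: R_simps)
    then show "?P x"
    proof (induction rule: lin_span.induct)
      case zero
      then show ?case using deg D.hcomp_zero by (auto simp: M_dim M_entry)
    next
      case (step s x c)
      obtain i j h b where s: "s = E i j b" "i < n" "j < n" "bl i \<le> bl j" "h \<in> carrier G" "b \<in> hcomp B h"
        "gs ! i \<otimes>\<^bsub>G\<^esub> h \<otimes>\<^bsub>G\<^esub> inv\<^bsub>G\<^esub> (gs ! j) = g"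
        using step(1) by (auto simp: pos_iff)
      have b: "b \<in> carrier B" using D.hcomp_carrier s by blast
      have "entry_deg g i j = h"
        unfolding s(7)[symmetric] using gs_carrier[OF s(2)] gs_carrier[OF s(3)] s(5)
        by (simp add: D.G.m_assoc) (simp add: D.G.m_assoc[symmetric])
      then have sP: "?P s"
        using s b deg D.hcomp_zero by (auto simp: E_dim E_entry)
      show ?case
        using sP step.IH deg
        by (auto simp: M_dim M_entry D.B.smult_zero intro!: D.hcomp_add D.hcomp_smult)
    qed
  }
  assume P: "?P x"
  have xB: "x $$ (i, j) \<in> carrier B" if "i < n" "j < n" for i j
  proof -
    have "if bl i \<le> bl j then x $$ (i, j) \<in> hcomp B (entry_deg g i j) else x $$ (i, j) = \<zero>"
      using P that by blast
    then show ?thesis using D.hcomp_carrier[OF deg[OF that]] by (auto split: if_splits)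
  qed
  \<comment> \<open>The restriction of x to a set T of positions; enlarging T by one position adds
    one spanning tensor, or nothing below the diagonal blocks.\<close>
  define part where "part T = mat n n (\<lambda>p. if p \<in> T then x $$ p else \<zero>)" for T
  have "part T \<in> lin_span M ?S" if "finite T" "T \<subseteq> {..<n} \<times> {..<n}" for T
    using that
  proof (induction T rule: finite_induct)
    case empty
    have "part {} = \<zero>\<^bsub>M\<^esub>" unfolding part_def by (intro M_eqI M_dim) (auto simp: M_entry)
    then show ?case using lin_span.zero[of M ?S] by simp
  next
    case (insert p T)
    obtain i j where p: "p = (i, j)" "i < n" "j < n" using insert by (cases p) auto
    show ?case
    proof (cases "bl i \<le> bl j")
      case True
      have b: "x $$ (i, j) \<in> hcomp B (entry_deg g i j)" using P p True by auto
      have "gs ! i \<otimes>\<^bsub>G\<^esub> (entry_deg g i j) \<otimes>\<^bsub>G\<^esub> inv\<^bsub>G\<^esub> (gs ! j) = g"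
        using gs_carrier[OF p(2)] gs_carrier[OF p(3)] g
        by (simp add: D.G.m_assoc) (simp add: D.G.m_assoc[symmetric])
      then have "E i j (x $$ (i, j)) \<in> ?S" using b p True deg pos_iff by blast
      then have "1 \<odot>\<^bsub>M\<^esub> E i j (x $$ (i, j)) \<oplus>\<^bsub>M\<^esub> part T \<in> lin_span M ?S"
        using insert by (intro lin_span.step) auto
      moreover have "1 \<odot>\<^bsub>M\<^esub> E i j (x $$ (i, j)) \<oplus>\<^bsub>M\<^esub> part T = part (insert p T)"
        using p insert(2) xB
        by (intro M_eqI M_dim) (auto simp: M_entry part_def E_entry D.B.smult_1 D.B.smult_zero)
      ultimately show ?thesis by simp
    next
      case False
      then have "x $$ p = \<zero>" using P p by auto
      then have "part (insert p T) = part T" unfolding part_def by (intro cong_mat) auto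
      then show ?thesis using insert by simp
    qed
  qed
  from this[of "{..<n} \<times> {..<n}"] have "part ({..<n} \<times> {..<n}) \<in> hcomp R g" by (simp add: R_simps)
  moreover have "part ({..<n} \<times> {..<n}) = x" unfolding part_def using P by (intro eq_matI) auto
  ultimately show "x \<in> hcomp R g" by simp
qed

lemma hcomp_R_subset: "g \<in> carrier G \<Longrightarrow> hcomp R g \<subseteq> carrier R"
proof
  fix x assume g: "g \<in> carrier G" and x: "x \<in> hcomp R g"
  have "x $$ (i, j) \<in> carrier B" if ij: "i < n" "j < n" for i j
  proof -
    have "entry_deg g i j \<in> carrier G" using ij gs_carrier g by simp
    moreover have "if bl i \<le> bl j then x $$ (i, j) \<in> hcomp B (entry_deg g i j) else x $$ (i, j) = \<zero>"
      using x ij unfolding hcomp_iff[OF g] by blast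
    ultimately show ?thesis using D.hcomp_carrier by (auto split: if_splits)
  qed
  then show "x \<in> carrier R" using x unfolding hcomp_iff[OF g] R_carrier by (auto split: if_splits)
qed

lemma E_hcomp:
  assumes "i < n" "j < n" "bl i \<le> bl j" "h \<in> carrier G" "b \<in> hcomp B h"
  shows "E i j b \<in> hcomp R (gs ! i \<otimes>\<^bsub>G\<^esub> h \<otimes>\<^bsub>G\<^esub> inv\<^bsub>G\<^esub> (gs ! j))"
proof -
  have "inv\<^bsub>G\<^esub> (gs ! i) \<otimes>\<^bsub>G\<^esub> (gs ! i \<otimes>\<^bsub>G\<^esub> h \<otimes>\<^bsub>G\<^esub> inv\<^bsub>G\<^esub> (gs ! j)) \<otimes>\<^bsub>G\<^esub> gs ! j = h"
    using gs_carrier[OF assms(1)] gs_carrier[OF assms(2)] assms(4)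
    by (simp add: D.G.m_assoc) (simp add: D.G.m_assoc[symmetric])
  then show ?thesis
    using assms gs_carrier D.hcomp_carrier[OF assms(4,5)] D.hcomp_zero
    by (subst hcomp_iff) (auto simp: E_dim E_entry)
qed

end

section \<open>Graded identities modulo the radical\<close>

lemma block_of_less:
  assumes "i < sum_list ds"
  shows "block_of ds i < length ds"
proof -
  have "ds \<noteq> []" using assms by auto
  then have "block_of ds i \<le> length ds - 1"
    unfolding block_of_def using assms by (intro Least_le) simp
  then show ?thesis using \<open>ds \<noteq> []\<close> by (cases ds) auto
qed

context block_tensor
begin

text \<open>Every strictly block-triangular factor raises the block index by at least one, so the
  k-th power is supported at least k blocks above the diagonal.\<close>

lemma strict_pow_entry:
  assumes x: "x \<in> carrier R" "\<And>i j. i < n \<Longrightarrow> j < n \<Longrightarrow> bl i = bl j \<Longrightarrow> x $$ (i, j) = \<zero>"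
    and ij: "i < n" "j < n" "\<not> bl i + k \<le> bl j"
  shows "(x [^]\<^bsub>R\<^esub> k) $$ (i, j) = \<zero>"
  using ij
proof (induction k arbitrary: j)
  case 0
  then show ?case by (auto simp: R_entry)
next
  case (Suc k)
  have cl: "x [^]\<^bsub>R\<^esub> k \<in> carrier R" using x by simp
  have "(x [^]\<^bsub>R\<^esub> Suc k) $$ (i, j) = (\<Oplus>l\<in>{..<n}. (x [^]\<^bsub>R\<^esub> k) $$ (i, l) \<otimes> x $$ (l, j))"
    using Suc.prems by (simp add: R_entry)
  also have "\<dots> = (\<Oplus>l\<in>{..<n}. \<zero>)"
  proof (rule D.B.finsum_cong')
    fix l assume "l \<in> {..<n}"
    then have l: "l < n" by simp
    have c: "(x [^]\<^bsub>R\<^esub> k) $$ (i, l) \<in> carrier B" "x $$ (l, j) \<in> carrier B"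
      using cl x(1) l Suc.prems unfolding R_carrier by auto
    show "(x [^]\<^bsub>R\<^esub> k) $$ (i, l) \<otimes> x $$ (l, j) = \<zero>"
    proof (cases "bl i + k \<le> bl l")
      case True
      then have "bl j < bl l \<or> bl l = bl j" using Suc.prems by linarith
      then have "x $$ (l, j) = \<zero>" using x l Suc.prems unfolding R_carrier by auto
      then show ?thesis using c by simp
    next
      case False
      then show ?thesis using Suc.IH[OF Suc.prems(1) l] c by simp
    qed
  qed auto
  finally show ?case by simp
qed

lemma strict_nilpotent:
  assumes x: "x \<in> carrier R" "\<And>i j. i < n \<Longrightarrow> j < n \<Longrightarrow> bl i = bl j \<Longrightarrow> x $$ (i, j) = \<zero>"
  shows "x [^]\<^bsub>R\<^esub> length ds = \<zero>\<^bsub>R\<^esub>"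
proof (rule R_eqI)
  fix i j assume ij: "i < n" "j < n"
  have "bl j < length ds" by (rule block_of_less[OF ij(2)])
  then have "(x [^]\<^bsub>R\<^esub> length ds) $$ (i, j) = \<zero>"
    by (intro strict_pow_entry x ij) simp_all
  then show "(x [^]\<^bsub>R\<^esub> length ds) $$ (i, j) = \<zero>\<^bsub>R\<^esub> $$ (i, j)"
    unfolding R_entry(4)[OF ij] .
qed (use x in auto)

definition admissible :: "(nat \<times> 'g \<Rightarrow> 'b mat) \<Rightarrow> bool" where
  "admissible v \<longleftrightarrow> (\<forall>i g. g \<in> carrier G \<longrightarrow> v (i, g) \<in> hcomp R g) \<and> (\<forall>x. v x \<in> carrier R)"

lemma admissible_closed: "admissible v \<Longrightarrow> v x \<in> carrier R"
  unfolding admissible_def by blast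

text \<open>\<open>f\<close> is visible if it does not vanish modulo the strictly block-triangular matrices.\<close>

definition visible :: "(nat \<times> 'g, 'k) ncpoly \<Rightarrow> bool" where
  "visible f \<longleftrightarrow> (\<exists>v a b. admissible v \<and> a < n \<and> b < n \<and> bl a = bl b \<and>
    eval_ncpoly R v f $$ (a, b) \<noteq> \<zero>)"

lemma zero_hcomp: "g \<in> carrier G \<Longrightarrow> \<zero>\<^bsub>R\<^esub> \<in> hcomp R g"
  unfolding R_simps by (rule lin_span.zero)

text \<open>The value of f is strictly block-triangular and stays so after multiplication by the
  extra variable, hence is nilpotent of index at most the number of blocks. The extra variable is
  there for the converse, where it closes a path from a to b into a loop.\<close>

lemma not_visible_identity:
  assumes f: "\<not> visible f" "f \<in> graded_ncpolys G" and g: "g \<in> carrier G"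
  shows "ncpow (ncmult f (Poly_Mapping.single [(i, g)] 1)) (length ds) \<in> graded_identities G R"
    (is "?F \<in> _")
proof (rule graded_identitiesI[OF R.unital_algebra_axioms _ hcomp_R_subset])
  have "ncvars ?F \<subseteq> ncvars f \<union> {(i, g)}"
    using ncvars_ncpow[of "ncmult f (Poly_Mapping.single [(i, g)] 1)" "length ds"]
      ncvars_ncmult[of f "Poly_Mapping.single [(i, g)] 1"] ncvars_single[of "[(i, g)]" "1::'k"] by auto
  then have "snd ` ncvars ?F \<subseteq> snd ` (ncvars f \<union> {(i, g)})" by (rule image_mono)
  also have "\<dots> \<subseteq> carrier G" using f(2) g unfolding graded_ncpolys_iff by simp
  finally show "?F \<in> graded_ncpolys G" unfolding graded_ncpolys_iff .
next
  fix v :: "nat \<times> 'g \<Rightarrow> 'b mat"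
  assume v: "\<And>i g. g \<in> carrier G \<Longrightarrow> v (i, g) \<in> hcomp R g" "\<And>x. v x \<in> carrier R"
  have adm: "admissible v" unfolding admissible_def using v by blast
  let ?y = "eval_ncpoly R v f" and ?z = "v (i, g)"
  have y: "?y \<in> carrier R" using v(2) by (rule R.eval_ncpoly_closed)
  have "(?y \<otimes>\<^bsub>R\<^esub> ?z) $$ (a, b) = \<zero>" if ab: "a < n" "b < n" "bl a = bl b" for a b
  proof -
    have "(?y \<otimes>\<^bsub>R\<^esub> ?z) $$ (a, b) = (\<Oplus>l\<in>{..<n}. ?y $$ (a, l) \<otimes> ?z $$ (l, b))"
      using ab by (simp add: R_entry)
    also have "\<dots> = (\<Oplus>l\<in>{..<n}. \<zero>)"
    proof (rule D.B.finsum_cong')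
      fix l assume "l \<in> {..<n}"
      then have l: "l < n" by simp
      have c: "?y $$ (a, l) \<in> carrier B" "?z $$ (l, b) \<in> carrier B"
        using y v(2)[of "(i, g)"] l ab unfolding R_carrier by auto
      show "?y $$ (a, l) \<otimes> ?z $$ (l, b) = \<zero>"
      proof (cases "bl a = bl l")
        case True
        then have "?y $$ (a, l) = \<zero>" using f(1) adm ab(1) l unfolding visible_def by blast
        then show ?thesis using c by simp
      next
        case False
        then have "\<not> bl a \<le> bl l \<or> \<not> bl l \<le> bl b" using ab by linarith
        then have "?y $$ (a, l) = \<zero> \<or> ?z $$ (l, b) = \<zero>"
          using y v(2)[of "(i, g)"] l ab unfolding R_carrier by blast
        then show ?thesis using c by auto
      qed
    qed auto
    finally show ?thesis by simp
  qed
  then have "(?y \<otimes>\<^bsub>R\<^esub> ?z) [^]\<^bsub>R\<^esub> length ds = \<zero>\<^bsub>R\<^esub>"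
    using y v(2) by (intro strict_nilpotent) auto
  then show "eval_ncpoly R v ?F = \<zero>\<^bsub>R\<^esub>"
    using v(2) by (simp add: R.eval_ncpow R.eval_ncpoly_ncmult R.eval_ncpoly_single R.smult_1)
qed

lemma E_pow: "a < n \<Longrightarrow> b \<in> carrier B \<Longrightarrow> k > 0 \<Longrightarrow> E a a b [^]\<^bsub>R\<^esub> (k::nat) = E a a (b [^] k)"
proof (induction k)
  case (Suc k)
  then show ?case
    using E_carrier[of b a a] by (cases "k = 0") (simp_all add: E_mult)
qed simp

lemma E_neq_zero: "a < n \<Longrightarrow> b < n \<Longrightarrow> c \<in> carrier B \<Longrightarrow> c \<noteq> \<zero> \<Longrightarrow> E a b c \<noteq> \<zero>\<^bsub>R\<^esub>"
  using E_entry[of c a b a b] R_entry(4)[of a b] by auto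

lemma Units_pow: "b \<in> Units B \<Longrightarrow> b [^] (k::nat) \<in> Units B"
  by (induction k) auto

text \<open>The extra variable does not occur in f, so it may be sent to \<open>E b a\<close> of the
  unit without changing the value of f; its degree is forced by the position (b, a). The product is
  \<open>E a a c\<close>, whose powers are nonzero because c is invertible. Without the loop, a
  value with a \<noteq> b would have square zero.\<close>

lemma unit_value_not_identity:
  assumes v: "admissible v" and ab: "a < n" "b < n" "bl a = bl b" and c: "c \<in> Units B"
    and f: "eval_ncpoly R v f = E a b c" and fresh: "(i, gs ! b \<otimes>\<^bsub>G\<^esub> inv\<^bsub>G\<^esub> (gs ! a)) \<notin> ncvars f" and m: "m > 0"
  shows "ncpow (ncmult f (Poly_Mapping.single [(i, gs ! b \<otimes>\<^bsub>G\<^esub> inv\<^bsub>G\<^esub> (gs ! a))] 1)) m \<notin> graded_identities G R"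
    (is "?F \<notin> _")
proof
  assume F: "?F \<in> graded_identities G R"
  let ?g = "gs ! b \<otimes>\<^bsub>G\<^esub> inv\<^bsub>G\<^esub> (gs ! a)"
  let ?w = "v((i, ?g) := E b a \<one>)"
  have cB: "c \<in> carrier B" using c by blast
  have "E b a \<one> \<in> hcomp R (gs ! b \<otimes>\<^bsub>G\<^esub> \<one>\<^bsub>G\<^esub> \<otimes>\<^bsub>G\<^esub> inv\<^bsub>G\<^esub> (gs ! a))"
    using ab D.one_hcomp by (intro E_hcomp) auto
  then have Eg: "E b a \<one> \<in> hcomp R ?g" using gs_carrier[OF ab(2)] by simp
  have w: "admissible ?w"
    using v Eg E_carrier[of "\<one>" b a] ab unfolding admissible_def by auto
  have wc: "\<And>x. ?w x \<in> carrier R" using admissible_closed[OF w] .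
  have "eval_ncpoly R ?w f = eval_ncpoly R v f"
    using fresh wc by (intro R.eval_ncpoly_cong) auto
  then have "eval_ncpoly R ?w ?F = E a a c [^]\<^bsub>R\<^esub> m"
    using wc E_carrier[of "\<one>" b a] ab cB
    by (simp add: R.eval_ncpow R.eval_ncpoly_ncmult R.eval_ncpoly_single R.smult_1 f E_mult)
  also have "\<dots> = E a a (c [^] m)" using E_pow ab cB m by blast
  also have "\<dots> \<noteq> \<zero>\<^bsub>R\<^esub>"
    using Units_pow[OF c, of m] D.Units_neq_zero ab by (intro E_neq_zero) auto
  finally show False using graded_identitiesD(2)[OF F, of ?w] w unfolding admissible_def by blast
qed

text \<open>The rows connected with a by elements of degree in H, modulo the strictly
  block-triangular matrices. Its cardinality decides which alternating polynomials with degrees in H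
  vanish there.\<close>

definition cls :: "nat \<Rightarrow> nat set" where
  "cls a = {b. b < n \<and> bl b = bl a \<and> inv\<^bsub>G\<^esub> (gs ! a) \<otimes>\<^bsub>G\<^esub> gs ! b \<in> D.H}"

lemma cls_finite: "finite (cls a)"
  unfolding cls_def by simp

lemma cls_refl: "a < n \<Longrightarrow> a \<in> cls a"
  unfolding cls_def using gs_carrier D.H_one by simp

lemma cls_H:
  assumes "a < n" "i \<in> cls a" "j \<in> cls a"
  shows "inv\<^bsub>G\<^esub> (gs ! i) \<otimes>\<^bsub>G\<^esub> gs ! j \<in> D.H"
proof -
  have c: "gs ! i \<in> carrier G" "gs ! j \<in> carrier G" "gs ! a \<in> carrier G"
    using assms gs_carrier unfolding cls_def by auto
  have "inv\<^bsub>G\<^esub> (gs ! i) \<otimes>\<^bsub>G\<^esub> gs ! j = inv\<^bsub>G\<^esub> (inv\<^bsub>G\<^esub> (gs ! a) \<otimes>\<^bsub>G\<^esub> gs ! i) \<otimes>\<^bsub>G\<^esub> (inv\<^bsub>G\<^esub> (gs ! a) \<otimes>\<^bsub>G\<^esub> gs ! j)"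
    using c by (simp add: D.G.inv_mult_group D.G.m_assoc) (simp add: D.G.m_assoc[symmetric])
  then show ?thesis using assms D.H_mult D.H_inv unfolding cls_def by auto
qed

lemma deg_H:
  assumes "p \<in> carrier G" "q \<in> carrier G" "h \<in> D.H"
  shows "inv\<^bsub>G\<^esub> p \<otimes>\<^bsub>G\<^esub> h \<otimes>\<^bsub>G\<^esub> q \<in> D.H \<longleftrightarrow> inv\<^bsub>G\<^esub> p \<otimes>\<^bsub>G\<^esub> q \<in> D.H"
proof -
  have h: "h \<in> carrier G" using D.H_carrier assms by blast
  have e: "inv\<^bsub>G\<^esub> p \<otimes>\<^bsub>G\<^esub> h \<otimes>\<^bsub>G\<^esub> q = (inv\<^bsub>G\<^esub> p \<otimes>\<^bsub>G\<^esub> q) \<otimes>\<^bsub>G\<^esub> h" using assms h by (simp add: D.G.m_ac)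
  have "inv\<^bsub>G\<^esub> p \<otimes>\<^bsub>G\<^esub> q = (inv\<^bsub>G\<^esub> p \<otimes>\<^bsub>G\<^esub> h \<otimes>\<^bsub>G\<^esub> q) \<otimes>\<^bsub>G\<^esub> inv\<^bsub>G\<^esub> h" unfolding e using assms h by (simp add: D.G.m_assoc)
  then show ?thesis using e assms D.H_mult D.H_inv by metis
qed

context
  fixes v a
  assumes v: "admissible v" and a: "a < n"
begin

text \<open>The entry (i, j) of an element of degree h has degree inv g_i h g_j, which is the degree
  of \<open>frame i\<close> times h divided by the degree of \<open>frame j\<close>. Stripping off
  the frames thus leaves a multiple of \<open>u h\<close>.\<close>

definition frame :: "nat \<Rightarrow> 'b" where
  "frame i = D.u (inv\<^bsub>G\<^esub> (gs ! i) \<otimes>\<^bsub>G\<^esub> gs ! a)"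

lemma cls_less: "i \<in> cls a \<Longrightarrow> i < n" and cls_bl: "i \<in> cls a \<Longrightarrow> bl i = bl a"
  unfolding cls_def by auto

lemma frame_Units: "i \<in> cls a \<Longrightarrow> frame i \<in> Units B"
  unfolding frame_def using cls_H[OF a _ cls_refl[OF a]] D.u_Units by blast

text \<open>Column l lies either in an earlier block, where block-triangularity applies, or in the
  same block but another class, where the entry would have a degree outside the support of
  B.\<close>

lemma entry_zero_outside:
  assumes i: "i \<in> cls a" and l: "l < n" "bl l \<le> bl a" "l \<notin> cls a" and h: "h \<in> D.H"
  shows "v (k, h) $$ (i, l) = \<zero>"
proof -
  have hG: "h \<in> carrier G" using D.H_carrier h by blast
  have vx: "v (k, h) \<in> hcomp R h" using v hG unfolding admissible_def by blast
  have i': "i < n" "bl i = bl a" using i cls_less cls_bl by auto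
  have g: "gs ! i \<in> carrier G" "gs ! l \<in> carrier G" "gs ! a \<in> carrier G" using gs_carrier i' l a by auto
  show ?thesis
  proof (cases "bl i \<le> bl l")
    case True
    then have "bl l = bl a" using i' l by simp
    then have "inv\<^bsub>G\<^esub> (gs ! a) \<otimes>\<^bsub>G\<^esub> gs ! l \<notin> D.H" using l unfolding cls_def by blast
    moreover have "inv\<^bsub>G\<^esub> (gs ! a) \<otimes>\<^bsub>G\<^esub> gs ! l = (inv\<^bsub>G\<^esub> (gs ! a) \<otimes>\<^bsub>G\<^esub> gs ! i) \<otimes>\<^bsub>G\<^esub> (inv\<^bsub>G\<^esub> (gs ! i) \<otimes>\<^bsub>G\<^esub> gs ! l)"
      using g by (simp add: D.G.m_assoc) (simp add: D.G.m_assoc[symmetric])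
    ultimately have "inv\<^bsub>G\<^esub> (gs ! i) \<otimes>\<^bsub>G\<^esub> gs ! l \<notin> D.H"
      using cls_H[OF a cls_refl[OF a] i] D.H_mult by metis
    then have "entry_deg h i l \<notin> D.H" using deg_H g h by blast
    moreover have "v (k, h) $$ (i, l) \<in> hcomp B (entry_deg h i l)"
      using vx i' l True unfolding hcomp_iff[OF hG] by auto
    moreover have "entry_deg h i l \<in> carrier G" using g hG by simp
    ultimately show ?thesis using D.H_memI by blast
  next
    case False
    then show ?thesis using vx i' l unfolding hcomp_iff[OF hG] by auto
  qed
qed

definition coef :: "nat \<times> 'g \<Rightarrow> nat \<Rightarrow> nat \<Rightarrow> 'k" where
  "coef x i j = (SOME c. v x $$ (i, j) = c \<odot> (frame i \<otimes> D.u (snd x) \<otimes> inv (frame j)))"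

lemma coef:
  assumes ij: "i \<in> cls a" "j \<in> cls a" and x: "snd x \<in> D.H"
  shows "v x $$ (i, j) = coef x i j \<odot> (frame i \<otimes> D.u (snd x) \<otimes> inv (frame j))"
proof -
  obtain k h where xk: "x = (k, h)" by (cases x)
  have h: "h \<in> D.H" "h \<in> carrier G" using x xk D.H_carrier by auto
  have i': "i < n" "j < n" "bl i = bl j" using ij cls_less cls_bl by auto
  have g: "gs ! i \<in> carrier G" "gs ! j \<in> carrier G" "gs ! a \<in> carrier G" using gs_carrier i' a by auto
  let ?d = "entry_deg h i j"
  have dH: "?d \<in> D.H" using deg_H[OF g(1,2) h(1)] cls_H[OF a ij] by blast
  have "v x \<in> hcomp R h" using v h xk unfolding admissible_def by blast
  then have 1: "v x $$ (i, j) \<in> hcomp B ?d" using i' unfolding hcomp_iff[OF h(2)] by auto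
  let ?e = "frame i \<otimes> D.u h \<otimes> inv (frame j)"
  have fH: "inv\<^bsub>G\<^esub> (gs ! i) \<otimes>\<^bsub>G\<^esub> gs ! a \<in> D.H" "inv\<^bsub>G\<^esub> (gs ! j) \<otimes>\<^bsub>G\<^esub> gs ! a \<in> D.H"
    using cls_H[OF a _ cls_refl[OF a]] ij by blast+
  have "?e \<in> hcomp B ((inv\<^bsub>G\<^esub> (gs ! i) \<otimes>\<^bsub>G\<^esub> gs ! a) \<otimes>\<^bsub>G\<^esub> h \<otimes>\<^bsub>G\<^esub> inv\<^bsub>G\<^esub> (inv\<^bsub>G\<^esub> (gs ! j) \<otimes>\<^bsub>G\<^esub> gs ! a))"
    unfolding frame_def using fH h D.H_carrier
    by (intro D.hcomp_mult D.hcomp_inverse D.u_hcomp_eq(1) D.u_neq_zero) auto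
  moreover have "(inv\<^bsub>G\<^esub> (gs ! i) \<otimes>\<^bsub>G\<^esub> gs ! a) \<otimes>\<^bsub>G\<^esub> h \<otimes>\<^bsub>G\<^esub> inv\<^bsub>G\<^esub> (inv\<^bsub>G\<^esub> (gs ! j) \<otimes>\<^bsub>G\<^esub> gs ! a) = ?d"
  proof -
    have "(inv\<^bsub>G\<^esub> (gs ! i) \<otimes>\<^bsub>G\<^esub> gs ! a) \<otimes>\<^bsub>G\<^esub> h \<otimes>\<^bsub>G\<^esub> inv\<^bsub>G\<^esub> (inv\<^bsub>G\<^esub> (gs ! j) \<otimes>\<^bsub>G\<^esub> gs ! a) =
      inv\<^bsub>G\<^esub> (gs ! i) \<otimes>\<^bsub>G\<^esub> h \<otimes>\<^bsub>G\<^esub> gs ! j \<otimes>\<^bsub>G\<^esub> (gs ! a \<otimes>\<^bsub>G\<^esub> inv\<^bsub>G\<^esub> (gs ! a))"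
      using g h by (simp only: D.G.inv_mult_group D.G.inv_inv D.G.inv_closed D.G.m_closed D.G.m_ac)
    then show ?thesis using g h by simp
  qed
  ultimately have 2: "?e \<in> hcomp B ?d" by simp
  have eU: "?e \<in> Units B"
    using frame_Units ij D.u_Units h by (intro D.B.Units_m_closed D.B.Units_inv_Units) auto
  obtain c1 where c1: "v x $$ (i, j) = c1 \<odot> D.u ?d" using D.hcomp_memE[OF dH 1] by blast
  obtain c2 where c2: "?e = c2 \<odot> D.u ?d" using D.hcomp_memE[OF dH 2] by blast
  have "c2 \<noteq> 0" using D.Units_neq_zero[OF eU] c2 D.B.smult_0[OF D.u_closed[OF dH]] by auto
  then have "v x $$ (i, j) = (c1 / c2) \<odot> ?e"
    unfolding c1 c2 by (simp add: D.B.smult_smult D.u_closed[OF dH])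
  then have "\<exists>c. v x $$ (i, j) = c \<odot> (frame i \<otimes> D.u (snd x) \<otimes> inv (frame j))"
    unfolding xk snd_conv by (rule exI)
  then show ?thesis unfolding coef_def by (rule someI_ex)
qed

text \<open>Conjugating by the frame, elements of degree \<open>h \<in> H\<close> become \<open>c \<otimes>\<^bsub>G\<^esub> u\<^sub>h\<close> with a scalar matrix \<open>c\<close>.\<close>

lemma word_entry:
  assumes "\<And>x. x \<in> set w \<Longrightarrow> snd x \<in> D.H" "i \<in> cls a"
  shows "j \<in> cls a \<Longrightarrow> eval_word R v w $$ (i, j) = path_entry (cls a) (map coef w) i j \<odot>
      (frame i \<otimes> eval_word B D.u (map snd w) \<otimes> inv (frame j))"
    and "j < n \<Longrightarrow> bl j = bl a \<Longrightarrow> j \<notin> cls a \<Longrightarrow> eval_word R v w $$ (i, j) = \<zero>"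
  using assms
proof (induction w arbitrary: i)
  case Nil
  {
    case 1
    have f: "frame i \<in> Units B" "frame j \<in> Units B" using 1 frame_Units by auto
    then show ?case using 1 cls_less by (auto simp: R_entry D.B.smult_1 D.B.smult_0 D.B.Units_r_inv)
  next
    case 2
    then show ?case using cls_less by (auto simp: R_entry)
  }
next
  case (Cons x w)
  have wR: "eval_word R v w \<in> carrier R" using admissible_closed[OF v] by (rule R.eval_word_closed)
  have xR: "v x \<in> carrier R" using admissible_closed[OF v] .
  let ?W = "eval_word B D.u (map snd w)"
  \<comment> \<open>The sum over intermediate rows shrinks to the class: rows of later blocks are
    killed by the second factor, which would lie below the diagonal blocks, and all other rows
    outside the class by the first.\<close>
  have key: "eval_word R v (x # w) $$ (i, j) = (\<Oplus>l\<in>cls a. v x $$ (i, l) \<otimes> eval_word R v w $$ (l, j))"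
    if i: "i \<in> cls a" and j: "j < n" "bl j = bl a" and x: "snd x \<in> D.H" for i j
  proof -
    have i': "i < n" using i cls_less by blast
    have c: "v x $$ (i, l) \<in> carrier B" "eval_word R v w $$ (l, j) \<in> carrier B" if "l < n" for l
      using xR wR that i' j unfolding R_carrier by auto
    have "eval_word R v (x # w) $$ (i, j) = (\<Oplus>l\<in>{..<n}. v x $$ (i, l) \<otimes> eval_word R v w $$ (l, j))"
      using i' j by (simp add: R_entry)
    also have "\<dots> = (\<Oplus>l\<in>cls a. v x $$ (i, l) \<otimes> eval_word R v w $$ (l, j))"
    proof (rule D.B.add.finprod_mono_neutral_cong_right)
      show "cls a \<subseteq> {..<n}" using cls_less by blast
      fix l assume "l \<in> {..<n} - cls a"
      then have l: "l < n" "l \<notin> cls a" by auto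
      show "v x $$ (i, l) \<otimes> eval_word R v w $$ (l, j) = \<zero>"
      proof (cases "bl l \<le> bl a")
        case True
        have "v x $$ (i, l) = \<zero>"
          using entry_zero_outside[OF i l(1) True l(2) x, of "fst x"] by simp
        then show ?thesis using c[OF l(1)] by simp
      next
        case False
        then have "eval_word R v w $$ (l, j) = \<zero>" using wR l j unfolding R_carrier by auto
        then show ?thesis using c[OF l(1)] by simp
      qed
    qed (use c in auto)
    finally show ?thesis .
  qed
  {
    case 1
    have x: "snd x \<in> D.H" and w: "\<And>y. y \<in> set w \<Longrightarrow> snd y \<in> D.H" using 1 by auto
    have WB: "?W \<in> carrier B" using w D.u_closed by (intro D.B.eval_word_closed) auto
    have j: "j < n" "bl j = bl a" using 1 cls_less cls_bl by auto
    have fr: "frame l \<in> carrier B" "inv (frame l) \<in> carrier B" if "l \<in> cls a" for l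
      using frame_Units[OF that] by auto
    have ux: "D.u (snd x) \<in> carrier B" using D.u_closed x by blast
    let ?e = "frame i \<otimes> eval_word B D.u (map snd (x # w)) \<otimes> inv (frame j)"
    have eB: "?e \<in> carrier B" using fr 1 ux WB by simp
    have "v x $$ (i, l) \<otimes> eval_word R v w $$ (l, j) =
      (coef x i l * path_entry (cls a) (map coef w) l j) \<odot> ?e" if l: "l \<in> cls a" for l
    proof -
      have "(frame i \<otimes> D.u (snd x) \<otimes> inv (frame l)) \<otimes> (frame l \<otimes> ?W \<otimes> inv (frame j)) =
        frame i \<otimes> D.u (snd x) \<otimes> (inv (frame l) \<otimes> frame l) \<otimes> ?W \<otimes> inv (frame j)"
        using fr l 1 ux WB by (simp add: D.B.m_assoc)
      also have "\<dots> = ?e" using fr l 1 ux WB frame_Units[OF l] by (simp add: D.B.Units_l_inv D.B.m_assoc)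
      finally have e: "(frame i \<otimes> D.u (snd x) \<otimes> inv (frame l)) \<otimes>
        (frame l \<otimes> ?W \<otimes> inv (frame j)) = ?e" .
      have IH: "eval_word R v w $$ (l, j) =
        path_entry (cls a) (map coef w) l j \<odot> (frame l \<otimes> ?W \<otimes> inv (frame j))"
        by (rule Cons.IH(1)[OF 1(1) w l])
      have "v x $$ (i, l) \<otimes> eval_word R v w $$ (l, j) =
        (coef x i l * path_entry (cls a) (map coef w) l j) \<odot>
        ((frame i \<otimes> D.u (snd x) \<otimes> inv (frame l)) \<otimes>
        (frame l \<otimes> ?W \<otimes> inv (frame j)))"
        unfolding coef[OF 1(3) l x] IH using fr l 1 ux WB by (intro D.B.smult_mult_smult) simp_all
      then show ?thesis unfolding e .
    qed
    then have "(\<Oplus>l\<in>cls a. v x $$ (i, l) \<otimes> eval_word R v w $$ (l, j)) =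
      (\<Oplus>l\<in>cls a. (coef x i l * path_entry (cls a) (map coef w) l j) \<odot> ?e)"
      using eB by (intro D.B.finsum_cong') (auto intro: D.B.smult_closed)
    also have "\<dots> = path_entry (cls a) (map coef (x # w)) i j \<odot> ?e"
      using eB cls_finite by (simp add: D.B.sum_smult)
    finally show ?case unfolding key[OF 1(3) j x] .
  next
    case 2
    have x: "snd x \<in> D.H" and w: "\<And>y. y \<in> set w \<Longrightarrow> snd y \<in> D.H" using 2 by auto
    have "(\<Oplus>l\<in>cls a. v x $$ (i, l) \<otimes> eval_word R v w $$ (l, j)) = (\<Oplus>l\<in>cls a. \<zero>)"
    proof (rule D.B.finsum_cong')
      fix l assume l: "l \<in> cls a"
      have "v x $$ (i, l) \<in> carrier B" using xR cls_less 2 l unfolding R_carrier by auto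
      then show "v x $$ (i, l) \<otimes> eval_word R v w $$ (l, j) = \<zero>"
        using Cons.IH(2)[OF 2(1-3) w l] by simp
    qed auto
    then show ?case unfolding key[OF 2(5,1,2) x] by simp
  }
qed

end

end

text \<open>Even and odd indices keep the alternating and the connecting variables apart, whatever
  their degrees.\<close>

definition gadget ::
  "nat \<Rightarrow> (nat \<Rightarrow> 'g) \<Rightarrow> (nat \<Rightarrow> 'g) \<Rightarrow> ((nat \<Rightarrow> nat) \<Rightarrow> 'k::comm_ring_1) \<Rightarrow> (nat \<times> 'g, 'k) ncpoly" where
  "gadget N dx dw \<epsilon> = alt_poly N (\<lambda>r. (2 * r, dx r)) (\<lambda>r. (2 * r + 1, dw r)) \<epsilon>"

lemma ncvars_gadget:
  "ncvars (gadget N dx dw \<epsilon>) \<subseteq> (\<lambda>r. (2 * r, dx r)) ` {0..<N} \<union> (\<lambda>r. (2 * r + 1, dw r)) ` {0..<N}"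
  unfolding gadget_def by (rule ncvars_alt_poly)

lemma (in abelian_monoid) finsum_one_elem: "f a \<in> carrier G \<Longrightarrow> (\<Oplus>x\<in>{a}. f x) = f a"
  by simp

lemma gadget_graded:
  assumes "\<And>r. r < N \<Longrightarrow> dx r \<in> carrier G" "\<And>r. r < N \<Longrightarrow> dw r \<in> carrier G"
  shows "gadget N dx dw \<epsilon> \<in> graded_ncpolys G"
proof -
  have "snd ` ncvars (gadget N dx dw \<epsilon>) \<subseteq>
    snd ` ((\<lambda>r. (2 * r, dx r)) ` {0..<N} \<union> (\<lambda>r. (2 * r + 1, dw r)) ` {0..<N})"
    by (rule image_mono[OF ncvars_gadget])
  also have "\<dots> \<subseteq> carrier G" using assms by auto
  finally show ?thesis unfolding graded_ncpolys_iff .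
qed

text \<open>The indices 0 and 1 share a position and cannot be told apart; all others are fixed by
  their positions. What remains is the identity and the swap of 0 and 1.\<close>

lemma permutes_mismatch_double:
  fixes \<pi> :: "nat \<Rightarrow> nat"
  assumes \<pi>: "\<pi> permutes {0..<N}" "\<pi> \<noteq> id" "\<pi> \<noteq> transpose 0 1"
    and inj: "inj_on (\<lambda>r. (\<rho> r, \<kappa> r)) {1..<N}" and eq: "\<rho> 0 = \<rho> 1" "\<kappa> 0 = \<kappa> 1" and N: "2 \<le> N"
  shows "\<exists>r<N. \<kappa> (\<pi> r) \<noteq> \<kappa> r \<or> (r > 0 \<and> \<rho> (\<pi> r) \<noteq> \<rho> r)"
proof (rule ccontr)
  assume c: "\<not> ?thesis"
  have img: "\<pi> r < N" if "r < N" for r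
  proof -
    have "\<pi> r \<in> \<pi> ` {0..<N}" using that by (intro imageI) simp
    then show ?thesis unfolding permutes_image[OF \<pi>(1)] by simp
  qed
  have fix2: "\<pi> r = r" if r: "2 \<le> r" for r
  proof (cases "r < N")
    case True
    have e: "\<rho> (\<pi> r) = \<rho> r" "\<kappa> (\<pi> r) = \<kappa> r" using c True r by auto
    have "\<pi> r \<noteq> 0"
    proof
      assume "\<pi> r = 0"
      then have "\<rho> 1 = \<rho> r" "\<kappa> 1 = \<kappa> r" using e eq by simp_all
      then have "1 = r" using inj_onD[OF inj, of 1 r] True r N by simp
      then show False using r by simp
    qed
    then show ?thesis using inj_onD[OF inj, of "\<pi> r" r] e img[OF True] True r by simp
  next
    case False
    then show ?thesis using permutes_not_in[OF \<pi>(1), of r] by simp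
  qed
  have inj\<pi>: "\<pi> r = \<pi> s \<longleftrightarrow> r = s" for r s using permutes_inj[OF \<pi>(1)] by (simp add: inj_eq)
  have small: "\<pi> r < 2" if "r < 2" for r
  proof (rule ccontr)
    assume "\<not> \<pi> r < 2"
    then have "\<pi> (\<pi> r) = \<pi> r" using fix2 by simp
    then have "\<pi> r = r" using inj\<pi> by blast
    then show False using that \<open>\<not> \<pi> r < 2\<close> by simp
  qed
  have "\<pi> 0 < 2" "\<pi> 1 < 2" "\<pi> 0 \<noteq> \<pi> 1" using small inj\<pi> by auto
  then consider "\<pi> 0 = 0" "\<pi> 1 = 1" | "\<pi> 0 = 1" "\<pi> 1 = 0" by linarith
  then show False
  proof cases
    case 1
    have "\<pi> r = r" for r using 1 fix2[of r] by (cases "r = 0"; cases "r = 1") auto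
    then show False using \<pi>(2) by auto
  next
    case 2
    have "\<pi> r = transpose 0 1 r" for r
      using 2 fix2[of r] by (cases "r = 0"; cases "r = 1") (auto simp: transpose_def)
    then show False using \<pi>(3) by auto
  qed
qed

context block_tensor
begin

text \<open>In the frame every word is a scalar path times a product of elements \<open>u\<close>.
  The weights \<epsilon> are assumed to turn all these products into one \<open>U0\<close> up to the
  sign of the permutation, so the entry is a framed \<open>U0\<close> times an ordinary Capelli sum
  over the class, which vanishes once N exceeds the number of positions. An entry outside the class
  vanishes word by word.\<close>

lemma gadget_vanishes:
  assumes dx: "\<And>r. r < N \<Longrightarrow> dx r \<in> D.H" and dw: "\<And>r. r < N \<Longrightarrow> dw r \<in> D.H"
    and U0: "U0 \<in> carrier B"
    and \<epsilon>: "\<And>\<pi>. \<pi> permutes {0..<N} \<Longrightarrow>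
      \<epsilon> \<pi> \<odot> eval_word B D.u (concat (map (\<lambda>r. [dx (\<pi> r), dw r]) [0..<N])) = signof \<pi> \<odot> U0"
    and v: "admissible v" and ij: "i < n" "j < n" "bl i = bl j" and N: "j \<in> cls i \<Longrightarrow> card (cls i) * card (cls i) < N"
  shows "eval_ncpoly R v (gadget N dx dw \<epsilon>) $$ (i, j) = \<zero>"
proof -
  let ?X = "\<lambda>r. (2 * r, dx r)" and ?W = "\<lambda>r. (2 * r + 1, dw r)"
  let ?S = "{\<pi>. \<pi> permutes {0..<N}}"
  have vR: "\<And>x. v x \<in> carrier R" using admissible_closed[OF v] .
  have wR: "eval_word R v w \<in> carrier R" for w using vR by (rule R.eval_word_closed)
  have deg: "snd x \<in> D.H" if "\<pi> \<in> ?S" "x \<in> set (alt_word N ?X ?W \<pi>)" for \<pi> x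
    using that set_alt_word[of \<pi> N ?X ?W] dx dw by auto
  have sw: "map snd (alt_word N ?X ?W \<pi>) = concat (map (\<lambda>r. [dx (\<pi> r), dw r]) [0..<N])" for \<pi>
    by (simp add: alt_word_def map_concat o_def)
  have "eval_ncpoly R v (gadget N dx dw \<epsilon>) $$ (i, j) =
    (\<Oplus>\<pi>\<in>?S. (\<epsilon> \<pi> \<odot>\<^bsub>R\<^esub> eval_word R v (alt_word N ?X ?W \<pi>)) $$ (i, j))"
    unfolding gadget_def R.eval_alt_poly[OF vR]
    by (rule R_finsum_entry) (use ij wR R.smult_closed in \<open>auto simp: finite_permutations\<close>)
  also have "\<dots> = (\<Oplus>\<pi>\<in>?S. \<epsilon> \<pi> \<odot> eval_word R v (alt_word N ?X ?W \<pi>) $$ (i, j))"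
    using ij by (simp add: R_entry)
  also have "\<dots> = \<zero>"
  proof (cases "j \<in> cls i")
    case False
    have "eval_word R v (alt_word N ?X ?W \<pi>) $$ (i, j) = \<zero>" if "\<pi> \<in> ?S" for \<pi>
      by (rule word_entry(2)[OF v ij(1) deg[OF that] cls_refl[OF ij(1)] ij(2) ij(3)[symmetric] False])
    then have "(\<Oplus>\<pi>\<in>?S. \<epsilon> \<pi> \<odot> eval_word R v (alt_word N ?X ?W \<pi>) $$ (i, j)) = (\<Oplus>\<pi>\<in>?S. \<zero>)"
      by (intro D.B.finsum_cong') (auto simp: D.B.smult_zero)
    then show ?thesis by simp
  next
    case True
    define f where "f = frame i i"
    define f' where "f' = inv (frame i j)"
    have f: "f \<in> carrier B" "f' \<in> carrier B"
      unfolding f_def f'_def using frame_Units[OF v ij(1)] cls_refl[OF ij(1)] True by auto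
    let ?c = "\<lambda>\<pi>. path_entry (cls i) (concat (map (\<lambda>r. [coef v i (?X (\<pi> r)), coef v i (?W r)]) [0..<N])) i j"
    have "\<epsilon> \<pi> \<odot> eval_word R v (alt_word N ?X ?W \<pi>) $$ (i, j) = (signof \<pi> * ?c \<pi>) \<odot> (f \<otimes> U0 \<otimes> f')"
      if \<pi>: "\<pi> \<in> ?S" for \<pi>
    proof -
      let ?U = "eval_word B D.u (map snd (alt_word N ?X ?W \<pi>))"
      have U: "?U \<in> carrier B" using deg[OF \<pi>] D.u_closed by (intro D.B.eval_word_closed) auto
      have mp: "map (coef v i) (alt_word N ?X ?W \<pi>) =
        concat (map (\<lambda>r. [coef v i (?X (\<pi> r)), coef v i (?W r)]) [0..<N])"
        by (simp add: alt_word_def map_concat o_def)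
      have "eval_word R v (alt_word N ?X ?W \<pi>) $$ (i, j) = ?c \<pi> \<odot> (f \<otimes> ?U \<otimes> f')"
        unfolding f_def f'_def mp[symmetric]
        by (rule word_entry(1)[OF v ij(1) deg[OF \<pi>] cls_refl[OF ij(1)] True])
      then have "\<epsilon> \<pi> \<odot> eval_word R v (alt_word N ?X ?W \<pi>) $$ (i, j) =
        ?c \<pi> \<odot> (f \<otimes> (\<epsilon> \<pi> \<odot> ?U) \<otimes> f')"
        using f U by (simp add: D.B.smult_mult_left D.B.smult_mult_right D.B.smult_smult D.B.smult_closed mult.commute)
      also have "\<epsilon> \<pi> \<odot> ?U = signof \<pi> \<odot> U0" unfolding sw using \<epsilon> \<pi> by simp
      also have "?c \<pi> \<odot> (f \<otimes> (signof \<pi> \<odot> U0) \<otimes> f') = (signof \<pi> * ?c \<pi>) \<odot> (f \<otimes> U0 \<otimes> f')"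
        using f U0 by (simp add: D.B.smult_mult_left D.B.smult_mult_right D.B.smult_smult D.B.smult_closed mult.commute)
      finally show ?thesis .
    qed
    then have "(\<Oplus>\<pi>\<in>?S. \<epsilon> \<pi> \<odot> eval_word R v (alt_word N ?X ?W \<pi>) $$ (i, j)) =
      (\<Oplus>\<pi>\<in>?S. (signof \<pi> * ?c \<pi>) \<odot> (f \<otimes> U0 \<otimes> f'))"
      using f U0 by (intro D.B.finsum_cong') (auto intro: D.B.smult_closed)
    also have "\<dots> = (\<Sum>\<pi>\<in>?S. signof \<pi> * ?c \<pi>) \<odot> (f \<otimes> U0 \<otimes> f')"
      using f U0 by (intro D.B.sum_smult[symmetric]) (auto simp: finite_permutations)
    also have "(\<Sum>\<pi>\<in>?S. signof \<pi> * ?c \<pi>) = 0"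
      by (rule capelli_vanishes[OF cls_finite N[OF True] cls_refl[OF ij(1)]])
    finally show ?thesis using f U0 by (simp add: D.B.smult_0)
  qed
  finally show ?thesis .
qed

text \<open>The variable \<open>2 r\<close> is sent to position \<open>(\<rho> r, \<kappa> r)\<close>, and \<open>2 r + 1\<close> to \<open>(\<kappa> r, \<rho> (r + 1))\<close>.\<close>

definition gval :: "(nat \<Rightarrow> nat) \<Rightarrow> (nat \<Rightarrow> nat) \<Rightarrow> nat \<times> 'g \<Rightarrow> 'b mat" where
  "gval \<rho> \<kappa> x = (let r = fst x div 2; p = if even (fst x) then \<rho> r else \<kappa> r;
      q = if even (fst x) then \<kappa> r else \<rho> (Suc r); d = entry_deg (snd x) p q
    in if snd x \<in> carrier G \<and> d \<in> D.H then E p q (D.u d) else \<zero>\<^bsub>R\<^esub>)"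

context
  fixes \<rho> \<kappa> :: "nat \<Rightarrow> nat" and k :: nat
  assumes less: "\<And>r. \<rho> r < n" "\<And>r. \<kappa> r < n" and blk: "\<And>r. bl (\<rho> r) = k" "\<And>r. bl (\<kappa> r) = k"
begin

lemma E_deg_hcomp:
  assumes pq: "p < n" "q < n" "bl p = bl q" and g: "g \<in> carrier G" and d: "entry_deg g p q \<in> D.H"
  shows "E p q (D.u (entry_deg g p q)) \<in> hcomp R g"
proof -
  have c: "gs ! p \<in> carrier G" "gs ! q \<in> carrier G" using pq gs_carrier by auto
  have "gs ! p \<otimes>\<^bsub>G\<^esub> (entry_deg g p q) \<otimes>\<^bsub>G\<^esub> inv\<^bsub>G\<^esub> (gs ! q) = g"
    using c g by (simp add: D.G.m_assoc) (simp add: D.G.m_assoc[symmetric])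
  then show ?thesis using E_hcomp[OF pq(1,2) _ D.H_carrier[OF d] D.u_hcomp_eq(1)[OF d]] pq by simp
qed

lemma gval_admissible: "admissible (gval \<rho> \<kappa>)"
  unfolding admissible_def
proof (intro conjI allI impI)
  have pos: "(if b then \<rho> r else \<kappa> r) < n" "(if b then \<kappa> r else \<rho> (Suc r)) < n"
    "bl (if b then \<rho> r else \<kappa> r) = bl (if b then \<kappa> r else \<rho> (Suc r))" for b r
    using less blk by auto
  show hc: "gval \<rho> \<kappa> (i, g) \<in> hcomp R g" if "g \<in> carrier G" for i g
    unfolding gval_def Let_def using E_deg_hcomp[OF pos that] that zero_hcomp by simp
  fix x
  show "gval \<rho> \<kappa> x \<in> carrier R"
  proof (cases "snd x \<in> carrier G")
    case True
    then show ?thesis using hc[of "snd x" "fst x"] hcomp_R_subset by auto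
  qed (simp add: gval_def Let_def)
qed

lemma gval_X: "g \<in> carrier G \<Longrightarrow> entry_deg g (\<rho> r) (\<kappa> r) \<in> D.H \<Longrightarrow>
    gval \<rho> \<kappa> (2 * r, g) = E (\<rho> r) (\<kappa> r) (D.u (entry_deg g (\<rho> r) (\<kappa> r)))"
  and gval_W: "g \<in> carrier G \<Longrightarrow> entry_deg g (\<kappa> r) (\<rho> (Suc r)) \<in> D.H \<Longrightarrow>
    gval \<rho> \<kappa> (2 * r + 1, g) = E (\<kappa> r) (\<rho> (Suc r)) (D.u (entry_deg g (\<kappa> r) (\<rho> (Suc r))))"
  by (simp_all add: gval_def Let_def)

lemma gval_cases:
  obtains "gval \<rho> \<kappa> (2 * r, g) = \<zero>\<^bsub>R\<^esub>" | b where "b \<in> carrier B" "gval \<rho> \<kappa> (2 * r, g) = E (\<rho> r) (\<kappa> r) b"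
proof (cases "g \<in> carrier G \<and> entry_deg g (\<rho> r) (\<kappa> r) \<in> D.H")
  case True
  then show ?thesis using that(2)[OF D.u_closed gval_X] by blast
next
  case False
  then show ?thesis by (intro that(1)) (auto simp: gval_def Let_def)
qed


lemma gval_cases':
  obtains "gval \<rho> \<kappa> (2 * r + 1, g) = \<zero>\<^bsub>R\<^esub>"
  | b where "b \<in> carrier B" "gval \<rho> \<kappa> (2 * r + 1, g) = E (\<kappa> r) (\<rho> (Suc r)) b"
proof (cases "g \<in> carrier G \<and> entry_deg g (\<kappa> r) (\<rho> (Suc r)) \<in> D.H")
  case True
  then show ?thesis using that(2)[OF D.u_closed gval_W] by blast
next
  case False
  then show ?thesis by (intro that(1)) (auto simp: gval_def Let_def)
qed


lemma gval_closed: "gval \<rho> \<kappa> x \<in> carrier R"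
  using gval_admissible admissible_closed by blast

lemma gval_XW: "\<kappa> s \<noteq> \<kappa> r \<Longrightarrow> gval \<rho> \<kappa> (2 * s, g) \<otimes>\<^bsub>R\<^esub> gval \<rho> \<kappa> (2 * r + 1, g') = \<zero>\<^bsub>R\<^esub>"
proof -
  assume ne: "\<kappa> s \<noteq> \<kappa> r"
  show ?thesis
  proof (rule gval_cases[of s g])
    assume "gval \<rho> \<kappa> (2 * s, g) = \<zero>\<^bsub>R\<^esub>"
    then show ?thesis using gval_closed by simp
  next
    fix b assume b: "b \<in> carrier B" "gval \<rho> \<kappa> (2 * s, g) = E (\<rho> s) (\<kappa> s) b"
    show ?thesis
    proof (rule gval_cases'[of r g'])
      assume "gval \<rho> \<kappa> (2 * r + 1, g') = \<zero>\<^bsub>R\<^esub>"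
      then show ?thesis using gval_closed R.r_null by metis
    next
      fix c assume "c \<in> carrier B" "gval \<rho> \<kappa> (2 * r + 1, g') = E (\<kappa> r) (\<rho> (Suc r)) c"
      then show ?thesis unfolding b(2) using E_mult[OF less(1) less(2) less(2) less(1) b(1)] ne by simp
    qed
  qed
qed

lemma gval_WX: "\<rho> s \<noteq> \<rho> (Suc r) \<Longrightarrow> gval \<rho> \<kappa> (2 * r + 1, g') \<otimes>\<^bsub>R\<^esub> gval \<rho> \<kappa> (2 * s, g) = \<zero>\<^bsub>R\<^esub>"
proof -
  assume ne: "\<rho> s \<noteq> \<rho> (Suc r)"
  show ?thesis
  proof (rule gval_cases[of s g])
    assume "gval \<rho> \<kappa> (2 * s, g) = \<zero>\<^bsub>R\<^esub>"
    then show ?thesis using gval_closed R.r_null by metis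
  next
    fix b assume b: "b \<in> carrier B" "gval \<rho> \<kappa> (2 * s, g) = E (\<rho> s) (\<kappa> s) b"
    show ?thesis
    proof (rule gval_cases'[of r g'])
      assume "gval \<rho> \<kappa> (2 * r + 1, g') = \<zero>\<^bsub>R\<^esub>"
      then show ?thesis using gval_closed R.l_null by metis
    next
      fix c assume c: "c \<in> carrier B" "gval \<rho> \<kappa> (2 * r + 1, g') = E (\<kappa> r) (\<rho> (Suc r)) c"
      show ?thesis unfolding b(2) c(2) using E_mult[OF less(2) less(1) less(1) less(2) c(1) b(1)] ne by simp
    qed
  qed
qed

context
  fixes N :: nat and dx dw :: "nat \<Rightarrow> 'g"
  assumes dx: "\<And>r. r < N \<Longrightarrow> dx r \<in> carrier G" "\<And>r. r < N \<Longrightarrow> entry_deg (dx r) (\<rho> r) (\<kappa> r) \<in> D.H"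
    and dw: "\<And>r. r < N \<Longrightarrow> dw r \<in> carrier G" "\<And>r. r < N \<Longrightarrow> entry_deg (dw r) (\<kappa> r) (\<rho> (Suc r)) \<in> D.H"
begin

abbreviation "gword m \<equiv> eval_word R (gval \<rho> \<kappa>) (concat (map (\<lambda>r. [(2 * r, dx r), (2 * r + 1, dw r)]) [m..<N]))"
abbreviation "aword \<pi> \<equiv> eval_word R (gval \<rho> \<kappa>) (alt_word N (\<lambda>r. (2 * r, dx r)) (\<lambda>r. (2 * r + 1, dw r)) \<pi>)"

definition unit_at :: "nat \<Rightarrow> nat \<Rightarrow> 'b mat \<Rightarrow> bool" where
  "unit_at i j y \<longleftrightarrow> i < n \<and> j < n \<and> bl i = k \<and> bl j = k \<and> (\<exists>b\<in>Units B. y = E i j b)"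

lemma unit_at_mult: "unit_at i j y \<Longrightarrow> unit_at j m z \<Longrightarrow> unit_at i m (y \<otimes>\<^bsub>R\<^esub> z)"
proof -
  assume "unit_at i j y" "unit_at j m z"
  then obtain b c where bc: "b \<in> Units B" "c \<in> Units B" "y = E i j b" "z = E j m c"
    and ijm: "i < n" "j < n" "m < n" "bl i = k" "bl m = k"
    unfolding unit_at_def by blast
  have "y \<otimes>\<^bsub>R\<^esub> z = E i m (b \<otimes> c)"
    unfolding bc(3,4) using bc(1,2) ijm by (simp add: E_mult D.B.Units_closed)
  then show ?thesis unfolding unit_at_def using ijm bc by blast
qed

lemma unit_at_one: "unit_at i j y \<Longrightarrow> y \<otimes>\<^bsub>R\<^esub> \<one>\<^bsub>R\<^esub> = y"
  unfolding unit_at_def using E_carrier D.B.Units_closed by auto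

lemma unit_at_X: "r < N \<Longrightarrow> unit_at (\<rho> r) (\<kappa> r) (gval \<rho> \<kappa> (2 * r, dx r))"
  unfolding unit_at_def gval_X[OF dx] using less blk D.u_Units[OF dx(2)] by auto

lemma unit_at_W: "r < N \<Longrightarrow> unit_at (\<kappa> r) (\<rho> (Suc r)) (gval \<rho> \<kappa> (2 * r + 1, dw r))"
  unfolding unit_at_def gval_W[OF dw] using less blk D.u_Units[OF dw(2)] by auto

lemma gword_unit: "m < N \<Longrightarrow> unit_at (\<rho> m) (\<rho> N) (gword m)"
  by (rule eval_alt_word_chain[where Q = unit_at and X = "\<lambda>r. (2 * r, dx r)" and W = "\<lambda>r. (2 * r + 1, dw r)"
        and v = "gval \<rho> \<kappa>" and \<kappa> = \<kappa>])
    (use unit_at_mult unit_at_one unit_at_X unit_at_W in auto)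

lemma gadget_word_zero:
  assumes "\<pi> permutes {0..<N}" "r < N" "\<kappa> (\<pi> r) \<noteq> \<kappa> r \<or> (r > 0 \<and> \<rho> (\<pi> r) \<noteq> \<rho> r)"
  shows "aword \<pi> = \<zero>\<^bsub>R\<^esub>"
  by (rule R.eval_alt_word_zero[where \<rho> = \<rho> and \<kappa> = \<kappa>])
    (use gval_closed gval_XW gval_WX assms in auto)

lemma gadget_eval_restrict:
  assumes S: "\<And>\<pi>. \<pi> permutes {0..<N} \<Longrightarrow> \<pi> \<notin> S \<Longrightarrow>
      \<exists>r<N. \<kappa> (\<pi> r) \<noteq> \<kappa> r \<or> (r > 0 \<and> \<rho> (\<pi> r) \<noteq> \<rho> r)"
    and S': "S \<subseteq> {\<pi>. \<pi> permutes {0..<N}}"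
  shows "eval_ncpoly R (gval \<rho> \<kappa>) (gadget N dx dw \<epsilon>) = (\<Oplus>\<^bsub>R\<^esub>\<pi>\<in>S. \<epsilon> \<pi> \<odot>\<^bsub>R\<^esub>
    aword \<pi>)"
  unfolding gadget_def R.eval_alt_poly[OF gval_closed]
proof (rule R.add.finprod_mono_neutral_cong_right)
  show "\<epsilon> \<pi> \<odot>\<^bsub>R\<^esub> aword \<pi> = \<zero>\<^bsub>R\<^esub>"
    if \<pi>: "\<pi> \<in> {\<pi>. \<pi> permutes {0..<N}} - S" for \<pi>
  proof -
    obtain r where "r < N" "\<kappa> (\<pi> r) \<noteq> \<kappa> r \<or> (r > 0 \<and> \<rho> (\<pi> r) \<noteq> \<rho> r)" using S \<pi> by blast
    then show ?thesis using gadget_word_zero[of \<pi> r] \<pi> R.smult_zero by simp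
  qed
qed (use S' gval_closed in \<open>auto simp: finite_permutations intro!: R.smult_closed R.eval_word_closed\<close>)

lemma gadget_eval_distinct:
  assumes N: "0 < N" and inj: "inj_on (\<lambda>r. (\<rho> r, \<kappa> r)) {0..<N}"
  shows "unit_at (\<rho> 0) (\<rho> N) (eval_ncpoly R (gval \<rho> \<kappa>) (gadget N dx dw signof))"
proof -
  have w: "aword id = gword 0"
    by (simp add: alt_word_def)
  have cl: "gword 0 \<in> carrier R" using gval_closed by (intro R.eval_word_closed)
  have "eval_ncpoly R (gval \<rho> \<kappa>) (gadget N dx dw signof) = (\<Oplus>\<^bsub>R\<^esub>\<pi>\<in>{id}. signof \<pi> \<odot>\<^bsub>R\<^esub>
    aword \<pi>)"
    using permutes_mismatch[OF _ _ inj] by (intro gadget_eval_restrict) (auto simp: permutes_id)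
  also have "\<dots> = gword 0"
  proof (subst R.finsum_one_elem)
    show "signof id \<odot>\<^bsub>R\<^esub>
      aword id \<in> carrier R"
      unfolding w using cl by (rule R.smult_closed)
    show "signof id \<odot>\<^bsub>R\<^esub>
      aword id = gword 0"
      unfolding w signof_id using cl by (rule R.smult_1)
  qed
  finally show ?thesis using gword_unit[OF N] by simp
qed

text \<open>The alternating variables 0 and 1 share a diagonal position, with the unit between them.
  The two surviving permutations give u_a u_b r and -c u_b u_a r, where a and b are their degrees;
  commuting the second into the first leaves the factor 1 - c \<beta>(b, a).\<close>

lemma gadget_eval_double:
  assumes N: "2 \<le> N" and inj: "inj_on (\<lambda>r. (\<rho> r, \<kappa> r)) {1..<N}"
    and eq: "\<rho> 0 = \<kappa> 0" "\<rho> 1 = \<rho> 0" "\<kappa> 1 = \<kappa> 0" and dw0: "dw 0 = \<one>\<^bsub>G\<^esub>"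
    and h: "dx 0 \<in> D.H" "dx 1 \<in> D.H"
    and \<epsilon>: "\<epsilon> id = 1" "\<epsilon> (transpose 0 1) = - c" "c * D.\<beta> (dx 1) (dx 0) \<noteq> 1"
  shows "unit_at (\<rho> 0) (\<rho> N) (eval_ncpoly R (gval \<rho> \<kappa>) (gadget N dx dw \<epsilon>))"
proof -
  let ?X = "\<lambda>r. (2 * r, dx r)" and ?W = "\<lambda>r. (2 * r + 1, dw r)"
  let ?p = "\<rho> 0" and ?v = "gval \<rho> \<kappa>"
  let ?a = "D.u (dx 0)" and ?b = "D.u (dx 1)"
  \<comment> \<open>The tail shared by both surviving words, after the two alternating variables and
    the unit between them.\<close>
  define rest where "rest = eval_word R ?v (?W 1 # concat (map (\<lambda>r. [?X r, ?W r]) [2..<N]))"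
  have "unit_at (\<kappa> 1) (\<rho> N) rest"
  proof (cases "N = 2")
    case True
    then show ?thesis unfolding rest_def using unit_at_W[of 1] unit_at_one[OF unit_at_W[of 1]]
      by (simp add: numeral_2_eq_2)
  next
    case False
    then have "unit_at (\<rho> 2) (\<rho> N) (gword 2)" using gword_unit[of 2] N by simp
    then show ?thesis unfolding rest_def
      using unit_at_mult[OF unit_at_W[of 1], of "\<rho> N" "gword 2"] N by (simp add: numeral_2_eq_2)
  qed
  then obtain r where r: "r \<in> Units B" "rest = E ?p (\<rho> N) r" using eq unfolding unit_at_def by auto
  have p: "?p < n" "\<rho> N < n" "gs ! ?p \<in> carrier G" using less gs_carrier by auto
  have H1: "dx 0 \<in> carrier G" "dx 1 \<in> carrier G" using h D.H_carrier by auto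
  have cn: "entry_deg g ?p ?p = g" if "g \<in> carrier G" for g
    using that p by (simp add: D.G.m_assoc D.G.m_comm[of g]) (simp add: D.G.m_assoc[symmetric])
  have vX: "?v (?X 0) = E ?p ?p ?a" "?v (?X 1) = E ?p ?p ?b"
    using gval_X[of "dx 0" 0] gval_X[of "dx 1" 1] eq h H1 cn by simp_all
  have vW: "?v (?W 0) = E ?p ?p \<one>"
    using gval_W[of "\<one>\<^bsub>G\<^esub>" 0] eq dw0 cn[of "\<one>\<^bsub>G\<^esub>"] D.H_one by simp
  have cl: "?a \<in> carrier B" "?b \<in> carrier B" "r \<in> carrier B" using h D.u_closed r by auto
  have up: "[0..<N] = 0 # 1 # [2..<N]" using N by (simp add: upt_conv_Cons numeral_2_eq_2)
  have w1: "alt_word N ?X ?W id = ?X 0 # ?W 0 # ?X 1 # ?W 1 # concat (map (\<lambda>r. [?X r, ?W r]) [2..<N])"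
    unfolding alt_word_def up by simp
  have "map (\<lambda>r. [?X (transpose 0 1 r), ?W r]) [2..<N] = map (\<lambda>r. [?X r, ?W r]) [2..<N]"
    by (intro map_cong refl) (auto simp: transpose_def)
  then have w2: "alt_word N ?X ?W (transpose 0 1) =
    ?X 1 # ?W 0 # ?X 0 # ?W 1 # concat (map (\<lambda>r. [?X r, ?W r]) [2..<N])"
    unfolding alt_word_def up list.map concat.simps append.simps by (simp only: transpose_apply_first transpose_apply_second)
  have e1: "eval_word R ?v (alt_word N ?X ?W id) = E ?p (\<rho> N) (?a \<otimes> (?b \<otimes> r))"
    unfolding w1 using r(2)[unfolded rest_def] vX vW cl p by (simp add: E_mult)
  have e2: "eval_word R ?v (alt_word N ?X ?W (transpose 0 1)) = E ?p (\<rho> N) (?b \<otimes> (?a \<otimes> r))"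
    unfolding w2 using r(2)[unfolded rest_def] vX vW cl p by (simp add: E_mult)
  have "?b \<otimes> (?a \<otimes> r) = D.\<beta> (dx 1) (dx 0) \<odot> (?a \<otimes> (?b \<otimes> r))"
    using cl D.u_commute[OF h(2,1)] by (simp add: D.B.m_assoc[symmetric] D.B.smult_mult_left)
  then have e3: "E ?p (\<rho> N) (?b \<otimes> (?a \<otimes> r)) =
    D.\<beta> (dx 1) (dx 0) \<odot>\<^bsub>R\<^esub> E ?p (\<rho> N) (?a \<otimes> (?b \<otimes> r))" (is "_ = _ \<odot>\<^bsub>R\<^esub> ?Z")
    using cl by (intro M_eqI) (auto simp: E_dim R_simps M_dim M_entry E_entry D.B.smult_closed D.B.smult_zero)
  have Z: "?Z \<in> carrier R" using cl blk by (intro E_carrier) auto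
  have ne: "id \<noteq> (transpose 0 1 :: nat \<Rightarrow> nat)"
  proof
    assume "id = (transpose 0 1 :: nat \<Rightarrow> nat)"
    then have "id 0 = (transpose 0 1 :: nat \<Rightarrow> nat) 0" by (rule fun_cong)
    then show False by simp
  qed
  have "eval_ncpoly R ?v (gadget N dx dw \<epsilon>) = (\<Oplus>\<^bsub>R\<^esub>\<pi>\<in>{id, transpose 0 1}. \<epsilon> \<pi> \<odot>\<^bsub>R\<^esub>
    eval_word R ?v (alt_word N ?X ?W \<pi>))"
  proof (rule gadget_eval_restrict)
    show "\<exists>r<N. \<kappa> (\<pi> r) \<noteq> \<kappa> r \<or> (r > 0 \<and> \<rho> (\<pi> r) \<noteq> \<rho> r)"
      if "\<pi> permutes {0..<N}" "\<pi> \<notin> {id, transpose 0 1}" for \<pi>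
      by (rule permutes_mismatch_double[OF that(1) _ _ inj _ _ N]) (use that(2) eq in simp_all)
    have "transpose 0 1 permutes {0..<N}" using N by (intro permutes_swap_id) simp_all
    then show "{id, transpose 0 1} \<subseteq> {\<pi>. \<pi> permutes {0..<N}}" by (simp add: permutes_id)
  qed
  also have "\<dots> = 1 \<odot>\<^bsub>R\<^esub> ?Z \<oplus>\<^bsub>R\<^esub> (- c) \<odot>\<^bsub>R\<^esub> (D.\<beta> (dx 1) (dx 0) \<odot>\<^bsub>R\<^esub> ?Z)"
  proof -
    have "(\<Oplus>\<^bsub>R\<^esub>\<pi>\<in>{id, transpose 0 1}. f \<pi>) = f id \<oplus>\<^bsub>R\<^esub> f (transpose 0 1)"
      if "f id \<in> carrier R" "f (transpose 0 1) \<in> carrier R" for f :: "(nat \<Rightarrow> nat) \<Rightarrow> 'b mat"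
      using that ne by simp
    from this[of "\<lambda>\<pi>. \<epsilon> \<pi> \<odot>\<^bsub>R\<^esub> eval_word R ?v (alt_word N ?X ?W \<pi>)"] show ?thesis
      unfolding e1 e2 e3 \<epsilon>(1,2) using Z R.smult_closed by blast
  qed
  also have "\<dots> = (1 - c * D.\<beta> (dx 1) (dx 0)) \<odot>\<^bsub>R\<^esub> ?Z"
    using Z R.smult_add_left[OF Z, of 1 "- c * D.\<beta> (dx 1) (dx 0)"] by (simp add: R.smult_smult)
  also have "\<dots> = E ?p (\<rho> N) ((1 - c * D.\<beta> (dx 1) (dx 0)) \<odot> (?a \<otimes> (?b \<otimes> r)))"
    using cl by (intro M_eqI) (auto simp: E_dim R_simps M_dim M_entry E_entry D.B.smult_closed D.B.smult_zero)
  finally have ev: "eval_ncpoly R ?v (gadget N dx dw \<epsilon>) =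
    E ?p (\<rho> N) ((1 - c * D.\<beta> (dx 1) (dx 0)) \<odot> (?a \<otimes> (?b \<otimes> r)))" .
  have U: "?a \<otimes> (?b \<otimes> r) \<in> Units B" using h D.u_Units r by simp
  have "d \<odot> y \<in> Units B" if d: "d \<noteq> 0" and y: "y \<in> Units B" for d y
  proof -
    have yc: "y \<in> carrier B" "inv y \<in> carrier B" using y by auto
    have "(d \<odot> y) \<otimes> (inverse d \<odot> inv y) = \<one>" "(inverse d \<odot> inv y) \<otimes> (d \<odot> y) = \<one>"
      using d y yc by (simp_all add: D.B.smult_mult_smult D.B.Units_r_inv D.B.Units_l_inv D.B.smult_1)
    then show ?thesis using yc D.B.smult_closed unfolding Units_def by blast
  qed
  then have "(1 - c * D.\<beta> (dx 1) (dx 0)) \<odot> (?a \<otimes> (?b \<otimes> r)) \<in> Units B" using U \<epsilon>(3) by simp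
  then show ?thesis unfolding ev unit_at_def using less blk by blast
qed

end

end

end

lemma sorted_filter_pair:
  fixes p q N :: nat
  assumes "p < q" "q < N"
  shows "filter (\<lambda>r. r = p \<or> r = q) [0..<N] = [p, q]"
proof (rule sorted_distinct_set_unique)
  show "set (filter (\<lambda>r. r = p \<or> r = q) [0..<N]) = set [p, q]" using assms by auto
qed (use assms in \<open>auto simp: sorted_wrt_filter\<close>)

text \<open>Letters of trivial degree evaluate to the unit, so only the letters with indices 0 and 1
  remain, in the order in which \<pi> places them.\<close>

lemma (in graded_division) word_two:
  assumes \<pi>: "\<pi> permutes {0..<N}" and N: "2 \<le> N"
    and dx: "\<And>r. 2 \<le> r \<Longrightarrow> dx r = \<one>" "dx 0 \<in> H" "dx 1 \<in> H"
  shows "eval_word B u (concat (map (\<lambda>r. [dx (\<pi> r), \<one>]) [0..<N])) =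
    (if inv_into UNIV \<pi> 0 < inv_into UNIV \<pi> 1 then u (dx 0) \<otimes>\<^bsub>B\<^esub> u (dx 1) else u (dx 1) \<otimes>\<^bsub>B\<^esub> u (dx 0))"
proof -
  have dxH: "dx r \<in> H" for r
    using dx(1)[of r] dx(2,3) H_one by (cases "r = 0"; cases "r = 1") auto
  have skip: "eval_word B u (concat (map (\<lambda>r. [dx (\<pi> r), \<one>]) rs)) =
    eval_word B u (map (\<lambda>r. dx (\<pi> r)) (filter (\<lambda>r. \<pi> r < 2) rs))" for rs
  proof (induction rs)
    case (Cons r rs)
    have "eval_word B u (map (\<lambda>r. dx (\<pi> r)) (filter (\<lambda>r. \<pi> r < 2) rs)) \<in> carrier B"
      using dxH u_closed by (intro B.eval_word_closed) auto
    then show ?case using Cons dx(1)[of "\<pi> r"] u_closed[OF dxH[of "\<pi> r"]] by simp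
  qed simp
  let ?p = "inv_into UNIV \<pi> 0" and ?q = "inv_into UNIV \<pi> 1"
  have pq: "\<pi> ?p = 0" "\<pi> ?q = 1" using permutes_surj[OF \<pi>] by (simp_all add: surj_f_inv_f)
  have "?p \<noteq> ?q" using pq by auto
  have less: "r < N" if "\<pi> r < N" for r
  proof (rule ccontr)
    assume "\<not> r < N"
    then show False using that permutes_not_in[OF \<pi>, of r] by simp
  qed
  have pqN: "?p < N" "?q < N" using less[of ?p] less[of ?q] pq N by simp_all
  have inj: "\<pi> r = \<pi> s \<longleftrightarrow> r = s" for r s using permutes_inj[OF \<pi>] by (simp add: inj_eq)
  have small: "\<pi> r < 2 \<longleftrightarrow> r = ?p \<or> r = ?q" for r
    using inj[of r ?p] inj[of r ?q] unfolding pq by (auto simp: less_2_cases_iff)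
  show ?thesis
  proof (cases "?p < ?q")
    case True
    have "filter (\<lambda>r. \<pi> r < 2) [0..<N] = [?p, ?q]"
      unfolding small by (rule sorted_filter_pair[OF True pqN(2)])
    then show ?thesis unfolding skip using True pq u_closed dx by simp
  next
    case False
    then have "?q < ?p" using \<open>?p \<noteq> ?q\<close> by simp
    then have "filter (\<lambda>r. r = ?q \<or> r = ?p) [0..<N] = [?q, ?p]" using pqN by (intro sorted_filter_pair)
    then have "filter (\<lambda>r. \<pi> r < 2) [0..<N] = [?q, ?p]" unfolding small by (simp add: disj_commute)
    then show ?thesis unfolding skip using False pq u_closed dx by simp
  qed
qed

lemma (in block_tensor) cls_lessI: "i \<in> cls a \<Longrightarrow> i < n"
  and cls_blI: "i \<in> cls a \<Longrightarrow> bl i = bl a"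
  unfolding cls_def by auto

lemma (in block_tensor) unit_atD:
  assumes "\<And>r. \<rho> r < n" "\<And>r. \<kappa> r < n" "\<And>r. bl (\<rho> r) = k" "\<And>r. bl (\<kappa> r) = k"
    and u: "unit_at k i j y"
  shows "\<exists>b\<in>Units B. y = E i j b"
proof -
  \<comment> \<open>The definition carries the degree conditions of the context in which it was
    made; N = 0 makes them vacuous.\<close>
  have "unit_at k i j y \<longleftrightarrow> i < n \<and> j < n \<and> bl i = k \<and> bl j = k \<and> (\<exists>b\<in>Units B. y = E i j b)"
    by (rule unit_at_def[OF assms(1-4), where N = 0]) simp_all
  from iffD1[OF this u] show ?thesis by (elim conjE)
qed

lemma fresh_variable: "\<exists>i. (i, g) \<notin> ncvars (f :: (nat \<times> 'g, 'k::zero) ncpoly)"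
proof -
  have "finite (fst ` ncvars f)" unfolding ncvars_def by simp
  then obtain i where "i \<notin> fst ` ncvars f" using ex_new_if_finite infinite_UNIV_nat by blast
  then show ?thesis by (intro exI[of _ i]) force
qed

text \<open>Pairs in P are enumerated by their digits in base s. Reduction modulo s * s is the
  identity on the stated range and keeps the first coordinate inside P for all larger
  arguments.\<close>

lemma two_index_inj:
  fixes s :: nat
  assumes e: "bij_betw e {0..<s} P"
  shows "inj_on (\<lambda>r. (e ((r mod (s * s)) div s), e (r mod s))) {0..<s * s}"
proof (rule inj_onI)
  fix x y
  assume xy: "x \<in> {0..<s * s}" "y \<in> {0..<s * s}"
    and eq: "(e ((x mod (s * s)) div s), e (x mod s)) = (e ((y mod (s * s)) div s), e (y mod s))"
  have s: "s > 0" using xy by (cases s) auto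
  have inj: "inj_on e {0..<s}" using e unfolding bij_betw_def by blast
  have "x div s < s" "y div s < s" using xy by (simp_all add: less_mult_imp_div_less)
  then have "x div s = y div s" using eq xy inj_onD[OF inj, of "x div s" "y div s"] by simp
  moreover have "x mod s = y mod s" using eq s inj_onD[OF inj, of "x mod s" "y mod s"] by simp
  ultimately show "x = y" by (metis div_mult_mod_eq)
qed

section \<open>Comparison of two algebras with the same graded identities\<close>

locale two_block_tensors =
  A: block_tensor G B ds gs + A': block_tensor G B' ds' gs'
  for G :: "('g, 'n) monoid_scheme" (structure)
    and B :: "('k::{alg_closed_field, field_char_0}, 'b, 'g) gr_algebra" and ds gs
    and B' :: "('k, 'c, 'g) gr_algebra" and ds' gs' +
  assumes Id: "graded_identities G (UT_tensor G ds gs B) = graded_identities G (UT_tensor G ds' gs' B')"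
begin

text \<open>If f were invisible for R', its product with one further variable would have a power
  that is an identity of R', hence of R, where the given value forbids it. The exponent is the
  number of blocks of R', the algebra on which f is assumed invisible.\<close>

lemma transfer:
  assumes f: "f \<in> graded_ncpolys G"
    and v: "A.admissible v" "a < A.n" "b < A.n" "A.bl a = A.bl b"
      "c \<in> Units B" "eval_ncpoly A.R v f = A.E a b c"
  shows "A'.visible f"
proof (rule ccontr)
  assume nv: "\<not> A'.visible f"
  let ?g = "gs ! b \<otimes> inv (gs ! a)"
  obtain i where i: "(i, ?g) \<notin> ncvars f" using fresh_variable[of ?g f] by (elim exE)
  have g: "?g \<in> carrier G"
    by (intro A.D.G.m_closed A.D.G.inv_closed A.gs_carrier v(2,3))
  have len: "length ds' > 0" using A'.ds(1) by simp
  show False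
    using A.unit_value_not_identity[OF v(1-6) i len] A'.not_visible_identity[OF nv f g, of i]
    unfolding Id by (rule notE)
qed

lemma transfer':
  assumes f: "f \<in> graded_ncpolys G"
    and v: "A'.admissible v" "a < A'.n" "b < A'.n" "A'.bl a = A'.bl b"
      "c \<in> Units B'" "eval_ncpoly A'.R v f = A'.E a b c"
  shows "A.visible f"
proof (rule ccontr)
  assume nv: "\<not> A.visible f"
  let ?g = "gs' ! b \<otimes> inv (gs' ! a)"
  obtain i where i: "(i, ?g) \<notin> ncvars f" using fresh_variable[of ?g f] by (elim exE)
  have g: "?g \<in> carrier G"
    by (intro A.D.G.m_closed A.D.G.inv_closed A'.gs_carrier v(2,3))
  have len: "length ds > 0" using A.ds(1) by simp
  show False
    using A'.unit_value_not_identity[OF v(1-6) i len] A.not_visible_identity[OF nv f g, of i]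
    unfolding Id by (rule notE)
qed

end

lemma index_less:
  fixes s :: nat
  assumes "0 < s"
  shows "(r mod (s * s)) div s < s" "r mod s < s"
  using assms by (simp_all add: less_mult_imp_div_less)

context two_block_tensors
begin

definition s where "s = Max ((\<lambda>a. card (A.cls a)) ` {..<A.n})"

lemma A_n_pos: "0 < A.n"
  using A.ds by (cases ds) auto

lemma s_attained:
  obtains a where "a < A.n" "card (A.cls a) = s"
proof -
  have "s \<in> (\<lambda>a. card (A.cls a)) ` {..<A.n}"
    unfolding s_def using A_n_pos by (intro Max_in) auto
  then show ?thesis using that by auto
qed

lemma s_max: "a < A.n \<Longrightarrow> card (A.cls a) \<le> s"
  unfolding s_def by (intro Max_ge) auto

lemma s_pos: "0 < s"
proof -
  obtain a where "a < A.n" "card (A.cls a) = s" by (rule s_attained)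
  then show ?thesis using A.cls_refl[of a] A.cls_finite[of a] by (metis card_gt_0_iff empty_iff)
qed

lemma not_visible_large:
  assumes "\<And>r. r < s * s + 1 \<Longrightarrow> dx r \<in> A.D.H" "\<And>r. r < s * s + 1 \<Longrightarrow> dw r \<in> A.D.H" "U0 \<in> carrier B"
    and "\<And>\<pi>. \<pi> permutes {0..<s * s + 1} \<Longrightarrow>
      \<epsilon> \<pi> \<odot>\<^bsub>B\<^esub> eval_word B A.D.u (concat (map (\<lambda>r. [dx (\<pi> r), dw r]) [0..<s * s + 1])) = signof \<pi> \<odot>\<^bsub>B\<^esub> U0"
  shows "\<not> A.visible (gadget (s * s + 1) dx dw \<epsilon>)"
proof
  assume "A.visible (gadget (s * s + 1) dx dw \<epsilon>)"
  then obtain v a b where v: "A.admissible v" "a < A.n" "b < A.n" "A.bl a = A.bl b"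
    "eval_ncpoly A.R v (gadget (s * s + 1) dx dw \<epsilon>) $$ (a, b) \<noteq> \<zero>\<^bsub>B\<^esub>"
    unfolding A.visible_def by blast
  have "card (A.cls a) * card (A.cls a) < s * s + 1"
    using mult_le_mono[OF s_max[OF v(2)] s_max[OF v(2)]] by simp
  then have "eval_ncpoly A.R v (gadget (s * s + 1) dx dw \<epsilon>) $$ (a, b) = \<zero>\<^bsub>B\<^esub>"
    by (intro A.gadget_vanishes[OF _ _ assms(3) _ v(1-4)] assms)
  then show False using v(5) by blast
qed

text \<open>On R the Capelli polynomial of the s * s positions of a largest class, followed by a
  variable of degree h, takes an invertible value in one position. So it is visible on R'. There the
  alternating factor forces a class with at least s rows, and the last variable leads from this
  class to a row b of the same block.\<close>

lemma linked_class:
  assumes h: "h \<in> A.D.H"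
  obtains a l b where "a < A'.n" "l \<in> A'.cls a" "b < A'.n" "A'.bl b = A'.bl a" "s \<le> card (A'.cls a)"
    "A'.entry_deg h l b \<in> A'.D.H"
proof -
  obtain a0 where a0: "a0 < A.n" "card (A.cls a0) = s" by (rule s_attained)
  obtain e where e: "bij_betw e {0..<s} (A.cls a0)"
    using ex_bij_betw_nat_finite[OF A.cls_finite] a0(2) by metis
  have e_cls: "e i \<in> A.cls a0" if "i < s" for i using e that unfolding bij_betw_def by auto
  define \<rho> where "\<rho> r = e ((r mod (s * s)) div s)" for r
  define \<kappa> where "\<kappa> r = e (r mod s)" for r
  let ?N = "s * s" and ?d = "\<lambda>_::nat. \<one>"
  have N: "0 < ?N" using s_pos by simp
  have cl: "\<rho> r \<in> A.cls a0" "\<kappa> r \<in> A.cls a0" for r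
    unfolding \<rho>_def \<kappa>_def using e_cls index_less[OF s_pos] by auto
  have less: "\<rho> r < A.n" "\<kappa> r < A.n" and blk: "A.bl (\<rho> r) = A.bl a0" "A.bl (\<kappa> r) = A.bl a0" for r
    using cl[of r] A.cls_lessI A.cls_blI by auto
  have hG: "h \<in> carrier G" using A.D.H_carrier h by blast
  have degH: "A.entry_deg g i j \<in> A.D.H"
    if "i \<in> A.cls a0" "j \<in> A.cls a0" "g \<in> A.D.H" for i j g
  proof -
    have "gs ! i \<in> carrier G" "gs ! j \<in> carrier G" using that A.cls_lessI A.gs_carrier by auto
    then show ?thesis using A.deg_H[OF _ _ that(3)] A.cls_H[OF a0(1) that(1,2)] by blast
  qed
  let ?v = "A.gval \<rho> \<kappa>"
  have "A.unit_at (A.bl a0) (\<rho> 0) (\<rho> ?N) (eval_ncpoly A.R ?v (gadget ?N ?d ?d signof))"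
  proof (rule A.gadget_eval_distinct)
    show "inj_on (\<lambda>r. (\<rho> r, \<kappa> r)) {0..<?N}" unfolding \<rho>_def \<kappa>_def by (rule two_index_inj[OF e])
  qed (use less blk N degH[OF cl(1) cl(2) A.D.H_one] degH[OF cl(2) cl(1) A.D.H_one] in auto)
  from A.unit_atD[OF less blk this]
  obtain b where b: "b \<in> Units B" "eval_ncpoly A.R ?v (gadget ?N ?d ?d signof) = A.E (\<rho> 0) (\<rho> ?N) b"
    by (elim bexE)
  \<comment> \<open>The last variable continues the sequence of alternating variables at index s *
    s, where the position functions have wrapped around to the first position.\<close>
  define c where "c = A.D.u (A.entry_deg h (\<rho> ?N) (\<kappa> ?N))"
  have c: "c \<in> Units B" "?v (2 * ?N, h) = A.E (\<rho> ?N) (\<kappa> ?N) c"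
    unfolding c_def using A.D.u_Units[OF degH[OF cl(1) cl(2) h]] A.gval_X[OF less blk hG degH[OF cl(1) cl(2) h]]
    by simp_all
  let ?f = "ncmult (gadget ?N ?d ?d signof) (Poly_Mapping.single [(2 * ?N, h)] 1) :: (nat \<times> 'g, 'k) ncpoly"
  have adm: "A.admissible ?v" by (rule A.gval_admissible[OF less blk])
  have vc: "\<And>x. ?v x \<in> carrier A.R" using A.admissible_closed[OF adm] .
  have ev: "eval_ncpoly A.R ?v ?f = A.E (\<rho> 0) (\<kappa> ?N) (b \<otimes>\<^bsub>B\<^esub> c)"
    using vc b c less
    by (simp add: A.R.eval_ncpoly_ncmult A.R.eval_ncpoly_single A.R.smult_1 A.E_mult A.D.B.Units_closed
        A.E_carrier blk)
  have g1: "gadget ?N ?d ?d signof \<in> graded_ncpolys G" for \<epsilon> :: "(nat \<Rightarrow> nat) \<Rightarrow> 'k"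
    by (rule gadget_graded) simp_all
  have "ncvars ?f \<subseteq> ncvars (gadget ?N ?d ?d (signof :: _ \<Rightarrow> 'k)) \<union> {(2 * ?N, h)}"
    using ncvars_ncmult ncvars_single[of "[(2 * ?N, h)]" "1::'k"] by fastforce
  then have "snd ` ncvars ?f \<subseteq> snd ` (ncvars (gadget ?N ?d ?d (signof :: _ \<Rightarrow> 'k)) \<union> {(2 * ?N, h)})" by (rule image_mono)
  also have "\<dots> \<subseteq> carrier G" using g1 hG unfolding graded_ncpolys_iff by auto
  finally have fg: "?f \<in> graded_ncpolys G" unfolding graded_ncpolys_iff .
  have "A'.visible ?f"
    by (rule transfer[OF fg adm less(1) less(2) _ _ ev]) (use blk b c in auto)
  then obtain v a b where v: "A'.admissible v" "a < A'.n" "b < A'.n" "A'.bl a = A'.bl b"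
    "eval_ncpoly A'.R v ?f $$ (a, b) \<noteq> \<zero>\<^bsub>B'\<^esub>"
    unfolding A'.visible_def by blast
  have vR: "\<And>x. v x \<in> carrier A'.R" using A'.admissible_closed[OF v(1)] .
  let ?y = "eval_ncpoly A'.R v (gadget ?N ?d ?d signof)" and ?z = "v (2 * ?N, h)"
  have yR: "?y \<in> carrier A'.R" using vR by (rule A'.R.eval_ncpoly_closed)
  have yz: "?y $$ (a, l) \<in> carrier B'" "?z $$ (l, b) \<in> carrier B'" if "l < A'.n" for l
    using yR vR[of "(2 * ?N, h)"] that v unfolding A'.R_carrier by auto
  have "eval_ncpoly A'.R v ?f $$ (a, b) = (\<Oplus>\<^bsub>B'\<^esub>l\<in>{..<A'.n}. ?y $$ (a, l) \<otimes>\<^bsub>B'\<^esub> ?z $$ (l, b))"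
    using vR v by (simp add: A'.R.eval_ncpoly_ncmult A'.R.eval_ncpoly_single A'.R.smult_1 A'.R_entry)
  then have "\<exists>l<A'.n. ?y $$ (a, l) \<otimes>\<^bsub>B'\<^esub> ?z $$ (l, b) \<noteq> \<zero>\<^bsub>B'\<^esub>"
  proof -
    assume eq: "eval_ncpoly A'.R v ?f $$ (a, b) = (\<Oplus>\<^bsub>B'\<^esub>l\<in>{..<A'.n}. ?y $$ (a, l) \<otimes>\<^bsub>B'\<^esub> ?z $$ (l, b))"
    show ?thesis
    proof (rule ccontr)
      assume "\<not> ?thesis"
      then have "(\<Oplus>\<^bsub>B'\<^esub>l\<in>{..<A'.n}. ?y $$ (a, l) \<otimes>\<^bsub>B'\<^esub> ?z $$ (l, b)) = (\<Oplus>\<^bsub>B'\<^esub>l\<in>{..<A'.n}. \<zero>\<^bsub>B'\<^esub>)"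
        by (intro A'.D.B.finsum_cong') auto
      then show False using eq v(5) by simp
    qed
  qed
  then obtain l where l: "l < A'.n" "?y $$ (a, l) \<otimes>\<^bsub>B'\<^esub> ?z $$ (l, b) \<noteq> \<zero>\<^bsub>B'\<^esub>" by blast
  have y0: "?y $$ (a, l) \<noteq> \<zero>\<^bsub>B'\<^esub>" and z0: "?z $$ (l, b) \<noteq> \<zero>\<^bsub>B'\<^esub>" using l yz by auto
  have "A'.bl a \<le> A'.bl l" using y0 yR l v unfolding A'.R_carrier by blast
  moreover have "A'.bl l \<le> A'.bl b" using z0 vR[of "(2 * ?N, h)"] l v unfolding A'.R_carrier by blast
  ultimately have bl: "A'.bl a = A'.bl l" using v by simp
  \<comment> \<open>If either condition failed, the alternating factor would vanish at (a,
    l).\<close>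
  have key: "l \<in> A'.cls a \<and> \<not> card (A'.cls a) * card (A'.cls a) < ?N"
  proof (rule ccontr)
    assume c: "\<not> ?thesis"
    have "?y $$ (a, l) = \<zero>\<^bsub>B'\<^esub>"
    proof (rule A'.gadget_vanishes[OF A'.D.H_one A'.D.H_one _ _ v(1,2) l(1) bl])
      show "eval_word B' A'.D.u (concat (map (\<lambda>r. [\<one>, \<one>]) [0..<?N])) \<in> carrier B'"
        using A'.D.u_closed[OF A'.D.H_one] by (intro A'.D.B.eval_word_closed) (auto split: if_splits)
    qed (use c in auto)
    then show False using y0 by blast
  qed
  have "s \<le> card (A'.cls a)"
    using key mult_strict_mono[of "card (A'.cls a)" s "card (A'.cls a)" s] s_pos by linarith
  moreover have "A'.entry_deg h l b \<in> A'.D.H"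
  proof (rule A'.D.H_memI[OF _ _ z0])
    show "A'.entry_deg h l b \<in> carrier G" using A'.gs_carrier l v hG by simp
    have "?z \<in> hcomp A'.R h" using v(1) hG unfolding A'.admissible_def by blast
    then show "?z $$ (l, b) \<in> hcomp B' (A'.entry_deg h l b)"
      unfolding A'.hcomp_iff[OF hG] using l v bl by auto
  qed
  ultimately show ?thesis using that[of a l b] v key by simp
qed

lemma subset_enum:
  assumes "s \<le> card (A'.cls a)"
  obtains e P where "bij_betw e {0..<s} P" "P \<subseteq> A'.cls a"
proof -
  obtain P where P: "P \<subseteq> A'.cls a" "card P = s" "finite P"
    using obtain_subset_with_card_n[OF assms] by metis
  obtain e where e: "bij_betw e {0..<s} P" using ex_bij_betw_nat_finite[OF P(3)] unfolding P(2) by (elim exE)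
  show ?thesis by (rule that[OF e P(1)])
qed

text \<open>If h were not in the support of B', the row b linked to the large class by degree h
  would lie outside that class. The s * s positions of the class, a step of degree h, and the
  position (b, b) then make s * s + 1 distinct positions, so the Capelli polynomial has an
  invertible value on R'. On R all its degrees lie in H and it has too many variables to be
  visible.\<close>

lemma supp_subset: "A.D.H \<subseteq> A'.D.H"
proof
  fix h assume h: "h \<in> A.D.H"
  have hG: "h \<in> carrier G" using A.D.H_carrier h by blast
  obtain a l b where a: "a < A'.n" and l: "l \<in> A'.cls a" and b: "b < A'.n" "A'.bl b = A'.bl a"
    and card: "s \<le> card (A'.cls a)" and deg: "A'.entry_deg h l b \<in> A'.D.H"
    by (rule linked_class[OF h])
  have gG: "gs' ! i \<in> carrier G" if "i < A'.n" for i using that A'.gs_carrier by blast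
  have lG: "l < A'.n" using l A'.cls_lessI by blast
  obtain e P where e: "bij_betw e {0..<s} P" "P \<subseteq> A'.cls a"
    by (rule subset_enum[OF card])
  have e_cls: "e i \<in> A'.cls a" if "i < s" for i
    by (rule subsetD[OF e(2) bij_betwE[OF e(1), rule_format]]) (simp add: that)
  show "h \<in> A'.D.H"
  proof (rule ccontr)
    assume hH: "h \<notin> A'.D.H"
    have link: "A'.entry_deg h i b \<in> A'.D.H" if i: "i \<in> A'.cls a" for i
    proof -
      have "A'.entry_deg h i b =
        (inv (gs' ! i) \<otimes> gs' ! l) \<otimes> (A'.entry_deg h l b)"
        using gG[OF A'.cls_lessI[OF i]] gG[OF lG] gG[OF b(1)] hG
        by (simp add: A.D.G.m_assoc) (simp add: A.D.G.m_assoc[symmetric])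
      then show ?thesis using A'.cls_H[OF a i l] deg A'.D.H_mult by simp
    qed
    have bP: "b \<notin> A'.cls a"
    proof
      assume "b \<in> A'.cls a"
      then have "A'.entry_deg h b b \<in> A'.D.H" by (rule link)
      moreover have "A'.entry_deg h b b = h \<otimes> (inv (gs' ! b) \<otimes> gs' ! b)"
        using gG[OF b(1)] hG by (simp only: A.D.G.m_ac A.D.G.inv_closed A.D.G.m_closed)
      ultimately show False using gG[OF b(1)] hG hH by simp
    qed
    let ?N = "s * s + 1"
    \<comment> \<open>All pairs from the class come first and (b, b) last; the connecting variable
      at index s * s - 1 is the one that leaves the class and therefore gets degree h.\<close>
    define \<rho> where "\<rho> r = (if r < s * s then e ((r mod (s * s)) div s) else b)" for r
    define \<kappa> where "\<kappa> r = (if r < s * s then e (r mod s) else b)" for r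
    let ?dx = "\<lambda>_::nat. \<one>"
    define dw where "dw r = (if r = s * s - 1 then h else \<one>)" for r
    have cl: "\<rho> r \<in> A'.cls a" "\<kappa> r \<in> A'.cls a" if "r < s * s" for r
      unfolding \<rho>_def \<kappa>_def using e_cls[OF index_less(1)[OF s_pos]] e_cls[OF index_less(2)[OF s_pos]] that
      by (simp_all del: mod_less)
    have less: "\<rho> r < A'.n" "\<kappa> r < A'.n" and blk: "A'.bl (\<rho> r) = A'.bl a" "A'.bl (\<kappa> r) = A'.bl a" for r
      using cl[of r] A'.cls_lessI A'.cls_blI b unfolding \<rho>_def \<kappa>_def by (cases "r < s * s"; auto)+
    have one: "A'.entry_deg \<one> i j \<in> A'.D.H"
      if "i \<in> A'.cls a \<and> j \<in> A'.cls a \<or> i = b \<and> j = b" for i j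
      using that A'.cls_H[OF a, of i j] gG[OF b(1)] gG[OF A'.cls_lessI[of i a]] A'.D.H_one by auto
    have N0: "0 < s * s" using s_pos by simp
    have "A'.unit_at (A'.bl a) (\<rho> 0) (\<rho> ?N) (eval_ncpoly A'.R (A'.gval \<rho> \<kappa>) (gadget ?N ?dx dw signof))"
    proof (rule A'.gadget_eval_distinct[OF less blk])
      show "inj_on (\<lambda>r. (\<rho> r, \<kappa> r)) {0..<?N}"
      proof (rule inj_onI)
        fix x y assume xy: "x \<in> {0..<?N}" "y \<in> {0..<?N}" "(\<rho> x, \<kappa> x) = (\<rho> y, \<kappa> y)"
        have c: "\<rho> r \<noteq> b" if "r < s * s" for r using cl(1)[OF that] bP by auto
        have b': "\<rho> r = b" if "\<not> r < s * s" for r using that unfolding \<rho>_def by simp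
        show "x = y"
        proof (cases "x < s * s")
          case True
          then have "y < s * s" using xy(3) c b' by (metis prod.inject)
          then show ?thesis
            using True xy(3) inj_onD[OF two_index_inj[OF e(1)], of x y] unfolding \<rho>_def \<kappa>_def by simp
        next
          case False
          then have "\<not> y < s * s" using xy(3) c b' by (metis prod.inject)
          then show ?thesis using False xy by simp
        qed
      qed
      fix r assume r: "r < ?N"
      show "A'.entry_deg \<one> (\<rho> r) (\<kappa> r) \<in> A'.D.H"
        using cl[of r] by (intro one) (auto simp: \<rho>_def \<kappa>_def)
      show "dw r \<in> carrier G" unfolding dw_def using hG by simp
      consider "Suc r < s * s" | "Suc r = s * s" | "r = s * s" using r by linarith
      then show "A'.entry_deg (dw r) (\<kappa> r) (\<rho> (Suc r)) \<in> A'.D.H"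
      proof cases
        case 1
        then have "dw r = \<one>" unfolding dw_def by auto
        then show ?thesis using cl(2)[of r] cl(1)[of "Suc r"] 1 one by simp
      next
        case 2
        then have "dw r = h" "\<rho> (Suc r) = b" unfolding dw_def \<rho>_def by auto
        then show ?thesis using link[OF cl(2)[of r]] 2 by simp
      next
        case 3
        then have "r \<noteq> s * s - 1" using N0 by linarith
        then have "dw r = \<one>" "\<kappa> r = b" "\<rho> (Suc r) = b" unfolding dw_def \<rho>_def \<kappa>_def using 3 by simp_all
        then show ?thesis using one by simp
      qed
    qed simp_all
    from A'.unit_atD[OF less blk this]
    obtain c where c: "c \<in> Units B'"
      "eval_ncpoly A'.R (A'.gval \<rho> \<kappa>) (gadget ?N ?dx dw signof) = A'.E (\<rho> 0) (\<rho> ?N) c"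
      by (elim bexE)
    have "A.visible (gadget ?N ?dx dw signof)"
    proof (rule transfer'[OF _ A'.gval_admissible[OF less blk] less(1) less(1) _ c])
      show "gadget ?N ?dx dw signof \<in> graded_ncpolys G"
        by (rule gadget_graded) (auto simp: dw_def hG)
    qed (simp add: blk)
    moreover have "\<not> A.visible (gadget ?N ?dx dw signof)"
    proof (rule not_visible_large)
      show dwH: "dw r \<in> A.D.H" for r unfolding dw_def using h A.D.H_one by simp
      show "eval_word B A.D.u (concat (map (\<lambda>r. [\<one>, dw r]) [0..<?N])) \<in> carrier B"
        using dwH A.D.u_closed A.D.H_one by (intro A.D.B.eval_word_closed) (auto split: if_splits)
    qed (simp_all add: A.D.H_one)
    ultimately show False by blast
  qed
qed

text \<open>Only s * s distinct positions are guaranteed in R', so one of them is used twice, with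
  degrees h and k. The two surviving terms are u_h u_k and -\<beta>(h, k) u_k u_h, followed by a
  common factor. They cancel in B by the definition of \<beta>, whereas in B' they add up to a
  nonzero multiple of u_h u_k if the commutation factors differ.\<close>

lemma \<beta>_eq:
  assumes hk: "h \<in> A.D.H" "k \<in> A.D.H"
  shows "A'.D.\<beta> h k = A.D.\<beta> h k"
proof (rule ccontr)
  assume ne: "A'.D.\<beta> h k \<noteq> A.D.\<beta> h k"
  have hk': "h \<in> A'.D.H" "k \<in> A'.D.H" using hk supp_subset by blast+
  have hkG: "h \<in> carrier G" "k \<in> carrier G" using A.D.H_carrier hk by blast+
  obtain a l b where a: "a < A'.n" and card: "s \<le> card (A'.cls a)"
    by (rule linked_class[OF A.D.H_one])
  obtain e P where e: "bij_betw e {0..<s} P" "P \<subseteq> A'.cls a"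
    by (rule subset_enum[OF card])
  have e_cls: "e i \<in> A'.cls a" if "i < s" for i
    by (rule subsetD[OF e(2) bij_betwE[OF e(1), rule_format]]) (simp add: that)
  let ?N = "s * s + 1"
  have N: "2 \<le> ?N" using s_pos by (cases s) auto
  \<comment> \<open>Truncated subtraction gives the indices 0 and 1 the same position, while 1, ...,
    s * s run through all pairs once.\<close>
  define \<rho> where "\<rho> r = e (((r - 1) mod (s * s)) div s)" for r
  define \<kappa> where "\<kappa> r = e ((r - 1) mod s)" for r
  define dx where "dx r = (if r = 0 then h else if r = 1 then k else \<one>)" for r :: nat
  let ?dw = "\<lambda>_::nat. \<one>"
  \<comment> \<open>Words in which k precedes h get the additional factor \<beta>(h, k), which in B
    turns u_k u_h into u_h u_k; all words then agree up to the sign.\<close>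
  define \<epsilon> where "\<epsilon> \<pi> = (if inv_into UNIV \<pi> 0 < inv_into UNIV \<pi> (1::nat) then signof \<pi>
    else signof \<pi> * A.D.\<beta> h k)" for \<pi> :: "nat \<Rightarrow> nat"
  have dx: "dx r \<in> A.D.H" "dx r \<in> A'.D.H" "dx r \<in> carrier G" for r
    unfolding dx_def using hk hk' hkG A.D.H_one A'.D.H_one by auto
  have cl: "\<rho> r \<in> A'.cls a" "\<kappa> r \<in> A'.cls a" for r
    unfolding \<rho>_def \<kappa>_def using e_cls index_less[OF s_pos] by auto
  have less: "\<rho> r < A'.n" "\<kappa> r < A'.n" and blk: "A'.bl (\<rho> r) = A'.bl a" "A'.bl (\<kappa> r) = A'.bl a" for r
    using cl[of r] A'.cls_lessI A'.cls_blI by auto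
  have degH: "A'.entry_deg g i j \<in> A'.D.H"
    if "i \<in> A'.cls a" "j \<in> A'.cls a" "g \<in> A'.D.H" for i j g
  proof -
    have "gs' ! i \<in> carrier G" "gs' ! j \<in> carrier G" using that A'.cls_lessI A'.gs_carrier by auto
    then show ?thesis using A'.deg_H[OF _ _ that(3)] A'.cls_H[OF a that(1,2)] by blast
  qed
  have nz: "A'.D.\<beta> h k \<noteq> 0" using A'.D.\<beta>_neq_zero hk' by blast
  have "A'.unit_at (A'.bl a) (\<rho> 0) (\<rho> ?N) (eval_ncpoly A'.R (A'.gval \<rho> \<kappa>) (gadget ?N dx ?dw \<epsilon>))"
  proof (rule A'.gadget_eval_double[OF less blk, where c = "A.D.\<beta> h k"])
    show "inj_on (\<lambda>r. (\<rho> r, \<kappa> r)) {1..<?N}"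
    proof (rule inj_onI)
      fix x y assume xy: "x \<in> {1..<?N}" "y \<in> {1..<?N}" "(\<rho> x, \<kappa> x) = (\<rho> y, \<kappa> y)"
      have "x - 1 = y - 1"
        by (rule inj_onD[OF two_index_inj[OF e(1)]]) (use xy in \<open>auto simp: \<rho>_def \<kappa>_def\<close>)
      then show "x = y" using xy by auto
    qed
    show "\<rho> 0 = \<kappa> 0" "\<rho> 1 = \<rho> 0" "\<kappa> 1 = \<kappa> 0" unfolding \<rho>_def \<kappa>_def by simp_all
    show "\<epsilon> id = 1" unfolding \<epsilon>_def by (simp add: sign_id)
    have "inv_into UNIV (transpose 0 (1::nat)) = transpose 0 1" by simp
    then show "\<epsilon> (transpose 0 1) = - A.D.\<beta> h k" unfolding \<epsilon>_def by (simp add: sign_swap_id)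
    show "A.D.\<beta> h k * A'.D.\<beta> (dx 1) (dx 0) \<noteq> 1"
    proof
      assume "A.D.\<beta> h k * A'.D.\<beta> (dx 1) (dx 0) = 1"
      then have "A.D.\<beta> h k * A'.D.\<beta> k h = A'.D.\<beta> h k * A'.D.\<beta> k h" "A'.D.\<beta> k h \<noteq> 0"
        using nz A'.D.\<beta>_swap[of k h] unfolding dx_def by auto
      then show False using ne by simp
    qed
  qed (use N dx degH[OF cl(1) cl(2) dx(2)] degH[OF cl(2) cl(1) A'.D.H_one] in auto)
  from A'.unit_atD[OF less blk this]
  obtain c where c: "c \<in> Units B'"
    "eval_ncpoly A'.R (A'.gval \<rho> \<kappa>) (gadget ?N dx ?dw \<epsilon>) = A'.E (\<rho> 0) (\<rho> ?N) c"
    by (elim bexE)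
  have "A.visible (gadget ?N dx ?dw \<epsilon>)"
  proof (rule transfer'[OF _ A'.gval_admissible[OF less blk] less(1) less(1) _ c])
    show "gadget ?N dx ?dw \<epsilon> \<in> graded_ncpolys G" by (rule gadget_graded) (simp_all add: dx)
  qed (simp add: blk)
  moreover have "\<not> A.visible (gadget ?N dx ?dw \<epsilon>)"
  proof (rule not_visible_large)
    show "A.D.u h \<otimes>\<^bsub>B\<^esub> A.D.u k \<in> carrier B" using hk A.D.u_closed by simp
    fix \<pi> :: "nat \<Rightarrow> nat" assume \<pi>: "\<pi> permutes {0..<?N}"
    have d: "\<And>r. 2 \<le> r \<Longrightarrow> dx r = \<one>" "dx 0 = h" "dx 1 = k" unfolding dx_def by auto
    have w: "eval_word B A.D.u (concat (map (\<lambda>r. [dx (\<pi> r), \<one>]) [0..<?N])) =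
      (if inv_into UNIV \<pi> 0 < inv_into UNIV \<pi> 1 then A.D.u h \<otimes>\<^bsub>B\<^esub> A.D.u k else A.D.u k \<otimes>\<^bsub>B\<^esub> A.D.u h)"
      using A.D.word_two[OF \<pi> N, of dx] d hk by simp
    have "A.D.u h \<otimes>\<^bsub>B\<^esub> A.D.u k = A.D.\<beta> h k \<odot>\<^bsub>B\<^esub> (A.D.u k \<otimes>\<^bsub>B\<^esub> A.D.u h)" by (rule A.D.u_commute[OF hk])
    then show "\<epsilon> \<pi> \<odot>\<^bsub>B\<^esub> eval_word B A.D.u (concat (map (\<lambda>r. [dx (\<pi> r), \<one>]) [0..<?N])) =
      signof \<pi> \<odot>\<^bsub>B\<^esub> (A.D.u h \<otimes>\<^bsub>B\<^esub> A.D.u k)"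
      unfolding w \<epsilon>_def using hk A.D.u_closed by (auto simp: A.D.B.smult_smult)
  qed (simp_all add: dx A.D.H_one)
  ultimately show False by blast
qed

end

theorem graded_identities_determine_division:
  assumes "two_block_tensors G B ds gs B' ds' gs'"
  shows "supp G B' = supp G B" "graded_isomorphic G B B'"
proof -
  \<comment> \<open>The hypotheses are symmetric in the two algebras, so the inclusion of supports
    holds both ways.\<close>
  have "two_block_tensors G B' ds' gs' B ds gs"
    using assms unfolding two_block_tensors_def two_block_tensors_axioms_def by simp
  then show supp: "supp G B' = supp G B"
    using two_block_tensors.supp_subset[OF assms] two_block_tensors.supp_subset by (intro equalityI)
  have D: "graded_division G B" "graded_division G B'"
    using assms unfolding two_block_tensors_def block_tensor_def by simp_all
  show "graded_isomorphic G B B'"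
    by (rule graded_division_isomorphic[OF D supp two_block_tensors.\<beta>_eq[OF assms]])
qed

section \<open>Coarsened gradings\<close>

lemma coarsening_simps [simp]:
  "carrier (coarsening G \<alpha> R) = carrier R"
  "monoid.mult (coarsening G \<alpha> R) = monoid.mult R"
  "one (coarsening G \<alpha> R) = one R"
  "ring.zero (coarsening G \<alpha> R) = ring.zero R"
  "ring.add (coarsening G \<alpha> R) = ring.add R"
  "module.smult (coarsening G \<alpha> R) = module.smult R"
  "hcomp (coarsening G \<alpha> R) q = lin_span R (\<Union>g\<in>{g \<in> carrier G. \<alpha> g = q}. hcomp R g)"
  by (simp_all add: coarsening_def)

text \<open>The two records may differ in their gradings; evaluation reads only the operations
  compared here.\<close>

lemma eval_ncpoly_ops:
  assumes "monoid.mult A' = monoid.mult A" "one A' = one A" "ring.zero A' = ring.zero A"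
    "ring.add A' = ring.add A" "module.smult A' = module.smult A" "carrier A' = carrier A"
  shows "eval_ncpoly A' v f = eval_ncpoly A v f"
proof -
  have w: "eval_word A' v w = eval_word A v w" for w
    unfolding eval_word_def by (simp add: assms)
  have fs: "finsum A' h S = finsum A h S" for h and S :: "'x list set"
    unfolding finsum_def by (simp add: assms finprod_def)
  show ?thesis unfolding eval_ncpoly_def fs w assms ..
qed

lemma unital_algebra_coarsening: "unital_algebra A \<Longrightarrow> unital_algebra (coarsening G \<alpha> A)"
proof -
  assume A: "unital_algebra A"
  interpret unital_algebra A by (rule A)
  show ?thesis
    by (rule unital_algebra_subalgebra[OF A]) (simp_all add: smult_closed)
qed

text \<open>Terms of equal fine degree are collected, so that the sum is indexed by degrees and each
  degree can be given one variable.\<close>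

lemma lin_span_components:
  fixes A :: "('k::field, 'a, 'g, 'm) gr_algebra_scheme"
  assumes A: "unital_algebra A"
    and sub: "\<And>g. g \<in> S \<Longrightarrow> hcomp A g \<subseteq> carrier A"
    and comp: "\<And>g. g \<in> S \<Longrightarrow> \<zero>\<^bsub>A\<^esub> \<in> hcomp A g"
      "\<And>g x y. g \<in> S \<Longrightarrow> x \<in> hcomp A g \<Longrightarrow> y \<in> hcomp A g \<Longrightarrow> x \<oplus>\<^bsub>A\<^esub> y \<in> hcomp A g"
      "\<And>g c x. g \<in> S \<Longrightarrow> x \<in> hcomp A g \<Longrightarrow> c \<odot>\<^bsub>A\<^esub> x \<in> hcomp A g"
    and x: "x \<in> lin_span A (\<Union>g\<in>S. hcomp A g)"
  shows "\<exists>F r. finite F \<and> F \<subseteq> S \<and> (\<forall>g\<in>F. r g \<in> hcomp A g) \<and> x = (\<Oplus>\<^bsub>A\<^esub>g\<in>F. r g)"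
  using x
proof (induction rule: lin_span.induct)
  case zero
  interpret unital_algebra A by (rule A)
  show ?case by (intro exI[of _ "{}"]) simp
next
  case (step s x c)
  interpret unital_algebra A by (rule A)
  obtain F r where F: "finite F" "F \<subseteq> S" "\<And>g. g \<in> F \<Longrightarrow> r g \<in> hcomp A g" "x = (\<Oplus>\<^bsub>A\<^esub>g\<in>F. r g)"
    using step.IH by blast
  obtain g where g: "g \<in> S" "s \<in> hcomp A g" using step.hyps by blast
  \<comment> \<open>The new term joins the component already present in its degree, or starts a new
    one.\<close>
  define r' where "r' h = (if h = g then (c \<odot>\<^bsub>A\<^esub> s) \<oplus>\<^bsub>A\<^esub> (if g \<in> F then r g else \<zero>\<^bsub>A\<^esub>) else r h)" for h
  have cl: "\<And>h. h \<in> F \<Longrightarrow> r h \<in> carrier A" using F sub by blast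
  have s: "c \<odot>\<^bsub>A\<^esub> s \<in> carrier A" using g sub comp(3) by blast
  have r': "r' h \<in> hcomp A h" if "h \<in> insert g F" for h
    using that g F comp unfolding r'_def by auto
  have rest: "(\<Oplus>\<^bsub>A\<^esub>h\<in>F - {g}. r' h) = (\<Oplus>\<^bsub>A\<^esub>h\<in>F - {g}. r h)"
    using cl by (intro finsum_cong') (auto simp: r'_def)
  have restc: "(\<Oplus>\<^bsub>A\<^esub>h\<in>F - {g}. r h) \<in> carrier A" using cl by (intro finsum_closed) auto
  have ins: "insert g F = insert g (F - {g})" by blast
  have "(\<Oplus>\<^bsub>A\<^esub>h\<in>insert g F. r' h) = r' g \<oplus>\<^bsub>A\<^esub> (\<Oplus>\<^bsub>A\<^esub>h\<in>F - {g}. r' h)"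
    unfolding ins using r' g sub F(1,2) by (subst finsum_insert) fastforce+
  also have "\<dots> = c \<odot>\<^bsub>A\<^esub> s \<oplus>\<^bsub>A\<^esub> x"
  proof (cases "g \<in> F")
    case True
    then have "x = r g \<oplus>\<^bsub>A\<^esub> (\<Oplus>\<^bsub>A\<^esub>h\<in>F - {g}. r h)"
      unfolding F(4) using F(1) cl finsum_insert[of "F - {g}" g r] by (auto simp: insert_absorb)
    then show ?thesis unfolding rest using True s cl[OF True] restc by (simp add: r'_def a_assoc)
  next
    case False
    then have "F - {g} = F" by blast
    then show ?thesis using False s restc unfolding rest F(4) by (simp add: r'_def)
  qed
  finally have "c \<odot>\<^bsub>A\<^esub> s \<oplus>\<^bsub>A\<^esub> x = (\<Oplus>\<^bsub>A\<^esub>h\<in>insert g F. r' h)" ..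
  then show ?case
    using F(1,2) g(1) r' by (intro exI[of _ "insert g F"] exI[of _ r']) auto
qed

text \<open>A valuation involves only finitely many fine degrees at each variable. Replacing each
  coarse variable by the sum of fine variables of these degrees turns f into a graded polynomial for
  G. It is an identity of A, because such sums have the right coarse degree, hence an identity of
  A', where it specializes to the value of f. The polynomial depends on the valuation since the
  fibres of \<alpha> may be infinite.\<close>

lemma coarsening_identities_mono:
  fixes A :: "('k::field, 'a, 'g, 'm) gr_algebra_scheme" and A' :: "('k, 'b, 'g, 'm2) gr_algebra_scheme"
    and Q :: "('q, 'z) monoid_scheme" and \<alpha> :: "'g \<Rightarrow> 'q"
  assumes A: "unital_algebra A" and A': "unital_algebra A'"
    and subA: "\<And>g. g \<in> carrier G \<Longrightarrow> hcomp A g \<subseteq> carrier A"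
    and sub: "\<And>g. g \<in> carrier G \<Longrightarrow> hcomp A' g \<subseteq> carrier A'"
    and comp: "\<And>g. g \<in> carrier G \<Longrightarrow> \<zero>\<^bsub>A'\<^esub> \<in> hcomp A' g"
      "\<And>g x y. g \<in> carrier G \<Longrightarrow> x \<in> hcomp A' g \<Longrightarrow> y \<in> hcomp A' g \<Longrightarrow> x \<oplus>\<^bsub>A'\<^esub> y \<in> hcomp A' g"
      "\<And>g c x. g \<in> carrier G \<Longrightarrow> x \<in> hcomp A' g \<Longrightarrow> c \<odot>\<^bsub>A'\<^esub> x \<in> hcomp A' g"
    and Id: "graded_identities G A \<subseteq> graded_identities G A'"
  shows "graded_identities Q (coarsening G \<alpha> A) \<subseteq> graded_identities Q (coarsening G \<alpha> A')"
proof
  interpret A: unital_algebra A by (rule A)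
  interpret A': unital_algebra A' by (rule A')
  let ?S = "\<lambda>q. {g \<in> carrier G. \<alpha> g = q}"
  fix f assume f: "f \<in> graded_identities Q (coarsening G \<alpha> A)"
  have fQ: "snd ` ncvars f \<subseteq> carrier Q"
    using graded_identitiesD(1)[OF f] unfolding graded_ncpolys_iff .
  show "f \<in> graded_identities Q (coarsening G \<alpha> A')"
  proof (rule graded_identitiesI[OF unital_algebra_coarsening[OF A'] graded_identitiesD(1)[OF f]])
    show "hcomp (coarsening G \<alpha> A') q \<subseteq> carrier (coarsening G \<alpha> A')" for q
    proof
      have S: "(\<Union>g\<in>?S q. hcomp A' g) \<subseteq> carrier A'" using sub by auto
      fix x assume "x \<in> hcomp (coarsening G \<alpha> A') q"
      then show "x \<in> carrier (coarsening G \<alpha> A')" using A'.lin_span_closed[OF _ S] by simp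
    qed
    fix v :: "nat \<times> 'q \<Rightarrow> 'b"
    assume v: "\<And>i q. q \<in> carrier Q \<Longrightarrow> v (i, q) \<in> hcomp (coarsening G \<alpha> A') q"
    have "\<exists>F r. finite F \<and> F \<subseteq> ?S q \<and> (\<forall>g\<in>F. r g \<in> hcomp A' g) \<and> v (i, q) = (\<Oplus>\<^bsub>A'\<^esub>g\<in>F. r g)"
      if "q \<in> carrier Q" for i q
      using v[OF that, of i] sub comp by (intro lin_span_components[OF A']) auto
    then have "\<forall>x. \<exists>W. snd x \<in> carrier Q \<longrightarrow> finite (fst W) \<and> fst W \<subseteq> ?S (snd x) \<and>
        (\<forall>g\<in>fst W. snd W g \<in> hcomp A' g) \<and> v x = (\<Oplus>\<^bsub>A'\<^esub>g\<in>fst W. snd W g)"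
      by simp
    from choice[OF this] obtain W where W: "\<forall>x. snd x \<in> carrier Q \<longrightarrow> finite (fst (W x)) \<and>
        fst (W x) \<subseteq> ?S (snd x) \<and> (\<forall>g\<in>fst (W x). snd (W x) g \<in> hcomp A' g) \<and>
        v x = (\<Oplus>\<^bsub>A'\<^esub>g\<in>fst (W x). snd (W x) g)" ..
    define F where "F x = fst (W x)" for x
    define r where "r x = snd (W x)" for x
    have Fr: "finite (F x) \<and> F x \<subseteq> ?S (snd x) \<and> (\<forall>g\<in>F x. r x g \<in> hcomp A' g) \<and> v x = (\<Oplus>\<^bsub>A'\<^esub>g\<in>F x. r x g)"
      if "snd x \<in> carrier Q" for x
      unfolding F_def r_def by (rule mp[OF spec[OF W] that])
    define s :: "nat \<times> 'q \<Rightarrow> (nat \<times> 'g, 'k) ncpoly"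
      where "s x = (\<Sum>g\<in>F x. Poly_Mapping.single [(fst x, g)] 1)" for x
    let ?f = "ncsubst s f"
    have s_vars: "ncvars (s x) \<subseteq> Pair (fst x) ` F x" for x
      unfolding s_def using ncvars_sum[of "\<lambda>g. Poly_Mapping.single [(fst x, g)] (1::'k)" "F x"]
        ncvars_single[of "[(fst x, _)]" "1::'k"] by fastforce
    have "snd ` ncvars ?f \<subseteq> carrier G"
    proof
      fix g assume "g \<in> snd ` ncvars ?f"
      then obtain x where x: "x \<in> ncvars f" "g \<in> snd ` ncvars (s x)" using ncvars_ncsubst[of s f] by fast
      then have "g \<in> F x" using s_vars[of x] by auto
      then show "g \<in> carrier G" using Fr[of x] fQ x(1) by blast
    qed
    then have fG: "?f \<in> graded_ncpolys G" unfolding graded_ncpolys_iff .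
    have "?f \<in> graded_identities G A"
    proof (rule graded_identitiesI[OF A fG subA])
      fix w assume w: "\<And>(i::nat) g. g \<in> carrier G \<Longrightarrow> w (i, g) \<in> hcomp A g" "\<And>x. w x \<in> carrier A"
      have ev: "eval_ncpoly A w (s x) \<in> lin_span A (\<Union>g\<in>?S (snd x). hcomp A g)" if "snd x \<in> carrier Q" for x
      proof -
        have fin: "finite (F x)" using Fr that by blast
        have "eval_ncpoly A w (s x) = (\<Oplus>\<^bsub>A\<^esub>g\<in>F x. w (fst x, g))"
          unfolding s_def using w(2) fin
          by (simp add: A.eval_ncpoly_sum A.eval_ncpoly_single A.smult_1)
        also have "\<dots> \<in> lin_span A (\<Union>g\<in>?S (snd x). hcomp A g)"
        proof (rule A.lin_span_finsum[OF _ fin])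
          show S: "(\<Union>g\<in>?S (snd x). hcomp A g) \<subseteq> carrier A" using subA by auto
          fix g assume "g \<in> F x"
          then have "g \<in> ?S (snd x)" using Fr[OF that] by blast
          then show "w (fst x, g) \<in> lin_span A (\<Union>g\<in>?S (snd x). hcomp A g)"
            using w(1) by (intro A.lin_span_base[OF S]) blast
        qed
        finally show ?thesis .
      qed
      have "eval_ncpoly A w ?f = eval_ncpoly A (\<lambda>x. eval_ncpoly A w (s x)) f"
        by (rule A.eval_ncsubst) (rule w(2))
      also have "\<dots> = eval_ncpoly (coarsening G \<alpha> A) (\<lambda>x. eval_ncpoly A w (s x)) f"
        by (rule eval_ncpoly_ops) simp_all
      also have "\<dots> = \<zero>\<^bsub>coarsening G \<alpha> A\<^esub>"
      proof (rule graded_identitiesD(2)[OF f])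
        fix i :: nat and q assume "q \<in> carrier Q"
        then show "eval_ncpoly A w (s (i, q)) \<in> hcomp (coarsening G \<alpha> A) q" using ev[of "(i, q)"] by simp
      qed
      finally show "eval_ncpoly A w ?f = \<zero>\<^bsub>A\<^esub>" by simp
    qed
    then have fA': "?f \<in> graded_identities G A'" using Id by blast
    define w where "w y = (if snd y \<in> carrier G \<and> \<alpha> (snd y) \<in> carrier Q \<and> snd y \<in> F (fst y, \<alpha> (snd y))
      then r (fst y, \<alpha> (snd y)) (snd y) else \<zero>\<^bsub>A'\<^esub>)" for y
    have w: "w (i, g) \<in> hcomp A' g" if "g \<in> carrier G" for i g
      using that Fr comp(1) unfolding w_def by auto
    have wc: "w y \<in> carrier A'" for y
      using w[of "snd y" "fst y"] sub[of "snd y"] by (cases "snd y \<in> carrier G") (auto simp: w_def)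
    have ev: "eval_ncpoly A' w (s x) = v x" if q: "snd x \<in> carrier Q" for x
    proof -
      have F: "finite (F x)" "F x \<subseteq> ?S (snd x)"
        "\<forall>g\<in>F x. r x g \<in> hcomp A' g"
        "v x = (\<Oplus>\<^bsub>A'\<^esub>g\<in>F x. r x g)"
        using Fr[OF q] by simp_all
      have "eval_ncpoly A' w (s x) = (\<Oplus>\<^bsub>A'\<^esub>g\<in>F x. w (fst x, g))"
        unfolding s_def using wc F by (simp add: A'.eval_ncpoly_sum A'.eval_ncpoly_single A'.smult_1)
      also have "\<dots> = v x"
        unfolding F(4)
      proof (rule A'.finsum_cong')
        show "r x \<in> F x \<rightarrow> carrier A'" using F(2,3) sub by blast
        fix g assume g: "g \<in> F x"
        then have "g \<in> carrier G" "\<alpha> g = snd x" using F(2) by auto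
        then show "w (fst x, g) = r x g" using q g unfolding w_def by simp
      qed simp
      finally show ?thesis .
    qed
    have "eval_ncpoly (coarsening G \<alpha> A') v f = eval_ncpoly A' v f"
      by (rule eval_ncpoly_ops) simp_all
    also have "\<dots> = eval_ncpoly A' (\<lambda>x. eval_ncpoly A' w (s x)) f"
    proof (rule A'.eval_ncpoly_cong[symmetric])
      fix x assume "x \<in> ncvars f"
      then have "snd x \<in> carrier Q" using fQ by blast
      then show "eval_ncpoly A' w (s x) = v x \<and> eval_ncpoly A' w (s x) \<in> carrier A'"
        using ev[of x] A'.eval_ncpoly_closed[of w "s x"] wc by simp
    qed
    also have "\<dots> = eval_ncpoly A' w ?f" by (rule A'.eval_ncsubst[symmetric]) (rule wc)
    also have "\<dots> = \<zero>\<^bsub>A'\<^esub>" by (rule graded_identitiesD(2)[OF fA' w])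
    finally show "eval_ncpoly (coarsening G \<alpha> A') v f = \<zero>\<^bsub>coarsening G \<alpha> A'\<^esub>" by simp
  qed
qed

section \<open>Block-triangular matrices over the field, with elementary gradings\<close>

lemma UT_carrier: "x \<in> carrier (UT Q ds gs) \<longleftrightarrow> x \<in> carrier_mat (sum_list ds) (sum_list ds) \<and>
    (\<forall>i<sum_list ds. \<forall>j<sum_list ds. \<not> block_of ds i \<le> block_of ds j \<longrightarrow> x $$ (i, j) = 0)"
  by (auto simp: UT_def Let_def ut_positions_def module_mat_simps)

lemma UT_simps:
  fixes ds :: "nat list" and gs :: "'q list"
  defines "M \<equiv> module_mat TYPE('k::field) (sum_list ds) (sum_list ds)"
  shows "monoid.mult (UT Q ds gs :: ('k, _, _) gr_algebra) = monoid.mult M"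
    "one (UT Q ds gs :: ('k, _, _) gr_algebra) = one M"
    "ring.zero (UT Q ds gs :: ('k, _, _) gr_algebra) = ring.zero M"
    "ring.add (UT Q ds gs :: ('k, _, _) gr_algebra) = ring.add M"
    "module.smult (UT Q ds gs :: ('k, _, _) gr_algebra) = module.smult M"
    "hcomp (UT Q ds gs :: ('k, _, _) gr_algebra) q = lin_span M
        {matrix_unit (sum_list ds) i j | i j. (i, j) \<in> ut_positions ds \<and>
           gs ! i \<otimes>\<^bsub>Q\<^esub> inv\<^bsub>Q\<^esub> (gs ! j) = q}"
  by (simp_all add: UT_def Let_def M_def)

lemma unital_algebra_UT: "unital_algebra (UT Q ds gs :: ('k::field, 'k mat, 'q) gr_algebra)"
proof (rule unital_algebra_subalgebra[OF unital_algebra_module_mat[where n = "sum_list ds"] UT_simps(1-5)])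
  let ?n = "sum_list ds" and ?U = "UT Q ds gs :: ('k, 'k mat, 'q) gr_algebra" and ?b = "block_of ds"
  let ?M = "module_mat TYPE('k) ?n ?n"
  show "carrier ?U \<subseteq> carrier ?M" using UT_carrier by (auto simp: module_mat_simps)
  show "\<one>\<^bsub>?M\<^esub> \<in> carrier ?U" "\<zero>\<^bsub>?M\<^esub> \<in> carrier ?U"
    unfolding UT_carrier by (auto simp: module_mat_simps)
  fix x y :: "'k mat" and c
  assume x: "x \<in> carrier ?U"
  show "c \<odot>\<^bsub>?M\<^esub> x \<in> carrier ?U"
    using x unfolding UT_carrier by (auto simp: module_mat_simps)
  assume y: "y \<in> carrier ?U"
  show "x \<oplus>\<^bsub>?M\<^esub> y \<in> carrier ?U"
    using x y unfolding UT_carrier by (auto simp: module_mat_simps)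
  have "(x * y) $$ (i, j) = 0" if ij: "i < ?n" "j < ?n" "\<not> ?b i \<le> ?b j" for i j
  proof -
    have "(x * y) $$ (i, j) = (\<Sum>l<?n. x $$ (i, l) * y $$ (l, j))"
      using x y ij carrier_matD[of x ?n ?n] carrier_matD[of y ?n ?n]
      unfolding UT_carrier by (simp add: scalar_prod_def lessThan_atLeast0)
    also have "\<dots> = 0"
    proof (rule sum.neutral, rule ballI)
      fix l assume l: "l \<in> {..<?n}"
      have "\<not> ?b i \<le> ?b l \<or> \<not> ?b l \<le> ?b j" using ij(3) by linarith
      then have "x $$ (i, l) = 0 \<or> y $$ (l, j) = 0" using x y l ij unfolding UT_carrier by blast
      then show "x $$ (i, l) * y $$ (l, j) = 0" by auto
    qed
    finally show ?thesis .
  qed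
  then show "x \<otimes>\<^bsub>?M\<^esub> y \<in> carrier ?U"
    using x y unfolding UT_carrier by (auto simp: module_mat_simps)
qed

lemma UT_hcomp_iff:
  fixes x :: "'k::field mat"
  shows "x \<in> hcomp (UT Q ds gs) q \<longleftrightarrow> x \<in> carrier_mat (sum_list ds) (sum_list ds) \<and>
    (\<forall>i<sum_list ds. \<forall>j<sum_list ds. x $$ (i, j) \<noteq> 0 \<longrightarrow>
      block_of ds i \<le> block_of ds j \<and> gs ! i \<otimes>\<^bsub>Q\<^esub> inv\<^bsub>Q\<^esub> (gs ! j) = q)"
    (is "_ \<longleftrightarrow> ?P x")
proof
  let ?n = "sum_list ds"
  let ?M = "module_mat TYPE('k) ?n ?n"
  let ?S = "{matrix_unit ?n i j | i j. (i, j) \<in> ut_positions ds \<and> gs ! i \<otimes>\<^bsub>Q\<^esub> inv\<^bsub>Q\<^esub> (gs ! j) = q} :: 'k mat set"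
  {
    assume "x \<in> hcomp (UT Q ds gs) q"
    then have "x \<in> lin_span ?M ?S" unfolding UT_simps .
    then show "?P x"
    proof (induction rule: lin_span.induct)
      case zero
      then show ?case by (simp add: module_mat_simps)
    next
      case (step s x c)
      obtain k l where s: "s = matrix_unit ?n k l" "k < ?n" "l < ?n" "block_of ds k \<le> block_of ds l"
        "gs ! k \<otimes>\<^bsub>Q\<^esub> inv\<^bsub>Q\<^esub> (gs ! l) = q"
        using step.hyps(1) by (auto simp: ut_positions_def)
      have x: "x \<in> carrier_mat ?n ?n" using step.IH by blast
      have e: "(c \<odot>\<^bsub>?M\<^esub> s \<oplus>\<^bsub>?M\<^esub> x) $$ (i, j) = (if (i, j) = (k, l) then c + x $$ (i, j) else x $$ (i, j))"
        if "i < ?n" "j < ?n" for i j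
        using that x carrier_matD[OF x] unfolding s(1) by (auto simp: module_mat_simps matrix_unit_def)
      have "c \<odot>\<^bsub>?M\<^esub> s \<oplus>\<^bsub>?M\<^esub> x \<in> carrier_mat ?n ?n"
        using x unfolding s(1) by (simp add: module_mat_simps matrix_unit_def)
      then show ?case using step.IH s(4,5) by (auto simp: e split: if_splits)
    qed
  }
  assume P: "?P x"
  interpret M: unital_algebra ?M by (rule unital_algebra_module_mat)
  let ?T = "{..<?n} \<times> {..<?n}"
  let ?y = "\<lambda>p. x $$ p \<cdot>\<^sub>m matrix_unit ?n (fst p) (snd p) :: 'k mat"
  have S: "?S \<subseteq> carrier ?M" by (auto simp: module_mat_simps matrix_unit_def)
  have "(\<Oplus>\<^bsub>?M\<^esub>p\<in>?T. ?y p) \<in> lin_span ?M ?S"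
  proof (rule M.lin_span_finsum[OF S])
    fix p assume p: "p \<in> ?T"
    show "?y p \<in> lin_span ?M ?S"
    proof (cases "x $$ p = 0")
      case True
      then have "?y p = \<zero>\<^bsub>?M\<^esub>" by (intro eq_matI) (auto simp: module_mat_simps matrix_unit_def)
      then show ?thesis using lin_span.zero[of ?M ?S] by simp
    next
      case False
      have "matrix_unit ?n (fst p) (snd p) \<in> ?S"
        using P p False by (intro CollectI exI[of _ "fst p"] exI[of _ "snd p"]) (auto simp: ut_positions_def)
      from lin_span.step[OF this lin_span.zero, of ?M "x $$ p"] show ?thesis
        by (simp add: module_mat_simps matrix_unit_def)
    qed
  qed simp
  moreover have "(\<Oplus>\<^bsub>?M\<^esub>p\<in>?T. ?y p) = x"
  proof (rule eq_matI)
    have "(\<Oplus>\<^bsub>?M\<^esub>p\<in>?T. ?y p) \<in> carrier ?M"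
      by (intro M.finsum_closed) (auto simp: module_mat_simps matrix_unit_def)
    then show "dim_row (\<Oplus>\<^bsub>?M\<^esub>p\<in>?T. ?y p) = dim_row x" "dim_col (\<Oplus>\<^bsub>?M\<^esub>p\<in>?T. ?y p) = dim_col x"
      using P by (auto simp: module_mat_simps)
    fix i j assume "i < dim_row x" "j < dim_col x"
    then have ij: "i < ?n" "j < ?n" using P by auto
    have "(\<Oplus>\<^bsub>?M\<^esub>p\<in>?T. ?y p) $$ (i, j) = (\<Sum>p\<in>?T. ?y p $$ (i, j))"
      by (rule module_mat_finsum_entry) (auto simp: ij matrix_unit_def)
    also have "\<dots> = (\<Sum>p\<in>?T. if p = (i, j) then x $$ p else 0)"
      by (rule sum.cong) (auto simp: ij matrix_unit_def)
    also have "\<dots> = x $$ (i, j)" using ij by simp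
    finally show "(\<Oplus>\<^bsub>?M\<^esub>p\<in>?T. ?y p) $$ (i, j) = x $$ (i, j)" .
  qed
  ultimately show "x \<in> hcomp (UT Q ds gs) q" unfolding UT_simps by simp
qed

lemma UT_hcomp_subset: "hcomp (UT Q ds gs) q \<subseteq> carrier (UT Q ds gs :: ('k::field, 'k mat, 'q) gr_algebra)"
proof
  fix x :: "'k mat" assume "x \<in> hcomp (UT Q ds gs) q"
  then show "x \<in> carrier (UT Q ds gs)" unfolding UT_hcomp_iff UT_carrier by metis
qed

lemma sum_list_map_mult: "sum_list (map (\<lambda>d. d * t) ds) = sum_list ds * (t::nat)"
  by (induction ds) (simp_all add: algebra_simps)

lemma block_of_map_mult:
  assumes "t > 0"
  shows "block_of (map (\<lambda>d. d * t) ds) i = block_of ds (i div t)"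
proof -
  have "i < sum_list (take k (map (\<lambda>d. d * t) ds)) \<longleftrightarrow> i div t < sum_list (take k ds)" for k
    using assms by (simp add: take_map sum_list_map_mult div_less_iff_less_mult)
  then show ?thesis unfolding block_of_def by simp
qed

lemma nth_concat_replicate:
  "i < length xs * t \<Longrightarrow> concat (map (\<lambda>x. replicate t (f x)) xs) ! i = f (xs ! (i div t))"
proof (induction xs arbitrary: i)
  case (Cons x xs)
  have t: "t > 0" using Cons.prems by (cases t) auto
  show ?case
  proof (cases "i < t")
    case False
    then have "(i - t) div t = i div t - 1" "i div t > 0" using t by (simp_all add: le_div_geq div_greater_zero_iff)
    then show ?thesis using False Cons by (simp add: nth_append nth_Cons')
  qed (simp add: nth_append)
qed simp

lemma mult_add_less:
  fixes l :: nat
  assumes "l < n" "a < t"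
  shows "l * t + a < n * t"
proof -
  have "Suc l * t \<le> n * t" using assms(1) by (intro mult_le_mono1) simp
  then show ?thesis using assms(2) by simp
qed

lemma sum_div_mod:
  fixes f :: "nat \<Rightarrow> nat \<Rightarrow> 'c::comm_monoid_add"
  assumes "t > 0"
  shows "(\<Sum>L\<in>{0..<n * t}. f (L div t) (L mod t)) = (\<Sum>l\<in>{..<n}. \<Sum>c\<in>{0..<t}. f l c)"
proof -
  have "(\<Sum>l\<in>{..<n}. \<Sum>c\<in>{0..<t}. f l c) = (\<Sum>(l, c)\<in>{..<n} \<times> {0..<t}. f l c)"
    by (rule sum.cartesian_product)
  also have "\<dots> = (\<Sum>L\<in>{0..<n * t}. f (L div t) (L mod t))"
    by (rule sum.reindex_bij_witness[where i = "\<lambda>L. (L div t, L mod t)" and j = "\<lambda>(l, c). l * t + c"])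
      (use assms in \<open>auto simp: less_mult_imp_div_less intro: mult_add_less\<close>)
  finally show ?thesis ..
qed

section \<open>Coarsening R and replacing entries from B by scalar matrices\<close>

context block_tensor
begin

context
  fixes Q :: "('q, 'z) monoid_scheme" and \<alpha> :: "'g \<Rightarrow> 'q" and t :: nat and \<Phi> :: "('b \<Rightarrow> 'k mat) set"
  assumes Q: "group Q" and hom: "\<alpha> \<in> hom G Q"
    and ker: "\<And>g. g \<in> carrier G \<Longrightarrow> \<alpha> g = \<one>\<^bsub>Q\<^esub> \<longleftrightarrow> g \<in> D.H"
    and reps: "matrix_reps B t \<Phi>"
begin

interpretation Q: group Q by (rule Q)

abbreviation "C \<equiv> coarsening G \<alpha> R"
abbreviation "U \<equiv> UT Q (map (\<lambda>d. d * t) ds) (concat (map (\<lambda>g. replicate t (\<alpha> g)) gs)) :: ('k, 'k mat, 'q) gr_algebra"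
abbreviation "coarse i j \<equiv> \<alpha> (gs ! i) \<otimes>\<^bsub>Q\<^esub> inv\<^bsub>Q\<^esub> (\<alpha> (gs ! j))"

lemma \<alpha>_closed: "g \<in> carrier G \<Longrightarrow> \<alpha> g \<in> carrier Q"
  and \<alpha>_mult: "g \<in> carrier G \<Longrightarrow> h \<in> carrier G \<Longrightarrow> \<alpha> (g \<otimes>\<^bsub>G\<^esub> h) = \<alpha> g \<otimes>\<^bsub>Q\<^esub> \<alpha> h"
  using hom unfolding hom_def by auto

lemma \<alpha>_inv: "g \<in> carrier G \<Longrightarrow> \<alpha> (inv\<^bsub>G\<^esub> g) = inv\<^bsub>Q\<^esub> (\<alpha> g)"
  by (rule group_hom.hom_inv) (auto simp: group_hom_def group_hom_axioms_def Q hom D.G.is_group)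

text \<open>The support of B is the kernel of \<alpha>, so the coarse degree of a nonzero entry
  depends on its position alone.\<close>

lemma coarse_degree:
  assumes "i < n" "j < n" "g \<in> carrier G" "entry_deg g i j \<in> D.H"
  shows "\<alpha> g = coarse i j"
proof -
  have c: "gs ! i \<in> carrier G" "gs ! j \<in> carrier G" using assms gs_carrier by auto
  have g: "g = gs ! i \<otimes>\<^bsub>G\<^esub> (entry_deg g i j) \<otimes>\<^bsub>G\<^esub> inv\<^bsub>G\<^esub> (gs ! j)"
    using c assms(3) by (simp add: D.G.m_assoc) (simp add: D.G.m_assoc[symmetric])
  have "\<alpha> (entry_deg g i j) = \<one>\<^bsub>Q\<^esub>" using ker[of "entry_deg g i j"] assms c by simp
  then show ?thesis
    by (subst g) (use c assms(3) in \<open>simp add: \<alpha>_mult \<alpha>_inv \<alpha>_closed\<close>)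
qed

text \<open>All of B has trivial coarse degree, so a coarse component admits arbitrary elements of B
  in the positions of the right degree: the coarsened grading is elementary. For the converse an
  entry is expanded in the basis \<open>u h\<close>, whose terms are homogeneous for the fine
  grading.\<close>

lemma C_hcomp_iff:
  "x \<in> hcomp C q \<longleftrightarrow> x \<in> carrier R \<and> (\<forall>i<n. \<forall>j<n. x $$ (i, j) \<noteq> \<zero> \<longrightarrow> coarse i j = q)"
  (is "_ \<longleftrightarrow> ?P x")
proof
  let ?S = "\<Union>g\<in>{g \<in> carrier G. \<alpha> g = q}. hcomp R g"
  have S: "?S \<subseteq> carrier R" using hcomp_R_subset by auto
  {
    assume "x \<in> hcomp C q"
    then have "x \<in> lin_span R ?S" by simp
    then show "?P x"
    proof (induction rule: lin_span.induct)
      case zero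
      then show ?case by (simp add: R_entry)
    next
      case (step s x c)
      obtain g where g: "g \<in> carrier G" "\<alpha> g = q" "s \<in> hcomp R g" using step.hyps by blast
      have sR: "s \<in> carrier R" using g hcomp_R_subset by blast
      have s0: "s $$ (i, j) = \<zero>" if ij: "i < n" "j < n" "coarse i j \<noteq> q" for i j
      proof (rule ccontr)
        assume ne: "s $$ (i, j) \<noteq> \<zero>"
        have "if bl i \<le> bl j then s $$ (i, j) \<in> hcomp B (entry_deg g i j) else s $$ (i, j) = \<zero>"
          using g(3) ij unfolding hcomp_iff[OF g(1)] by blast
        then have "s $$ (i, j) \<in> hcomp B (entry_deg g i j)" using ne by (simp split: if_splits)
        then have "entry_deg g i j \<in> D.H"
          using ne g(1) gs_carrier ij by (intro D.H_memI[of _ "s $$ (i, j)"]) auto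
        then show False using coarse_degree[OF ij(1,2) g(1)] ij(3) g(2) by simp
      qed
      have "(c \<odot>\<^bsub>R\<^esub> s \<oplus>\<^bsub>R\<^esub> x) $$ (i, j) = \<zero>" if ij: "i < n" "j < n" "coarse i j \<noteq> q" for i j
      proof -
        have "x $$ (i, j) = \<zero>" using step.IH ij by blast
        then show ?thesis using s0[OF ij] ij by (simp add: R_entry D.B.smult_zero)
      qed
      then show ?case using step.IH sR by (auto intro: R.smult_closed)
    qed
  }
  assume P: "?P x"
  have cB: "\<And>i j. i < n \<Longrightarrow> j < n \<Longrightarrow> x $$ (i, j) \<in> carrier B" using P unfolding R_carrier by blast
  have E: "E i j b \<in> lin_span R ?S"
    if ij: "i < n" "j < n" "bl i \<le> bl j" "coarse i j = q" and b: "b \<in> carrier B" for i j b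
    using b
  proof (induction rule: D.B_induct)
    case zero
    have "E i j \<zero> = \<zero>\<^bsub>R\<^esub>" using ij by (intro R_eqI) (auto simp: E_carrier E_entry R_entry)
    then show ?case using lin_span.zero[of R ?S] by simp
  next
    case (step c h y)
    have u: "D.u h \<in> carrier B" using D.u_closed step by blast
    have hG: "h \<in> carrier G" using D.H_carrier step by blast
    have "\<alpha> h = \<one>\<^bsub>Q\<^esub>" using ker[OF hG] step by blast
    then have "\<alpha> (gs ! i \<otimes>\<^bsub>G\<^esub> h \<otimes>\<^bsub>G\<^esub> inv\<^bsub>G\<^esub> (gs ! j)) = q"
      using ij hG gs_carrier[of i] gs_carrier[of j] by (simp add: \<alpha>_mult \<alpha>_inv \<alpha>_closed)
    moreover have "E i j (D.u h) \<in> hcomp R (gs ! i \<otimes>\<^bsub>G\<^esub> h \<otimes>\<^bsub>G\<^esub> inv\<^bsub>G\<^esub> (gs ! j))"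
      using ij hG D.u_hcomp_eq(1)[OF step(1)] by (intro E_hcomp) auto
    moreover have "gs ! i \<otimes>\<^bsub>G\<^esub> h \<otimes>\<^bsub>G\<^esub> inv\<^bsub>G\<^esub> (gs ! j) \<in> carrier G" using ij hG gs_carrier by simp
    ultimately have "E i j (D.u h) \<in> ?S" by blast
    then have "c \<odot>\<^bsub>R\<^esub> E i j (D.u h) \<oplus>\<^bsub>R\<^esub> E i j y \<in> lin_span R ?S" using step by (intro lin_span.step) auto
    moreover have "c \<odot>\<^bsub>R\<^esub> E i j (D.u h) \<oplus>\<^bsub>R\<^esub> E i j y = E i j (c \<odot> D.u h \<oplus> y)"
      using ij u step
      by (intro R_eqI R.a_closed R.smult_closed E_carrier)
        (auto simp: E_entry R_entry D.B.smult_closed D.B.smult_zero)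
    ultimately show ?case by simp
  qed
  let ?T = "{p \<in> {..<n} \<times> {..<n}. x $$ p \<noteq> \<zero>}"
  let ?y = "\<Oplus>\<^bsub>R\<^esub>p\<in>?T. E (fst p) (snd p) (x $$ p)"
  have T: "E (fst p) (snd p) (x $$ p) \<in> lin_span R ?S" if "p \<in> ?T" for p
  proof -
    have "fst p < n" "snd p < n" "x $$ (fst p, snd p) \<noteq> \<zero>" using that by auto
    then have "bl (fst p) \<le> bl (snd p)" "coarse (fst p) (snd p) = q" "x $$ (fst p, snd p) \<in> carrier B"
      using P cB unfolding R_carrier by blast+
    then show ?thesis using that E[of "fst p" "snd p" "x $$ p"] by auto
  qed
  have TR: "E (fst p) (snd p) (x $$ p) \<in> carrier R" if "p \<in> ?T" for p
    using T[OF that] R.lin_span_closed S by blast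
  have fin: "finite ?T" by simp
  have "?y = x"
  proof (rule R_eqI)
    fix i j assume ij: "i < n" "j < n"
    have "?y $$ (i, j) = (\<Oplus>p\<in>?T. E (fst p) (snd p) (x $$ p) $$ (i, j))"
      by (rule R_finsum_entry[OF fin TR ij])
    also have "\<dots> = (\<Oplus>p\<in>?T. if (i, j) = p then x $$ p else \<zero>)"
      using cB ij by (intro D.B.finsum_cong') (auto simp: E_entry split: if_splits)
    also have "\<dots> = x $$ (i, j)"
    proof (cases "x $$ (i, j) = \<zero>")
      case True
      then have "(\<Oplus>p\<in>?T. if (i, j) = p then x $$ p else \<zero>) = (\<Oplus>p\<in>?T. \<zero>)"
        by (intro D.B.finsum_cong') auto
      then show ?thesis using True by simp
    next
      case False
      then show ?thesis using ij cB fin D.B.finsum_singleton[of "(i, j)" ?T "\<lambda>p. x $$ p"] by fastforce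
    qed
    finally show "?y $$ (i, j) = x $$ (i, j)" .
  qed (use P TR in \<open>auto intro!: R.finsum_closed\<close>)
  moreover have "?y \<in> lin_span R ?S"
    by (rule R.lin_span_finsum[OF S fin T])
  ultimately show "x \<in> hcomp C q" by simp
qed

lemma t_pos: "t > 0" using reps unfolding matrix_reps_def by blast

text \<open>The map induced by \<phi> on matrices over B. As B has trivial coarse degree, all t rows
  that replace a row of R carry the same coset, whence the repetitions in the grading of
  \<open>U\<close>.\<close>

definition inflate :: "('b \<Rightarrow> 'k mat) \<Rightarrow> 'b mat \<Rightarrow> 'k mat" where
  "inflate \<phi> x = mat (n * t) (n * t) (\<lambda>(i, j). \<phi> (x $$ (i div t, j div t)) $$ (i mod t, j mod t))"

lemma U_hcomp_iff: "y \<in> hcomp U q \<longleftrightarrow> y \<in> carrier_mat (n * t) (n * t) \<and>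
    (\<forall>i<n * t. \<forall>j<n * t. y $$ (i, j) \<noteq> 0 \<longrightarrow>
      bl (i div t) \<le> bl (j div t) \<and> coarse (i div t) (j div t) = q)"
  unfolding UT_hcomp_iff sum_list_map_mult block_of_map_mult[OF t_pos]
  using gs(1) by (simp add: nth_concat_replicate)

lemma U_carrier: "y \<in> carrier U \<longleftrightarrow> y \<in> carrier_mat (n * t) (n * t) \<and>
    (\<forall>i<n * t. \<forall>j<n * t. \<not> bl (i div t) \<le> bl (j div t) \<longrightarrow> y $$ (i, j) = 0)"
  unfolding UT_carrier sum_list_map_mult block_of_map_mult[OF t_pos] ..

lemma index_div: "i < n * t \<Longrightarrow> i div t < n" and index_mod: "i mod t < t"
  using t_pos by (simp_all add: less_mult_imp_div_less)

context
  fixes \<phi> assumes \<phi>: "\<phi> \<in> \<Phi>"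
begin

lemma \<phi>_hom: "algebra_hom B (module_mat TYPE('k) t t) \<phi>" and \<phi>_surj: "\<phi> ` carrier B = carrier_mat t t"
  using reps \<phi> unfolding matrix_reps_def by auto

lemma \<phi>_closed: "b \<in> carrier B \<Longrightarrow> \<phi> b \<in> carrier_mat t t"
  and \<phi>_smult: "b \<in> carrier B \<Longrightarrow> \<phi> (c \<odot> b) = c \<cdot>\<^sub>m \<phi> b"
  and \<phi>_one: "\<phi> \<one> = 1\<^sub>m t"
  and \<phi>_mult: "b \<in> carrier B \<Longrightarrow> b' \<in> carrier B \<Longrightarrow> \<phi> (b \<otimes> b') = \<phi> b * \<phi> b'"
  and \<phi>_add: "b \<in> carrier B \<Longrightarrow> b' \<in> carrier B \<Longrightarrow> \<phi> (b \<oplus> b') = \<phi> b + \<phi> b'"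
  using \<phi>_surj \<phi>_hom unfolding algebra_hom_def Ring.ring_hom_def by (auto simp: module_mat_simps)

lemma \<phi>_zero: "\<phi> \<zero> = 0\<^sub>m t t"
proof -
  have "\<phi> ((0::'k) \<odot> \<zero>) = 0 \<cdot>\<^sub>m \<phi> \<zero>" by (rule \<phi>_smult) simp
  also have "\<dots> = 0\<^sub>m t t" using \<phi>_closed[of "\<zero>"] by auto
  finally show ?thesis by (simp add: D.B.smult_0)
qed

lemma \<phi>_finsum_entry:
  assumes "finite S" "\<And>s. s \<in> S \<Longrightarrow> f s \<in> carrier B" and ab: "a < t" "b < t"
  shows "\<phi> (\<Oplus>s\<in>S. f s) $$ (a, b) = (\<Sum>s\<in>S. \<phi> (f s) $$ (a, b))"
  using assms(1,2)
proof (induction S rule: finite_induct)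
  case empty
  then show ?case using ab by (simp add: \<phi>_zero)
next
  case (insert s S)
  have c: "(\<Oplus>s\<in>S. f s) \<in> carrier B" "f s \<in> carrier B" using insert by (auto intro: D.B.finsum_closed)
  have "(\<Oplus>s\<in>insert s S. f s) = f s \<oplus> (\<Oplus>s\<in>S. f s)"
    using insert by (intro D.B.finsum_insert) auto
  then show ?case
    using insert c ab carrier_matD[OF \<phi>_closed[OF c(1)]] carrier_matD[OF \<phi>_closed[OF c(2)]]
    by (simp add: \<phi>_add)
qed

lemma inflate_dim: "inflate \<phi> x \<in> carrier_mat (n * t) (n * t)"
  by (simp add: inflate_def)

lemma inflate_entry: "i < n * t \<Longrightarrow> j < n * t \<Longrightarrow>
    inflate \<phi> x $$ (i, j) = \<phi> (x $$ (i div t, j div t)) $$ (i mod t, j mod t)"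
  by (simp add: inflate_def)

lemma inflate_carrier: "x \<in> carrier R \<Longrightarrow> inflate \<phi> x \<in> carrier U"
  unfolding U_carrier R_carrier using index_div index_mod
  by (auto simp: inflate_dim inflate_entry \<phi>_zero)

lemma inflate_mult:
  assumes x: "x \<in> carrier R" and y: "y \<in> carrier R"
  shows "inflate \<phi> (x \<otimes>\<^bsub>R\<^esub> y) = inflate \<phi> x * inflate \<phi> y"
proof (rule eq_matI)
  fix i j assume "i < dim_row (inflate \<phi> x * inflate \<phi> y)" "j < dim_col (inflate \<phi> x * inflate \<phi> y)"
  then have ij: "i < n * t" "j < n * t" using carrier_matD[OF inflate_dim] by simp_all
  have c: "x $$ (i div t, l) \<in> carrier B" "y $$ (l, j div t) \<in> carrier B" if "l < n" for l
    using x y index_div[OF ij(1)] index_div[OF ij(2)] that unfolding R_carrier by auto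
  have "inflate \<phi> (x \<otimes>\<^bsub>R\<^esub> y) $$ (i, j) =
    \<phi> (\<Oplus>l\<in>{..<n}. x $$ (i div t, l) \<otimes> y $$ (l, j div t)) $$ (i mod t, j mod t)"
    using ij index_div by (simp add: inflate_entry R_entry)
  also have "\<dots> = (\<Sum>l<n. \<phi> (x $$ (i div t, l) \<otimes> y $$ (l, j div t)) $$ (i mod t, j mod t))"
    by (rule \<phi>_finsum_entry) (use c index_mod in auto)
  also have "\<dots> = (\<Sum>l<n. \<Sum>c=0..<t. \<phi> (x $$ (i div t, l)) $$ (i mod t, c) * \<phi> (y $$ (l, j div t)) $$ (c, j mod t))"
  proof (rule sum.cong[OF refl])
    fix l assume "l \<in> {..<n}"
    then have l: "x $$ (i div t, l) \<in> carrier B" "y $$ (l, j div t) \<in> carrier B" using c by auto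
    show "\<phi> (x $$ (i div t, l) \<otimes> y $$ (l, j div t)) $$ (i mod t, j mod t) =
      (\<Sum>c=0..<t. \<phi> (x $$ (i div t, l)) $$ (i mod t, c) * \<phi> (y $$ (l, j div t)) $$ (c, j mod t))"
      using carrier_matD[OF \<phi>_closed[OF l(1)]] carrier_matD[OF \<phi>_closed[OF l(2)]] index_mod
      by (simp add: \<phi>_mult[OF l] scalar_prod_def)
  qed
  also have "\<dots> = (\<Sum>L=0..<n * t. inflate \<phi> x $$ (i, L) * inflate \<phi> y $$ (L, j))"
    unfolding sum_div_mod[OF t_pos, symmetric] using ij by (intro sum.cong) (auto simp: inflate_entry)
  also have "\<dots> = (inflate \<phi> x * inflate \<phi> y) $$ (i, j)"
    using ij carrier_matD[OF inflate_dim] by (simp add: scalar_prod_def)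
  finally show "inflate \<phi> (x \<otimes>\<^bsub>R\<^esub> y) $$ (i, j) = (inflate \<phi> x * inflate \<phi> y) $$ (i, j)" .
qed (use carrier_matD[OF inflate_dim] in simp_all)

lemma inflate_hom:
  shows "inflate \<phi> \<one>\<^bsub>R\<^esub> = \<one>\<^bsub>U\<^esub>"
    and "x \<in> carrier R \<Longrightarrow> y \<in> carrier R \<Longrightarrow> inflate \<phi> (x \<otimes>\<^bsub>R\<^esub> y) = inflate \<phi> x \<otimes>\<^bsub>U\<^esub> inflate \<phi> y"
    and "x \<in> carrier R \<Longrightarrow> y \<in> carrier R \<Longrightarrow> inflate \<phi> (x \<oplus>\<^bsub>R\<^esub> y) = inflate \<phi> x \<oplus>\<^bsub>U\<^esub> inflate \<phi> y"
    and "x \<in> carrier R \<Longrightarrow> inflate \<phi> (c \<odot>\<^bsub>R\<^esub> x) = c \<odot>\<^bsub>U\<^esub> inflate \<phi> x"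
proof -
  have eqI: "inflate \<phi> z = w" if "w \<in> carrier_mat (n * t) (n * t)"
    "\<And>i j. i < n * t \<Longrightarrow> j < n * t \<Longrightarrow> \<phi> (z $$ (i div t, j div t)) $$ (i mod t, j mod t) = w $$ (i, j)" for z w
    using that by (intro eq_matI) (auto simp: inflate_def)
  have decomp: "i = j \<longleftrightarrow> i div t = j div t \<and> i mod t = j mod t" for i j :: nat
    by (metis div_mult_mod_eq)
  show "inflate \<phi> \<one>\<^bsub>R\<^esub> = \<one>\<^bsub>U\<^esub>"
    unfolding UT_simps sum_list_map_mult
  proof (rule eqI)
    fix i j assume ij: "i < n * t" "j < n * t"
    show "\<phi> (\<one>\<^bsub>R\<^esub> $$ (i div t, j div t)) $$ (i mod t, j mod t) =
      \<one>\<^bsub>module_mat TYPE('k) (n * t) (n * t)\<^esub> $$ (i, j)"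
      using ij decomp[of i j] index_div[OF ij(1)] index_div[OF ij(2)] index_mod
      by (cases "i div t = j div t") (simp_all add: module_mat_simps R_entry \<phi>_one \<phi>_zero)
  qed (simp add: module_mat_simps)
  assume x: "x \<in> carrier R"
  have xB: "x $$ (i div t, j div t) \<in> carrier B" if "i < n * t" "j < n * t" for i j
    using x that index_div unfolding R_carrier by blast
  have xd: "dim_row (\<phi> (x $$ (i div t, j div t))) = t" "dim_col (\<phi> (x $$ (i div t, j div t))) = t"
    if "i < n * t" "j < n * t" for i j using \<phi>_closed[OF xB[OF that]] by auto
  show "inflate \<phi> (c \<odot>\<^bsub>R\<^esub> x) = c \<odot>\<^bsub>U\<^esub> inflate \<phi> x"
    unfolding UT_simps sum_list_map_mult
    by (rule eqI) (use index_div index_mod xB xd in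
      \<open>auto simp: module_mat_simps R_entry \<phi>_smult inflate_def\<close>)
  assume y: "y \<in> carrier R"
  have yB: "y $$ (i div t, j div t) \<in> carrier B" if "i < n * t" "j < n * t" for i j
    using y that index_div unfolding R_carrier by blast
  have yd: "dim_row (\<phi> (y $$ (i div t, j div t))) = t" "dim_col (\<phi> (y $$ (i div t, j div t))) = t"
    if "i < n * t" "j < n * t" for i j using \<phi>_closed[OF yB[OF that]] by auto
  show "inflate \<phi> (x \<oplus>\<^bsub>R\<^esub> y) = inflate \<phi> x \<oplus>\<^bsub>U\<^esub> inflate \<phi> y"
    unfolding UT_simps sum_list_map_mult
    by (rule eqI) (use index_div index_mod xB yB xd yd in
      \<open>auto simp: module_mat_simps R_entry \<phi>_add inflate_def\<close>)
  show "inflate \<phi> (x \<otimes>\<^bsub>R\<^esub> y) = inflate \<phi> x \<otimes>\<^bsub>U\<^esub> inflate \<phi> y"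
    unfolding UT_simps module_mat_simps by (rule inflate_mult[OF x y])
qed

lemma inflate_degree:
  assumes "x \<in> hcomp C q"
  shows "inflate \<phi> x \<in> hcomp U q"
  unfolding U_hcomp_iff
proof (intro conjI allI impI inflate_dim)
  fix i j assume ij: "i < n * t" "j < n * t" "inflate \<phi> x $$ (i, j) \<noteq> 0"
  have "x $$ (i div t, j div t) \<noteq> \<zero>"
    using ij index_mod by (auto simp: inflate_entry \<phi>_zero)
  then show "bl (i div t) \<le> bl (j div t)" "coarse (i div t) (j div t) = q"
    using assms index_div[OF ij(1)] index_div[OF ij(2)] unfolding C_hcomp_iff R_carrier by blast+
qed

lemma inflate_lift:
  assumes y: "y \<in> hcomp U q"
  shows "\<exists>x\<in>hcomp C q. inflate \<phi> x = y"
proof -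
  have "\<exists>b. b \<in> carrier B \<and> \<phi> b = m" if "m \<in> carrier_mat t t" for m
    using \<phi>_surj that by (metis imageE)
  then obtain \<psi> where \<psi>: "\<And>m. m \<in> carrier_mat t t \<Longrightarrow> \<psi> m \<in> carrier B \<and> \<phi> (\<psi> m) = m" by metis
  define m where "m i j = mat t t (\<lambda>(a, b). y $$ (i * t + a, j * t + b))" for i j
  have mc: "m i j \<in> carrier_mat t t" for i j by (simp add: m_def)
  \<comment> \<open>Zero blocks are lifted to zero explicitly: another preimage of the zero matrix
    could be a nonzero entry in a position of the wrong degree.\<close>
  define x where "x = mat n n (\<lambda>(i, j). if m i j = 0\<^sub>m t t then \<zero> else \<psi> (m i j))"
  have x: "x $$ (i, j) \<in> carrier B \<and> \<phi> (x $$ (i, j)) = m i j" if "i < n" "j < n" for i j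
    using that \<psi>[OF mc] \<phi>_zero by (auto simp: x_def)
  have nz: "bl i \<le> bl j \<and> coarse i j = q" if ij: "i < n" "j < n" "x $$ (i, j) \<noteq> \<zero>" for i j
  proof -
    have "m i j \<noteq> 0\<^sub>m t t" using ij by (auto simp: x_def)
    moreover have "m i j = 0\<^sub>m t t" if "\<And>a b. a < t \<Longrightarrow> b < t \<Longrightarrow> y $$ (i * t + a, j * t + b) = 0"
      unfolding m_def using that by (intro eq_matI) auto
    ultimately obtain a b where ab: "a < t" "b < t" "y $$ (i * t + a, j * t + b) \<noteq> 0" by blast
    have less: "i * t + a < n * t" "j * t + b < n * t" using ij ab by (auto intro: mult_add_less)
    have "(i * t + a) div t = i" "(j * t + b) div t = j" using ab by simp_all
    moreover have "bl ((i * t + a) div t) \<le> bl ((j * t + b) div t) \<and> coarse ((i * t + a) div t) ((j * t + b) div t) = q"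
      using y ab(3) less unfolding U_hcomp_iff by blast
    ultimately show ?thesis by simp
  qed
  have "x \<in> hcomp C q" unfolding C_hcomp_iff R_carrier
  proof (intro conjI allI impI)
    show "x \<in> carrier_mat n n" by (simp add: x_def)
  qed (use x nz in blast)+
  moreover have "inflate \<phi> x = y"
  proof (rule eq_matI)
    have yc: "y \<in> carrier_mat (n * t) (n * t)" using y unfolding U_hcomp_iff by blast
    then show "dim_row (inflate \<phi> x) = dim_row y" "dim_col (inflate \<phi> x) = dim_col y" by (simp_all add: inflate_def)
    fix i j assume "i < dim_row y" "j < dim_col y"
    then have ij: "i < n * t" "j < n * t" using yc by auto
    then show "inflate \<phi> x $$ (i, j) = y $$ (i, j)"
      using x[OF index_div[OF ij(1)] index_div[OF ij(2)]] index_mod by (simp add: inflate_entry m_def)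
  qed
  ultimately show ?thesis by blast
qed

end

lemma inflate_separates:
  assumes x: "x \<in> carrier R" and z: "\<And>\<phi>. \<phi> \<in> \<Phi> \<Longrightarrow> inflate \<phi> x = \<zero>\<^bsub>U\<^esub>"
  shows "x = \<zero>\<^bsub>R\<^esub>"
proof (rule R_eqI[OF x R.zero_closed])
  fix i j assume ij: "i < n" "j < n"
  have xB: "x $$ (i, j) \<in> carrier B" using x ij unfolding R_carrier by blast
  have "\<phi> (x $$ (i, j)) = 0\<^sub>m t t" if \<phi>: "\<phi> \<in> \<Phi>" for \<phi>
  proof (rule eq_matI)
    have c: "\<phi> (x $$ (i, j)) \<in> carrier_mat t t" by (rule \<phi>_closed[OF \<phi> xB])
    then show "dim_row (\<phi> (x $$ (i, j))) = dim_row (0\<^sub>m t t)" "dim_col (\<phi> (x $$ (i, j))) = dim_col (0\<^sub>m t t)" by auto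
    fix a b assume "a < dim_row (0\<^sub>m t t :: 'k mat)" "b < dim_col (0\<^sub>m t t :: 'k mat)"
    then have ab: "a < t" "b < t" by simp_all
    have less: "i * t + a < n * t" "j * t + b < n * t" using ij ab by (auto intro: mult_add_less)
    have "inflate \<phi> x $$ (i * t + a, j * t + b) = 0"
      unfolding z[OF \<phi>] using less by (simp add: UT_simps sum_list_map_mult module_mat_simps)
    then show "\<phi> (x $$ (i, j)) $$ (a, b) = 0\<^sub>m t t $$ (a, b)"
      using ab less by (simp add: inflate_entry[OF \<phi>])
  qed
  then show "x $$ (i, j) = \<zero>\<^bsub>R\<^esub> $$ (i, j)"
    unfolding R_entry(4)[OF ij] using reps xB unfolding matrix_reps_def by blast
qed

lemma C_hcomp_subset: "hcomp C q \<subseteq> carrier C"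
  using C_hcomp_iff by auto

text \<open>One representation, with homogeneous lifts, carries identities from \<open>C\<close> to
  \<open>U\<close>; the whole separating family carries them back.\<close>

theorem coarsening_identities: "graded_identities Q C = graded_identities Q U"
proof (intro equalityI subsetI)
  have uC: "unital_algebra C" by (rule unital_algebra_coarsening[OF R.unital_algebra_axioms])
  have uU: "unital_algebra U" by (rule unital_algebra_UT)
  interpret C: unital_algebra C by (rule uC)
  interpret U: unital_algebra U by (rule uU)
  have eval: "inflate \<phi> (eval_ncpoly C v f) = eval_ncpoly U (\<lambda>x. inflate \<phi> (v x)) f"
    if \<phi>: "\<phi> \<in> \<Phi>" and v: "\<And>x. v x \<in> carrier R" for \<phi> v and f :: "(nat \<times> 'q, 'k) ncpoly"
    by (rule eval_ncpoly_hom[OF uC uU])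
      (simp_all add: inflate_carrier[OF \<phi>] inflate_hom[OF \<phi>] v)
  have zero: "inflate \<phi> \<zero>\<^bsub>R\<^esub> = \<zero>\<^bsub>U\<^esub>" if "\<phi> \<in> \<Phi>" for \<phi>
    unfolding UT_simps sum_list_map_mult
    by (rule eq_matI) (use index_div index_mod in \<open>auto simp: inflate_def module_mat_simps R_entry \<phi>_zero[OF that]\<close>)
  {
    fix f assume f: "f \<in> graded_identities Q C"
    show "f \<in> graded_identities Q U"
    proof (rule graded_identitiesI[OF uU graded_identitiesD(1)[OF f] UT_hcomp_subset])
      fix v assume v: "\<And>(i::nat) q. q \<in> carrier Q \<Longrightarrow> v (i, q) \<in> hcomp U q" "\<And>x. v x \<in> carrier U"
      obtain \<phi> where \<phi>: "\<phi> \<in> \<Phi>" using reps unfolding matrix_reps_def by blast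
      have "\<exists>x. (snd y \<in> carrier Q \<longrightarrow> x \<in> hcomp C (snd y) \<and> inflate \<phi> x = v y) \<and> x \<in> carrier R" for y
      proof (cases "snd y \<in> carrier Q")
        case True
        then have "v y \<in> hcomp U (snd y)" using v(1)[of "snd y" "fst y"] by simp
        then show ?thesis using inflate_lift[OF \<phi>] C_hcomp_subset by fastforce
      qed (use R.zero_closed in blast)
      then obtain w where w: "\<And>y. snd y \<in> carrier Q \<Longrightarrow> w y \<in> hcomp C (snd y)"
        "\<And>y. snd y \<in> carrier Q \<Longrightarrow> inflate \<phi> (w y) = v y" "\<And>y. w y \<in> carrier R" by metis
      have "eval_ncpoly U v f = eval_ncpoly U (\<lambda>x. inflate \<phi> (w x)) f"
      proof (rule U.eval_ncpoly_cong)
        fix x assume "x \<in> ncvars f"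
        then have "snd x \<in> carrier Q" using graded_identitiesD(1)[OF f] unfolding graded_ncpolys_iff by blast
        then show "v x = inflate \<phi> (w x) \<and> v x \<in> carrier U" using w(2) v(2) by simp
      qed
      also have "\<dots> = inflate \<phi> (eval_ncpoly C w f)" by (rule eval[OF \<phi> w(3), symmetric])
      also have "eval_ncpoly C w f = \<zero>\<^bsub>C\<^esub>"
        by (rule graded_identitiesD(2)[OF f]) (use w(1) in force)
      finally show "eval_ncpoly U v f = \<zero>\<^bsub>U\<^esub>" using zero[OF \<phi>] by simp
    qed
  next
    fix f assume f: "f \<in> graded_identities Q U"
    show "f \<in> graded_identities Q C"
    proof (rule graded_identitiesI[OF uC graded_identitiesD(1)[OF f] C_hcomp_subset])
      fix v assume v: "\<And>(i::nat) q. q \<in> carrier Q \<Longrightarrow> v (i, q) \<in> hcomp C q" "\<And>x. v x \<in> carrier C"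
      have vR: "\<And>x. v x \<in> carrier R" using v(2) by simp
      have "eval_ncpoly C v f = \<zero>\<^bsub>R\<^esub>"
      proof (rule inflate_separates)
        show "eval_ncpoly C v f \<in> carrier R" using C.eval_ncpoly_closed[OF v(2)] by simp
        fix \<phi> assume \<phi>: "\<phi> \<in> \<Phi>"
        show "inflate \<phi> (eval_ncpoly C v f) = \<zero>\<^bsub>U\<^esub>"
          unfolding eval[OF \<phi> vR] by (rule graded_identitiesD(2)[OF f]) (rule inflate_degree[OF \<phi> v(1)])
      qed
      then show "eval_ncpoly C v f = \<zero>\<^bsub>C\<^esub>" by simp
    qed
  }
qed

end

end

text \<open>Serves to identify the p.i. degrees of B and B'.\<close>

lemma graded_isomorphic_identities:
  fixes A :: "('k::field, 'a, 'g, 'm) gr_algebra_scheme" and A' :: "('k, 'b, 'g, 'm2) gr_algebra_scheme"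
  assumes A: "unital_algebra A" and A': "unital_algebra A'" and iso: "graded_isomorphic G A A'"
  shows "identities A = identities A'"
proof -
  interpret A: unital_algebra A by (rule A)
  interpret A': unital_algebra A' by (rule A')
  obtain h where iso: "h \<in> ring_iso A A'" and hs: "\<forall>c. \<forall>x\<in>carrier A. h (c \<odot>\<^bsub>A\<^esub> x) = c \<odot>\<^bsub>A'\<^esub> h x"
    using iso unfolding graded_isomorphic_def by (elim bexE conjE)
  have h: "h \<in> Ring.ring_hom A A'" "bij_betw h (carrier A) (carrier A')" using iso unfolding ring_iso_def by simp_all
  have hom: "algebra_hom A A' h" unfolding algebra_hom_def using h hs by simp
  have "h \<zero>\<^bsub>A\<^esub> = \<zero>\<^bsub>A'\<^esub>"
    by (rule ring_hom_zero[OF h(1) A.ring_axioms A'.ring_axioms])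
  then have "x = \<zero>\<^bsub>A\<^esub>" if "x \<in> carrier A" "h x = \<zero>\<^bsub>A'\<^esub>" for x
    using inj_onD[OF bij_betw_imp_inj_on[OF h(2)], of x "\<zero>\<^bsub>A\<^esub>"] that by simp
  then show ?thesis
    by (intro identities_separating_homs[OF A A', of "{h}"])
      (simp_all add: hom bij_betw_imp_surj_on[OF h(2)])
qed

section \<open>Isomorphisms of block-triangular matrix algebras\<close>

lemma block_of_surj:
  assumes pos: "\<forall>d\<in>set ds. d > 0" and k: "k < length ds"
  shows "\<exists>i<sum_list ds. block_of ds i = k"
proof (intro exI conjI)
  let ?i = "sum_list (take k ds)"
  have split: "sum_list (take k ds) + sum_list (drop k ds) = sum_list ds"
    by (metis append_take_drop_id sum_list_append)
  have suc: "sum_list (take (Suc k) ds) = ?i + ds ! k" using k by (simp add: take_Suc_conv_app_nth)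
  have "ds ! k > 0" using pos k by simp
  moreover have "ds ! k \<le> sum_list (drop k ds)" using k by (simp add: Cons_nth_drop_Suc[symmetric])
  ultimately show "?i < sum_list ds" using split by linarith
  show "block_of ds ?i = k"
    unfolding block_of_def
  proof (rule Least_equality)
    show "?i < sum_list (take (Suc k) ds)" using suc \<open>ds ! k > 0\<close> by simp
    fix l assume l: "?i < sum_list (take (Suc l) ds)"
    show "k \<le> l"
    proof (rule ccontr)
      assume "\<not> k \<le> l"
      then have "take k ds = take (Suc l) ds @ take (k - Suc l) (drop (Suc l) ds)"
        by (metis take_add le_add_diff_inverse not_less_eq_eq)
      then show False using l by simp
    qed
  qed
qed

lemma matrix_unit_entry: "r < n \<Longrightarrow> s < n \<Longrightarrow> matrix_unit n i j $$ (r, s) = (if r = i \<and> s = j then 1 else 0)"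
  by (simp add: matrix_unit_def)

lemma mult_entry:
  assumes "x \<in> carrier_mat n n" "y \<in> carrier_mat n n" "i < n" "j < n"
  shows "(x * y) $$ (i, j) = (\<Sum>l\<in>{0..<n}. x $$ (i, l) * y $$ (l, j))"
proof -
  have d: "dim_row x = n" "dim_col x = n" "dim_row y = n" "dim_col y = n" using assms(1,2) by auto
  show ?thesis using assms(3,4) by (simp add: d scalar_prod_def)
qed

lemma matrix_unit_sandwich:
  fixes x :: "'k::field mat"
  assumes x: "x \<in> carrier_mat n n" and ij: "i < n" "j < n"
  shows "matrix_unit n i i * x * matrix_unit n j j = x $$ (i, j) \<cdot>\<^sub>m matrix_unit n i j"
proof (rule eq_matI)
  let ?e = "matrix_unit n :: nat \<Rightarrow> nat \<Rightarrow> 'k mat"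
  have ex: "?e i i * x \<in> carrier_mat n n" using mult_carrier_mat[OF matrix_unit_carrier x] .
  show "dim_row (?e i i * x * ?e j j) = dim_row (x $$ (i, j) \<cdot>\<^sub>m ?e i j)"
    "dim_col (?e i i * x * ?e j j) = dim_col (x $$ (i, j) \<cdot>\<^sub>m ?e i j)" by (simp_all add: matrix_unit_def)
  fix r s assume "r < dim_row (x $$ (i, j) \<cdot>\<^sub>m ?e i j)" "s < dim_col (x $$ (i, j) \<cdot>\<^sub>m ?e i j)"
  then have rs: "r < n" "s < n" by (simp_all add: matrix_unit_def)
  have e1: "(?e i i * x) $$ (r, l) = (if r = i then x $$ (i, l) else 0)" if "l < n" for l
  proof -
    have "(?e i i * x) $$ (r, l) = (\<Sum>k\<in>{0..<n}. if k = i then (if r = i then x $$ (k, l) else 0) else 0)"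
      unfolding mult_entry[OF matrix_unit_carrier x rs(1) that]
      by (intro sum.cong) (auto simp: matrix_unit_entry rs)
    then show ?thesis using ij by simp
  qed
  have "(?e i i * x * ?e j j) $$ (r, s) = (\<Sum>l\<in>{0..<n}. if l = j then (if r = i \<and> s = j then x $$ (i, l) else 0) else 0)"
    unfolding mult_entry[OF ex matrix_unit_carrier rs]
    by (intro sum.cong) (auto simp: matrix_unit_entry rs e1)
  also have "\<dots> = (x $$ (i, j) \<cdot>\<^sub>m ?e i j) $$ (r, s)" using ij rs by (simp add: matrix_unit_def)
  finally show "(?e i i * x * ?e j j) $$ (r, s) = (x $$ (i, j) \<cdot>\<^sub>m ?e i j) $$ (r, s)" .
qed

locale UT_isomorphism =
  fixes Q :: "('q, 'z) monoid_scheme" (structure) and ds ds' :: "nat list" and ps ps' :: "'q list"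
    and f :: "'k::field mat \<Rightarrow> 'k mat"
  assumes pos: "\<forall>d\<in>set ds. d > 0" and len: "length ds' = length ds"
    and sum: "sum_list ds' = sum_list ds"
    and iso: "f \<in> ring_iso (UT Q ds ps) (UT Q ds' ps')"
    and linear: "\<And>c x. x \<in> carrier (UT Q ds ps) \<Longrightarrow>
      f (c \<odot>\<^bsub>UT Q ds ps\<^esub> x) = c \<odot>\<^bsub>UT Q ds' ps'\<^esub> f x"
begin

abbreviation "n \<equiv> sum_list ds"
abbreviation "b \<equiv> block_of ds"
abbreviation "b' \<equiv> block_of ds'"
abbreviation "U \<equiv> UT Q ds ps :: ('k, 'k mat, 'q) gr_algebra"
abbreviation "U' \<equiv> UT Q ds' ps' :: ('k, 'k mat, 'q) gr_algebra"
abbreviation "e \<equiv> matrix_unit n :: nat \<Rightarrow> nat \<Rightarrow> 'k mat"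

lemma U_mem: "x \<in> carrier U \<longleftrightarrow> x \<in> carrier_mat n n \<and> (\<forall>i<n. \<forall>j<n. \<not> b i \<le> b j \<longrightarrow> x $$ (i, j) = 0)"
  by (rule UT_carrier)

lemma U'_mem: "x \<in> carrier U' \<longleftrightarrow> x \<in> carrier_mat n n \<and> (\<forall>i<n. \<forall>j<n. \<not> b' i \<le> b' j \<longrightarrow> x $$ (i, j) = 0)"
  using UT_carrier[of x Q ds' ps'] unfolding sum .

lemma f_hom: "f \<in> Ring.ring_hom U U'" and f_bij: "bij_betw f (carrier U) (carrier U')"
  using iso unfolding ring_iso_def by simp_all

lemma f_closed: "x \<in> carrier U \<Longrightarrow> f x \<in> carrier U'"
  using f_hom by (rule ring_hom_closed)

lemma f_mat: "x \<in> carrier U \<Longrightarrow> f x \<in> carrier_mat n n"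
  using f_closed U'_mem by blast

lemma f_mult: "x \<in> carrier U \<Longrightarrow> y \<in> carrier U \<Longrightarrow> f (x * y) = f x * f y"
  using ring_hom_mult[OF f_hom] unfolding UT_simps module_mat_simps .

lemma f_zero: "f (0\<^sub>m n n) = 0\<^sub>m n n"
proof -
  have "ring U" "ring U'" using unital_algebra_UT unfolding unital_algebra_def by blast+
  then have "f \<zero>\<^bsub>U\<^esub> = \<zero>\<^bsub>U'\<^esub>" by (rule ring_hom_zero[OF f_hom])
  then show ?thesis unfolding UT_simps module_mat_simps sum by simp
qed

lemma e_U: "i < n \<Longrightarrow> j < n \<Longrightarrow> b i \<le> b j \<Longrightarrow> e i j \<in> carrier U"
  unfolding U_mem by (auto simp: matrix_unit_carrier matrix_unit_entry)

lemma e_neq_zero: "i < n \<Longrightarrow> j < n \<Longrightarrow> e i j \<noteq> 0\<^sub>m n n"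
  by (metis index_zero_mat(1) matrix_unit_entry zero_neq_one)

lemma f_e_neq_zero:
  assumes "i < n" "j < n" "b i \<le> b j"
  shows "f (e i j) \<noteq> 0\<^sub>m n n"
proof
  assume "f (e i j) = 0\<^sub>m n n"
  then have "f (e i j) = f (0\<^sub>m n n)" using f_zero by simp
  moreover have "0\<^sub>m n n \<in> carrier U" unfolding U_mem by simp
  ultimately have "e i j = 0\<^sub>m n n"
    using inj_onD[OF bij_betw_imp_inj_on[OF f_bij]] e_U[OF assms] by blast
  then show False using e_neq_zero assms by blast
qed

text \<open>Picks a nonzero column of the idempotent \<open>f (e i i)\<close>, that is, a nonzero
  vector in its image.\<close>

definition pivot :: "nat \<Rightarrow> nat" where
  "pivot i = (SOME c. c < n \<and> (\<exists>r<n. f (e i i) $$ (r, c) \<noteq> 0))"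

lemma pivot:
  assumes "i < n"
  shows "pivot i < n" "\<exists>r<n. f (e i i) $$ (r, pivot i) \<noteq> 0"
proof -
  have c: "f (e i i) \<in> carrier_mat n n" using assms by (intro f_mat e_U) auto
  have "\<exists>c. c < n \<and> (\<exists>r<n. f (e i i) $$ (r, c) \<noteq> 0)"
  proof (rule ccontr)
    assume "\<not> ?thesis"
    then have "f (e i i) = 0\<^sub>m n n" using c by (intro eq_matI) auto
    then show False using f_e_neq_zero[of i i] assms by simp
  qed
  from someI_ex[OF this] show "pivot i < n" "\<exists>r<n. f (e i i) $$ (r, pivot i) \<noteq> 0"
    unfolding pivot_def by auto
qed

text \<open>The columns of \<open>W\<close> diagonalize the orthogonal idempotents \<open>f (e i i)\<close>.\<close>

definition W :: "'k mat" where
  "W = mat n n (\<lambda>(r, i). f (e i i) $$ (r, pivot i))"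

lemma W_mat: "W \<in> carrier_mat n n"
  by (simp add: W_def)

lemma W_column: "i < n \<Longrightarrow> \<exists>r<n. W $$ (r, i) \<noteq> 0"
proof -
  assume i: "i < n"
  obtain r where "r < n" "f (e i i) $$ (r, pivot i) \<noteq> 0" using pivot(2)[OF i] by blast
  then show ?thesis using i by (intro exI[of _ r]) (simp add: W_def)
qed

text \<open>Column j of \<open>W\<close> is a column of the idempotent \<open>f (e j j)\<close>,
  hence fixed by it and annihilated by the others.\<close>

lemma idempotent_W:
  assumes i: "i < n"
  shows "f (e i i) * W = W * e i i"
proof (rule eq_matI)
  have fi: "f (e i i) \<in> carrier_mat n n" if "i < n" for i using that by (intro f_mat e_U) auto
  show "dim_row (f (e i i) * W) = dim_row (W * e i i)" "dim_col (f (e i i) * W) = dim_col (W * e i i)"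
    using fi[OF i] by (simp_all add: W_def matrix_unit_def)
  fix r j assume "r < dim_row (W * e i i)" "j < dim_col (W * e i i)"
  then have rj: "r < n" "j < n" by (simp_all add: W_def matrix_unit_def)
  have "(f (e i i) * W) $$ (r, j) = (\<Sum>l\<in>{0..<n}. f (e i i) $$ (r, l) * f (e j j) $$ (l, pivot j))"
    unfolding mult_entry[OF fi[OF i] W_mat rj] using rj by (intro sum.cong) (auto simp: W_def)
  also have "\<dots> = (f (e i i) * f (e j j)) $$ (r, pivot j)"
    by (rule mult_entry[OF fi[OF i] fi[OF rj(2)] rj(1) pivot(1)[OF rj(2)], symmetric])
  also have "f (e i i) * f (e j j) = f (e i i * e j j)"
    using i rj by (intro f_mult[symmetric] e_U) auto
  also have "e i i * e j j = (if i = j then e i j else 0\<^sub>m n n)"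
    by (rule matrix_unit_mult[OF i i rj(2) rj(2)])
  also have "f (if i = j then e i j else 0\<^sub>m n n) $$ (r, pivot j) = (if i = j then W $$ (r, j) else 0)"
    using rj pivot(1)[OF rj(2)] by (simp add: f_zero W_def)
  also have "\<dots> = (\<Sum>l\<in>{0..<n}. if l = i then (if j = i then W $$ (r, l) else 0) else 0)"
    using i by auto
  also have "\<dots> = (W * e i i) $$ (r, j)"
    unfolding mult_entry[OF W_mat matrix_unit_carrier rj]
    by (intro sum.cong) (auto simp: matrix_unit_entry rj)
  finally show "(f (e i i) * W) $$ (r, j) = (W * e i i) $$ (r, j)" .
qed

text \<open>Applying \<open>f (e i i)\<close> to a linear relation among the columns isolates its
  i-th term, and no column is zero.\<close>

lemma det_W: "det W \<noteq> 0"
proof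
  assume "det W = 0"
  then obtain v where v: "v \<in> carrier_vec n" "v \<noteq> 0\<^sub>v n" "W *\<^sub>v v = 0\<^sub>v n"
    using det_0_iff_vec_prod_zero_field[OF W_mat] by blast
  have "v $ i = 0" if i: "i < n" for i
  proof -
    obtain r where r: "r < n" "W $$ (r, i) \<noteq> 0" using W_column[OF i] by blast
    have fi: "f (e i i) \<in> carrier_mat n n" using i by (intro f_mat e_U) auto
    have "(W * e i i) *\<^sub>v v = f (e i i) *\<^sub>v (W *\<^sub>v v)"
      unfolding idempotent_W[OF i, symmetric] by (rule assoc_mult_mat_vec[OF fi W_mat v(1)])
    moreover have "f (e i i) *\<^sub>v 0\<^sub>v n = 0\<^sub>v n" using fi by (intro eq_vecI) auto
    ultimately have "(W * e i i) *\<^sub>v v = 0\<^sub>v n" unfolding v(3) by simp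
    then have "((W * e i i) *\<^sub>v v) $ r = 0" using r by simp
    moreover have "((W * e i i) *\<^sub>v v) $ r = (\<Sum>l\<in>{0..<n}. (W * e i i) $$ (r, l) * v $ l)"
      using r v(1) carrier_matD[OF mult_carrier_mat[OF W_mat matrix_unit_carrier[of n i i]]]
      by (simp add: scalar_prod_def del: index_mult_mat(1))
    moreover have "(W * e i i) $$ (r, l) = (if l = i then W $$ (r, i) else 0)" if l: "l < n" for l
    proof -
      have "(W * e i i) $$ (r, l) = (\<Sum>k\<in>{0..<n}. if k = i then (if l = i then W $$ (r, k) else 0) else 0)"
        unfolding mult_entry[OF W_mat matrix_unit_carrier r(1) l]
        by (intro sum.cong) (auto simp: matrix_unit_entry l)
      then show ?thesis using i by simp
    qed
    ultimately have "(\<Sum>l\<in>{0..<n}. if l = i then W $$ (r, i) * v $ l else 0) = 0"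
      by (simp add: if_distrib[of "\<lambda>x. x * _"] cong: if_cong)
    then show ?thesis using i r by simp
  qed
  then have "v = 0\<^sub>v n" using v(1) by (intro eq_vecI) auto
  then show False using v(2) by blast
qed

definition V :: "'k mat" where "V = (SOME V. V \<in> carrier_mat n n \<and> V * W = 1\<^sub>m n \<and> W * V = 1\<^sub>m n)"

lemma V: "V \<in> carrier_mat n n" "V * W = 1\<^sub>m n" "W * V = 1\<^sub>m n"
proof -
  have "W \<in> Units (ring_mat TYPE('k) n ())" by (rule det_non_zero_imp_unit[OF W_mat det_W])
  then have "\<exists>V. V \<in> carrier_mat n n \<and> V * W = 1\<^sub>m n \<and> W * V = 1\<^sub>m n"
    unfolding Units_def by (auto simp: ring_mat_simps)
  from someI_ex[OF this] show "V \<in> carrier_mat n n" "V * W = 1\<^sub>m n" "W * V = 1\<^sub>m n"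
    unfolding V_def by auto
qed

text \<open>f followed by conjugation with \<open>W\<close>. It fixes the diagonal matrix units and
  therefore acts on each position by a scalar.\<close>

definition F :: "'k mat \<Rightarrow> 'k mat" where "F x = V * (f x * W)"

lemma F_mat: "x \<in> carrier U \<Longrightarrow> F x \<in> carrier_mat n n"
  unfolding F_def using V(1) f_mat W_mat by (intro mult_carrier_mat)

lemma W_F:
  assumes "x \<in> carrier U"
  shows "W * F x = f x * W"
proof -
  have fw: "f x * W \<in> carrier_mat n n" using f_mat[OF assms] W_mat by (rule mult_carrier_mat)
  have "W * F x = (W * V) * (f x * W)" unfolding F_def by (rule assoc_mult_mat[OF W_mat V(1) fw, symmetric])
  then show ?thesis unfolding V(3) left_mult_one_mat[OF fw] .
qed

lemma F_mult:
  assumes "x \<in> carrier U" "y \<in> carrier U"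
  shows "F (x * y) = F x * F y"
proof -
  have c: "f x \<in> carrier_mat n n" "f y \<in> carrier_mat n n" using assms f_mat by auto
  have "F x * F y = V * (f x * W) * F y" unfolding F_def[of x] ..
  also have "\<dots> = V * (f x * W * F y)"
    by (rule assoc_mult_mat[OF V(1) mult_carrier_mat[OF c(1) W_mat] F_mat[OF assms(2)]])
  also have "f x * W * F y = f x * (W * F y)"
    by (rule assoc_mult_mat[OF c(1) W_mat F_mat[OF assms(2)]])
  also have "\<dots> = f x * (f y * W)" by (simp only: W_F[OF assms(2)])
  also have "\<dots> = f x * f y * W" by (rule assoc_mult_mat[OF c W_mat, symmetric])
  also have "V * (f x * f y * W) = F (x * y)" unfolding F_def f_mult[OF assms] ..
  finally show ?thesis ..
qed

lemma F_idempotent: "i < n \<Longrightarrow> F (e i i) = e i i"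
proof -
  assume i: "i < n"
  have "F (e i i) = V * (W * e i i)" unfolding F_def idempotent_W[OF i] ..
  also have "\<dots> = (V * W) * e i i" by (rule assoc_mult_mat[OF V(1) W_mat matrix_unit_carrier, symmetric])
  also have "\<dots> = e i i" unfolding V(2) by (rule left_mult_one_mat[OF matrix_unit_carrier])
  finally show ?thesis .
qed

lemma F_sandwich:
  assumes x: "x \<in> carrier U" and ij: "i < n" "j < n"
  shows "F (e i i * x * e j j) = F x $$ (i, j) \<cdot>\<^sub>m e i j"
proof -
  have c: "e i i \<in> carrier U" "e j j \<in> carrier U" using ij by (auto intro: e_U)
  have ex: "e i i * x \<in> carrier U"
  proof -
    interpret U: unital_algebra U by (rule unital_algebra_UT)
    show ?thesis using U.m_closed[OF c(1) x] unfolding UT_simps module_mat_simps .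
  qed
  have "F (e i i * x * e j j) = e i i * F x * e j j"
    by (simp only: F_mult[OF ex c(2)] F_mult[OF c(1) x] F_idempotent[OF ij(1)] F_idempotent[OF ij(2)])
  also have "\<dots> = F x $$ (i, j) \<cdot>\<^sub>m e i j" by (rule matrix_unit_sandwich[OF F_mat[OF x] ij])
  finally show ?thesis .
qed

text \<open>Sandwiching between fixed diagonal units makes the image of \<open>e i j\<close> under
  \<open>F\<close> a multiple of \<open>e i j\<close>; the factor is nonzero because f is injective
  and \<open>W\<close> invertible.\<close>

lemma F_matrix_unit:
  assumes ij: "i < n" "j < n" "b i \<le> b j"
  obtains c where "c \<noteq> 0" "f (e i j) * W = c \<cdot>\<^sub>m (W * e i j)"
proof -
  let ?c = "F (e i j) $$ (i, j)"
  have eU: "e i j \<in> carrier U" using ij by (rule e_U)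
  have "e i i * e i j * e j j = e i j" using ij by (simp add: matrix_unit_mult)
  then have F: "F (e i j) = ?c \<cdot>\<^sub>m e i j" using F_sandwich[OF eU ij(1,2)] by simp
  have eq: "f (e i j) * W = ?c \<cdot>\<^sub>m (W * e i j)"
    unfolding W_F[OF eU, symmetric]
    by (subst F) (rule mult_smult_distrib[OF W_mat matrix_unit_carrier])
  have "?c \<noteq> 0"
  proof
    assume z: "?c = 0"
    have fc: "f (e i j) \<in> carrier_mat n n" by (rule f_mat[OF eU])
    have "f (e i j) = f (e i j) * (W * V)" using fc by (simp add: V(3))
    also have "\<dots> = f (e i j) * W * V" by (rule assoc_mult_mat[OF fc W_mat V(1), symmetric])
    also have "f (e i j) * W = 0\<^sub>m n n"
      unfolding eq z by (rule eq_matI) (simp_all add: W_def matrix_unit_def)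
    also have "0\<^sub>m n n * V = 0\<^sub>m n n" by (rule left_mult_zero_mat[OF V(1)])
    finally show False using f_e_neq_zero[OF ij] by blast
  qed
  then show ?thesis using eq by (rule that)
qed

text \<open>\<open>f (e i j)\<close> carries column j of \<open>W\<close> to a nonzero multiple of
  column i, so a nonzero entry of column i must arise from a nonzero entry of column j.\<close>

lemma W_link:
  assumes ij: "i < n" "j < n" "b i \<le> b j" and r: "r < n" "W $$ (r, i) \<noteq> 0"
  obtains s where "s < n" "f (e i j) $$ (r, s) \<noteq> 0" "W $$ (s, j) \<noteq> 0"
proof -
  obtain c where c: "c \<noteq> 0" "f (e i j) * W = c \<cdot>\<^sub>m (W * e i j)" by (rule F_matrix_unit[OF ij])
  have fc: "f (e i j) \<in> carrier_mat n n" by (rule f_mat[OF e_U[OF ij]])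
  have "(W * e i j) $$ (r, j) = (\<Sum>k\<in>{0..<n}. if k = i then W $$ (r, k) else 0)"
    unfolding mult_entry[OF W_mat matrix_unit_carrier r(1) ij(2)]
    by (intro sum.cong) (auto simp: matrix_unit_entry ij)
  then have "(W * e i j) $$ (r, j) = W $$ (r, i)" using ij by simp
  then have "(f (e i j) * W) $$ (r, j) = c * W $$ (r, i)"
    unfolding c(2) using r ij by (simp add: W_def matrix_unit_def)
  then have "(\<Sum>s\<in>{0..<n}. f (e i j) $$ (r, s) * W $$ (s, j)) \<noteq> 0"
    unfolding mult_entry[OF fc W_mat r(1) ij(2)] using c(1) r(2) by simp
  then obtain s where "s \<in> {0..<n}" "f (e i j) $$ (r, s) * W $$ (s, j) \<noteq> 0" by (rule sum.not_neutral_contains_not_neutral)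
  then show ?thesis using that by auto
qed

text \<open>Column vectors supported in the blocks up to k form a submodule under \<open>U'\<close>;
  the level is the first k whose submodule contains column i of \<open>W\<close>.\<close>

definition level :: "nat \<Rightarrow> nat" where
  "level i = Max (b' ` {r. r < n \<and> W $$ (r, i) \<noteq> 0})"

lemma level_ge: "r < n \<Longrightarrow> W $$ (r, i) \<noteq> 0 \<Longrightarrow> b' r \<le> level i"
  unfolding level_def by (intro Max_ge) auto

lemma level_attained:
  assumes "i < n"
  obtains r where "r < n" "W $$ (r, i) \<noteq> 0" "b' r = level i"
proof -
  have "level i \<in> b' ` {r. r < n \<and> W $$ (r, i) \<noteq> 0}"
    unfolding level_def using W_column[OF assms] by (intro Max_in) auto
  then show ?thesis using that by auto
qed

text \<open>Column i is, up to a scalar, the image of column j under an element of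
  \<open>U'\<close>, so it lies in every submodule that contains column j.\<close>

lemma level_mono:
  assumes ij: "i < n" "j < n" "b i \<le> b j"
  shows "level i \<le> level j"
proof -
  obtain r where r: "r < n" "W $$ (r, i) \<noteq> 0" "b' r = level i" by (rule level_attained[OF ij(1)])
  obtain s where s: "s < n" "f (e i j) $$ (r, s) \<noteq> 0" "W $$ (s, j) \<noteq> 0" by (rule W_link[OF ij r(1,2)])
  have "b' r \<le> b' s" using f_closed[OF e_U[OF ij]] r(1) s(1,2) unfolding U'_mem by blast
  then show ?thesis using level_ge[OF s(1,3)] r(3) by simp
qed

text \<open>Equal levels would give \<open>y \<in> U'\<close> moving column \<open>i\<close> of \<open>W\<close> to column \<open>j\<close>, although the
  \<open>(j, i)\<close> entry vanishes on \<open>U\<close>.\<close>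

lemma level_strict:
  assumes ij: "i < n" "j < n" "b i < b j"
  shows "level i < level j"
proof (rule ccontr)
  assume "\<not> level i < level j"
  then have eq: "level i = level j" using level_mono[of i j] ij by simp
  obtain r where r: "r < n" "W $$ (r, i) \<noteq> 0" "b' r = level i" by (rule level_attained[OF ij(1)])
  \<comment> \<open>The only nonzero column of y is column r, a multiple of column j of
    \<open>W\<close>. It is block-triangular because column j reaches no block beyond that of r when
    the levels agree.\<close>
  define y where "y = mat n n (\<lambda>(s, l). if l = r then W $$ (s, j) / W $$ (r, i) else 0)"
  have ym: "y \<in> carrier_mat n n" by (simp add: y_def)
  have "y \<in> carrier U'"
    unfolding U'_mem
  proof (intro conjI allI impI ym)
    fix s l assume sl: "s < n" "l < n" "\<not> b' s \<le> b' l"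
    show "y $$ (s, l) = 0"
    proof (cases "l = r")
      case True
      then have "W $$ (s, j) = 0" using level_ge[OF sl(1), of j] sl(3) r(3) eq by auto
      then show ?thesis using sl by (simp add: y_def)
    qed (use sl in \<open>simp add: y_def\<close>)
  qed
  then obtain x where x: "x \<in> carrier U" "f x = y" using bij_betw_imp_surj_on[OF f_bij] by (metis imageE)
  have yW: "(y * W) $$ (s, i) = W $$ (s, j)" if s: "s < n" for s
  proof -
    have "(y * W) $$ (s, i) = (\<Sum>l\<in>{0..<n}. if l = r then W $$ (s, j) else 0)"
      unfolding mult_entry[OF ym W_mat s ij(1)]
      using r(2) s by (intro sum.cong) (auto simp: y_def)
    then show ?thesis using r(1) by simp
  qed
  have "F x $$ (j, i) = (\<Sum>s\<in>{0..<n}. V $$ (j, s) * (y * W) $$ (s, i))"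
    unfolding F_def x(2) by (rule mult_entry[OF V(1) mult_carrier_mat[OF ym W_mat] ij(2,1)])
  also have "\<dots> = (\<Sum>s\<in>{0..<n}. V $$ (j, s) * W $$ (s, j))"
    by (rule sum.cong) (auto simp: yW)
  also have "\<dots> = (V * W) $$ (j, j)" by (rule mult_entry[OF V(1) W_mat ij(2,2), symmetric])
  also have "\<dots> = 1" unfolding V(2) using ij by simp
  finally have one: "F x $$ (j, i) = 1" .
  have xm: "x \<in> carrier_mat n n" "x $$ (j, i) = 0" using x(1) ij unfolding U_mem by auto
  have "e j j * x * e i i = 0\<^sub>m n n"
    unfolding matrix_unit_sandwich[OF xm(1) ij(2,1)] xm(2)
    by (rule eq_matI) (simp_all add: matrix_unit_def)
  then have "F (0\<^sub>m n n) = 1 \<cdot>\<^sub>m e j i" using F_sandwich[OF x(1) ij(2,1)] unfolding one by simp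
  also have "\<dots> = e j i" by (rule eq_matI) simp_all
  finally have "F (0\<^sub>m n n) = e j i" .
  moreover have "F (0\<^sub>m n n) = 0\<^sub>m n n"
    unfolding F_def f_zero using V(1) W_mat by simp
  ultimately show False using e_neq_zero[OF ij(2,1)] by simp
qed

text \<open>Levels increase strictly from block to block and are bounded by the common number of
  blocks; counting down from the last block bounds each of them. The variable d is the distance to
  the last block.\<close>

lemma level_le: "i < n \<Longrightarrow> level i \<le> b i"
proof -
  have "level i + d \<le> length ds - 1" if "i < n" "b i + d = length ds - 1" for d
    using that
  proof (induction d arbitrary: i)
    case 0
    obtain r where "r < n" "b' r = level i" by (rule level_attained[OF 0(1)])
    then show ?case using block_of_less[of r ds'] sum len by simp
  next
    case (Suc d)
    then have "Suc (b i) < length ds" by linarith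
    then obtain j where j: "j < n" "b j = Suc (b i)" using block_of_surj[OF pos] by blast
    have "level j + d \<le> length ds - 1" using Suc j by (intro Suc.IH) auto
    moreover have "level i < level j" using Suc.prems j by (intro level_strict) auto
    ultimately show ?case by linarith
  qed
  moreover assume "i < n"
  moreover have "b i \<le> length ds - 1" using block_of_less[OF \<open>i < n\<close>] by simp
  ultimately have "level i + (length ds - 1 - b i) \<le> length ds - 1" by simp
  then show "level i \<le> b i" using \<open>b i \<le> length ds - 1\<close> by linarith
qed

lemma W_block: "r < n \<Longrightarrow> i < n \<Longrightarrow> W $$ (r, i) \<noteq> 0 \<Longrightarrow> b' r \<le> b i"
  using level_ge level_le le_trans by blast

text \<open>A nonzero product in the expansion of the determinant. The expansion assigns columns to
  rows; the inverse is taken because the columns of \<open>W\<close> stand for the rows of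
  \<open>U\<close>.\<close>

lemma W_permutation:
  obtains \<pi> where "\<pi> permutes {0..<n}" "\<And>i. i < n \<Longrightarrow> W $$ (\<pi> i, i) \<noteq> 0"
proof -
  have "(\<Sum>p\<in>{p. p permutes {0..<n}}. signof p * (\<Prod>i=0..<n. W $$ (i, p i))) \<noteq> 0"
    using det_W unfolding det_def'[OF W_mat] .
  then obtain p where "p \<in> {p. p permutes {0..<n}}" "signof p * (\<Prod>i=0..<n. W $$ (i, p i)) \<noteq> (0::'k)"
    by (rule sum.not_neutral_contains_not_neutral)
  then have p: "p permutes {0..<n}" "(\<Prod>i=0..<n. W $$ (i, p i)) \<noteq> 0" by auto
  have nz: "W $$ (i, p i) \<noteq> 0" if "i < n" for i using p(2) that by auto
  have "W $$ (inv_into UNIV p i, i) \<noteq> 0" if "i < n" for i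
  proof -
    have "inv_into UNIV p i \<in> {0..<n}" using permutes_in_image[OF permutes_inv[OF p(1)]] that by auto
    then show ?thesis using nz[of "inv_into UNIV p i"] permutes_inverses(1)[OF p(1)] by simp
  qed
  then show ?thesis using that[OF permutes_inv[OF p(1)]] by blast
qed

text \<open>Homogeneity of the \<open>f (e i j)\<close> has two effects: the nonzero entries of one
  column of \<open>W\<close> lie in rows of equal degree, and degree quotients are preserved between
  rows i and j with \<open>b i \<le> b j\<close>. Since blocks are totally ordered, every row can be
  compared with row 0 in one direction or the other, which gives a single shift g.\<close>

lemma W_degree:
  assumes Q: "comm_group Q" and ps: "\<And>i. i < n \<Longrightarrow> ps ! i \<in> carrier Q" "\<And>i. i < n \<Longrightarrow> ps' ! i \<in> carrier Q"
    and graded: "\<And>q. q \<in> carrier Q \<Longrightarrow> f ` hcomp U q \<subseteq> hcomp U' q"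
  obtains g where "g \<in> carrier Q"
    "\<And>r i. r < n \<Longrightarrow> i < n \<Longrightarrow> W $$ (r, i) \<noteq> 0 \<Longrightarrow> ps' ! r = g \<otimes> ps ! i"
proof (cases "n = 0")
  case True
  interpret Q: comm_group Q by (rule Q)
  show ?thesis using that[of "\<one>"] True by simp
next
  case False
  interpret Q: comm_group Q by (rule Q)
  have deg: "ps' ! r \<otimes> inv (ps' ! s) = ps ! i \<otimes> inv (ps ! j)"
    if ij: "i < n" "j < n" "b i \<le> b j" and rs: "r < n" "s < n" "f (e i j) $$ (r, s) \<noteq> 0" for i j r s
  proof -
    have "e i j \<in> hcomp U (ps ! i \<otimes> inv (ps ! j))"
      unfolding UT_hcomp_iff using ij by (auto simp: matrix_unit_carrier matrix_unit_entry split: if_splits)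
    moreover have "ps ! i \<otimes> inv (ps ! j) \<in> carrier Q" using ij ps by simp
    ultimately have "f (e i j) \<in> hcomp U' (ps ! i \<otimes> inv (ps ! j))" using graded by blast
    then show ?thesis using rs unfolding UT_hcomp_iff sum by blast
  qed
  have col: "ps' ! r = ps' ! pivot i" if ri: "r < n" "i < n" "W $$ (r, i) \<noteq> 0" for r i
  proof -
    have "f (e i i) $$ (r, pivot i) \<noteq> 0" using ri by (simp add: W_def)
    from deg[OF ri(2,2) order.refl ri(1) pivot(1)[OF ri(2)] this]
    have "ps' ! r \<otimes> inv (ps' ! pivot i) = \<one>" using ps(1)[OF ri(2)] by simp
    then show ?thesis using ps(2)[OF ri(1)] ps(2)[OF pivot(1)[OF ri(2)]] Q.inv_solve_right' by force
  qed
  let ?P = "\<lambda>i. ps' ! pivot i"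
  have P: "?P i \<in> carrier Q" if "i < n" for i using ps(2)[OF pivot(1)[OF that]] .
  have shift: "?P i \<otimes> inv (?P j) = ps ! i \<otimes> inv (ps ! j)"
    if ij: "i < n" "j < n" "b i \<le> b j" for i j
  proof -
    obtain r where r: "r < n" "W $$ (r, i) \<noteq> 0" using W_column[OF ij(1)] by blast
    obtain s where s: "s < n" "f (e i j) $$ (r, s) \<noteq> 0" "W $$ (s, j) \<noteq> 0" by (rule W_link[OF ij r])
    show ?thesis using deg[OF ij r(1) s(1,2)] unfolding col[OF r(1) ij(1) r(2)] col[OF s(1) ij(2) s(3)] .
  qed
  have n0: "0 < n" using False by linarith
  define g where "g = ?P 0 \<otimes> inv (ps ! 0)"
  have g: "g \<in> carrier Q" unfolding g_def using P[OF n0] ps(1)[OF n0] by simp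
  have solve: "x = (y \<otimes> inv w) \<otimes> z"
    if "x \<otimes> inv y = z \<otimes> inv w" "x \<in> carrier Q" "y \<in> carrier Q" "z \<in> carrier Q" "w \<in> carrier Q"
    for x y z w
  proof -
    have "x = x \<otimes> inv y \<otimes> y" using that(2,3) by (simp add: Q.m_assoc)
    also have "\<dots> = z \<otimes> inv w \<otimes> y" unfolding that(1) ..
    also have "\<dots> = (y \<otimes> inv w) \<otimes> z" using that(2-5) by (simp add: Q.m_ac)
    finally show ?thesis .
  qed
  have solve': "y = (x \<otimes> inv z) \<otimes> w"
    if "x \<otimes> inv y = z \<otimes> inv w" "x \<in> carrier Q" "y \<in> carrier Q" "z \<in> carrier Q" "w \<in> carrier Q"
    for x y z w
  proof -
    have "inv (x \<otimes> inv y) = inv (z \<otimes> inv w)" unfolding that(1) ..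
    then have "y \<otimes> inv x = w \<otimes> inv z" using that(2-5) by (simp add: Q.inv_mult Q.m_comm)
    from solve[OF this that(3,2,5,4)] show ?thesis .
  qed
  have Pi: "?P i = g \<otimes> ps ! i" if i: "i < n" for i
  proof (cases "b i \<le> b 0")
    case True
    show ?thesis unfolding g_def
      by (rule solve[OF shift[OF i n0 True] P[OF i] P[OF n0] ps(1)[OF i] ps(1)[OF n0]])
  next
    case c: False
    have "b 0 \<le> b i" using c by simp
    show ?thesis unfolding g_def
      by (rule solve'[OF shift[OF n0 i \<open>b 0 \<le> b i\<close>] P[OF n0] P[OF i] ps(1)[OF n0] ps(1)[OF i]])
  qed
  show ?thesis
  proof (rule that[OF g])
    fix r i assume "r < n" "i < n" "W $$ (r, i) \<noteq> 0"
    then show "ps' ! r = g \<otimes> ps ! i" using col Pi by simp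
  qed
qed

end

lemma UT_graded_isomorphic_permutation:
  fixes Q :: "('q, 'z) monoid_scheme"
  assumes Q: "comm_group Q"
    and pos: "\<forall>d\<in>set ds. d > 0" "\<forall>d\<in>set ds'. d > 0" and len: "length ds' = length ds"
    and sum: "sum_list ds' = sum_list ds"
    and ps: "\<And>i. i < sum_list ds \<Longrightarrow> ps ! i \<in> carrier Q" "\<And>i. i < sum_list ds \<Longrightarrow> ps' ! i \<in> carrier Q"
    and iso: "graded_isomorphic Q (UT Q ds ps :: ('k::field, 'k mat, 'q) gr_algebra) (UT Q ds' ps')"
  obtains \<pi> g where "\<pi> permutes {0..<sum_list ds}" "g \<in> carrier Q"
    "\<And>i. i < sum_list ds \<Longrightarrow> block_of ds' (\<pi> i) = block_of ds i"
    "\<And>i. i < sum_list ds \<Longrightarrow> ps' ! \<pi> i = g \<otimes>\<^bsub>Q\<^esub> ps ! i"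
proof -
  let ?U = "UT Q ds ps :: ('k, 'k mat, 'q) gr_algebra" and ?U' = "UT Q ds' ps' :: ('k, 'k mat, 'q) gr_algebra"
  let ?n = "sum_list ds"
  obtain f where f: "f \<in> ring_iso ?U ?U'" "\<forall>c. \<forall>x\<in>carrier ?U. f (c \<odot>\<^bsub>?U\<^esub> x) = c \<odot>\<^bsub>?U'\<^esub> f x"
    "\<forall>q\<in>carrier Q. f ` hcomp ?U q \<subseteq> hcomp ?U' q"
    using iso unfolding graded_isomorphic_def by (elim bexE conjE)
  have rings: "ring ?U" "ring ?U'" using unital_algebra_UT unfolding unital_algebra_def by blast+
  interpret I: UT_isomorphism Q ds ds' ps ps' f
    by unfold_locales (use pos len sum f in auto)
  define h where "h = inv_into (carrier ?U) f"
  have h_iso: "h \<in> ring_iso ?U' ?U" unfolding h_def by (rule ring_iso_set_sym[OF rings(1) f(1)])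
  have bij: "bij_betw f (carrier ?U) (carrier ?U')" by (rule I.f_bij)
  have h_mem: "h y \<in> carrier ?U" "f (h y) = y" if "y \<in> carrier ?U'" for y
  proof -
    have "y \<in> f ` carrier ?U" using bij_betw_imp_surj_on[OF bij] that by blast
    then show "h y \<in> carrier ?U" "f (h y) = y" unfolding h_def by (rule inv_into_into, rule f_inv_into_f)
  qed
  have h_lin: "h (c \<odot>\<^bsub>?U'\<^esub> y) = c \<odot>\<^bsub>?U\<^esub> h y" if y: "y \<in> carrier ?U'" for c y
  proof -
    interpret U: unital_algebra ?U by (rule unital_algebra_UT)
    have "c \<odot>\<^bsub>?U'\<^esub> y = f (c \<odot>\<^bsub>?U\<^esub> h y)" using I.linear[OF h_mem(1)[OF y]] h_mem(2)[OF y] by simp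
    then show ?thesis
      unfolding h_def using inv_into_f_f[OF bij_betw_imp_inj_on[OF bij]] U.smult_closed[OF h_mem(1)[OF y]]
      by (simp add: h_def)
  qed
  interpret J: UT_isomorphism Q ds' ds ps' ps h
    by unfold_locales (use pos len sum h_iso h_lin in auto)
  obtain \<pi> where \<pi>: "\<pi> permutes {0..<?n}" "\<And>i. i < ?n \<Longrightarrow> I.W $$ (\<pi> i, i) \<noteq> 0" using I.W_permutation by blast
  obtain \<pi>' where \<pi>': "\<pi>' permutes {0..<?n}" "\<And>i. i < ?n \<Longrightarrow> J.W $$ (\<pi>' i, i) \<noteq> 0"
    using J.W_permutation unfolding sum by blast
  have less: "\<pi> i < ?n" "\<pi>' i < ?n" if "i < ?n" for i
    using permutes_in_image[OF \<pi>(1)] permutes_in_image[OF \<pi>'(1)] that by auto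
  have le: "block_of ds' (\<pi> i) \<le> block_of ds i" if "i < ?n" for i
    by (rule I.W_block[OF less(1)[OF that] that \<pi>(2)[OF that]])
  have le': "block_of ds (\<pi>' i) \<le> block_of ds' i" if "i < ?n" for i
    using J.W_block[of "\<pi>' i" i] less(2)[OF that] that \<pi>'(2)[OF that] unfolding sum by blast
  \<comment> \<open>Both permutations can only lower the block index. Summed over all rows the two
    inequalities become equalities, hence they are equalities for every row.\<close>
  have "(\<Sum>i\<in>{0..<?n}. block_of ds i) = (\<Sum>i\<in>{0..<?n}. block_of ds (\<pi>' i))"
    by (rule sum.permute[OF \<pi>'(1), unfolded comp_def])
  also have "\<dots> \<le> (\<Sum>i\<in>{0..<?n}. block_of ds' i)" using le' by (intro sum_mono) auto
  also have "\<dots> = (\<Sum>i\<in>{0..<?n}. block_of ds' (\<pi> i))" by (rule sum.permute[OF \<pi>(1), unfolded comp_def])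
  finally have ge: "(\<Sum>i\<in>{0..<?n}. block_of ds i) \<le> (\<Sum>i\<in>{0..<?n}. block_of ds' (\<pi> i))" .
  have eq: "block_of ds' (\<pi> i) = block_of ds i" if i: "i < ?n" for i
  proof (rule ccontr)
    assume "block_of ds' (\<pi> i) \<noteq> block_of ds i"
    then have "block_of ds' (\<pi> i) < block_of ds i" using le[OF i] by simp
    then have "(\<Sum>i\<in>{0..<?n}. block_of ds' (\<pi> i)) < (\<Sum>i\<in>{0..<?n}. block_of ds i)"
      using i le by (intro sum_strict_mono_ex1) auto
    then show False using ge by simp
  qed
  have graded: "\<And>q. q \<in> carrier Q \<Longrightarrow> f ` hcomp ?U q \<subseteq> hcomp ?U' q" using f(3) by blast
  obtain g where g: "g \<in> carrier Q" "\<And>r i. r < ?n \<Longrightarrow> i < ?n \<Longrightarrow> I.W $$ (r, i) \<noteq> 0 \<Longrightarrow> ps' ! r = g \<otimes>\<^bsub>Q\<^esub> ps ! i"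
    using I.W_degree[OF Q ps graded] by blast
  have "ps' ! \<pi> i = g \<otimes>\<^bsub>Q\<^esub> ps ! i" if "i < ?n" for i
    by (rule g(2)[OF less(1)[OF that] that \<pi>(2)[OF that]])
  then show ?thesis using that[OF \<pi>(1) g(1) eq] by blast
qed

section \<open>From inflated rows back to rows\<close>

lemma count_image_mset_set:
  "finite A \<Longrightarrow> count (image_mset f (mset_set A)) y = card {x \<in> A. f x = y}"
proof -
  assume A: "finite A"
  have "f -` {y} \<inter> A = {x \<in> A. f x = y}" by blast
  then show ?thesis using A by (simp add: count_image_mset)
qed

lemma card_div:
  assumes "t > 0"
  shows "card {j \<in> {0..<n * t}. P (j div t)} = t * card {i \<in> {0..<n}. P i}"
proof -
  have "card {j \<in> {0..<n * t}. P (j div t)} = (\<Sum>j\<in>{0..<n * t}. if P (j div t) then 1 else 0)"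
    by (simp add: sum.If_cases Int_def)
  also have "\<dots> = (\<Sum>i<n. \<Sum>c\<in>{0..<t}. if P i then 1 else 0)"
    by (rule sum_div_mod[OF assms, of "\<lambda>i c. if P i then 1 else 0"])
  also have "\<dots> = t * (\<Sum>i<n. if P i then 1 else 0)"
    unfolding sum_distrib_left by (rule sum.cong) auto
  also have "(\<Sum>i<n. if P i then 1 else 0) = card {i \<in> {0..<n}. P i}"
    by (simp add: sum.If_cases Int_def lessThan_atLeast0)
  finally show ?thesis .
qed

text \<open>\<pi> need not respect the groups of t rows, so \<rho> is not induced by it. Instead the
  number of rows with a given label is compared: it is multiplied by t on both sides, so the labels
  already agree as multisets before inflation.\<close>

lemma deflate_permutation:
  fixes k k' :: "nat \<Rightarrow> 'x"
  assumes t: "t > 0" and \<pi>: "\<pi> permutes {0..<n * t}"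
    and k: "\<And>j. j < n * t \<Longrightarrow> k' (\<pi> j div t) = k (j div t)"
  obtains \<rho> where "\<rho> permutes {0..<n}" "\<And>i. i < n \<Longrightarrow> k' (\<rho> i) = k i"
proof -
  have "card {i \<in> {0..<n}. k i = y} = card {i \<in> {0..<n}. k' i = y}" for y
  proof -
    have "\<pi> ` {j \<in> {0..<n * t}. k (j div t) = y} = {j \<in> {0..<n * t}. k' (j div t) = y}"
    proof (intro equalityI subsetI)
      fix x assume "x \<in> \<pi> ` {j \<in> {0..<n * t}. k (j div t) = y}"
      then obtain j where j: "x = \<pi> j" "j \<in> {0..<n * t}" "k (j div t) = y" by blast
      then show "x \<in> {j \<in> {0..<n * t}. k' (j div t) = y}"
        using permutes_in_image[OF \<pi>, of j] k[of j] by simp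
    next
      fix x assume x: "x \<in> {j \<in> {0..<n * t}. k' (j div t) = y}"
      then obtain j where j: "x = \<pi> j" "j \<in> {0..<n * t}" using permutes_image[OF \<pi>] by blast
      then show "x \<in> \<pi> ` {j \<in> {0..<n * t}. k (j div t) = y}"
        using x k[of j] by (intro image_eqI[where x = j]) auto
    qed
    moreover have "card (\<pi> ` {j \<in> {0..<n * t}. k (j div t) = y}) = card {j \<in> {0..<n * t}. k (j div t) = y}"
      by (rule card_image[OF inj_on_subset[OF permutes_inj[OF \<pi>] subset_UNIV]])
    ultimately have "card {j \<in> {0..<n * t}. k (j div t) = y} = card {j \<in> {0..<n * t}. k' (j div t) = y}"
      by (simp only:)
    then show ?thesis
      using t card_div[OF t, of n "\<lambda>i. k i = y"] card_div[OF t, of n "\<lambda>i. k' i = y"] by simp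
  qed
  then have "image_mset k (mset_set {0..<n}) = image_mset k' (mset_set {0..<n})"
    by (intro multiset_eqI) (simp add: count_image_mset_set)
  from image_mset_eq_implies_permutes[OF _ this]
  obtain \<rho> where "\<rho> permutes {0..<n}" "\<forall>i\<in>{0..<n}. k i = k' (\<rho> i)" by auto
  then show ?thesis using that by simp
qed

context block_tensor
begin

lemma R_unital: "unital_algebra R" by (rule R.unital_algebra_axioms)

lemma hcomp_R_add:
  assumes g: "g \<in> carrier G" and xy: "x \<in> hcomp R g" "y \<in> hcomp R g"
  shows "x \<oplus>\<^bsub>R\<^esub> y \<in> hcomp R g"
proof -
  have "x \<oplus>\<^bsub>R\<^esub> y \<in> carrier R" using xy hcomp_R_subset[OF g] by (intro R.a_closed) auto
  moreover have "entry_deg g i j \<in> carrier G" if "i < n" "j < n" for i j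
    using that gs_carrier g by simp
  ultimately have cm: "x \<oplus>\<^bsub>R\<^esub> y \<in> carrier_mat n n"
    and deg: "\<And>i j. i < n \<Longrightarrow> j < n \<Longrightarrow> entry_deg g i j \<in> carrier G"
    unfolding R_carrier by simp_all
  show ?thesis
    unfolding hcomp_iff[OF g]
  proof (intro conjI allI impI cm)
    fix i j assume ij: "i < n" "j < n"
    have "if bl i \<le> bl j then x $$ (i, j) \<in> hcomp B (entry_deg g i j)
        else x $$ (i, j) = \<zero>"
      "if bl i \<le> bl j then y $$ (i, j) \<in> hcomp B (entry_deg g i j)
        else y $$ (i, j) = \<zero>"
      using xy ij unfolding hcomp_iff[OF g] by blast+
    then show "if bl i \<le> bl j then (x \<oplus>\<^bsub>R\<^esub> y) $$ (i, j) \<in> hcomp B (entry_deg g i j)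
        else (x \<oplus>\<^bsub>R\<^esub> y) $$ (i, j) = \<zero>"
      using D.hcomp_add[OF deg[OF ij]] by (simp add: R_entry[OF ij] D.B.smult_zero split: if_splits)
  qed
qed

lemma hcomp_R_smult:
  assumes g: "g \<in> carrier G" and x: "x \<in> hcomp R g"
  shows "c \<odot>\<^bsub>R\<^esub> x \<in> hcomp R g"
proof -
  have "c \<odot>\<^bsub>R\<^esub> x \<in> carrier R" using x hcomp_R_subset[OF g] by (intro R.smult_closed) auto
  moreover have "entry_deg g i j \<in> carrier G" if "i < n" "j < n" for i j
    using that gs_carrier g by simp
  ultimately have cm: "c \<odot>\<^bsub>R\<^esub> x \<in> carrier_mat n n"
    and deg: "\<And>i j. i < n \<Longrightarrow> j < n \<Longrightarrow> entry_deg g i j \<in> carrier G"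
    unfolding R_carrier by simp_all
  show ?thesis
    unfolding hcomp_iff[OF g]
  proof (intro conjI allI impI cm)
    fix i j assume ij: "i < n" "j < n"
    have "if bl i \<le> bl j then x $$ (i, j) \<in> hcomp B (entry_deg g i j)
        else x $$ (i, j) = \<zero>"
      using x ij unfolding hcomp_iff[OF g] by blast
    then show "if bl i \<le> bl j then (c \<odot>\<^bsub>R\<^esub> x) $$ (i, j) \<in> hcomp B (entry_deg g i j)
        else (c \<odot>\<^bsub>R\<^esub> x) $$ (i, j) = \<zero>"
      using D.hcomp_smult[OF deg[OF ij]] by (simp add: R_entry[OF ij] D.B.smult_zero split: if_splits)
  qed
qed

end

section \<open>Isomorphism of the tensor products from a matching of their rows\<close>

locale regraded_block_tensors =
  A: block_tensor G B ds gs + A': block_tensor G B' ds' gs'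
  for G :: "('g, 'n) monoid_scheme"
    and B :: "('k::{alg_closed_field, field_char_0}, 'b, 'g) gr_algebra" and ds gs
    and B' :: "('k, 'c, 'g) gr_algebra" (structure) and ds' gs' +
  fixes \<phi> :: "'b \<Rightarrow> 'c" and \<rho> :: "nat \<Rightarrow> nat" and g\<^sub>0 :: 'g and h :: "nat \<Rightarrow> 'g"
  assumes \<phi>: "\<phi> \<in> ring_iso B B'" "\<And>c b. b \<in> carrier B \<Longrightarrow> \<phi> (c \<odot>\<^bsub>B\<^esub> b) = c \<odot> \<phi> b"
      "\<And>g. g \<in> carrier G \<Longrightarrow> \<phi> ` hcomp B g \<subseteq> hcomp B' g"
    and size: "sum_list ds' = sum_list ds"
    and \<rho>: "\<rho> permutes {0..<sum_list ds}" "\<And>i. i < sum_list ds \<Longrightarrow> block_of ds' (\<rho> i) = block_of ds i"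
    and g\<^sub>0: "g\<^sub>0 \<in> carrier G" and h: "\<And>i. i < sum_list ds \<Longrightarrow> h i \<in> supp G B'"
      "\<And>i. i < sum_list ds \<Longrightarrow> gs' ! \<rho> i = g\<^sub>0 \<otimes>\<^bsub>G\<^esub> gs ! i \<otimes>\<^bsub>G\<^esub> h i"
begin

abbreviation "v i \<equiv> A'.D.u (h i)"
abbreviation "w i \<equiv> inv (A'.D.u (h i))"

text \<open>The invertible element of degree \<open>h i\<close> makes up for the discrepancy between
  the degree of row \<rho>(i) of R' and the shifted degree of row i of R. Over all positions this is
  \<phi> followed by conjugation with an invertible diagonal matrix.\<close>

definition conj :: "nat \<Rightarrow> nat \<Rightarrow> 'b \<Rightarrow> 'c" where "conj i j b = w i \<otimes> \<phi> b \<otimes> v j"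

lemma \<phi>_hom: "\<phi> \<in> Ring.ring_hom B B'" and \<phi>_bij: "bij_betw \<phi> (carrier B) (carrier B')"
  using \<phi>(1) unfolding ring_iso_def by simp_all

lemma \<phi>_closed: "b \<in> carrier B \<Longrightarrow> \<phi> b \<in> carrier B'"
  using \<phi>_hom by (rule ring_hom_closed)

lemma v_closed: "i < A.n \<Longrightarrow> v i \<in> carrier B'" and w_closed: "i < A.n \<Longrightarrow> w i \<in> carrier B'"
  and w_v: "i < A.n \<Longrightarrow> w i \<otimes> v i = \<one>" and v_w: "i < A.n \<Longrightarrow> v i \<otimes> w i = \<one>"
  using A'.D.u_Units[OF h(1)] by (simp_all add: A'.D.B.Units_closed)

lemma conj_closed: "i < A.n \<Longrightarrow> j < A.n \<Longrightarrow> b \<in> carrier B \<Longrightarrow> conj i j b \<in> carrier B'"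
  unfolding conj_def using v_closed w_closed \<phi>_closed by simp

lemma conj_add:
  assumes ij: "i < A.n" "j < A.n" and b: "b \<in> carrier B" "c \<in> carrier B"
  shows "conj i j (b \<oplus>\<^bsub>B\<^esub> c) = conj i j b \<oplus> conj i j c"
  unfolding conj_def ring_hom_add[OF \<phi>_hom b]
  using v_closed[OF ij(2)] w_closed[OF ij(1)] \<phi>_closed[OF b(1)] \<phi>_closed[OF b(2)]
  by (simp add: A'.D.B.r_distr A'.D.B.l_distr)

lemma conj_smult:
  assumes ij: "i < A.n" "j < A.n" and b: "b \<in> carrier B"
  shows "conj i j (c \<odot>\<^bsub>B\<^esub> b) = c \<odot> conj i j b"
  unfolding conj_def \<phi>(2)[OF b]
  using v_closed[OF ij(2)] w_closed[OF ij(1)] \<phi>_closed[OF b]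
  by (simp add: A'.D.B.smult_mult_left A'.D.B.smult_mult_right)

lemma conj_zero: "i < A.n \<Longrightarrow> j < A.n \<Longrightarrow> conj i j \<zero>\<^bsub>B\<^esub> = \<zero>"
  unfolding conj_def ring_hom_zero[OF \<phi>_hom A.D.B.ring_axioms A'.D.B.ring_axioms]
  using v_closed w_closed by simp

lemma conj_one: "i < A.n \<Longrightarrow> conj i i \<one>\<^bsub>B\<^esub> = \<one>"
  unfolding conj_def ring_hom_one[OF \<phi>_hom] using w_closed w_v by simp

lemma conj_mult:
  assumes ij: "i < A.n" "j < A.n" "l < A.n" and b: "b \<in> carrier B" "c \<in> carrier B"
  shows "conj i j (b \<otimes>\<^bsub>B\<^esub> c) = conj i l b \<otimes> conj l j c"
proof -
  let ?b = "\<phi> b" and ?c = "\<phi> c"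
  have cl: "?b \<in> carrier B'" "?c \<in> carrier B'" using b \<phi>_closed by auto
  have "conj i l b \<otimes> conj l j c = w i \<otimes> ?b \<otimes> (v l \<otimes> w l) \<otimes> ?c \<otimes> v j"
    unfolding conj_def using cl v_closed w_closed ij by (simp add: A'.D.B.m_assoc)
  also have "\<dots> = w i \<otimes> (?b \<otimes> ?c) \<otimes> v j"
    unfolding v_w[OF ij(3)] using cl v_closed w_closed ij by (simp add: A'.D.B.m_assoc)
  also have "\<dots> = conj i j (b \<otimes>\<^bsub>B\<^esub> c)" unfolding conj_def ring_hom_mult[OF \<phi>_hom b] ..
  finally show ?thesis ..
qed

lemma conj_finsum:
  assumes ij: "i < A.n" "j < A.n"
  shows "finite S \<Longrightarrow> (\<And>s. s \<in> S \<Longrightarrow> f s \<in> carrier B) \<Longrightarrow>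
    conj i j (\<Oplus>\<^bsub>B\<^esub>s\<in>S. f s) = (\<Oplus>s\<in>S. conj i j (f s))"
proof (induction S rule: finite_induct)
  case empty
  then show ?case using ij by (simp add: conj_zero)
next
  case (insert a S)
  then have c: "f \<in> S \<rightarrow> carrier B" "f a \<in> carrier B" "(\<lambda>s. conj i j (f s)) \<in> S \<rightarrow> carrier B'"
    using conj_closed[OF ij] by auto
  have "(\<Oplus>\<^bsub>B\<^esub>s\<in>S. f s) \<in> carrier B" by (rule A.D.B.finsum_closed[OF c(1)])
  then show ?case using insert c conj_closed[OF ij c(2)] conj_add[OF ij c(2)]
    by (simp add: A.D.B.finsum_insert A'.D.B.finsum_insert)
qed

lemma unconj:
  assumes ij: "i < A.n" "j < A.n" and c: "c \<in> carrier B'"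
  shows "v i \<otimes> (w i \<otimes> c \<otimes> v j) \<otimes> w j = c" "w i \<otimes> (v i \<otimes> c \<otimes> w j) \<otimes> v j = c"
proof -
  note cl = v_closed[OF ij(1)] v_closed[OF ij(2)] w_closed[OF ij(1)] w_closed[OF ij(2)] c
  have "v i \<otimes> (w i \<otimes> c \<otimes> v j) \<otimes> w j = (v i \<otimes> w i) \<otimes> c \<otimes> (v j \<otimes> w j)"
    using cl by (simp only: A'.D.B.m_assoc A'.D.B.m_closed)
  then show "v i \<otimes> (w i \<otimes> c \<otimes> v j) \<otimes> w j = c" using cl v_w ij by simp
  have "w i \<otimes> (v i \<otimes> c \<otimes> w j) \<otimes> v j = (w i \<otimes> v i) \<otimes> c \<otimes> (w j \<otimes> v j)"
    using cl by (simp only: A'.D.B.m_assoc A'.D.B.m_closed)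
  then show "w i \<otimes> (v i \<otimes> c \<otimes> w j) \<otimes> v j = c" using cl w_v ij by simp
qed

lemma conj_inj:
  assumes ij: "i < A.n" "j < A.n" and b: "b \<in> carrier B" "c \<in> carrier B" and eq: "conj i j b = conj i j c"
  shows "b = c"
proof -
  have "\<phi> b = v i \<otimes> conj i j b \<otimes> w j"
    unfolding conj_def by (rule unconj(1)[OF ij \<phi>_closed[OF b(1)], symmetric])
  also have "\<dots> = \<phi> c" unfolding eq unfolding conj_def by (rule unconj(1)[OF ij \<phi>_closed[OF b(2)]])
  finally have "\<phi> b = \<phi> c" .
  then show ?thesis using inj_onD[OF bij_betw_imp_inj_on[OF \<phi>_bij]] b by blast
qed

lemma conj_surj:
  assumes ij: "i < A.n" "j < A.n" and c: "c \<in> carrier B'"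
  shows "\<exists>b\<in>carrier B. conj i j b = c"
proof -
  have "v i \<otimes> c \<otimes> w j \<in> carrier B'" using c v_closed[OF ij(1)] w_closed[OF ij(2)] by simp
  then obtain b where "b \<in> carrier B" "\<phi> b = v i \<otimes> c \<otimes> w j"
    using bij_betw_imp_surj_on[OF \<phi>_bij] by (metis imageE)
  then show ?thesis unfolding conj_def using unconj(2)[OF ij c] by (intro bexI[of _ b]) simp_all
qed

lemma conj_degree:
  assumes ij: "i < A.n" "j < A.n" and g: "g \<in> carrier G"
    and b: "b \<in> hcomp B (A.entry_deg g i j)"
  shows "conj i j b \<in> hcomp B' (A'.entry_deg g (\<rho> i) (\<rho> j))"
proof -
  have c: "gs ! i \<in> carrier G" "gs ! j \<in> carrier G" "h i \<in> carrier G" "h j \<in> carrier G"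
    using ij A.gs_carrier A'.D.H_carrier h(1) by auto
  have d: "A.entry_deg g i j \<in> carrier G" using c g by simp
  have wi: "w i \<in> hcomp B' (inv\<^bsub>G\<^esub> (h i))"
    by (rule A'.D.hcomp_inverse[OF c(3) A'.D.u_hcomp_eq(1)[OF h(1)[OF ij(1)]] A'.D.u_neq_zero[OF h(1)[OF ij(1)]]])
  have "\<phi> b \<in> hcomp B' (A.entry_deg g i j)" using \<phi>(3)[OF d] b by blast
  then have wb: "w i \<otimes> \<phi> b \<in> hcomp B' (inv\<^bsub>G\<^esub> (h i) \<otimes>\<^bsub>G\<^esub> (A.entry_deg g i j))"
    using c by (intro A'.D.hcomp_mult wi d A.D.G.inv_closed)
  have m: "conj i j b \<in> hcomp B' (inv\<^bsub>G\<^esub> (h i) \<otimes>\<^bsub>G\<^esub> (A.entry_deg g i j) \<otimes>\<^bsub>G\<^esub> h j)"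
    unfolding conj_def
    by (rule A'.D.hcomp_mult[OF _ c(4) wb A'.D.u_hcomp_eq(1)[OF h(1)[OF ij(2)]]]) (use c d in simp)
  \<comment> \<open>The common shift cancels because G is abelian; only the corrections
    \<open>h i\<close> and \<open>h j\<close> remain.\<close>
  have "A'.entry_deg g (\<rho> i) (\<rho> j) = inv\<^bsub>G\<^esub> (g\<^sub>0 \<otimes>\<^bsub>G\<^esub> gs ! i \<otimes>\<^bsub>G\<^esub> h i) \<otimes>\<^bsub>G\<^esub> g \<otimes>\<^bsub>G\<^esub> (g\<^sub>0 \<otimes>\<^bsub>G\<^esub> gs ! j \<otimes>\<^bsub>G\<^esub> h j)"
    using h(2)[OF ij(1)] h(2)[OF ij(2)] by simp
  also have "\<dots> = inv\<^bsub>G\<^esub> (h i) \<otimes>\<^bsub>G\<^esub> (A.entry_deg g i j) \<otimes>\<^bsub>G\<^esub> h j \<otimes>\<^bsub>G\<^esub> (inv\<^bsub>G\<^esub> g\<^sub>0 \<otimes>\<^bsub>G\<^esub> g\<^sub>0)"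
    using c g g\<^sub>0 by (simp only: A.D.G.inv_mult A.D.G.m_ac A.D.G.inv_closed A.D.G.m_closed)
  also have "\<dots> = inv\<^bsub>G\<^esub> (h i) \<otimes>\<^bsub>G\<^esub> (A.entry_deg g i j) \<otimes>\<^bsub>G\<^esub> h j"
    using c d g\<^sub>0 by simp
  finally show ?thesis using m by simp
qed

abbreviation "\<tau> \<equiv> inv_into UNIV \<rho>"

definition transfer :: "'b mat \<Rightarrow> 'c mat" where
  "transfer x = mat A.n A.n (\<lambda>(r, s). conj (\<tau> r) (\<tau> s) (x $$ (\<tau> r, \<tau> s)))"

lemma \<rho>_less: "i < A.n \<Longrightarrow> \<rho> i < A.n" and \<tau>_less: "i < A.n \<Longrightarrow> \<tau> i < A.n"
  using permutes_in_image[OF \<rho>(1), of i] permutes_in_image[OF permutes_inv[OF \<rho>(1)], of i] by simp_all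

lemma \<rho>_\<tau>: "\<rho> (\<tau> i) = i" and \<tau>_\<rho>: "\<tau> (\<rho> i) = i"
  using permutes_inverses[OF \<rho>(1)] by simp_all

lemma \<tau>_bl: "r < A.n \<Longrightarrow> A'.bl r = A.bl (\<tau> r)"
  using \<rho>(2)[OF \<tau>_less] \<rho>_\<tau> by simp

lemma transfer_entry: "r < A.n \<Longrightarrow> s < A.n \<Longrightarrow> transfer x $$ (r, s) = conj (\<tau> r) (\<tau> s) (x $$ (\<tau> r, \<tau> s))"
  by (simp add: transfer_def)

lemma x_entry: "x \<in> carrier A.R \<Longrightarrow> r < A.n \<Longrightarrow> s < A.n \<Longrightarrow> x $$ (\<tau> r, \<tau> s) \<in> carrier B"
  unfolding A.R_carrier using \<tau>_less by blast

lemma transfer_closed: "x \<in> carrier A.R \<Longrightarrow> transfer x \<in> carrier A'.R"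
  unfolding A'.R_carrier size
proof (intro conjI allI impI)
  assume x: "x \<in> carrier A.R"
  show "transfer x \<in> carrier_mat A.n A.n" by (simp add: transfer_def)
  fix r s assume rs: "r < A.n" "s < A.n"
  show "transfer x $$ (r, s) \<in> carrier B'"
    unfolding transfer_entry[OF rs] by (intro conj_closed \<tau>_less rs x_entry x)
  assume "\<not> A'.bl r \<le> A'.bl s"
  then have "x $$ (\<tau> r, \<tau> s) = \<zero>\<^bsub>B\<^esub>"
    using x \<tau>_less rs unfolding A.R_carrier \<tau>_bl[OF rs(1)] \<tau>_bl[OF rs(2)] by blast
  then show "transfer x $$ (r, s) = \<zero>" unfolding transfer_entry[OF rs] using conj_zero \<tau>_less rs by simp
qed

lemma transfer_eqI:
  assumes "x \<in> carrier A.R" "y \<in> carrier A'.R"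
    and "\<And>r s. r < A.n \<Longrightarrow> s < A.n \<Longrightarrow> conj (\<tau> r) (\<tau> s) (x $$ (\<tau> r, \<tau> s)) = y $$ (r, s)"
  shows "transfer x = y"
  by (rule A'.R_eqI[OF transfer_closed[OF assms(1)] assms(2)]) (simp add: size transfer_entry assms(3))

lemma transfer_mult:
  assumes x: "x \<in> carrier A.R" and y: "y \<in> carrier A.R"
  shows "transfer (x \<otimes>\<^bsub>A.R\<^esub> y) = transfer x \<otimes>\<^bsub>A'.R\<^esub> transfer y"
proof (rule transfer_eqI)
  show "x \<otimes>\<^bsub>A.R\<^esub> y \<in> carrier A.R" using x y by simp
  show "transfer x \<otimes>\<^bsub>A'.R\<^esub> transfer y \<in> carrier A'.R" using x y transfer_closed by simp
  fix r s assume rs: "r < A.n" "s < A.n"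
  let ?i = "\<tau> r" and ?j = "\<tau> s"
  have ij: "?i < A.n" "?j < A.n" using rs \<tau>_less by auto
  have c: "x $$ (?i, l) \<in> carrier B" "y $$ (l, ?j) \<in> carrier B" if "l < A.n" for l
    using x y ij that unfolding A.R_carrier by auto
  have t: "transfer x $$ (r, l) \<otimes> transfer y $$ (l, s) \<in> carrier B'" if "l < A.n" for l
    using transfer_closed[OF x] transfer_closed[OF y] rs that unfolding A'.R_carrier size by simp
  have img: "\<rho> ` {..<A.n} = {..<A.n}" using permutes_image[OF \<rho>(1)] by (simp add: atLeast0LessThan)
  have "(x \<otimes>\<^bsub>A.R\<^esub> y) $$ (?i, ?j) = (\<Oplus>\<^bsub>B\<^esub>l\<in>{..<A.n}. x $$ (?i, l) \<otimes>\<^bsub>B\<^esub> y $$ (l, ?j))"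
    by (rule A.R_entry(2)[OF ij])
  then have "conj ?i ?j ((x \<otimes>\<^bsub>A.R\<^esub> y) $$ (?i, ?j)) = (\<Oplus>l\<in>{..<A.n}. conj ?i ?j (x $$ (?i, l) \<otimes>\<^bsub>B\<^esub> y $$ (l, ?j)))"
    using conj_finsum[OF ij, of "{..<A.n}" "\<lambda>l. x $$ (?i, l) \<otimes>\<^bsub>B\<^esub> y $$ (l, ?j)"] c by simp
  also have "\<dots> = (\<Oplus>l\<in>{..<A.n}. transfer x $$ (r, \<rho> l) \<otimes> transfer y $$ (\<rho> l, s))"
  proof (rule A'.D.B.finsum_cong')
    show "(\<lambda>l. transfer x $$ (r, \<rho> l) \<otimes> transfer y $$ (\<rho> l, s)) \<in> {..<A.n} \<rightarrow> carrier B'"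
      using t \<rho>_less by blast
    fix l assume "l \<in> {..<A.n}"
    then have l: "l < A.n" by simp
    show "conj ?i ?j (x $$ (?i, l) \<otimes>\<^bsub>B\<^esub> y $$ (l, ?j)) = transfer x $$ (r, \<rho> l) \<otimes> transfer y $$ (\<rho> l, s)"
      unfolding transfer_entry[OF rs(1) \<rho>_less[OF l]] transfer_entry[OF \<rho>_less[OF l] rs(2)] \<tau>_\<rho>
      by (rule conj_mult[OF ij l c[OF l]])
  qed simp
  also have "\<dots> = (\<Oplus>l\<in>\<rho> ` {..<A.n}. transfer x $$ (r, l) \<otimes> transfer y $$ (l, s))"
    using t unfolding img
    by (subst A'.D.B.finsum_reindex[where h = \<rho> and A = "{..<A.n}", unfolded img, symmetric])
      (auto intro: inj_on_subset[OF permutes_inj[OF \<rho>(1)]])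
  also have "\<dots> = (transfer x \<otimes>\<^bsub>A'.R\<^esub> transfer y) $$ (r, s)"
    unfolding img using A'.R_entry(2)[of r s "transfer x" "transfer y"] rs unfolding size by simp
  finally show "conj ?i ?j ((x \<otimes>\<^bsub>A.R\<^esub> y) $$ (?i, ?j)) = (transfer x \<otimes>\<^bsub>A'.R\<^esub> transfer y) $$ (r, s)" .
qed

lemma transfer_hom:
  assumes x: "x \<in> carrier A.R"
  shows "transfer (c \<odot>\<^bsub>A.R\<^esub> x) = c \<odot>\<^bsub>A'.R\<^esub> transfer x"
    "y \<in> carrier A.R \<Longrightarrow> transfer (x \<oplus>\<^bsub>A.R\<^esub> y) = transfer x \<oplus>\<^bsub>A'.R\<^esub> transfer y"
    "transfer \<one>\<^bsub>A.R\<^esub> = \<one>\<^bsub>A'.R\<^esub>"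
proof -
  note e = A.R_entry A'.R_entry[unfolded size]
  note t = transfer_closed
  show "transfer (c \<odot>\<^bsub>A.R\<^esub> x) = c \<odot>\<^bsub>A'.R\<^esub> transfer x"
    by (rule transfer_eqI)
      (use x t in \<open>simp_all add: e \<tau>_less x_entry conj_smult transfer_entry A.R.smult_closed A'.R.smult_closed\<close>)
  show "transfer (x \<oplus>\<^bsub>A.R\<^esub> y) = transfer x \<oplus>\<^bsub>A'.R\<^esub> transfer y" if y: "y \<in> carrier A.R"
    by (rule transfer_eqI) (use x y t in \<open>simp_all add: e \<tau>_less x_entry conj_add transfer_entry\<close>)
  have eq: "\<tau> r = \<tau> s \<longleftrightarrow> r = s" for r s using \<rho>_\<tau> by metis
  show "transfer \<one>\<^bsub>A.R\<^esub> = \<one>\<^bsub>A'.R\<^esub>"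
    by (rule transfer_eqI) (simp_all add: e \<tau>_less eq conj_one conj_zero)
qed

lemma transfer_inj: "inj_on transfer (carrier A.R)"
proof (rule inj_onI)
  fix x y assume xy: "x \<in> carrier A.R" "y \<in> carrier A.R" "transfer x = transfer y"
  show "x = y"
  proof (rule A.R_eqI[OF xy(1,2)])
    fix i j assume ij: "i < A.n" "j < A.n"
    have "transfer x $$ (\<rho> i, \<rho> j) = transfer y $$ (\<rho> i, \<rho> j)" using xy(3) by simp
    then have "conj i j (x $$ (i, j)) = conj i j (y $$ (i, j))"
      unfolding transfer_entry[OF \<rho>_less[OF ij(1)] \<rho>_less[OF ij(2)]] \<tau>_\<rho> .
    moreover have "x $$ (i, j) \<in> carrier B" "y $$ (i, j) \<in> carrier B" using xy ij unfolding A.R_carrier by auto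
    ultimately show "x $$ (i, j) = y $$ (i, j)" using conj_inj[OF ij] by blast
  qed
qed

lemma transfer_surj: "y \<in> carrier A'.R \<Longrightarrow> \<exists>x\<in>carrier A.R. transfer x = y"
proof -
  assume y: "y \<in> carrier A'.R"
  have "\<exists>b\<in>carrier B. conj i j b = c" if "i < A.n" "j < A.n" "c \<in> carrier B'" for i j c
    by (rule conj_surj[OF that])
  then obtain \<psi> where \<psi>: "\<And>i j c. i < A.n \<Longrightarrow> j < A.n \<Longrightarrow> c \<in> carrier B' \<Longrightarrow> \<psi> i j c \<in> carrier B"
    "\<And>i j c. i < A.n \<Longrightarrow> j < A.n \<Longrightarrow> c \<in> carrier B' \<Longrightarrow> conj i j (\<psi> i j c) = c" by metis
  define x where "x = mat A.n A.n (\<lambda>(i, j). \<psi> i j (y $$ (\<rho> i, \<rho> j)))"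
  have yB: "y $$ (r, s) \<in> carrier B'" if "r < A.n" "s < A.n" for r s
    using y that unfolding A'.R_carrier size by blast
  have xR: "x \<in> carrier A.R"
    unfolding A.R_carrier
  proof (intro conjI allI impI)
    show "x \<in> carrier_mat A.n A.n" by (simp add: x_def)
    fix i j assume ij: "i < A.n" "j < A.n"
    have y_ij: "y $$ (\<rho> i, \<rho> j) \<in> carrier B'" using yB \<rho>_less ij by blast
    show xB: "x $$ (i, j) \<in> carrier B" using \<psi>(1)[OF ij y_ij] ij by (simp add: x_def)
    assume "\<not> A.bl i \<le> A.bl j"
    then have "y $$ (\<rho> i, \<rho> j) = \<zero>"
      using y \<rho>_less ij \<rho>(2)[OF ij(1)] \<rho>(2)[OF ij(2)] unfolding A'.R_carrier size by auto
    then have "conj i j (x $$ (i, j)) = conj i j \<zero>\<^bsub>B\<^esub>"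
      using \<psi>(2)[OF ij y_ij] ij conj_zero[OF ij] by (simp add: x_def)
    then show "x $$ (i, j) = \<zero>\<^bsub>B\<^esub>" by (rule conj_inj[OF ij xB A.D.B.zero_closed])
  qed
  have "transfer x = y"
  proof (rule transfer_eqI[OF xR y])
    fix r s assume rs: "r < A.n" "s < A.n"
    show "conj (\<tau> r) (\<tau> s) (x $$ (\<tau> r, \<tau> s)) = y $$ (r, s)"
      using \<psi>(2)[OF \<tau>_less[OF rs(1)] \<tau>_less[OF rs(2)] yB[OF rs]] \<tau>_less rs by (simp add: x_def \<rho>_\<tau>)
  qed
  then show ?thesis using xR by blast
qed

lemma transfer_degree:
  assumes g: "g \<in> carrier G" and x: "x \<in> hcomp A.R g"
  shows "transfer x \<in> hcomp A'.R g"
  unfolding A'.hcomp_iff[OF g] size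
proof (intro conjI allI impI)
  show "transfer x \<in> carrier_mat A.n A.n" by (simp add: transfer_def)
  fix r s assume rs: "r < A.n" "s < A.n"
  have ij: "\<tau> r < A.n" "\<tau> s < A.n" using \<tau>_less rs by auto
  have *: "if A.bl (\<tau> r) \<le> A.bl (\<tau> s) then x $$ (\<tau> r, \<tau> s) \<in> hcomp B (A.entry_deg g (\<tau> r) (\<tau> s))
    else x $$ (\<tau> r, \<tau> s) = \<zero>\<^bsub>B\<^esub>" using x ij unfolding A.hcomp_iff[OF g] by blast
  show "if A'.bl r \<le> A'.bl s then transfer x $$ (r, s) \<in> hcomp B' (A'.entry_deg g r s)
    else transfer x $$ (r, s) = \<zero>"
  proof (cases "A.bl (\<tau> r) \<le> A.bl (\<tau> s)")
    case True
    then show ?thesis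
      using * conj_degree[OF ij g] unfolding transfer_entry[OF rs] \<tau>_bl[OF rs(1)] \<tau>_bl[OF rs(2)] \<rho>_\<tau> by simp
  next
    case False
    then show ?thesis
      using * conj_zero[OF ij] unfolding transfer_entry[OF rs] \<tau>_bl[OF rs(1)] \<tau>_bl[OF rs(2)] by simp
  qed
qed

theorem tensors_isomorphic: "graded_isomorphic G A.R A'.R"
  unfolding graded_isomorphic_def ring_iso_def
proof (intro bexI[of _ transfer] CollectI conjI allI ballI)
  show "transfer \<in> Ring.ring_hom A.R A'.R"
    by (rule ring_hom_memI) (simp_all add: transfer_closed transfer_mult transfer_hom[OF A.R.one_closed] transfer_hom(2))
  show "bij_betw transfer (carrier A.R) (carrier A'.R)"
    unfolding bij_betw_def using transfer_inj transfer_closed transfer_surj by blast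
  show "transfer (c \<odot>\<^bsub>A.R\<^esub> x) = c \<odot>\<^bsub>A'.R\<^esub> transfer x" if "x \<in> carrier A.R" for c x
    by (rule transfer_hom(1)[OF that])
  show "transfer ` hcomp A.R g \<subseteq> hcomp A'.R g" if "g \<in> carrier G" for g
    using transfer_degree[OF that] by blast
qed

end

lemma coset_eqD:
  assumes "comm_group G" "subgroup H G" "x \<in> carrier G" "y \<in> carrier G" "H #>\<^bsub>G\<^esub> x = H #>\<^bsub>G\<^esub> y"
  shows "inv\<^bsub>G\<^esub> y \<otimes>\<^bsub>G\<^esub> x \<in> H"
proof -
  interpret comm_group G by (rule assms(1))
  have "x \<in> H #>\<^bsub>G\<^esub> y" using rcos_self[OF assms(3,2)] assms(5) by simp
  then obtain h where "h \<in> H" "x = h \<otimes>\<^bsub>G\<^esub> y" unfolding r_coset_def by blast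
  moreover have "h \<in> carrier G" using \<open>h \<in> H\<close> subgroup.subset[OF assms(2)] by blast
  ultimately have "inv\<^bsub>G\<^esub> y \<otimes>\<^bsub>G\<^esub> x = h" using assms(4) by (simp add: m_lcomm)
  then show ?thesis using \<open>h \<in> H\<close> by simp
qed

text \<open>The graded isomorphism matches inflated rows by block and coset up to one shift in the
  quotient, and counting brings this down to the rows of R and R'. A lift of the shift to G leaves
  for every row an error in H, which invertible homogeneous elements of B' can absorb.\<close>

lemma UT_isomorphic_imp_tensors_isomorphic:
  fixes G :: "('g, 'n) monoid_scheme"
    and B :: "('k::{alg_closed_field, field_char_0}, 'b, 'g) gr_algebra" and B' :: "('k, 'c, 'g) gr_algebra"
  defines "H \<equiv> supp G B" and "Q \<equiv> G Mod supp G B"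
  defines "\<alpha> \<equiv> \<lambda>g. H #>\<^bsub>G\<^esub> g"
  assumes bt: "block_tensor G B ds gs" and bt': "block_tensor G B' ds' gs'"
    and len: "length ds' = length ds" and size: "sum_list ds' = sum_list ds"
    and supp: "supp G B' = supp G B" and iso: "graded_isomorphic G B B'" and t: "t > 0"
    and U: "graded_isomorphic Q
      (UT Q (map (\<lambda>d. d * t) ds) (concat (map (\<lambda>g. replicate t (\<alpha> g)) gs)) :: ('k, 'k mat, 'g set) gr_algebra)
      (UT Q (map (\<lambda>d. d * t) ds') (concat (map (\<lambda>g. replicate t (\<alpha> g)) gs')))"
  shows "graded_isomorphic G (UT_tensor G ds gs B) (UT_tensor G ds' gs' B')"
proof -
  interpret D: graded_division G B using bt unfolding block_tensor_def by blast
  let ?n = "sum_list ds"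
  have ds: "\<forall>d\<in>set ds. d > 0" "\<forall>d\<in>set ds'. d > 0" "length gs = ?n" "length gs' = ?n"
    "set gs \<subseteq> carrier G" "set gs' \<subseteq> carrier G"
    using bt bt' size unfolding block_tensor_def block_tensor_axioms_def by auto
  have H: "subgroup H G" unfolding H_def by (rule D.subgroup_H)
  have Q: "comm_group Q" unfolding Q_def by (rule D.G.abelian_FactGroup[OF D.subgroup_H])
  have HN: "H \<lhd> G" using D.G.normal_iff_subgroup H by blast
  have gsc: "gs ! i \<in> carrier G" "gs' ! i \<in> carrier G" if "i < ?n" for i using ds that by auto
  have \<alpha>Q: "\<alpha> g \<in> carrier Q" if "g \<in> carrier G" for g
    unfolding Q_def \<alpha>_def H_def[symmetric] by (simp add: FactGroup_def) (rule D.G.rcosetsI[OF subgroup.subset[OF H] that])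
  have size_t: "sum_list (map (\<lambda>d. d * t) ds) = ?n * t" "sum_list (map (\<lambda>d. d * t) ds') = ?n * t"
    by (simp_all add: sum_list_map_mult size)
  let ?S = "\<lambda>gs. concat (map (\<lambda>g. replicate t (\<alpha> g)) gs)"
  have nth: "?S gs ! i = \<alpha> (gs ! (i div t))" "?S gs' ! i = \<alpha> (gs' ! (i div t))" if "i < ?n * t" for i
    using that ds(3,4) by (simp_all add: nth_concat_replicate)
  have div: "i div t < ?n" if "i < ?n * t" for i using that by (simp add: less_mult_imp_div_less)
  have p1: "\<forall>d\<in>set (map (\<lambda>d. d * t) ds). d > 0" "\<forall>d\<in>set (map (\<lambda>d. d * t) ds'). d > 0" using ds t by auto
  have p2: "length (map (\<lambda>d. d * t) ds') = length (map (\<lambda>d. d * t) ds)" using len by simp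
  have p3: "sum_list (map (\<lambda>d. d * t) ds') = sum_list (map (\<lambda>d. d * t) ds)" using size_t by simp
  have p4: "?S gs ! i \<in> carrier Q" "?S gs' ! i \<in> carrier Q" if "i < sum_list (map (\<lambda>d. d * t) ds)" for i
    using that nth \<alpha>Q gsc div unfolding size_t by auto
  obtain \<pi> q where \<pi>: "\<pi> permutes {0..<?n * t}" "q \<in> carrier Q"
    "\<And>i. i < ?n * t \<Longrightarrow> block_of (map (\<lambda>d. d * t) ds') (\<pi> i) = block_of (map (\<lambda>d. d * t) ds) i"
    "\<And>i. i < ?n * t \<Longrightarrow> ?S gs' ! \<pi> i = q \<otimes>\<^bsub>Q\<^esub> ?S gs ! i"
    using UT_graded_isomorphic_permutation[OF Q p1 p2 p3 p4 U] unfolding size_t by blast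
  have "(block_of ds' (\<pi> j div t), \<alpha> (gs' ! (\<pi> j div t))) = (block_of ds (j div t), q \<otimes>\<^bsub>Q\<^esub> \<alpha> (gs ! (j div t)))"
    if j: "j < ?n * t" for j
  proof -
    have "\<pi> j < ?n * t" using permutes_in_image[OF \<pi>(1), of j] j by simp
    then show ?thesis using \<pi>(3,4)[OF j] nth j unfolding block_of_map_mult[OF t] by simp
  qed
  \<comment> \<open>The label of a row is the pair of its block and its coset, with the shift built
    into the labels of the first algebra.\<close>
  from deflate_permutation[where k = "\<lambda>i. (block_of ds i, q \<otimes>\<^bsub>Q\<^esub> \<alpha> (gs ! i))"
      and k' = "\<lambda>i. (block_of ds' i, \<alpha> (gs' ! i))", OF t \<pi>(1) this]
  obtain \<rho> where \<rho>: "\<rho> permutes {0..<?n}"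
    "\<And>i. i < ?n \<Longrightarrow> (block_of ds' (\<rho> i), \<alpha> (gs' ! \<rho> i)) = (block_of ds i, q \<otimes>\<^bsub>Q\<^esub> \<alpha> (gs ! i))" by blast
  obtain g\<^sub>0 where g\<^sub>0: "g\<^sub>0 \<in> carrier G" "q = \<alpha> g\<^sub>0"
    using \<pi>(2) unfolding Q_def \<alpha>_def H_def[symmetric] by (auto simp: FactGroup_def RCOSETS_def)
  define h where "h i = inv\<^bsub>G\<^esub> (g\<^sub>0 \<otimes>\<^bsub>G\<^esub> gs ! i) \<otimes>\<^bsub>G\<^esub> gs' ! \<rho> i" for i
  have \<rho>_less: "\<rho> i < ?n" if "i < ?n" for i using permutes_in_image[OF \<rho>(1), of i] that by simp
  have hH: "h i \<in> supp G B'" if i: "i < ?n" for i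
  proof -
    have "\<alpha> (gs' ! \<rho> i) = \<alpha> (g\<^sub>0 \<otimes>\<^bsub>G\<^esub> gs ! i)"
      using \<rho>(2)[OF i] g\<^sub>0 gsc[OF i] normal.rcos_sum[OF HN] unfolding Q_def \<alpha>_def H_def[symmetric] by simp
    then show ?thesis
      unfolding h_def supp H_def[symmetric] \<alpha>_def
      using gsc[OF i] gsc[OF \<rho>_less[OF i]] g\<^sub>0 by (intro coset_eqD[OF D.G.comm_group_axioms H]) simp_all
  qed
  have h2: "gs' ! \<rho> i = g\<^sub>0 \<otimes>\<^bsub>G\<^esub> gs ! i \<otimes>\<^bsub>G\<^esub> h i" if i: "i < ?n" for i
    unfolding h_def using gsc[OF i] gsc[OF \<rho>_less[OF i]] g\<^sub>0
    by (simp add: D.G.m_assoc[symmetric])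
  obtain \<phi> where \<phi>: "\<phi> \<in> ring_iso B B'" "\<forall>c. \<forall>x\<in>carrier B. \<phi> (c \<odot>\<^bsub>B\<^esub> x) = c \<odot>\<^bsub>B'\<^esub> \<phi> x"
    "\<forall>g\<in>carrier G. \<phi> ` hcomp B g \<subseteq> hcomp B' g"
    using iso unfolding graded_isomorphic_def by (elim bexE conjE)
  have "regraded_block_tensors G B ds gs B' ds' gs' \<phi> \<rho> g\<^sub>0 h"
    unfolding regraded_block_tensors_def regraded_block_tensors_axioms_def
    using bt bt' \<phi> size \<rho> g\<^sub>0(1) hH h2 by simp
  then show ?thesis by (rule regraded_block_tensors.tensors_isomorphic)
qed

theorem theorem3:
  fixes G :: "('g, 'n) monoid_scheme"
    and K :: "'g set"
    and B :: "('k::{alg_closed_field, field_char_0}, 'b, 'g) gr_algebra"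
    and B' :: "('k, 'c, 'g) gr_algebra"
    and ds ds' :: "nat list"
    and gs gs' :: "'g list"
  defines "R \<equiv> UT_tensor G ds gs B"
    and "R' \<equiv> UT_tensor G ds' gs' B'"
  assumes G: "comm_group G"
    and m: "ds \<noteq> []" "length ds' = length ds"
    and pos: "\<forall>d\<in>set ds. d > 0" "\<forall>d\<in>set ds'. d > 0"
    and n: "sum_list ds' = sum_list ds"
    and gs: "length gs = sum_list ds" "set gs \<subseteq> carrier G"
    and gs': "length gs' = sum_list ds'" "set gs' \<subseteq> carrier G"
    and K: "subgroup K G" "\<exists>S. finite S \<and> S \<subseteq> carrier G \<and> K = generate G S"
    and B: "graded_division_algebra G B" "supp G B \<subseteq> K" "is_pi_algebra B"
    and B': "graded_division_algebra G B'" "supp G B' \<subseteq> K" "is_pi_algebra B'"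
    and Id: "graded_identities G R = graded_identities G R'"
  shows "supp G B = supp G B' \<and> graded_isomorphic G B B' \<and>
    (let H = supp G B;
         Q = G Mod H;
         \<alpha> = (\<lambda>g. H #>\<^bsub>G\<^esub> g);
         t = pi_degree B;
         U = UT Q (map (\<lambda>d. d * t) ds) (concat (map (\<lambda>g. replicate t (\<alpha> g)) gs));
         U' = UT Q (map (\<lambda>d. d * t) ds') (concat (map (\<lambda>g. replicate t (\<alpha> g)) gs'))
     in pi_degree B' = t \<and>
        graded_identities Q (coarsening G \<alpha> R) = graded_identities Q U \<and>
        graded_identities Q U = graded_identities Q U' \<and>
        graded_identities Q U' = graded_identities Q (coarsening G \<alpha> R') \<and>
        (graded_isomorphic Q U U' \<longrightarrow> graded_isomorphic G R R'))"
proof -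
  have uB: "unital_algebra B" "unital_algebra B'"
    using B(1) B'(1) unfolding graded_division_algebra_def graded_algebra_def by blast+
  have D: "graded_division G B" "graded_division G B'"
    using G uB B(1) B'(1) unfolding graded_division_def graded_division_axioms_def by simp_all
  have "ds' \<noteq> []" using m by auto
  then have bt: "block_tensor G B ds gs" "block_tensor G B' ds' gs'"
    using D m pos gs gs' unfolding block_tensor_def block_tensor_axioms_def by simp_all
  have tb: "two_block_tensors G B ds gs B' ds' gs'"
    using bt Id unfolding two_block_tensors_def two_block_tensors_axioms_def R_def R'_def by simp
  have supp: "supp G B' = supp G B" and iso: "graded_isomorphic G B B'"
    by (rule graded_identities_determine_division[OF tb])+
  define H where "H = supp G B"
  define Q where "Q = G Mod H"
  define \<alpha> where "\<alpha> = (\<lambda>g. H #>\<^bsub>G\<^esub> g)"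
  define t where "t = pi_degree B"
  define U where "U = (UT Q (map (\<lambda>d. d * t) ds) (concat (map (\<lambda>g. replicate t (\<alpha> g)) gs)) :: ('k, 'k mat, 'g set) gr_algebra)"
  define U' where "U' = (UT Q (map (\<lambda>d. d * t) ds') (concat (map (\<lambda>g. replicate t (\<alpha> g)) gs')) :: ('k, 'k mat, 'g set) gr_algebra)"
  obtain t\<^sub>1 \<Phi> where reps1: "matrix_reps B t\<^sub>1 \<Phi>" by (rule graded_division.matrix_reps_exist[OF D(1) B(3)])
  obtain t\<^sub>2 \<Phi>' where reps2: "matrix_reps B' t\<^sub>2 \<Phi>'" by (rule graded_division.matrix_reps_exist[OF D(2) B'(3)])
  have t1: "t\<^sub>1 = t" unfolding t_def using pi_degree_matrix_reps[OF uB(1) reps1] ..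
  \<comment> \<open>The p.i. degree is defined from the identities alone, and isomorphic algebras
    have the same identities.\<close>
  have pi: "pi_degree B' = t"
    unfolding t_def pi_degree_def graded_isomorphic_identities[OF uB iso] ..
  have t2: "t\<^sub>2 = t" using pi_degree_matrix_reps[OF uB(2) reps2] pi by simp
  note reps = reps1[unfolded t1] reps2[unfolded t2]
  interpret G: comm_group G by (rule G)
  have H: "subgroup H G" unfolding H_def by (rule graded_division.subgroup_H[OF D(1)])
  then have HN: "H \<lhd> G" using G.normal_iff_subgroup by blast
  have grp: "group Q" unfolding Q_def by (rule normal.factorgroup_is_group[OF HN])
  have hom: "\<alpha> \<in> hom G Q" unfolding \<alpha>_def Q_def by (rule normal.r_coset_hom_Mod[OF HN])
  have ker: "\<alpha> g = \<one>\<^bsub>Q\<^esub> \<longleftrightarrow> g \<in> H" if "g \<in> carrier G" for g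
    unfolding \<alpha>_def Q_def using G.coset_join1[OF _ that H] G.coset_join2[OF that H] by auto
  have ids: "graded_identities Q (coarsening G \<alpha> R) = graded_identities Q U"
    unfolding R_def U_def
    by (rule block_tensor.coarsening_identities[OF bt(1) grp hom ker[unfolded H_def] reps(1)])
  have ids': "graded_identities Q (coarsening G \<alpha> R') = graded_identities Q U'"
    unfolding R'_def U'_def
    by (rule block_tensor.coarsening_identities[OF bt(2) grp hom ker[unfolded H_def supp[symmetric]] reps(2)])
  have uR: "unital_algebra R" "unital_algebra R'"
    unfolding R_def R'_def using bt by (auto intro: block_tensor.R_unital)
  \<comment> \<open>\<open>U\<close> and \<open>U'\<close> are compared only through R and R':
    equality of the fine identities passes to the coarsened gradings.\<close>
  have "graded_identities Q (coarsening G \<alpha> R) = graded_identities Q (coarsening G \<alpha> R')"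
  proof (intro equalityI coarsening_identities_mono uR)
    show "graded_identities G R \<subseteq> graded_identities G R'" "graded_identities G R' \<subseteq> graded_identities G R"
      using Id by simp_all
  qed (simp_all add: R_def R'_def block_tensor.hcomp_R_subset[OF bt(1)] block_tensor.hcomp_R_subset[OF bt(2)]
      block_tensor.zero_hcomp[OF bt(1)] block_tensor.zero_hcomp[OF bt(2)]
      block_tensor.hcomp_R_add[OF bt(1)] block_tensor.hcomp_R_add[OF bt(2)]
      block_tensor.hcomp_R_smult[OF bt(1)] block_tensor.hcomp_R_smult[OF bt(2)])
  then have coarse: "graded_identities Q U = graded_identities Q U'" using ids ids' by simp
  have tpos: "t > 0" using reps(1) unfolding matrix_reps_def by blast
  have claim3: "graded_isomorphic G R R'" if "graded_isomorphic Q U U'"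
    unfolding R_def R'_def
    by (rule UT_isomorphic_imp_tensors_isomorphic[OF bt m(2) n supp iso tpos])
      (use that in \<open>simp only: U_def U'_def Q_def \<alpha>_def H_def\<close>)
  show ?thesis
    unfolding Let_def H_def[symmetric] Q_def[symmetric] \<alpha>_def[symmetric] t_def[symmetric] U_def[symmetric] U'_def[symmetric]
    using supp iso pi ids ids' coarse claim3 unfolding H_def by simp
qed

end
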